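(* Let $\Delta\geq 3$ be an integer, let $q\geq 1$ be real and let $p<p_c(q,\Delta)$. Then there exists a constant $\delta>0$ such that, as $n\to\infty$, the following holds with probability $1-o(1)$ over the choice of a uniformly random $\Delta$-regular graph $G=(V,E)$ with $n$ vertices: there is a polynomial-time algorithm which, on input the graph $G$, outputs a random set $S\subseteq E$ whose distribution $\nu_S$ satisfies $\|\nu_S-\varphi_G\|_{\mathrm{TV}}=O(1/n^{\delta})$, where $\varphi_G$ is the random-cluster distribution on $G$ with parameters $p,q$.
   Context: Random-cluster model: for a graph $G=(V,E)$, $p\in[0,1]$ and $q>0$, the distribution $\varphi_G$ on subsets $S\subseteq E$ is $\varphi_G(S)=p^{|S|}(1-p)^{|E\setminus S|}q^{k(S)}/Z$, where $k(S)$ is the number of connected components (including isolated vertices) of $(V,S)$ and $Z$ is the normalising constant. The critical value is $p_c(q,\Delta)=1-\frac{1}{1+\inf_{y>1}h(y)}$ with $h(y)=\frac{(y-1)(y^{\Delta-1}+q-1)}{y^{\Delta-1}-y}$. $\|\cdot\|_{\mathrm{TV}}$ denotes total variation distance. *)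

theory Defs
  imports "HOL-Probability.Probability"
begin

section \<open>Random regular graphs\<close>

text \<open>A graph is a pair of a vertex set and a set of two-element edges. The vertices of an
  \<open>n\<close>-vertex graph are \<open>0, \<dots>, n - 1\<close>; random regular graphs are labelled and simple.\<close>

definition simple_graph :: "nat \<Rightarrow> nat set set \<Rightarrow> bool" where
  "simple_graph n E \<longleftrightarrow> E \<subseteq> {{u, v} | u v. u < n \<and> v < n \<and> u \<noteq> v}"

definition regular_graphs :: "nat \<Rightarrow> nat \<Rightarrow> nat set set set" where
  "regular_graphs \<Delta> n = {E. simple_graph n E \<and> (\<forall>v<n. card {e \<in> E. v \<in> e} = \<Delta>)}"

text \<open>Meaningful only if a \<open>\<Delta>\<close>-regular graph on \<open>n\<close> vertices exists, that is, if \<open>n > \<Delta>\<close> and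
  \<open>\<Delta> * n\<close> is even.\<close>

definition random_regular_graph :: "nat \<Rightarrow> nat \<Rightarrow> nat set set pmf" where
  "random_regular_graph \<Delta> n = pmf_of_set (regular_graphs \<Delta> n)"

section \<open>The random-cluster model\<close>

definition connected_rel :: "'a set \<Rightarrow> 'a set set \<Rightarrow> ('a \<times> 'a) set" where
  "connected_rel V S = {(u, v). u \<in> V \<and> v \<in> V \<and> (u, v) \<in> {(a, b). {a, b} \<in> S}\<^sup>*}"

definition num_components :: "'a set \<Rightarrow> 'a set set \<Rightarrow> nat" where
  "num_components V S = card (V // connected_rel V S)"

definition rc_weight :: "real \<Rightarrow> real \<Rightarrow> 'a set \<Rightarrow> 'a set set \<Rightarrow> 'a set set \<Rightarrow> real" where
  "rc_weight p q V E S = p ^ card S * (1 - p) ^ card (E - S) * q ^ num_components V S"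

definition rc_partition :: "real \<Rightarrow> real \<Rightarrow> 'a set \<Rightarrow> 'a set set \<Rightarrow> real" where
  "rc_partition p q V E = (\<Sum>S\<in>Pow E. rc_weight p q V E S)"

definition random_cluster :: "real \<Rightarrow> real \<Rightarrow> 'a set \<Rightarrow> 'a set set \<Rightarrow> 'a set set pmf" where
  "random_cluster p q V E =
     embed_pmf (\<lambda>S. if S \<subseteq> E then rc_weight p q V E S / rc_partition p q V E else 0)"

lemma rc_weight_nonneg:
  assumes "p \<in> {0..1}" "q > 0"
  shows "rc_weight p q V E S \<ge> 0"
  using assms by (simp add: rc_weight_def)

lemma rc_partition_pos:
  assumes "finite E" "p \<in> {0..1}" "q > 0"
  shows "rc_partition p q V E > 0"
proof -
  define S where "S = (if p = 0 then {} else E)"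
  have "rc_weight p q V E S > 0"
    using assms by (auto simp: rc_weight_def S_def)
  moreover have "S \<in> Pow E"
    by (simp add: S_def)
  ultimately show ?thesis
    unfolding rc_partition_def using assms
    by (intro sum_pos2[of _ S]) (auto simp: rc_weight_nonneg)
qed

lemma pmf_random_cluster:
  assumes "finite E" "p \<in> {0..1}" "q > 0"
  shows "pmf (random_cluster p q V E) S =
           (if S \<subseteq> E then rc_weight p q V E S / rc_partition p q V E else 0)"
proof -
  let ?f = "\<lambda>S. if S \<subseteq> E then rc_weight p q V E S / rc_partition p q V E else 0"
  note pos = rc_partition_pos[OF assms, of V]
  have nonneg: "?f S \<ge> 0" for S
    using pos assms by (auto simp: rc_weight_nonneg)
  have "(\<integral>\<^sup>+S. ennreal (?f S) \<partial>count_space UNIV) = (\<Sum>S\<in>Pow E. ennreal (?f S))"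
    using assms(1) by (intro nn_integral_count_space') (auto split: if_splits)
  also have "\<dots> = ennreal (\<Sum>S\<in>Pow E. ?f S)"
    by (intro sum_ennreal nonneg)
  also have "(\<Sum>S\<in>Pow E. ?f S) = (\<Sum>S\<in>Pow E. rc_weight p q V E S) / rc_partition p q V E"
    unfolding sum_divide_distrib by (intro sum.cong) auto
  also have "\<dots> = 1"
    using pos by (simp add: rc_partition_def)
  finally have "(\<integral>\<^sup>+S. ennreal (?f S) \<partial>count_space UNIV) = 1"
    by simp
  with nonneg show ?thesis
    unfolding random_cluster_def by (rule pmf_embed_pmf)
qed

definition crit_h :: "real \<Rightarrow> nat \<Rightarrow> real \<Rightarrow> real" where
  "crit_h q \<Delta> y = (y - 1) * (y ^ (\<Delta> - 1) + q - 1) / (y ^ (\<Delta> - 1) - y)"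

definition p_crit :: "real \<Rightarrow> nat \<Rightarrow> real" where
  "p_crit q \<Delta> = 1 - 1 / (1 + (INF y\<in>{1<..}. crit_h q \<Delta> y))"

definition tv_dist :: "'a pmf \<Rightarrow> 'a pmf \<Rightarrow> real" where
  "tv_dist \<mu> \<nu> = (SUP A. \<bar>measure_pmf.prob \<mu> A - measure_pmf.prob \<nu> A\<bar>)"

section \<open>Randomised algorithms\<close>

text \<open>
  The machine model is a randomised random-access machine, programmed in a while-language, with
  natural-number variables and arrays, fair coin flips and a write-only output tape. A step costs
  one unit of time. The arithmetic operations are addition, truncated subtraction and halving;
  there is no unit-cost multiplication, so the bit length of the numbers grows by at most a
  constant (depending on the program) in each step and polynomial time on this machine is
  polynomial time on a probabilistic Turing machine.

  Parameters of a problem that are arbitrary real numbers need not be computable, so they cannot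
  in general be constants of the program. As is usual in computable analysis, the machine has
  access to their binary expansions: each real parameter is given on a read-only one-way tape,
  from which reading the next digit takes one step. Hence only polynomially many digits can be
  read in polynomial time.
\<close>

datatype aexp =
    N nat
  | V nat
  | Get nat aexp
  | Plus aexp aexp
  | Minus aexp aexp
  | Half aexp

datatype com =
    Skip
  | Assign nat aexp
  | Put nat aexp aexp
  | Flip nat
  | Digit nat nat
  | Print aexp
  | Seq com com
  | If aexp com com
  | While aexp com

record state =
  var :: "nat \<Rightarrow> nat"
  arr :: "nat \<Rightarrow> nat \<Rightarrow> nat"
  tape_pos :: "nat \<Rightarrow> nat"
  printed :: "nat list"

text \<open>The first cell of the tape for the nonnegative real \<open>x\<close> holds the integer part of \<open>x\<close>, the
  others hold the binary digits after the point.\<close>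

fun digit :: "real \<Rightarrow> nat \<Rightarrow> nat" where
  "digit x 0 = nat \<lfloor>x\<rfloor>"
| "digit x (Suc i) = nat \<lfloor>2 ^ Suc i * x\<rfloor> mod 2"

fun aval :: "aexp \<Rightarrow> state \<Rightarrow> nat" where
  "aval (N k) s = k"
| "aval (V x) s = var s x"
| "aval (Get a e) s = arr s a (aval e s)"
| "aval (Plus e f) s = aval e s + aval f s"
| "aval (Minus e f) s = aval e s - aval f s"
| "aval (Half e) s = aval e s div 2"

definition set_var :: "nat \<Rightarrow> nat \<Rightarrow> state \<Rightarrow> state" where
  "set_var x k s = s\<lparr>var := (var s)(x := k)\<rparr>"

text \<open>A configuration consists of the stack of commands still to be executed and the state; the
  machine has halted when the stack is empty. In a test, nonzero means true.\<close>

type_synonym config = "com list \<times> state"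

fun step :: "real list \<Rightarrow> config \<Rightarrow> config pmf" where
  "step \<theta> ([], s) = return_pmf ([], s)"
| "step \<theta> (Skip # K, s) = return_pmf (K, s)"
| "step \<theta> (Assign x e # K, s) = return_pmf (K, set_var x (aval e s) s)"
| "step \<theta> (Put a e f # K, s) =
     return_pmf (K, s\<lparr>arr := (arr s)(a := (arr s a)(aval e s := aval f s))\<rparr>)"
| "step \<theta> (Flip x # K, s) = map_pmf (\<lambda>b. (K, set_var x b s)) (pmf_of_set {0, 1})"
| "step \<theta> (Digit x j # K, s) =
     return_pmf (K, (set_var x (if j < length \<theta> then digit (\<theta> ! j) (tape_pos s j) else 0) s)
                      \<lparr>tape_pos := (tape_pos s)(j := tape_pos s j + 1)\<rparr>)"
| "step \<theta> (Print e # K, s) = return_pmf (K, s\<lparr>printed := printed s @ [aval e s]\<rparr>)"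
| "step \<theta> (Seq c d # K, s) = return_pmf (c # d # K, s)"
| "step \<theta> (If e c d # K, s) = return_pmf ((if aval e s \<noteq> 0 then c else d) # K, s)"
| "step \<theta> (While e c # K, s) = return_pmf (if aval e s \<noteq> 0 then c # While e c # K else K, s)"

text \<open>The input is a word of natural numbers, stored in array \<open>0\<close>; all other cells are initially
  zero.\<close>

definition init_state :: "nat list \<Rightarrow> state" where
  "init_state w =
     \<lparr>var = (\<lambda>_. 0),
      arr = (\<lambda>a i. if a = 0 \<and> i < length w then w ! i else 0),
      tape_pos = (\<lambda>_. 0),
      printed = []\<rparr>"

definition run :: "real list \<Rightarrow> com \<Rightarrow> nat list \<Rightarrow> nat \<Rightarrow> config pmf" where
  "run \<theta> c w t = ((\<lambda>\<mu>. bind_pmf \<mu> (step \<theta>)) ^^ t) (return_pmf ([c], init_state w))"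

text \<open>Halting is required for all outcomes of the coin flips.\<close>

definition halts_within :: "real list \<Rightarrow> com \<Rightarrow> nat list \<Rightarrow> nat \<Rightarrow> bool" where
  "halts_within \<theta> c w t \<longleftrightarrow> (\<forall>(K, s) \<in> set_pmf (run \<theta> c w t). K = [])"

definition polynomial_time :: "real list \<Rightarrow> com \<Rightarrow> nat list set \<Rightarrow> bool" where
  "polynomial_time \<theta> c W \<longleftrightarrow> (\<exists>k. \<forall>w\<in>W. halts_within \<theta> c w (k * length w ^ k + k))"

text \<open>Meaningful only if the program halts on the input within some fixed time. The choice of the
  time bound is irrelevant, see lemma \<open>run_halted\<close>.\<close>

definition output_pmf :: "real list \<Rightarrow> com \<Rightarrow> nat list \<Rightarrow> nat list pmf" where
  "output_pmf \<theta> c w =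
     map_pmf (\<lambda>(K, s). printed s) (run \<theta> c w (LEAST t. halts_within \<theta> c w t))"

lemma run_halted:
  assumes "halts_within \<theta> c w t" "t \<le> t'"
  shows "run \<theta> c w t' = run \<theta> c w t"
  using assms(2)
proof (induction t' rule: dec_induct)
  case (step m)
  have "run \<theta> c w (Suc m) = bind_pmf (run \<theta> c w t) (Defs.step \<theta>)"
    using step.IH by (simp add: run_def)
  also have "\<dots> = bind_pmf (run \<theta> c w t) return_pmf"
    using assms(1) by (intro bind_pmf_cong) (auto simp: halts_within_def)
  finally show ?case
    by (simp add: bind_return_pmf')
qed simp

text \<open>A graph is input as its number of vertices followed by its adjacency matrix (so the word has
  length \<open>n\<^sup>2 + 1\<close>); a set of edges is output as a list of endpoints.\<close>

definition encode_graph :: "nat \<Rightarrow> nat set set \<Rightarrow> nat list" where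
  "encode_graph n E = n # [of_bool ({i, j} \<in> E). i \<leftarrow> [0..<n], j \<leftarrow> [0..<n]]"

fun decode_edges :: "nat list \<Rightarrow> nat set set" where
  "decode_edges (u # v # w) = insert {u, v} (decode_edges w)"
| "decode_edges _ = {}"

definition graph_output :: "real list \<Rightarrow> com \<Rightarrow> nat \<Rightarrow> nat set set \<Rightarrow> nat set set pmf" where
  "graph_output \<theta> c n E = map_pmf decode_edges (output_pmf \<theta> c (encode_graph n E))"

definition graph_inputs :: "nat list set" where
  "graph_inputs = {encode_graph n E | n E. simple_graph n E}"

end

theory Submission
  imports Defs "HOL-Real_Asymp.Real_Asymp"
begin

text \<open>
  Up to a constant, the random-cluster weight of \<open>S\<close> is \<open>x ^ card S * q ^ excess S\<close>, where
  \<open>x = p / ((1 - p) q)\<close> and the excess is the number of independent cycles of \<open>S\<close>. Hence \<open>S\<close> can be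
  sampled by rejection: percolation with edge probability \<open>x / (1 + x)\<close> produces a proposal, accepted with
  probability \<open>q\<close> to the power \<open>excess S - L\<close>. This takes polynomially many trials if \<open>L\<close> is logarithmic
  in \<open>n\<close>, and it is accurate if the excess exceeds \<open>L\<close> with random-cluster probability \<open>O(1/n)\<close> only.

  For \<open>p < p_crit q \<Delta>\<close> the recursion on the wired \<open>\<Delta>\<close>-regular tree converges to the trivial fixed point \<open>1\<close>.
  So an edge leading into a tree-like neighbourhood of large fixed radius is open with conditional probability
  close to \<open>x / (1 + x) < 1 / (\<Delta> - 1)\<close>, whatever happens elsewhere. In a random regular graph, a
  path of logarithmic length leaves all but boundedly many of its vertices into such neighbourhoods, because many
  exceptions would produce many short ears attached to the path. Hence the expected number of open cycles, which
  bounds the excess, is logarithmic, and no long path is open. The same holds for a slightly larger \<open>q\<close>; comparing the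
  two parameters turns Markov's inequality into the required tail bound.
\<close>

section \<open>Components and excess\<close>

text \<open>The weight is not local: whether an edge contributes \<open>x\<close> or
  \<open>x * q\<close> depends on connections far away. But only upper bounds on the probability of
  open edges are needed, and for \<open>q \<ge> 1\<close> a wired boundary is the worst case. So a
  tree of fixed radius ahead of an edge suffices, whatever the rest of the graph looks like. On a
  path of logarithmic length in a good graph this works for all but \<open>K0\<close> edges, and the
  exceptions cost a constant factor. The random graph enters through two first-moment estimates
  only, collected in \<open>good_graph\<close>: no path carries a chain of \<open>m\<close> ears,
  and a weighted number of cycles is at most \<open>ln n\<close>. The strict inequality
  \<open>p < p_crit q \<Delta>\<close> is what leaves room to enlarge \<open>q\<close> to
  \<open>lam * q\<close> while \<open>x\<close> stays fixed. On the machine \<open>p\<close> and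
  \<open>q\<close> are known by finitely many digits. A number of digits
  \<open>K = b * bitlen n\<close> makes all relative errors polynomially small, and powers of
  \<open>2 ^ K\<close>, which govern the running time, are still polynomial in
  \<open>n\<close>.\<close>

definition sedges :: "'a set \<Rightarrow> 'a set set" where
  "sedges X = {{u, v} | u v. u \<in> X \<and> v \<in> X \<and> u \<noteq> v}"

lemma sedges_iff: "{u, v} \<in> sedges X \<longleftrightarrow> u \<in> X \<and> v \<in> X \<and> u \<noteq> v"
proof
  assume "{u, v} \<in> sedges X"
  then obtain a b where "{u, v} = {a, b}" "a \<in> X" "b \<in> X" "a \<noteq> b"
    unfolding sedges_def by blast
  then show "u \<in> X \<and> v \<in> X \<and> u \<noteq> v"
    unfolding doubleton_eq_iff by blast
qed (auto simp: sedges_def)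

definition adj :: "'a set set \<Rightarrow> ('a \<times> 'a) set" where
  "adj S = {(a, b). {a, b} \<in> S}"

definition conn :: "'a set set \<Rightarrow> 'a \<Rightarrow> 'a \<Rightarrow> bool" where
  "conn S u v \<longleftrightarrow> (u, v) \<in> (adj S)\<^sup>*"

lemma conn_refl [simp]: "conn S u u"
  by (simp add: conn_def)

lemma conn_trans: "conn S u v \<Longrightarrow> conn S v w \<Longrightarrow> conn S u w"
  unfolding conn_def by (rule rtrancl_trans)

lemma sym_adj: "sym (adj S)"
  by (auto simp: sym_def adj_def insert_commute)

lemma conn_sym: "conn S u v \<Longrightarrow> conn S v u"
  unfolding conn_def using sym_adj[of S] by (metis sym_rtrancl symD)

text \<open>A route through the new edge can be shortened until it uses that edge once, in one of
  its two directions. The edge consists of two ordered pairs, so \<open>rtrancl_insert\<close> is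
  applied twice, and the cases that use both pairs collapse.\<close>

lemma conn_insert:
  "conn (insert {u, v} S) a b \<longleftrightarrow>
     conn S a b \<or> conn S a u \<and> conn S v b \<or> conn S a v \<and> conn S u b"
proof -
  have "adj (insert {u, v} S) = insert (u, v) (insert (v, u) (adj S))"
    by (auto simp: adj_def doubleton_eq_iff)
  moreover have 1: "(a, b) \<in> (insert (v, u) (adj S))\<^sup>* \<longleftrightarrow> conn S a b \<or> conn S a v \<and> conn S u b" for a b
    by (simp add: rtrancl_insert conn_def)
  ultimately have "conn (insert {u, v} S) a b \<longleftrightarrow>
      (conn S a b \<or> conn S a v \<and> conn S u b) \<or>
      (conn S a u \<or> conn S a v \<and> conn S u u) \<and> (conn S v b \<or> conn S v v \<and> conn S u b)"
    unfolding conn_def[of "insert _ _"] by (simp add: rtrancl_insert[of u v] 1)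
  then show ?thesis
    using conn_trans[of S a u b] conn_trans[of S a v b] by auto
qed

text \<open>Connections are refuted below by a set that is closed under the edges of
  \<open>S\<close>, contains one end and misses the other.\<close>

lemma conn_closed:
  assumes "conn S a b" "a \<in> A" "\<And>u v. u \<in> A \<Longrightarrow> {u, v} \<in> S \<Longrightarrow> v \<in> A"
  shows "b \<in> A"
  using assms(1) unfolding conn_def
  by (induction rule: rtrancl_induct) (use assms(2,3) in \<open>auto simp: adj_def\<close>)

lemma num_components_image:
  "num_components X S = card ((\<lambda>x. {y \<in> X. conn S x y}) ` X)"
proof -
  have "X // connected_rel X S = (\<lambda>x. {y \<in> X. conn S x y}) ` X"
    unfolding quotient_def connected_rel_def conn_def adj_def by (auto simp: Image_def)
  then show ?thesis
    by (simp add: num_components_def)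
qed

lemma num_components_empty: "num_components X {} = card X"
proof -
  have "{y \<in> X. conn {} x y} = {x}" if "x \<in> X" for x
    using that by (auto simp: conn_def adj_def)
  then have "(\<lambda>x. {y \<in> X. conn {} x y}) ` X = (\<lambda>x. {x}) ` X"
    by auto
  then show ?thesis
    unfolding num_components_image by (simp add: card_image)
qed

text \<open>If the ends are already connected, no class changes. Otherwise the classes of
  \<open>u\<close> and \<open>v\<close> are replaced by their union, which is not an old class, and
  nothing else moves.\<close>

lemma num_components_insert:
  assumes "finite X" "u \<in> X" "v \<in> X"
  shows "num_components X S = num_components X (insert {u, v} S) + of_bool (\<not> conn S u v)"
proof (cases "conn S u v")
  case True
  then have "conn (insert {u, v} S) a b \<longleftrightarrow> conn S a b" for a b
    unfolding conn_insert by (meson conn_sym conn_trans)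
  with True show ?thesis
    by (simp add: num_components_image)
next
  case False
  define cl where "cl = (\<lambda>x. {y \<in> X. conn S x y})"
  define cl' where "cl' = (\<lambda>x. {y \<in> X. conn (insert {u, v} S) x y})"
  have tr: "conn S x t \<longleftrightarrow> conn S y t" if "conn S x y" for x y t
    using that by (meson conn_sym conn_trans)
  have cl_eq: "cl x = cl y \<longleftrightarrow> conn S x y" if "x \<in> X" "y \<in> X" for x y
  proof
    assume "cl x = cl y"
    moreover have "y \<in> cl y" using that by (simp add: cl_def)
    ultimately have "y \<in> cl x" by simp
    then show "conn S x y" by (simp add: cl_def)
  next
    assume "conn S x y"
    from tr[OF this] show "cl x = cl y" by (simp add: cl_def)
  qed
  have cl': "cl' x = (if conn S x u \<or> conn S x v then cl u \<union> cl v else cl x)" for x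
  proof -
    consider "conn S x u" | "conn S x v" | "\<not> conn S x u" "\<not> conn S x v" by blast
    then show ?thesis
    proof cases
      case 1
      moreover have "\<not> conn S x v" using False tr[OF 1] by simp
      ultimately show ?thesis unfolding cl'_def cl_def conn_insert by (auto simp: tr[OF 1])
    next
      case 2
      moreover have "\<not> conn S x u" using False tr[OF 2, of u] conn_sym[of S v u] by blast
      ultimately show ?thesis unfolding cl'_def cl_def conn_insert by (auto simp: tr[OF 2])
    next
      case 3
      then show ?thesis unfolding cl'_def cl_def conn_insert by auto
    qed
  qed
  have *: "cl' ` X = insert (cl u \<union> cl v) (cl ` X - {cl u, cl v})"
  proof (intro equalityI subsetI)
    fix A assume "A \<in> cl' ` X"
    then obtain x where x: "x \<in> X" "A = cl' x" by auto
    show "A \<in> insert (cl u \<union> cl v) (cl ` X - {cl u, cl v})"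
      using x cl'[of x] cl_eq[of x u] cl_eq[of x v] assms by (auto split: if_splits)
  next
    fix A assume A: "A \<in> insert (cl u \<union> cl v) (cl ` X - {cl u, cl v})"
    show "A \<in> cl' ` X"
    proof (cases "A = cl u \<union> cl v")
      case True
      then have "A = cl' u" using cl'[of u] by simp
      then show ?thesis using assms by blast
    next
      case False
      with A obtain x where x: "x \<in> X" "A = cl x" "cl x \<noteq> cl u" "cl x \<noteq> cl v" by auto
      then have "cl' x = A" using cl'[of x] cl_eq assms by auto
      then show ?thesis using x by blast
    qed
  qed
  have ne: "cl u \<noteq> cl v" using False cl_eq assms by blast
  have notin: "cl u \<union> cl v \<notin> cl ` X - {cl u, cl v}"
  proof
    assume "cl u \<union> cl v \<in> cl ` X - {cl u, cl v}"
    then obtain x where x: "x \<in> X" "cl x = cl u \<union> cl v" by auto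
    moreover have "u \<in> cl u" "v \<in> cl v" using assms by (simp_all add: cl_def)
    ultimately have "u \<in> cl x" "v \<in> cl x" by auto
    then have "conn S u x" "conn S x v" by (simp_all add: cl_def conn_sym)
    then show False using False conn_trans[of S u x v] by simp
  qed
  have "card (cl ` X) = card (cl ` X - {cl u, cl v}) + card {cl u, cl v}"
    using assms card_Diff_subset[of "{cl u, cl v}" "cl ` X"] card_mono[of "cl ` X" "{cl u, cl v}"] by auto
  moreover have "card (cl' ` X) = card (cl ` X - {cl u, cl v}) + 1"
    unfolding * using notin assms by (subst card_insert_disjoint) auto
  moreover have "num_components X S = card (cl ` X)"
    "num_components X (insert {u, v} S) = card (cl' ` X)"
    by (simp_all add: num_components_image cl_def cl'_def)
  ultimately show ?thesis
    using False ne by simp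
qed

text \<open>The cyclomatic number of the graph \<open>(X, S)\<close>. By
  \<open>card_le_components\<close> the truncated subtraction is exact for finite \<open>X\<close>
  and \<open>S \<subseteq> sedges X\<close>.\<close>

definition excess :: "'a set \<Rightarrow> 'a set set \<Rightarrow> nat" where
  "excess X S = card S + num_components X S - card X"

lemma finite_sedges: "finite X \<Longrightarrow> finite (sedges X)"
  by (rule finite_subset[of _ "Pow X"]) (auto simp: sedges_def)

lemma finite_edges: "finite X \<Longrightarrow> S \<subseteq> sedges X \<Longrightarrow> finite S"
  by (rule finite_subset[OF _ finite_sedges])

lemma card_le_components:
  assumes "finite X" "S \<subseteq> sedges X"
  shows "card X \<le> card S + num_components X S"
proof -
  have "finite S" using assms by (auto intro: finite_edges)
  then show ?thesis using assms(2)
  proof (induction S rule: finite_induct)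
    case empty
    then show ?case by (simp add: num_components_empty)
  next
    case (insert e S)
    then obtain u v where "e = {u, v}" "u \<in> X" "v \<in> X" unfolding sedges_def by auto
    then show ?case
      using insert num_components_insert[OF assms(1), of u v S]
      by (cases "conn S u v") auto
  qed
qed

lemma num_components_excess:
  assumes "finite X" "S \<subseteq> sedges X"
  shows "card S + num_components X S = card X + excess X S"
  using card_le_components[OF assms] by (simp add: excess_def)

lemma excess_empty [simp]: "excess X {} = 0"
  by (simp add: excess_def num_components_empty)

text \<open>When a configuration is built edge by edge, the excess counts the edges whose ends are
  already connected. The tree recursion, the bound by cycles and the counter kept by the program all
  rest on this.\<close>

lemma excess_insert:
  assumes "finite X" "insert {u, v} S \<subseteq> sedges X" "{u, v} \<notin> S"
  shows "excess X (insert {u, v} S) = excess X S + of_bool (conn S u v)"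
proof -
  have fin: "finite S" using assms by (auto intro: finite_edges)
  have uv: "u \<in> X" "v \<in> X" using assms(2) by (simp_all add: sedges_iff)
  have 1: "card S + num_components X S = card X + excess X S"
    using num_components_excess[of X S] assms by blast
  have 2: "card (insert {u, v} S) + num_components X (insert {u, v} S) = card X + excess X (insert {u, v} S)"
    using num_components_excess[of X "insert {u, v} S"] assms by blast
  have 3: "card (insert {u, v} S) = Suc (card S)"
    using fin assms(3) by simp
  show ?thesis
    using 1 2 3 num_components_insert[OF assms(1) uv, of S]
    by (cases "conn S u v") (simp_all, linarith?)
qed

text \<open>Up to a factor that does not depend on the configuration, this is the random-cluster weight
  when \<open>x = p / ((1 - p) q)\<close>; see \<open>rc_weight_cw\<close>.\<close>

definition cw :: "'a set \<Rightarrow> real \<Rightarrow> real \<Rightarrow> 'a set set \<Rightarrow> real" where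
  "cw X x q S = x ^ card S * q ^ excess X S"

lemma cw_nonneg: "x \<ge> 0 \<Longrightarrow> q \<ge> 0 \<Longrightarrow> cw X x q S \<ge> 0"
  by (simp add: cw_def)

lemma cw_insert:
  assumes "finite X" "insert {u, v} S \<subseteq> sedges X" "{u, v} \<notin> S"
  shows "cw X x q (insert {u, v} S) = (if conn S u v then x * q else x) * cw X x q S"
proof -
  have "finite S" using assms by (auto intro: finite_edges)
  then show ?thesis
    using assms by (simp add: cw_def excess_insert)
qed

text \<open>The exponent of \<open>q\<close> is \<open>card X - card S + excess X S\<close>. The
  first term is constant, and the second turns the odds \<open>p / (1 - p)\<close> of an edge into
  \<open>x\<close>.\<close>

lemma rc_weight_cw:
  assumes "finite X" "E \<subseteq> sedges X" "S \<subseteq> E" "0 \<le> p" "p < 1" "q > 0"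
  shows "rc_weight p q X E S = (1 - p) ^ card E * q ^ card X * cw X (p / ((1 - p) * q)) q S"
proof -
  have fin: "finite E" "finite S"
    using finite_edges[OF assms(1,2)] finite_subset[OF assms(3)] by auto
  have E: "card E = card S + card (E - S)"
    using fin assms(3) by (simp add: card_Diff_subset card_mono)
  have k: "q ^ card S * q ^ num_components X S = q ^ card X * q ^ excess X S"
    using num_components_excess[of X S] assms by (simp flip: power_add)
  have "(1 - p) ^ card E * q ^ card X * cw X (p / ((1 - p) * q)) q S
      = (1 - p) ^ card S * (1 - p) ^ card (E - S) * (p / ((1 - p) * q)) ^ card S
         * (q ^ card S * q ^ num_components X S)"
    unfolding cw_def E k power_add by simp
  also have "\<dots> = p ^ card S * (1 - p) ^ card (E - S) * q ^ num_components X S"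
    using assms by (simp add: power_divide power_mult_distrib)
  finally show ?thesis by (simp add: rc_weight_def)
qed

section \<open>Connection odds on trees\<close>

lemma sum_Pow_Un:
  fixes g :: "'a set \<Rightarrow> real"
  assumes "A \<inter> B = {}"
  shows "(\<Sum>S\<in>Pow (A \<union> B). g S) = (\<Sum>P\<in>Pow A. \<Sum>R\<in>Pow B. g (P \<union> R))"
  unfolding sum.cartesian_product
  by (rule sum.reindex_bij_witness[of _ "\<lambda>(P, R). P \<union> R" "\<lambda>S. (S \<inter> A, S \<inter> B)"])
     (use assms in \<open>auto simp: Int_Un_distrib2 intro!: arg_cong[of _ _ g]\<close>)

lemma sum_Pow_insert:
  fixes g :: "'a set \<Rightarrow> real"
  assumes "e \<notin> B"
  shows "(\<Sum>S\<in>Pow (insert e B). g S) = (\<Sum>R\<in>Pow B. g R + g (insert e R))"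
proof -
  have "(\<Sum>S\<in>Pow (insert e B). g S) = (\<Sum>S\<in>Pow (B \<union> {e}). g S)"
    by simp
  also have "\<dots> = (\<Sum>P\<in>Pow B. \<Sum>R\<in>Pow {e}. g (P \<union> R))"
    using assms by (intro sum_Pow_Un) auto
  also have "\<dots> = (\<Sum>R\<in>Pow B. g R + g (insert e R))"
    by (intro sum.cong refl) (simp add: Pow_insert)
  finally show ?thesis .
qed

lemma sum_Pow_Un_insert:
  fixes g :: "'a set \<Rightarrow> real"
  assumes "A \<inter> B = {}" "e \<notin> A" "e \<notin> B"
  shows "(\<Sum>S\<in>Pow (A \<union> insert e B). g S) =
    (\<Sum>P\<in>Pow A. \<Sum>R\<in>Pow B. g (P \<union> R) + g (insert e (P \<union> R)))"
proof -
  have "(\<Sum>S\<in>Pow (A \<union> insert e B). g S) = (\<Sum>P\<in>Pow A. \<Sum>R\<in>Pow (insert e B). g (P \<union> R))"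
    using assms by (intro sum_Pow_Un) auto
  also have "\<dots> = (\<Sum>P\<in>Pow A. \<Sum>R\<in>Pow B. g (P \<union> R) + g (P \<union> insert e R))"
    using assms by (intro sum.cong refl sum_Pow_insert) auto
  finally show ?thesis by simp
qed

definition nb :: "'a set set \<Rightarrow> 'a \<Rightarrow> 'a set" where
  "nb E z = {u. {z, u} \<in> E}"

text \<open>In the following functions, \<open>z\<close> is the root of a subtree of depth \<open>r\<close>, and \<open>a\<close> is its parent,
  which does not belong to the subtree.\<close>

fun tedges :: "'a set set \<Rightarrow> nat \<Rightarrow> 'a \<Rightarrow> 'a \<Rightarrow> 'a set set" where
  "tedges E 0 a z = {}"
| "tedges E (Suc r) a z = (\<Union>y\<in>nb E z - {a}. insert {z, y} (tedges E r z y))"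

fun tverts :: "'a set set \<Rightarrow> nat \<Rightarrow> 'a \<Rightarrow> 'a \<Rightarrow> 'a set" where
  "tverts E 0 a z = {z}"
| "tverts E (Suc r) a z = insert z (\<Union>y\<in>nb E z - {a}. tverts E r z y)"

fun ttree :: "'a set set \<Rightarrow> nat \<Rightarrow> 'a \<Rightarrow> 'a \<Rightarrow> bool" where
  "ttree E 0 a z \<longleftrightarrow> True"
| "ttree E (Suc r) a z \<longleftrightarrow>
     (\<forall>y\<in>nb E z - {a}. ttree E r z y \<and> z \<notin> tverts E r z y) \<and>
     (\<forall>y\<in>nb E z - {a}. \<forall>y'\<in>nb E z - {a}. y \<noteq> y' \<longrightarrow> tverts E r z y \<inter> tverts E r z y' = {})"

text \<open>Truth at depth 0 is the wired boundary: a vertex at the bottom counts as joined to the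
  outside, whatever the configuration is there.\<close>

fun tconn :: "'a set set \<Rightarrow> 'a set set \<Rightarrow> nat \<Rightarrow> 'a \<Rightarrow> 'a \<Rightarrow> bool" where
  "tconn E S 0 a z \<longleftrightarrow> True"
| "tconn E S (Suc r) a z \<longleftrightarrow> (\<exists>y\<in>nb E z - {a}. {z, y} \<in> S \<and> tconn E S r z y)"

text \<open>The part of the open cluster of \<open>z\<close> inside the tree and above the bottom
  level. Where \<open>tconn\<close> fails the bottom is not reached, so the empty value at depth 0
  loses nothing.\<close>

fun treach :: "'a set set \<Rightarrow> 'a set set \<Rightarrow> nat \<Rightarrow> 'a \<Rightarrow> 'a \<Rightarrow> 'a set" where
  "treach E S 0 a z = {}"
| "treach E S (Suc r) a z = insert z (\<Union>y\<in>{y \<in> nb E z - {a}. {z, y} \<in> S}. treach E S r z y)"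

lemma root_in_tverts: "z \<in> tverts E r a z"
  by (cases r) auto

lemma tedges_subset: "tedges E r a z \<subseteq> E"
  by (induction E r a z rule: tedges.induct) (auto simp: nb_def)

lemma tedges_tverts: "e \<in> tedges E r a z \<Longrightarrow> e \<subseteq> tverts E r a z"
  by (induction E r a z rule: tedges.induct) (use root_in_tverts in \<open>fastforce+\<close>)

lemma treach_tverts: "treach E S r a z \<subseteq> tverts E r a z"
  by (induction E S r a z rule: treach.induct) auto

lemma tconn_cong:
  "S \<inter> tedges E r a z = S' \<inter> tedges E r a z \<Longrightarrow> tconn E S r a z \<longleftrightarrow> tconn E S' r a z"
proof (induction r arbitrary: a z)
  case (Suc r)
  have "{z, y} \<in> S \<and> tconn E S r z y \<longleftrightarrow> {z, y} \<in> S' \<and> tconn E S' r z y"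
    if y: "y \<in> nb E z - {a}" for y
  proof -
    have "insert {z, y} (tedges E r z y) \<subseteq> tedges E (Suc r) a z" using y by auto
    then have "S \<inter> insert {z, y} (tedges E r z y) = S' \<inter> insert {z, y} (tedges E r z y)"
      using Suc.prems by blast
    then show ?thesis using Suc.IH[of z y] by blast
  qed
  then show ?case by simp
qed simp

lemma treach_root: "\<not> tconn E S r a z \<Longrightarrow> z \<in> treach E S r a z"
  by (cases r) auto

text \<open>If no open path leads down to the bottom, the cluster below \<open>z\<close> ends inside
  the tree, and the only way out is the edge to the parent.\<close>

lemma treach_closed:
  assumes "S \<subseteq> E" "\<not> tconn E S r a z" "u \<in> treach E S r a z" "{u, v} \<in> S"
  shows "v \<in> treach E S r a z \<or> u = z \<and> v = a"
  using assms(2,3)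
proof (induction r arbitrary: a z)
  case (Suc r)
  consider "u = z" | y where "y \<in> nb E z - {a}" "{z, y} \<in> S" "u \<in> treach E S r z y"
    using Suc.prems(2) by auto
  then show ?case
  proof cases
    case 1
    show ?thesis
    proof (cases "v = a")
      case False
      then have v: "v \<in> nb E z - {a}" "{z, v} \<in> S"
        using 1 assms by (auto simp: nb_def)
      then have "\<not> tconn E S r z v" using Suc.prems(1) by auto
      then show ?thesis using v treach_root[of E S r z v] by auto
    qed (use 1 in auto)
  next
    case 2
    then have "\<not> tconn E S r z y" using Suc.prems(1) by auto
    from Suc.IH[OF this 2(3)] show ?thesis using 2 by auto
  qed
qed simp

text \<open>The recursion for the wired tree: \<open>Yit d w q r\<close> is the ratio in favour of an edge being joined to
  depth \<open>r\<close>, and the fixed point equation \<open>Yf d w q y = y\<close> is equivalent to \<open>w = crit_h q (d + 1) y\<close>.\<close>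

definition Yf :: "nat \<Rightarrow> real \<Rightarrow> real \<Rightarrow> real \<Rightarrow> real" where
  "Yf d w q y = 1 + w * (y ^ d - 1) / (y ^ d + q - 1 + w)"

definition Yit :: "nat \<Rightarrow> real \<Rightarrow> real \<Rightarrow> nat \<Rightarrow> real" where
  "Yit d w q r = (Yf d w q ^^ r) (1 + w)"

lemma Yf_ge_1: "w \<ge> 0 \<Longrightarrow> q \<ge> 1 \<Longrightarrow> y \<ge> 1 \<Longrightarrow> Yf d w q y \<ge> 1"
  unfolding Yf_def using one_le_power[of y d]
  by (simp, intro divide_nonneg_nonneg mult_nonneg_nonneg) linarith+

lemma Yit_ge_1: "w \<ge> 0 \<Longrightarrow> q \<ge> 1 \<Longrightarrow> Yit d w q r \<ge> 1"
  unfolding Yit_def by (induction r) (auto intro: Yf_ge_1)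

text \<open>The bound \<open>d\<close> counts children, that is, neighbours other than the one from
  which a vertex is entered. So it is \<open>\<Delta> - 1\<close> for a
  \<open>\<Delta>\<close>-regular graph.\<close>

locale rc_graph =
  fixes X :: "'a set" and E :: "'a set set" and x q :: real and d :: nat
  assumes finX: "finite X" and E_sub: "E \<subseteq> sedges X" and x0: "x \<ge> 0" and q1: "q \<ge> 1"
    and deg: "{u, v} \<in> E \<Longrightarrow> card (nb E v - {u}) \<le> d"
begin

abbreviation "W \<equiv> cw X x q"
abbreviation "Y \<equiv> Yit d (x * q) q"

lemma finE: "finite E"
  using finite_edges[OF finX E_sub] .

lemma W_nonneg: "W S \<ge> 0"
  using x0 q1 by (simp add: cw_nonneg)

lemma edge_D: "{u, v} \<in> E \<Longrightarrow> u \<in> X \<and> v \<in> X \<and> u \<noteq> v"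
  using E_sub sedges_iff[of u v X] by blast

lemma fin_nb: "finite (nb E z)"
  by (rule finite_subset[OF _ finX]) (auto simp: nb_def dest: edge_D)

lemma W_insert:
  assumes "insert {u, v} S \<subseteq> E" "{u, v} \<notin> S"
  shows "W (insert {u, v} S) = (if conn S u v then x * q else x) * W S"
  using assms E_sub finX by (intro cw_insert) auto

text \<open>This is where \<open>q \<ge> 1\<close> enters: an edge between connected vertices has
  the factor \<open>x * q\<close>, the larger of the two possible ones. Hence being joined through
  the outside is the worst case.\<close>

lemma W_insert_le:
  assumes "insert {u, v} S \<subseteq> E" "{u, v} \<notin> S"
  shows "W (insert {u, v} S) \<le> x * q * W S"
proof -
  have "x * 1 \<le> x * q" using x0 q1 by (intro mult_left_mono) auto
  then show ?thesis
    unfolding W_insert[OF assms] using W_nonneg[of S] by (auto intro!: mult_right_mono)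
qed

text \<open>By \<open>treach_closed\<close> the open cluster of \<open>z\<close> stays inside the
  tree while \<open>{a, z}\<close> is closed, and \<open>a\<close> is not in the tree. Opening
  \<open>{a, z}\<close> then multiplies the weight by exactly \<open>x\<close>, whatever the
  configuration outside.\<close>

lemma not_tconn_not_conn:
  assumes "S \<subseteq> E" "{a, z} \<notin> S" "\<not> tconn E S r a z" "a \<notin> tverts E r a z"
  shows "\<not> conn S a z"
proof
  assume "conn S a z"
  then have "conn S z a" by (rule conn_sym)
  then have "a \<in> treach E S r a z"
  proof (rule conn_closed)
    show "z \<in> treach E S r a z" using treach_root assms by metis
    show "v \<in> treach E S r a z" if "u \<in> treach E S r a z" "{u, v} \<in> S" for u v
      using treach_closed[OF assms(1,3) that] that assms(2) by (auto simp: insert_commute)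
  qed
  then show False using treach_tverts assms by fastforce
qed

text \<open>Consider a child \<open>y\<close> alone. Opening \<open>{z, y}\<close> has the factor
  \<open>x\<close> and joins \<open>z\<close> to the bottom if \<open>y\<close> is joined, so the
  hypothesis says that \<open>q\<close> times the odds of \<open>z\<close> being joined through
  \<open>y\<close> are at most \<open>Y r - 1\<close>. The bound on 1 plus \<open>q\<close> times
  the odds gains a factor \<open>Y r\<close> with every child, which gives
  \<open>Y r ^ card C\<close>. The induction over \<open>C\<close> keeps \<open>T\<close> arbitrary
  because the configuration below the new child is moved into it.\<close>

lemma child_step:
  assumes r: "ttree E (Suc r) a z"
    and IH: "\<And>y T. y \<in> nb E z - {a} \<Longrightarrow> T \<subseteq> E \<Longrightarrow> T \<inter> tedges E r z y = {} \<Longrightarrow> {z, y} \<notin> T \<Longrightarrow>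
      x * q * (\<Sum>S\<in>Pow (tedges E r z y). of_bool (tconn E S r z y) * W (T \<union> S))
      \<le> (Y r - 1) * ((1 + x) * (\<Sum>S\<in>Pow (tedges E r z y). of_bool (\<not> tconn E S r z y) * W (T \<union> S))
          + (\<Sum>S\<in>Pow (tedges E r z y). of_bool (tconn E S r z y) * W (T \<union> S)))"
    and C: "finite C" "C \<subseteq> nb E z - {a}"
    and T: "T \<subseteq> E" "T \<inter> (\<Union>y\<in>C. insert {z, y} (tedges E r z y)) = {}" "\<And>u. {z, u} \<notin> T"
  shows "(\<Sum>S\<in>Pow (\<Union>y\<in>C. insert {z, y} (tedges E r z y)).
            of_bool (\<exists>y\<in>C. {z, y} \<in> S \<and> tconn E S r z y) * W (T \<union> S))
         \<le> (Y r ^ card C - 1) / q *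
           (\<Sum>S\<in>Pow (\<Union>y\<in>C. insert {z, y} (tedges E r z y)).
            of_bool (\<not> (\<exists>y\<in>C. {z, y} \<in> S \<and> tconn E S r z y)) * W (T \<union> S))"
  using C T
proof (induction C arbitrary: T rule: finite_induct)
  case (insert y C)
  let ?ed = "\<lambda>C. \<Union>y\<in>C. insert {z, y} (tedges E r z y)"
  let ?cn = "\<lambda>C S. \<exists>y\<in>C. {z, y} \<in> S \<and> tconn E S r z y"
  define A where "A = ?ed C"
  define B where "B = tedges E r z y"
  define e where "e = {z, y}"
  define c where "c = ?cn C"
  define s where "s = (\<lambda>R. tconn E R r z y)"
  have y: "y \<in> nb E z - {a}" and Csub: "C \<subseteq> nb E z - {a}" using insert.prems by auto
  have yz: "y \<noteq> z" using y edge_D by (auto simp: nb_def)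
  have zB: "\<not> z \<in> f" if "f \<in> tedges E r z y'" "y' \<in> nb E z - {a}" for f y'
    using tedges_tverts[OF that(1)] r that(2) by auto
  have ed_ne: "f \<noteq> {}" if "f \<in> E" for f using E_sub that by (auto simp: sedges_def)
  have eB: "e \<notin> B" unfolding e_def B_def using zB[of "{z,y}" y] y by auto
  have eA: "e \<notin> A"
    unfolding e_def A_def using zB[of "{z,y}"] insert.hyps(2) Csub by (auto simp: doubleton_eq_iff)
  have AB: "A \<inter> B = {}"
  proof (rule ccontr)
    assume "A \<inter> B \<noteq> {}"
    then obtain f y' where f: "y' \<in> C" "f = {z, y'} \<or> f \<in> tedges E r z y'" "f \<in> B"
      unfolding A_def by auto
    then have "f \<in> tedges E r z y'" using zB[of f y] y unfolding B_def by auto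
    then have "f \<subseteq> tverts E r z y'" "f \<subseteq> tverts E r z y"
      using f(3) tedges_tverts unfolding B_def by metis+
    moreover have "tverts E r z y \<inter> tverts E r z y' = {}"
    proof -
      have "y' \<in> nb E z - {a}" "y \<noteq> y'" using f(1) Csub insert.hyps(2) by auto
      then show ?thesis using r y by simp
    qed
    moreover have "f \<noteq> {}" using f(3) tedges_subset ed_ne unfolding B_def by fastforce
    ultimately show False by blast
  qed
  have edI: "?ed (insert y C) = A \<union> insert e B"
    unfolding A_def B_def e_def by auto
  have BE: "B \<subseteq> E" unfolding B_def by (rule tedges_subset)
  have eE: "e \<in> E" using y by (auto simp: e_def nb_def)
  have AE: "A \<subseteq> E" unfolding A_def using tedges_subset[of E r z] Csub by (fastforce simp: nb_def)
  have finA: "finite A" "finite B" using finite_subset[OF AE finE] finite_subset[OF BE finE] .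
  have TT: "T \<inter> A = {}" "T \<inter> B = {}" "e \<notin> T" using insert.prems(3) unfolding edI by auto
  have cloc: "?cn C (T' \<union> P) \<longleftrightarrow> c P" if "T' \<inter> A = {}" "P \<subseteq> A" for T' P
    unfolding c_def
  proof (intro bex_cong refl conj_cong)
    fix y' assume y': "y' \<in> C"
    show "{z, y'} \<in> T' \<union> P \<longleftrightarrow> {z, y'} \<in> P" using that y' unfolding A_def by auto
    show "tconn E (T' \<union> P) r z y' \<longleftrightarrow> tconn E P r z y'"
      using that y' unfolding A_def by (intro tconn_cong) blast
  qed
  have sloc: "tconn E (T' \<union> R) r z y \<longleftrightarrow> s R" if "T' \<inter> B = {}" for T' R
    unfolding s_def using that unfolding B_def by (intro tconn_cong) blast
  have cn1: "?cn (insert y C) (P \<union> R) \<longleftrightarrow> c P" if "P \<subseteq> A" "R \<subseteq> B" for P R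
    using cloc[of R P] that AB eA eB unfolding Un_commute[of R P] e_def by auto
  have cn2: "?cn (insert y C) (insert e (P \<union> R)) \<longleftrightarrow> c P \<or> s R" if "P \<subseteq> A" "R \<subseteq> B" for P R
  proof -
    have "?cn C (insert e R \<union> P) \<longleftrightarrow> c P" using cloc[of "insert e R" P] that AB eA by blast
    moreover have "insert e R \<union> P = insert e (P \<union> R)" by auto
    moreover have "tconn E (insert e P \<union> R) r z y \<longleftrightarrow> s R" using sloc[of "insert e P" R] that AB eB by blast
    moreover have "insert e P \<union> R = insert e (P \<union> R)" by auto
    ultimately show ?thesis unfolding e_def by auto
  qed
  have nconn: "\<not> conn (T \<union> P \<union> R) z y" if P: "P \<subseteq> A" and R: "R \<subseteq> B" and n: "\<not> (c P \<and> s R)" for P R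
  proof (cases "s R")
    case False
    show ?thesis
    proof (rule not_tconn_not_conn)
      show "T \<union> P \<union> R \<subseteq> E" using insert.prems P R AE BE by auto
      show "{z, y} \<notin> T \<union> P \<union> R" using TT P R eA eB unfolding e_def by auto
      show "\<not> tconn E (T \<union> P \<union> R) r z y" using sloc[of "T \<union> P" R] TT P AB False by blast
      show "z \<notin> tverts E r z y" using r y by auto
    qed
  next
    case True
    then have nc: "\<not> c P" using n by auto
    let ?S = "T \<union> P \<union> R"
    \<comment> \<open>Here \<open>y\<close> is joined to the bottom and \<open>z\<close> is not. The
      cluster of \<open>z\<close> through the earlier children is then a closed set that misses
      \<open>y\<close>.\<close>
    define M where "M = insert z (\<Union>y'\<in>{y'\<in>C. {z, y'} \<in> ?S}. treach E ?S r z y')"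
    have SE: "?S \<subseteq> E" using insert.prems P R AE BE by auto
    have nt: "\<not> tconn E ?S r z y'" if "y' \<in> C" "{z, y'} \<in> ?S" for y'
    proof -
      have eq: "?S = T \<union> R \<union> P" by auto
      have "(T \<union> R) \<inter> A = {}" using TT R AB by blast
      from cloc[OF this P] have "?cn C ?S \<longleftrightarrow> c P" unfolding eq .
      then show ?thesis using nc that by blast
    qed
    have "v \<in> M" if "u \<in> M" "{u, v} \<in> ?S" for u v
    proof -
      consider "u = z" | y' where "y' \<in> C" "{z, y'} \<in> ?S" "u \<in> treach E ?S r z y'"
        using \<open>u \<in> M\<close> unfolding M_def by auto
      then show ?thesis
      proof cases
        case 1
        then have zv: "{z, v} \<in> ?S" using that by simp
        moreover have "{z, v} \<notin> T" using insert.prems by auto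
        moreover have "{z, v} \<notin> R" using R zB[of "{z,v}" y] y unfolding B_def by auto
        ultimately have "{z, v} \<in> A" using P by auto
        then obtain y' where y': "y' \<in> C" "{z, v} = {z, y'} \<or> {z, v} \<in> tedges E r z y'"
          unfolding A_def by auto
        then have "v = y'" using zB[of "{z, v}" y'] Csub by (auto simp: doubleton_eq_iff)
        then show ?thesis using y' zv nt treach_root unfolding M_def by fastforce
      next
        case 2
        from treach_closed[OF SE nt[OF 2(1,2)] 2(3) that(2)] show ?thesis
          using 2 unfolding M_def by auto
      qed
    qed
    moreover have "y \<notin> M"
    proof
      assume "y \<in> M"
      then obtain y' where y': "y' \<in> C" "y \<in> tverts E r z y'"
        using yz treach_tverts unfolding M_def by fastforce
      then have "y' \<in> nb E z - {a}" "y \<noteq> y'" using Csub insert.hyps(2) by auto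
      then have "tverts E r z y \<inter> tverts E r z y' = {}" using r y by simp
      then show False using y' root_in_tverts[of y E r z] by auto
    qed
    ultimately show ?thesis using conn_closed[of ?S z y M] unfolding M_def by blast
  qed
  define g where "g = (\<lambda>P R. W (T \<union> P \<union> R))"
  have g0: "g P R \<ge> 0" for P R unfolding g_def by (rule W_nonneg)
  have We: "W (T \<union> insert e (P \<union> R)) = x * g P R" if "P \<subseteq> A" "R \<subseteq> B" "\<not> (c P \<and> s R)" for P R
  proof -
    have "T \<union> insert e (P \<union> R) = insert {z, y} (T \<union> P \<union> R)" unfolding e_def by auto
    moreover have "W (insert {z, y} (T \<union> P \<union> R)) = x * g P R"
      unfolding g_def using nconn[OF that] that insert.prems AE BE eE TT eA eB
      by (subst W_insert) (auto simp: e_def)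
    ultimately show ?thesis by simp
  qed
  have Wle: "W (T \<union> insert e (P \<union> R)) \<le> x * q * g P R" if "P \<subseteq> A" "R \<subseteq> B" for P R
  proof -
    have "T \<union> insert e (P \<union> R) = insert {z, y} (T \<union> P \<union> R)" unfolding e_def by auto
    moreover have "W (insert {z, y} (T \<union> P \<union> R)) \<le> x * q * g P R"
      unfolding g_def using that insert.prems AE BE eE TT eA eB
      by (intro W_insert_le) (auto simp: e_def)
    ultimately show ?thesis by simp
  qed
  \<comment> \<open>Configurations with \<open>e\<close> closed, sorted by whether \<open>z\<close>
    is joined through an earlier child (\<gamma> and \<delta>) and whether \<open>y\<close> is
    joined to the bottom (\<beta> and \<delta>). Only in the class \<delta> can opening
    \<open>e\<close> have a factor other than \<open>x\<close>.\<close>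
  define \<alpha> where "\<alpha> = (\<Sum>P\<in>Pow A. \<Sum>R\<in>Pow B. of_bool (\<not> c P) * of_bool (\<not> s R) * g P R)"
  define \<beta> where "\<beta> = (\<Sum>P\<in>Pow A. \<Sum>R\<in>Pow B. of_bool (\<not> c P) * of_bool (s R) * g P R)"
  define \<gamma> where "\<gamma> = (\<Sum>P\<in>Pow A. \<Sum>R\<in>Pow B. of_bool (c P) * of_bool (\<not> s R) * g P R)"
  define \<delta> where "\<delta> = (\<Sum>P\<in>Pow A. \<Sum>R\<in>Pow B. of_bool (c P) * of_bool (s R) * g P R)"
  define \<kappa> where "\<kappa> = (Y r ^ card C - 1) / q"
  have Y1: "Y r \<ge> 1" using Yit_ge_1 x0 q1 by simp
  have \<kappa>0: "\<kappa> \<ge> 0" unfolding \<kappa>_def using Y1 q1 one_le_power[of "Y r" "card C"] by simp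
  have w0: "x * q \<ge> 0" using x0 q1 by simp
  \<comment> \<open>The configuration \<open>R\<close> below \<open>y\<close> is treated as part of
    the outside here, and so is \<open>P\<close> in \<open>IHy\<close>. Each hypothesis is thus used
    with the other side frozen.\<close>
  have IHC: "(\<Sum>P\<in>Pow A. of_bool (c P) * g P R) \<le> \<kappa> * (\<Sum>P\<in>Pow A. of_bool (\<not> c P) * g P R)"
    if R: "R \<subseteq> B" for R
  proof -
    have "(\<Sum>S\<in>Pow (?ed C). of_bool (?cn C S) * W (T \<union> R \<union> S))
      \<le> (Y r ^ card C - 1) / q * (\<Sum>S\<in>Pow (?ed C). of_bool (\<not> ?cn C S) * W (T \<union> R \<union> S))"
    proof (rule insert.IH)
      show "T \<union> R \<subseteq> E" using insert.prems R BE by auto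
      show "(T \<union> R) \<inter> ?ed C = {}"
        unfolding A_def[symmetric] using TT R AB by blast
      show "{z, u} \<notin> T \<union> R" for u using insert.prems(4)[of u] R zB[of "{z,u}" y] y unfolding B_def by auto
    qed (use Csub in auto)
    moreover have "T \<union> R \<union> S = T \<union> S \<union> R" for S by auto
    ultimately show ?thesis unfolding A_def c_def g_def \<kappa>_def by simp
  qed
  have IHy: "x * q * (\<Sum>R\<in>Pow B. of_bool (s R) * g P R)
      \<le> (Y r - 1) * ((1 + x) * (\<Sum>R\<in>Pow B. of_bool (\<not> s R) * g P R) + (\<Sum>R\<in>Pow B. of_bool (s R) * g P R))"
    if P: "P \<subseteq> A" for P
    unfolding B_def s_def g_def
  proof (rule IH)
    show "T \<union> P \<subseteq> E" using insert.prems P AE by auto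
    show "(T \<union> P) \<inter> tedges E r z y = {}" using TT P AB unfolding B_def by auto
    show "{z, y} \<notin> T \<union> P" using TT P eA unfolding e_def by auto
  qed (rule y)
  have 1: "\<delta> \<le> \<kappa> * \<beta>"
  proof -
    have "\<delta> = (\<Sum>R\<in>Pow B. of_bool (s R) * (\<Sum>P\<in>Pow A. of_bool (c P) * g P R))"
      unfolding \<delta>_def by (subst sum.swap) (simp add: sum_distrib_left mult_ac)
    also have "\<dots> \<le> (\<Sum>R\<in>Pow B. of_bool (s R) * (\<kappa> * (\<Sum>P\<in>Pow A. of_bool (\<not> c P) * g P R)))"
      by (intro sum_mono mult_left_mono IHC) auto
    also have "\<dots> = \<kappa> * \<beta>"
      unfolding \<beta>_def by (subst sum.swap) (simp add: sum_distrib_left mult_ac)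
    finally show ?thesis .
  qed
  have 2: "\<gamma> \<le> \<kappa> * \<alpha>"
  proof -
    have "\<gamma> = (\<Sum>R\<in>Pow B. of_bool (\<not> s R) * (\<Sum>P\<in>Pow A. of_bool (c P) * g P R))"
      unfolding \<gamma>_def by (subst sum.swap) (simp add: sum_distrib_left mult_ac)
    also have "\<dots> \<le> (\<Sum>R\<in>Pow B. of_bool (\<not> s R) * (\<kappa> * (\<Sum>P\<in>Pow A. of_bool (\<not> c P) * g P R)))"
      by (intro sum_mono mult_left_mono IHC) auto
    also have "\<dots> = \<kappa> * \<alpha>"
      unfolding \<alpha>_def by (subst sum.swap) (simp add: sum_distrib_left mult_ac)
    finally show ?thesis .
  qed
  have 3: "x * q * \<beta> \<le> (Y r - 1) * ((1 + x) * \<alpha> + \<beta>)"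
  proof -
    have "x * q * \<beta> = (\<Sum>P\<in>Pow A. of_bool (\<not> c P) * (x * q * (\<Sum>R\<in>Pow B. of_bool (s R) * g P R)))"
      unfolding \<beta>_def by (simp add: sum_distrib_left mult_ac)
    also have "\<dots> \<le> (\<Sum>P\<in>Pow A. of_bool (\<not> c P) * ((Y r - 1) *
        ((1 + x) * (\<Sum>R\<in>Pow B. of_bool (\<not> s R) * g P R) + (\<Sum>R\<in>Pow B. of_bool (s R) * g P R))))"
      by (intro sum_mono mult_left_mono IHy) auto
    also have "\<dots> = (Y r - 1) * ((1 + x) * \<alpha> + \<beta>)"
      unfolding \<alpha>_def \<beta>_def
      by (simp add: sum_distrib_left mult_ac distrib_left sum.distrib)
    finally show ?thesis .
  qed
  have lhs: "(\<Sum>S\<in>Pow (?ed (insert y C)). of_bool (?cn (insert y C) S) * W (T \<union> S))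
      \<le> (1 + x) * \<gamma> + (1 + x * q) * \<delta> + x * \<beta>"
  proof -
    have "(\<Sum>S\<in>Pow (?ed (insert y C)). of_bool (?cn (insert y C) S) * W (T \<union> S))
      = (\<Sum>P\<in>Pow A. \<Sum>R\<in>Pow B. of_bool (?cn (insert y C) (P \<union> R)) * W (T \<union> (P \<union> R)) +
          of_bool (?cn (insert y C) (insert e (P \<union> R))) * W (T \<union> insert e (P \<union> R)))"
      unfolding edI by (rule sum_Pow_Un_insert[OF AB eA eB])
    also have "\<dots> \<le> (\<Sum>P\<in>Pow A. \<Sum>R\<in>Pow B. (1 + x) * (of_bool (c P) * of_bool (\<not> s R) * g P R)
        + (1 + x * q) * (of_bool (c P) * of_bool (s R) * g P R)
        + x * (of_bool (\<not> c P) * of_bool (s R) * g P R))"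
    proof (intro sum_mono)
      fix P R assume "P \<in> Pow A" "R \<in> Pow B"
      then have PR: "P \<subseteq> A" "R \<subseteq> B" by auto
      have "W (T \<union> (P \<union> R)) = g P R" by (simp add: g_def Un_assoc)
      then show "of_bool (?cn (insert y C) (P \<union> R)) * W (T \<union> (P \<union> R)) +
          of_bool (?cn (insert y C) (insert e (P \<union> R))) * W (T \<union> insert e (P \<union> R))
        \<le> (1 + x) * (of_bool (c P) * of_bool (\<not> s R) * g P R)
        + (1 + x * q) * (of_bool (c P) * of_bool (s R) * g P R)
        + x * (of_bool (\<not> c P) * of_bool (s R) * g P R)"
        unfolding cn1[OF PR] cn2[OF PR] using We[OF PR] Wle[OF PR]
        by (cases "c P"; cases "s R") (auto simp: algebra_simps)
    qed
    also have "\<dots> = (1 + x) * \<gamma> + (1 + x * q) * \<delta> + x * \<beta>"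
      unfolding \<gamma>_def \<delta>_def \<beta>_def sum_distrib_left sum.distrib ..
    finally show ?thesis .
  qed
  have rhs: "(\<Sum>S\<in>Pow (?ed (insert y C)). of_bool (\<not> ?cn (insert y C) S) * W (T \<union> S))
      = (1 + x) * \<alpha> + \<beta>"
  proof -
    have "(\<Sum>S\<in>Pow (?ed (insert y C)). of_bool (\<not> ?cn (insert y C) S) * W (T \<union> S))
      = (\<Sum>P\<in>Pow A. \<Sum>R\<in>Pow B. of_bool (\<not> ?cn (insert y C) (P \<union> R)) * W (T \<union> (P \<union> R)) +
          of_bool (\<not> ?cn (insert y C) (insert e (P \<union> R))) * W (T \<union> insert e (P \<union> R)))"
      unfolding edI by (rule sum_Pow_Un_insert[OF AB eA eB])
    also have "\<dots> = (\<Sum>P\<in>Pow A. \<Sum>R\<in>Pow B. (1 + x) * (of_bool (\<not> c P) * of_bool (\<not> s R) * g P R)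
        + of_bool (\<not> c P) * of_bool (s R) * g P R)"
    proof (intro sum.cong refl)
      fix P R assume "P \<in> Pow A" "R \<in> Pow B"
      then have PR: "P \<subseteq> A" "R \<subseteq> B" by auto
      have "W (T \<union> (P \<union> R)) = g P R" by (simp add: g_def Un_assoc)
      then show "of_bool (\<not> ?cn (insert y C) (P \<union> R)) * W (T \<union> (P \<union> R)) +
          of_bool (\<not> ?cn (insert y C) (insert e (P \<union> R))) * W (T \<union> insert e (P \<union> R))
        = (1 + x) * (of_bool (\<not> c P) * of_bool (\<not> s R) * g P R)
        + of_bool (\<not> c P) * of_bool (s R) * g P R"
        unfolding cn1[OF PR] cn2[OF PR] using We[OF PR]
        by (cases "c P"; cases "s R") (auto simp: algebra_simps)
    qed
    also have "\<dots> = (1 + x) * \<alpha> + \<beta>"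
      unfolding \<alpha>_def \<beta>_def sum_distrib_left sum.distrib ..
    finally show ?thesis .
  qed
  have cd: "card (insert y C) = Suc (card C)" using insert.hyps by simp
  \<comment> \<open>With \<open>\<kappa> = (Y r ^ k - 1) / q\<close>, the factor
    \<open>\<kappa> * Y r + (Y r - 1) / q\<close> that results is
    \<open>(Y r ^ (k + 1) - 1) / q\<close>.\<close>
  have "(1 + x) * \<gamma> + (1 + x * q) * \<delta> + x * \<beta>
      \<le> (1 + x) * (\<kappa> * \<alpha>) + (1 + x * q) * (\<kappa> * \<beta>) + x * \<beta>"
    using 1 2 x0 w0 by (intro add_mono mult_left_mono) auto
  also have "\<dots> = \<kappa> * ((1 + x) * \<alpha> + \<beta>) + (\<kappa> + 1 / q) * (x * q * \<beta>)"
    using q1 by (simp add: field_simps)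
  also have "\<dots> \<le> \<kappa> * ((1 + x) * \<alpha> + \<beta>) + (\<kappa> + 1 / q) * ((Y r - 1) * ((1 + x) * \<alpha> + \<beta>))"
    using 3 \<kappa>0 q1 by (intro add_left_mono mult_left_mono) auto
  also have "\<dots> = (\<kappa> * Y r + (Y r - 1) / q) * ((1 + x) * \<alpha> + \<beta>)"
    using q1 by (simp add: field_simps)
  also have "\<kappa> * Y r + (Y r - 1) / q = (Y r ^ card (insert y C) - 1) / q"
    unfolding \<kappa>_def cd using q1 by (simp add: field_simps)
  finally show ?case
    using lhs unfolding rhs by linarith
qed simp

text \<open>Wired boundary is the worst case: the bound does not depend on the configuration \<open>T\<close> outside the
  subtree.\<close>

lemma tree_odds:
  assumes "{a, z} \<in> E" "ttree E r a z" "T \<subseteq> E" "T \<inter> tedges E r a z = {}" "{a, z} \<notin> T"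
  shows "x * q * (\<Sum>S\<in>Pow (tedges E r a z). of_bool (tconn E S r a z) * W (T \<union> S))
      \<le> (Y r - 1) * ((1 + x) * (\<Sum>S\<in>Pow (tedges E r a z). of_bool (\<not> tconn E S r a z) * W (T \<union> S))
          + (\<Sum>S\<in>Pow (tedges E r a z). of_bool (tconn E S r a z) * W (T \<union> S)))"
  using assms
proof (induction r arbitrary: a z T)
  case 0
  \<comment> \<open>The initial value \<open>1 + x * q\<close> of \<open>Yit\<close> makes this an
    equality: at depth 0 every configuration counts as joined.\<close>
  then show ?case by (simp add: Yit_def)
next
  case (Suc r)
  let ?C = "nb E z - {a}"
  define c where "c = (\<Sum>S\<in>Pow (tedges E (Suc r) a z). of_bool (tconn E S (Suc r) a z) * W (T \<union> S))"
  define m where "m = (\<Sum>S\<in>Pow (tedges E (Suc r) a z). of_bool (\<not> tconn E S (Suc r) a z) * W (T \<union> S))"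
  define \<kappa> where "\<kappa> = (Y r ^ d - 1) / q"
  have Y1: "Y r \<ge> 1" using Yit_ge_1 x0 q1 by simp
  have \<kappa>0: "\<kappa> \<ge> 0" unfolding \<kappa>_def using Y1 q1 one_le_power[of "Y r" d] by simp
  have c0: "c \<ge> 0" unfolding c_def by (intro sum_nonneg mult_nonneg_nonneg W_nonneg) auto
  have m0: "m \<ge> 0" unfolding m_def by (intro sum_nonneg mult_nonneg_nonneg W_nonneg) auto
  have "c \<le> (Y r ^ card ?C - 1) / q * m"
    unfolding c_def m_def tedges.simps tconn.simps
  proof (rule child_step[OF Suc.prems(2)])
    show "x * q * (\<Sum>S\<in>Pow (tedges E r z y). of_bool (tconn E S r z y) * W (T \<union> S))
      \<le> (Y r - 1) * ((1 + x) * (\<Sum>S\<in>Pow (tedges E r z y). of_bool (\<not> tconn E S r z y) * W (T \<union> S))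
          + (\<Sum>S\<in>Pow (tedges E r z y). of_bool (tconn E S r z y) * W (T \<union> S)))"
      if "y \<in> nb E z - {a}" "T \<subseteq> E" "T \<inter> tedges E r z y = {}" "{z, y} \<notin> T" for y T
      using Suc.IH[of z y T] that Suc.prems(2) by (auto simp: nb_def)
    show "{z, u} \<notin> T" for u
    proof
      assume "{z, u} \<in> T"
      moreover from this have "u \<noteq> a" using Suc.prems(5) by (auto simp: insert_commute)
      ultimately have "{z, u} \<in> tedges E (Suc r) a z" using Suc.prems(3) by (auto simp: nb_def)
      then show False using Suc.prems(4) \<open>{z, u} \<in> T\<close> by blast
    qed
  qed (use Suc.prems fin_nb in auto)
  also have "\<dots> \<le> \<kappa> * m"
    unfolding \<kappa>_def using Y1 q1 m0 deg[OF Suc.prems(1)]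
    by (intro mult_right_mono divide_right_mono diff_right_mono power_increasing) auto
  finally have cm: "c \<le> \<kappa> * m" .
  have Yd: "Y r ^ d = q * \<kappa> + 1" unfolding \<kappa>_def using q1 by simp
  \<comment> \<open>When \<open>Y r ^ d = q * \<kappa> + 1\<close> is put into \<open>Yf\<close>, a
    factor \<open>q\<close> cancels and the ratio is expressed by \<kappa>, the bound on the odds of
    \<open>z\<close> being joined.\<close>
  have "Y (Suc r) - 1 = x * q * (q * \<kappa>) / (q * (\<kappa> + (1 + x)))"
    using Yd unfolding Yit_def Yf_def by (simp add: algebra_simps)
  also have "\<dots> = x * q * \<kappa> / (\<kappa> + (1 + x))"
    using q1 by simp
  finally have Y': "Y (Suc r) - 1 = x * q * \<kappa> / (\<kappa> + (1 + x))" .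
  have pos: "\<kappa> + (1 + x) > 0" using \<kappa>0 x0 by linarith
  have "x * q * c * (\<kappa> + (1 + x)) = x * q * (c * \<kappa> + (1 + x) * c)" by (simp add: algebra_simps)
  also have "\<dots> \<le> x * q * (c * \<kappa> + (1 + x) * (\<kappa> * m))"
    using cm x0 q1 c0 by (intro mult_left_mono add_mono) auto
  also have "\<dots> = x * q * \<kappa> * ((1 + x) * m + c)" by (simp add: algebra_simps)
  finally have "x * q * c \<le> x * q * \<kappa> / (\<kappa> + (1 + x)) * ((1 + x) * m + c)"
    using pos by (simp add: field_simps)
  then show ?case unfolding Y'[symmetric] c_def m_def .
qed

text \<open>The factor for opening \<open>{a, z}\<close> is \<open>x\<close> if \<open>z\<close> is
  not joined to the bottom and at most \<open>x * q\<close> otherwise; \<open>tree_odds\<close>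
  bounds the second contribution by a multiple of \<open>Y r - 1\<close>. As \<open>Y r\<close>
  tends to 1, the odds tend to \<open>x\<close>, those of percolation with probability
  \<open>x / (1 + x)\<close>.\<close>

lemma edge_odds:
  assumes e: "{a, z} \<in> E" and tr: "ttree E r a z" "a \<notin> tverts E r a z"
    and T: "T \<subseteq> E" "T \<inter> tedges E r a z = {}" "{a, z} \<notin> T"
  shows "(\<Sum>S\<in>Pow (tedges E r a z). W (insert {a, z} (T \<union> S)))
    \<le> (x + (Y r - 1) * (1 + x)) * (\<Sum>S\<in>Pow (tedges E r a z). W (T \<union> S))"
proof -
  let ?B = "tedges E r a z"
  define \<beta> where "\<beta> = (\<Sum>S\<in>Pow ?B. of_bool (tconn E S r a z) * W (T \<union> S))"
  define \<alpha> where "\<alpha> = (\<Sum>S\<in>Pow ?B. of_bool (\<not> tconn E S r a z) * W (T \<union> S))"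
  have ab: "\<alpha> \<ge> 0" "\<beta> \<ge> 0" unfolding \<alpha>_def \<beta>_def
    by (intro sum_nonneg mult_nonneg_nonneg W_nonneg; simp)+
  have tot: "(\<Sum>S\<in>Pow ?B. W (T \<union> S)) = \<alpha> + \<beta>"
    unfolding \<alpha>_def \<beta>_def sum.distrib[symmetric] by (intro sum.cong) auto
  have eB: "{a, z} \<notin> ?B" using tedges_tverts tr by fastforce
  have "(\<Sum>S\<in>Pow ?B. W (insert {a, z} (T \<union> S)))
    \<le> (\<Sum>S\<in>Pow ?B. x * (of_bool (\<not> tconn E S r a z) * W (T \<union> S)) +
          x * q * (of_bool (tconn E S r a z) * W (T \<union> S)))"
  proof (intro sum_mono)
    fix S assume "S \<in> Pow ?B"
    then have S: "S \<subseteq> ?B" by simp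
    have sub: "insert {a, z} (T \<union> S) \<subseteq> E" "{a, z} \<notin> T \<union> S"
      using e T S tedges_subset eB by fastforce+
    have loc: "tconn E (T \<union> S) r a z = tconn E S r a z"
      using T by (intro tconn_cong) blast
    show "W (insert {a, z} (T \<union> S)) \<le> x * (of_bool (\<not> tconn E S r a z) * W (T \<union> S)) +
          x * q * (of_bool (tconn E S r a z) * W (T \<union> S))"
    proof (cases "tconn E S r a z")
      case True
      then show ?thesis using W_insert_le[OF sub] by simp
    next
      case False
      then have "\<not> conn (T \<union> S) a z"
        using not_tconn_not_conn[of "T \<union> S" a z r] sub tr loc by simp
      then show ?thesis using False W_insert[OF sub] by simp
    qed
  qed
  also have "\<dots> = x * \<alpha> + x * q * \<beta>"
    unfolding \<alpha>_def \<beta>_def sum_distrib_left sum.distrib ..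
  also have "\<dots> \<le> x * \<alpha> + (Y r - 1) * ((1 + x) * \<alpha> + \<beta>)"
    using tree_odds[OF e tr(1) T] unfolding \<alpha>_def \<beta>_def by simp
  also have "\<dots> \<le> x * (\<alpha> + \<beta>) + (Y r - 1) * ((1 + x) * \<alpha> + (1 + x) * \<beta>)"
    using ab x0 Yit_ge_1[of "x * q" q d r] q1 by (intro add_mono mult_left_mono) (auto simp: algebra_simps)
  also have "\<dots> = (x + (Y r - 1) * (1 + x)) * (\<alpha> + \<beta>)" by (simp add: algebra_simps)
  finally show ?thesis unfolding tot .
qed

section \<open>Unnormalised probabilities that given edges are open\<close>

definition mu :: "'a set set \<Rightarrow> real" where
  "mu A = (\<Sum>S\<in>Pow E. of_bool (A \<subseteq> S) * W S)"

lemma mu_nonneg: "mu A \<ge> 0"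
  unfolding mu_def by (intro sum_nonneg mult_nonneg_nonneg W_nonneg) auto

lemma mu_antimono: "A \<subseteq> B \<Longrightarrow> mu B \<le> mu A"
  unfolding mu_def by (intro sum_mono mult_right_mono W_nonneg) auto

definition ptil :: "nat \<Rightarrow> real" where
  "ptil r = (x + (Y r - 1) * (1 + x)) / (1 + (x + (Y r - 1) * (1 + x)))"

lemma ptil_range: "0 \<le> ptil r" "ptil r \<le> 1"
proof -
  have "x + (Y r - 1) * (1 + x) \<ge> 0" using x0 q1 Yit_ge_1[of "x * q" q d r] by simp
  then show "0 \<le> ptil r" "ptil r \<le> 1" unfolding ptil_def by (auto simp: field_simps)
qed

text \<open>The event \<open>A\<close> avoids the tree and the edge, hence it is decided by the
  configuration \<open>T\<close> on the remaining edges. For each such \<open>T\<close> the bound of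
  \<open>edge_odds\<close> applies, and \<open>ptil\<close> converts these odds into a
  probability.\<close>

lemma mu_insert_clean:
  assumes e: "{a, z} \<in> E" and tr: "ttree E r a z" "a \<notin> tverts E r a z"
    and A: "A \<inter> tedges E r a z = {}" "{a, z} \<notin> A"
  shows "mu (insert {a, z} A) \<le> ptil r * mu A"
proof -
  let ?B = "tedges E r a z" and ?e = "{a, z}"
  define C where "C = E - insert ?e ?B"
  have eB: "?e \<notin> ?B" using tedges_tverts tr by fastforce
  have EC: "E = C \<union> insert ?e ?B" unfolding C_def using e tedges_subset by fastforce
  have CB: "C \<inter> ?B = {}" "?e \<notin> C" unfolding C_def by auto
  define c o' where "c = (\<lambda>T. \<Sum>S\<in>Pow ?B. W (T \<union> S))" and "o' = (\<lambda>T. \<Sum>S\<in>Pow ?B. W (insert ?e (T \<union> S)))"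
  let ?k = "x + (Y r - 1) * (1 + x)"
  have k0: "?k \<ge> 0" using x0 q1 Yit_ge_1[of "x * q" q d r] by simp
  have oc: "o' T \<le> ptil r * (c T + o' T)" if "T \<subseteq> C" for T
  proof -
    have "o' T \<le> ?k * c T" unfolding o'_def c_def
      using that by (intro edge_odds[OF e tr]) (auto simp: C_def)
    then have "o' T * (1 + ?k) \<le> ?k * (c T + o' T)" by (simp add: algebra_simps)
    then show ?thesis using k0 unfolding ptil_def by (simp add: field_simps)
  qed
  have 1: "mu A = (\<Sum>T\<in>Pow C. of_bool (A \<subseteq> T) * (c T + o' T))"
  proof -
    have "mu A = (\<Sum>T\<in>Pow C. \<Sum>S\<in>Pow ?B. of_bool (A \<subseteq> T \<union> S) * W (T \<union> S) +
        of_bool (A \<subseteq> insert ?e (T \<union> S)) * W (insert ?e (T \<union> S)))"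
      unfolding mu_def by (subst EC, rule sum_Pow_Un_insert[OF CB eB])
    also have "\<dots> = (\<Sum>T\<in>Pow C. \<Sum>S\<in>Pow ?B. of_bool (A \<subseteq> T) * (W (T \<union> S) + W (insert ?e (T \<union> S))))"
    proof (intro sum.cong refl)
      fix T S assume "T \<in> Pow C" "S \<in> Pow ?B"
      then have "A \<subseteq> T \<union> S \<longleftrightarrow> A \<subseteq> T" "A \<subseteq> insert ?e (T \<union> S) \<longleftrightarrow> A \<subseteq> T" using A by auto
      then show "of_bool (A \<subseteq> T \<union> S) * W (T \<union> S) +
        of_bool (A \<subseteq> insert ?e (T \<union> S)) * W (insert ?e (T \<union> S)) =
        of_bool (A \<subseteq> T) * (W (T \<union> S) + W (insert ?e (T \<union> S)))" by auto
    qed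
    finally show ?thesis by (simp add: c_def o'_def sum_distrib_left sum.distrib distrib_left)
  qed
  have 2: "mu (insert ?e A) = (\<Sum>T\<in>Pow C. of_bool (A \<subseteq> T) * o' T)"
  proof -
    have "mu (insert ?e A) = (\<Sum>T\<in>Pow C. \<Sum>S\<in>Pow ?B. of_bool (insert ?e A \<subseteq> T \<union> S) * W (T \<union> S) +
        of_bool (insert ?e A \<subseteq> insert ?e (T \<union> S)) * W (insert ?e (T \<union> S)))"
      unfolding mu_def by (subst EC, rule sum_Pow_Un_insert[OF CB eB])
    also have "\<dots> = (\<Sum>T\<in>Pow C. \<Sum>S\<in>Pow ?B. of_bool (A \<subseteq> T) * W (insert ?e (T \<union> S)))"
    proof (intro sum.cong refl)
      fix T S assume "T \<in> Pow C" "S \<in> Pow ?B"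
      then have "\<not> insert ?e A \<subseteq> T \<union> S" "insert ?e A \<subseteq> insert ?e (T \<union> S) \<longleftrightarrow> A \<subseteq> T"
        using A CB eB by auto
      then show "of_bool (insert ?e A \<subseteq> T \<union> S) * W (T \<union> S) +
        of_bool (insert ?e A \<subseteq> insert ?e (T \<union> S)) * W (insert ?e (T \<union> S)) =
        of_bool (A \<subseteq> T) * W (insert ?e (T \<union> S))" by auto
    qed
    finally show ?thesis by (simp add: o'_def sum_distrib_left)
  qed
  show ?thesis
    unfolding 1 2 sum_distrib_left
    by (intro sum_mono) (use oc in \<open>auto simp: of_bool_def\<close>)
qed

end

section \<open>Paths and ears\<close>

fun pedges :: "'a list \<Rightarrow> 'a set set" where
  "pedges (u # v # zs) = insert {u, v} (pedges (v # zs))"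
| "pedges _ = {}"

lemma pedges_snoc: "xs \<noteq> [] \<Longrightarrow> pedges (xs @ [z]) = insert {last xs, z} (pedges xs)"
  by (induction xs rule: pedges.induct) auto

lemma pedges_append: "pedges (xs @ v # ys) = pedges (xs @ [v]) \<union> pedges (v # ys)"
  by (induction xs rule: pedges.induct) auto

lemma pedges_rev: "pedges (rev xs) = pedges xs"
proof (induction xs rule: pedges.induct)
  case (1 u v zs)
  have "pedges (rev (u # v # zs)) = pedges (rev (v # zs) @ [u])" by simp
  also have "\<dots> = insert {last (rev (v # zs)), u} (pedges (rev (v # zs)))"
    by (rule pedges_snoc) simp
  also have "\<dots> = insert {v, u} (pedges (v # zs))" unfolding 1 by (simp add: last_rev)
  finally show ?case by (simp add: insert_commute)
qed auto

lemma pedges_subset: "e \<in> pedges xs \<Longrightarrow> e \<subseteq> set xs"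
  by (induction xs rule: pedges.induct) auto

lemma pedges_nth: "{u, v} \<in> pedges xs \<Longrightarrow>
   \<exists>j. Suc j < length xs \<and> (u = xs ! j \<and> v = xs ! Suc j \<or> v = xs ! j \<and> u = xs ! Suc j)"
proof (induction xs rule: pedges.induct)
  case (1 a b zs)
  show ?case
  proof (cases "{u, v} = {a, b}")
    case True
    then show ?thesis by (intro exI[of _ 0]) (auto simp: doubleton_eq_iff)
  next
    case False
    with 1 obtain j where "Suc j < length (b # zs)"
      "u = (b # zs) ! j \<and> v = (b # zs) ! Suc j \<or> v = (b # zs) ! j \<and> u = (b # zs) ! Suc j" by auto
    then show ?thesis by (intro exI[of _ "Suc j"]) auto
  qed
qed auto

lemma nb_sym: "y \<in> nb E z \<longleftrightarrow> z \<in> nb E y"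
  by (simp add: nb_def insert_commute)

text \<open>Walks from \<open>z\<close> without immediate reversals, where \<open>a\<close> is regarded as the predecessor
  of \<open>z\<close>; the list does not include \<open>z\<close>.\<close>

fun nbw :: "'a set set \<Rightarrow> 'a \<Rightarrow> 'a \<Rightarrow> 'a list \<Rightarrow> bool" where
  "nbw E a z [] \<longleftrightarrow> True"
| "nbw E a z (y # ys) \<longleftrightarrow> y \<in> nb E z \<and> y \<noteq> a \<and> nbw E z y ys"

lemma nbw_snoc:
  "nbw E a z (zs @ [v]) \<longleftrightarrow>
     nbw E a z zs \<and> v \<in> nb E (last (z # zs)) \<and> v \<noteq> last (a # butlast (z # zs))"
proof (induction zs arbitrary: a z)
  case (Cons y ys)
  have "last (z # butlast (y # ys)) = last (a # butlast (z # y # ys))" by simp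
  then show ?case using Cons by auto
qed auto

lemma nbw_pedges: "nbw E a z zs \<Longrightarrow> pedges (z # zs) \<subseteq> E"
  by (induction zs arbitrary: a z) (auto simp: nb_def)

lemma tverts_nbw: "v \<in> tverts E r a z \<longleftrightarrow> (\<exists>zs. nbw E a z zs \<and> length zs \<le> r \<and> v = last (z # zs))"
proof (induction r arbitrary: a z)
  case (Suc r)
  show ?case
  proof
    assume "v \<in> tverts E (Suc r) a z"
    then consider "v = z" | y where "y \<in> nb E z - {a}" "v \<in> tverts E r z y" by auto
    then show "\<exists>zs. nbw E a z zs \<and> length zs \<le> Suc r \<and> v = last (z # zs)"
    proof cases
      case 2
      then obtain zs where "nbw E z y zs" "length zs \<le> r" "v = last (y # zs)" using Suc by blast
      then show ?thesis using 2 by (intro exI[of _ "y # zs"]) auto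
    qed (auto intro: exI[of _ "[]"])
  next
    assume "\<exists>zs. nbw E a z zs \<and> length zs \<le> Suc r \<and> v = last (z # zs)"
    then obtain zs where zs: "nbw E a z zs" "length zs \<le> Suc r" "v = last (z # zs)" by blast
    then show "v \<in> tverts E (Suc r) a z"
    proof (cases zs)
      case (Cons y ys)
      then have "v \<in> tverts E r z y" using zs Suc[of z y] by auto
      then show ?thesis using Cons zs by auto
    qed auto
  qed
qed auto

text \<open>Failures of the tree property are coincidences of ends: a subtree that contains
  \<open>z\<close> gives a walk with the same end as the empty walk, and overlapping subtrees give
  two walks that differ in their first step.\<close>

lemma ttree_if_inj:
  "inj_on (\<lambda>zs. last (z # zs)) {zs. nbw E a z zs \<and> length zs \<le> r} \<Longrightarrow> ttree E r a z"
proof (induction r arbitrary: a z)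
  case (Suc r)
  let ?A = "{zs. nbw E a z zs \<and> length zs \<le> Suc r}"
  have eqI: "y # ys = y' # ys'"
    if "y \<in> nb E z - {a}" "nbw E z y ys" "length ys \<le> r" "y' \<in> nb E z - {a}" "nbw E z y' ys'"
      "length ys' \<le> r" "last (y # ys) = last (y' # ys')" for y ys y' ys'
    using that by (intro inj_onD[OF Suc.prems]) auto
  show ?case
    unfolding ttree.simps
  proof (intro conjI ballI impI)
    fix y assume y: "y \<in> nb E z - {a}"
    have "inj_on (\<lambda>zs. last (y # zs)) {zs. nbw E z y zs \<and> length zs \<le> r}"
    proof (rule inj_onI)
      fix ys ys' assume "ys \<in> {zs. nbw E z y zs \<and> length zs \<le> r}"
        "ys' \<in> {zs. nbw E z y zs \<and> length zs \<le> r}" "last (y # ys) = last (y # ys')"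
      then show "ys = ys'" using eqI[OF y _ _ y, of ys ys'] by simp
    qed
    then show "ttree E r z y" by (rule Suc.IH)
    show "z \<notin> tverts E r z y"
    proof
      assume "z \<in> tverts E r z y"
      then obtain ys where ys: "nbw E z y ys" "length ys \<le> r" "z = last (y # ys)"
        unfolding tverts_nbw by blast
      have "y # ys = []" using ys y by (intro inj_onD[OF Suc.prems]) auto
      then show False by simp
    qed
    fix y' assume y': "y' \<in> nb E z - {a}" and ne: "y \<noteq> y'"
    show "tverts E r z y \<inter> tverts E r z y' = {}"
    proof (rule ccontr)
      assume "tverts E r z y \<inter> tverts E r z y' \<noteq> {}"
      then obtain v where "v \<in> tverts E r z y" "v \<in> tverts E r z y'" by blast
      then obtain ys ys' where "nbw E z y ys" "length ys \<le> r" "v = last (y # ys)"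
        "nbw E z y' ys'" "length ys' \<le> r" "v = last (y' # ys')" unfolding tverts_nbw by blast
      then show False using eqI[OF y _ _ y', of ys ys'] ne by auto
    qed
  qed
qed simp

text \<open>The vertex \<open>z\<close> continues the path \<open>xs\<close>.\<close>

definition clean :: "'a set set \<Rightarrow> nat \<Rightarrow> 'a list \<Rightarrow> 'a \<Rightarrow> bool" where
  "clean E R xs z \<longleftrightarrow> ttree E R (last xs) z \<and> tverts E R (last xs) z \<inter> set xs = {}"

text \<open>Each position is judged by the prefix before it, because the path is revealed from its
  start and each step is charged to the tree ahead of it.\<close>

definition badset :: "'a set set \<Rightarrow> nat \<Rightarrow> 'a list \<Rightarrow> nat set" where
  "badset E R xs = {i. 0 < i \<and> i < length xs \<and> \<not> clean E R (take i xs) (xs ! i)}"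

lemma finite_badset: "finite (badset E R xs)"
  by (rule finite_subset[of _ "{..<length xs}"]) (auto simp: badset_def)

lemma badset_snoc:
  assumes "xs \<noteq> []"
  shows "badset E R (xs @ [z]) = badset E R xs \<union> (if clean E R xs z then {} else {length xs})"
  using assms by (auto simp: badset_def nth_append less_Suc_eq)

context rc_graph begin

text \<open>A clean step gains the factor \<open>ptil R\<close>, since the tree ahead shares no edge
  with the path so far. A bad step gains nothing, by monotonicity of \<open>mu\<close>. The powers
  for the bad steps stand on the left so that no division by \<open>ptil R\<close> occurs.\<close>

lemma mu_path:
  assumes "distinct xs" "pedges xs \<subseteq> E" "xs \<noteq> []"
  shows "mu (pedges xs) * ptil R ^ card (badset E R xs) \<le> ptil R ^ (length xs - 1) * mu {}"
  using assms
proof (induction xs rule: rev_induct)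
  case (snoc z xs)
  show ?case
  proof (cases "xs = []")
    case True
    moreover have "badset E R [z] = {}" by (auto simp: badset_def)
    ultimately show ?thesis by simp
  next
    case False
    have pe: "pedges (xs @ [z]) = insert {last xs, z} (pedges xs)" using False by (rule pedges_snoc)
    have IH: "mu (pedges xs) * ptil R ^ card (badset E R xs) \<le> ptil R ^ (length xs - 1) * mu {}"
      using snoc False pe by auto
    obtain l where l: "length xs = Suc l" using False by (cases xs) auto
    have "mu (pedges (xs @ [z])) * ptil R ^ card (badset E R (xs @ [z]))
        \<le> ptil R * (mu (pedges xs) * ptil R ^ card (badset E R xs))"
    proof (cases "clean E R xs z")
      case True
      have disj: "tverts E R (last xs) z \<inter> set xs = {}" "ttree E R (last xs) z"
        using True by (auto simp: clean_def)
      have "mu (insert {last xs, z} (pedges xs)) \<le> ptil R * mu (pedges xs)"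
      proof (rule mu_insert_clean)
        show "{last xs, z} \<in> E" using snoc.prems pe by auto
        show "last xs \<notin> tverts E R (last xs) z" using disj False by auto
        show "pedges xs \<inter> tedges E R (last xs) z = {}"
        proof (rule ccontr)
          assume "pedges xs \<inter> tedges E R (last xs) z \<noteq> {}"
          then obtain e where e: "e \<in> pedges xs" "e \<in> tedges E R (last xs) z" by blast
          then have "e \<in> E" "e \<subseteq> set xs" "e \<subseteq> tverts E R (last xs) z"
            using pedges_subset tedges_tverts tedges_subset by fast+
          moreover from this have "e \<noteq> {}" using E_sub unfolding sedges_def by auto
          ultimately show False using disj by blast
        qed
        show "{last xs, z} \<notin> pedges xs" using snoc.prems pedges_subset[of "{last xs, z}" xs] by auto
      qed (rule disj)
      then have "mu (pedges (xs @ [z])) * ptil R ^ card (badset E R xs)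
          \<le> ptil R * mu (pedges xs) * ptil R ^ card (badset E R xs)"
        unfolding pe using ptil_range(1) by (intro mult_right_mono) auto
      moreover have "badset E R (xs @ [z]) = badset E R xs" using True badset_snoc[OF False] by simp
      ultimately show ?thesis by (simp add: mult_ac)
    next
      case bad: False
      have "badset E R (xs @ [z]) = insert (length xs) (badset E R xs)"
        using bad badset_snoc[OF False] by simp
      moreover have "length xs \<notin> badset E R xs" by (simp add: badset_def)
      ultimately have c: "card (badset E R (xs @ [z])) = Suc (card (badset E R xs))"
        using finite_badset[of E R xs] by simp
      have "mu (pedges (xs @ [z])) \<le> mu (pedges xs)" unfolding pe by (rule mu_antimono) auto
      then have "mu (pedges (xs @ [z])) * ptil R ^ card (badset E R (xs @ [z]))
          \<le> mu (pedges xs) * ptil R ^ card (badset E R (xs @ [z]))"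
        using ptil_range(1) by (intro mult_right_mono) auto
      then show ?thesis unfolding c by (simp add: mult_ac)
    qed
    also have "\<dots> \<le> ptil R * (ptil R ^ (length xs - 1) * mu {})"
      using IH ptil_range(1) by (rule mult_left_mono)
    finally show ?thesis using l by (simp add: mult_ac)
  qed
qed simp

end

text \<open>An ear is a walk from \<open>u\<close> through the new vertices \<open>f\<close> to \<open>t\<close>, attached to a subgraph with vertices
  \<open>U\<close> and edges \<open>F\<close>. Its last step leads to \<open>U\<close> or back to the ear itself.\<close>

definition is_ear :: "'a set \<Rightarrow> 'a set set \<Rightarrow> 'a \<Rightarrow> 'a list \<Rightarrow> 'a \<Rightarrow> bool" where
  "is_ear U F u f t \<longleftrightarrow> u \<in> U \<and> t \<in> U \<union> set f \<and> distinct f \<and> set f \<inter> U = {} \<and>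
     (if f = [] then t \<noteq> u \<and> {u, t} \<notin> F else t \<noteq> last f \<and> t \<noteq> last (u # butlast f))"

text \<open>Two walks with a common end, from \<open>u\<close> along \<open>c @ f\<close> and from
  \<open>t\<close> along \<open>g\<close>, contain an ear: follow the first as far as the first
  vertex of \<open>g\<close> that lies on \<open>f\<close>, then return along \<open>g\<close> to
  \<open>t\<close>. The stem \<open>c\<close> serves the case of two walks that leave
  \<open>U\<close> together and separate later; \<open>t\<close> is then the end of the
  stem.\<close>

lemma lasso_ear:
  assumes u: "u \<in> U" and t: "t \<in> U \<union> set c"
    and E: "pedges (u # c @ f) \<subseteq> E" "pedges (t # g) \<subseteq> E"
    and ne: "f \<noteq> []" "g \<noteq> []" "last f = last g"
    and dist: "distinct (c @ f)" "distinct (c @ g)" "set (c @ f) \<inter> U = {}" "set (c @ g) \<inter> U = {}"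
    and diff: "t \<noteq> last (u # c) \<or> hd f \<noteq> hd g"
  shows "\<exists>h. is_ear U F u h t \<and> pedges (u # h @ [t]) \<subseteq> E \<and> length h \<le> length c + length f + length g"
proof -
  have "\<exists>v\<in>set g. v \<in> set f" using ne last_in_set[of f] last_in_set[of g] by auto
  then obtain g1 v g2 where g: "g = g1 @ v # g2" "v \<in> set f" "\<forall>y\<in>set g1. y \<notin> set f"
    using split_list_first_prop[of g "\<lambda>v. v \<in> set f"] by blast
  then obtain f1 f2 where f: "f = f1 @ v # f2" by (meson split_list)
  define h where "h = c @ f1 @ v # rev g1"
  have vn: "v \<notin> U" "v \<notin> set c" using dist f by auto
  have dh: "distinct h" unfolding h_def using dist f g by auto
  have hU: "set h \<inter> U = {}" unfolding h_def using dist f g by auto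
  have tU: "t \<in> U \<union> set h" using t unfolding h_def by auto
  have tg: "t \<noteq> v" "t \<notin> set g1" "t \<notin> set f1" using t dist f g by auto
  have "last h \<in> insert v (set g1)" unfolding h_def by (cases g1) (auto simp: last_rev)
  then have 1: "t \<noteq> last h" using tg by auto
  \<comment> \<open>The ear could end with an immediate reversal only if both \<open>f1\<close> and
    \<open>g1\<close> are empty, and \<open>diff\<close> excludes this.\<close>
  have 2: "t \<noteq> last (u # butlast h)"
  proof (cases g1)
    case Nil
    then have b: "butlast h = c @ f1" unfolding h_def by (simp add: butlast_append)
    show ?thesis
    proof (cases f1 rule: rev_cases)
      case Nil': Nil
      then show ?thesis using diff f g Nil unfolding b by auto
    next
      case (snoc ys y)
      then show ?thesis using tg unfolding b by auto
    qed
  next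
    case (Cons y ys)
    have "butlast h = c @ f1 @ v # rev ys" unfolding h_def Cons by (simp add: butlast_append)
    then have "last (u # butlast h) \<in> insert v (set g1)"
      unfolding Cons by (cases ys) (auto simp: last_rev)
    then show ?thesis using tg by auto
  qed
  have ear: "is_ear U F u h t"
    unfolding is_ear_def using u tU dh hU 1 2 by (auto simp: h_def)
  have "pedges (u # h @ [t]) = pedges ((u # c @ f1) @ v # (rev g1 @ [t]))" unfolding h_def by simp
  also have "\<dots> = pedges ((u # c @ f1) @ [v]) \<union> pedges (v # rev g1 @ [t])" by (rule pedges_append)
  also have "v # rev g1 @ [t] = rev (t # g1 @ [v])" by simp
  also have "pedges (rev (t # g1 @ [v])) = pedges (t # g1 @ [v])" by (rule pedges_rev)
  finally have "pedges (u # h @ [t]) = pedges ((u # c @ f1) @ [v]) \<union> pedges (t # g1 @ [v])" .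
  moreover have "pedges ((u # c @ f1) @ [v]) \<subseteq> E"
    using E(1) pedges_append[of "u # c @ f1" v f2] unfolding f by auto
  moreover have "pedges ((t # g1) @ [v]) \<subseteq> E"
    using E(2) pedges_append[of "t # g1" v g2] unfolding g by auto
  ultimately have "pedges (u # h @ [t]) \<subseteq> E" by simp
  moreover have "length h \<le> length c + length f + length g" unfolding h_def using f g by simp
  ultimately show ?thesis using ear by blast
qed

text \<open>A walk of length at most \<open>R\<close> from \<open>xs ! i\<close> first follows the
  path and then leaves \<open>U\<close> for good without meeting itself, since the first violation
  would complete an ear. Two walks with the same end would form a lasso and hence an ear of length
  at most \<open>2 * R\<close>; so ends determine walks, and \<open>ttree_if_inj\<close> applies.
  The earlier part of the path is not met, because a walk moves only forward on the path or ends
  outside \<open>U\<close>.\<close>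

lemma clean_if_no_ear:
  assumes E: "E \<subseteq> sedges X"
    and xs: "distinct xs" "pedges xs \<subseteq> F" "set xs \<subseteq> U" and i: "0 < i" "i < length xs"
    and loc: "\<And>zs. nbw E (xs ! (i - 1)) (xs ! i) zs \<Longrightarrow> length zs \<le> R \<Longrightarrow> pedges (xs ! i # zs) \<subseteq> F \<Longrightarrow>
        \<exists>k. zs = take k (drop (Suc i) xs)"
    and no: "\<And>u f t. is_ear U F u f t \<Longrightarrow> pedges (u # f @ [t]) \<subseteq> E \<Longrightarrow> length f \<le> 2 * R \<Longrightarrow> False"
  shows "clean E R (take i xs) (xs ! i)"
proof -
  define a where "a = xs ! (i - 1)"
  define z where "z = xs ! i"
  define D where "D = drop (Suc i) xs"
  have zD: "z # D = drop i xs" unfolding z_def D_def using i by (simp add: Cons_nth_drop_Suc)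
  have dD: "distinct (z # D)" unfolding zD using xs by simp
  have zDU: "set (z # D) \<subseteq> U" unfolding zD using xs set_drop_subset by fastforce
  have irr: "u \<noteq> v" if "{u, v} \<in> E" for u v using that E sedges_iff[of u v X] by blast
  have DF: "pedges (z # take k D) \<subseteq> F" for k
  proof -
    have "xs = take i xs @ z # D" unfolding zD by simp
    then have "pedges (z # D) \<subseteq> F" using pedges_append[of "take i xs" z D] xs by auto
    moreover have "pedges (z # take k D) \<subseteq> pedges (z # D)"
    proof (cases "drop k D")
      case (Cons y ys)
      have "z # D = (z # take k D) @ y # ys" using Cons by (metis append_Cons append_take_drop_id)
      then show ?thesis using pedges_append[of "z # take k D" y ys] pedges_snoc[of "z # take k D" y] by auto
    qed simp
    ultimately show ?thesis by blast
  qed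
  have lastU: "last (z # take k D) \<in> U" for k
    using zDU set_take_subset[of k D] last_in_set[of "z # take k D"] by auto
  have A: "\<exists>k f. zs = take k D @ f \<and> distinct f \<and> set f \<inter> U = {}"
    if "nbw E a z zs" "length zs \<le> R" for zs
    using that
  proof (induction zs rule: rev_induct)
    case Nil
    then show ?case by (intro exI[of _ 0] exI[of _ "[]"]) auto
  next
    case (snoc v zs)
    then obtain k f where zs: "zs = take k D @ f" "distinct f" "set f \<inter> U = {}"
      by (auto simp: nbw_snoc)
    have v: "v \<in> nb E (last (z # zs))" "v \<noteq> last (a # butlast (z # zs))"
      using snoc.prems by (auto simp: nbw_snoc)
    have pE: "pedges (z # zs @ [v]) \<subseteq> E" using nbw_pedges[OF snoc.prems(1)] by simp
    define u where "u = last (z # take k D)"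
    have u: "u \<in> U" unfolding u_def by (rule lastU)
    have pE': "pedges (u # f @ [v]) \<subseteq> E"
    proof -
      have eq: "z # zs @ [v] = butlast (z # take k D) @ u # f @ [v]"
        unfolding u_def zs by (metis append_Cons append_assoc append_butlast_last_id append_Nil list.distinct(1))
      show ?thesis
        using pE pedges_append[of "butlast (z # take k D)" u "f @ [v]"] unfolding eq by auto
    qed
    show ?case
    proof (cases "f = []")
      case True
      then have lz: "last (z # zs) = u" using zs u_def by simp
      show ?thesis
      proof (cases "{u, v} \<in> F")
        case True
        then have "pedges (z # zs @ [v]) \<subseteq> F"
          using pedges_snoc[of "z # zs" v] DF[of k] zs \<open>f = []\<close> lz by auto
        then obtain k' where "zs @ [v] = take k' D"
          using loc[of "zs @ [v]"] snoc.prems unfolding a_def z_def D_def by auto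
        then show ?thesis by (intro exI[of _ k'] exI[of _ "[]"]) auto
      next
        case False
        have "v \<notin> U"
        proof
          assume "v \<in> U"
          then have "is_ear U F u [] v" unfolding is_ear_def
            using u False irr[of u v] v lz by (auto simp: nb_def)
          then show False using no[of u "[]" v] pE' True by auto
        qed
        then show ?thesis using zs True by (intro exI[of _ k] exI[of _ "[v]"]) auto
      qed
    next
      case False
      have lz: "last (z # zs) = last f" using zs False by simp
      have bl: "last (a # butlast (z # zs)) = last (u # butlast f)"
      proof (cases "butlast f = []")
        case True
        then have "butlast (z # zs) = z # take k D" using zs False by (simp add: butlast_append)
        then show ?thesis using True by (simp add: u_def)
      next
        case ne: False
        have "butlast (z # zs) = z # take k D @ butlast f" using zs False by (simp add: butlast_append)
        then show ?thesis using ne by simp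
      qed
      have "v \<notin> U \<union> set f"
      proof
        assume "v \<in> U \<union> set f"
        then have "is_ear U F u f v" unfolding is_ear_def
          using u False irr[of "last f" v] v lz bl zs by (auto simp: nb_def)
        then show False using no[of u f v] pE' snoc.prems zs by auto
      qed
      then show ?thesis using zs by (intro exI[of _ k] exI[of _ "f @ [v]"]) auto
    qed
  qed
  have inj: "inj_on (\<lambda>zs. last (z # zs)) {zs. nbw E a z zs \<and> length zs \<le> R}"
  proof (rule inj_onI)
    fix ys zs assume "ys \<in> {zs. nbw E a z zs \<and> length zs \<le> R}" "zs \<in> {zs. nbw E a z zs \<and> length zs \<le> R}"
      and last: "last (z # ys) = last (z # zs)"
    then have Y: "nbw E a z ys" "length ys \<le> R" and Z: "nbw E a z zs" "length zs \<le> R" by auto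
    obtain k f where ys: "ys = take k D @ f" "distinct f" "set f \<inter> U = {}" using A[OF Y] by blast
    obtain l g where zs: "zs = take l D @ g" "distinct g" "set g \<inter> U = {}" using A[OF Z] by blast
    define u where "u = last (z # take k D)"
    define t where "t = last (z # take l D)"
    have ut: "u \<in> U" "t \<in> U" unfolding u_def t_def by (rule lastU)+
    have same: "take k D = take l D" if "u = t"
    proof -
      have *: "last (z # take k D) = (z # D) ! min k (length D)" for k
        by (subst last_conv_nth) (auto simp: nth_Cons' min_def)
      \<comment> \<open>Different \<open>k\<close> and \<open>l\<close> give the same prefix once
        they exceed the length of \<open>D\<close>, so only the minima can be compared.\<close>
      have "min k (length D) = min l (length D)"
        using that dD unfolding u_def t_def * by (subst (asm) nth_eq_iff_index_eq) auto
      then show ?thesis by (metis min_def take_all_iff linorder_linear)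
    qed
    have key: "last (z # take m D @ h) \<in> U \<longleftrightarrow> h = []" if "set h \<inter> U = {}" for m h
    proof (cases "h = []")
      case True
      then show ?thesis using lastU[of m] by (metis append_Nil2)
    next
      case False
      then have "last (z # take m D @ h) = last h" by simp
      then show ?thesis using False last_in_set[OF False] that by (metis disjoint_iff)
    qed
    have fg: "f = [] \<longleftrightarrow> g = []"
      using key[OF ys(3), of k] key[OF zs(3), of l] last ys(1) zs(1) by metis
    have split: "w # xs' = butlast (z # take k D) @ v # xs''"
      if "w = z" "xs' = take k D @ xs''" "v = last (z # take k D)" for w xs' v xs'' k
      using that by (metis append_Cons append_assoc append_butlast_last_id append_Nil list.distinct(1))
    have pf: "pedges (u # f) \<subseteq> E"
      using nbw_pedges[OF Y(1)] pedges_append[of "butlast (z # take k D)" u f]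
      unfolding split[OF refl ys(1) u_def] by auto
    have pg: "pedges (t # g) \<subseteq> E"
      using nbw_pedges[OF Z(1)] pedges_append[of "butlast (z # take l D)" t g]
      unfolding split[OF refl zs(1) t_def] by auto
    show "ys = zs"
    proof (cases "f = []")
      case True
      then have "u = t" using last ys(1) zs(1) fg unfolding u_def t_def by (metis append_Nil2)
      then show ?thesis using True fg ys zs same by simp
    next
      case False
      then have gne: "g \<noteq> []" using fg by simp
      have lfg: "last f = last g" using last ys zs False gne by simp
      show ?thesis
      proof (cases "u = t")
        case ne: False
        obtain h where "is_ear U F u h t" "pedges (u # h @ [t]) \<subseteq> E" "length h \<le> length f + length g"
          using lasso_ear[of u U t "[]" f E g F] ut pf pg False gne lfg ys zs ne by auto
        then have False using no[of u h t] Y Z ys zs by auto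
        then show ?thesis ..
      next
        case eq: True
        \<comment> \<open>Both walks leave the path at the same vertex. After their common stem
          \<open>c\<close> they are either finished, and then equal, or they separate and form a
          lasso that ends at the last vertex of the stem.\<close>
        obtain c f' g' where c: "f = c @ f'" "g = c @ g'" "f' = [] \<or> g' = [] \<or> hd f' \<noteq> hd g'"
          using longest_common_prefix[of f g] by (metis list.sel(1))
        have "f' = [] \<longleftrightarrow> g' = []"
        proof (rule ccontr)
          assume ne: "\<not> (f' = [] \<longleftrightarrow> g' = [])"
          show False
          proof (cases "f' = []")
            case True
            then have "c \<noteq> []" "g' \<noteq> []" using False c ne by auto
            then have "last c \<in> set c" "last c \<in> set g'" using True c lfg last_in_set[of g'] last_in_set[of c] by auto
            then show False using zs c by auto
          next
            case nf: False
            then have "c \<noteq> []" "g' = []" using gne c ne by auto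
            then have "last c \<in> set c" "last c \<in> set f'" using nf c lfg last_in_set[of f'] last_in_set[of c] by auto
            then show False using ys c by auto
          qed
        qed
        show ?thesis
        proof (cases "f' = []")
          case True
          then show ?thesis using \<open>f' = [] \<longleftrightarrow> g' = []\<close> c ys zs same eq by simp
        next
          case nf: False
          then have ng: "g' \<noteq> []" using \<open>f' = [] \<longleftrightarrow> g' = []\<close> by simp
          have "pedges (last (u # c) # g') \<subseteq> E"
          proof -
            have "u # g = butlast (u # c) @ last (u # c) # g'"
              using c by (metis append_Cons append_assoc append_butlast_last_id append_Nil list.distinct(1))
            then show ?thesis
              using pg pedges_append[of "butlast (u # c)" "last (u # c)" g'] unfolding eq[symmetric] by auto
          qed
          then have "\<exists>h. is_ear U F u h (last (u # c)) \<and> pedges (u # h @ [last (u # c)]) \<subseteq> E \<and>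
              length h \<le> length c + length f' + length g'"
            using ut pf nf ng lfg ys zs c
            by (intro lasso_ear[where c = c and f = f' and g = g']) (auto split: if_splits)
          then obtain h where "is_ear U F u h (last (u # c))" "pedges (u # h @ [last (u # c)]) \<subseteq> E"
            "length h \<le> length c + length f' + length g'" by auto
          then have False using no[of u h "last (u # c)"] Y Z ys zs c by auto
          then show ?thesis ..
        qed
      qed
    qed
  qed
  have last: "last (take i xs) = a" unfolding a_def using i by (cases i) (auto simp: take_Suc_conv_app_nth)
  have "tverts E R a z \<inter> set (take i xs) = {}"
  proof (rule ccontr)
    assume "tverts E R a z \<inter> set (take i xs) \<noteq> {}"
    then obtain zs where zs: "nbw E a z zs" "length zs \<le> R" "last (z # zs) \<in> set (take i xs)"
      unfolding tverts_nbw by (auto simp: set_eq_iff tverts_nbw)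
    obtain k f where kf: "zs = take k D @ f" "distinct f" "set f \<inter> U = {}" using A[OF zs(1,2)] by blast
    show False
    proof (cases "f = []")
      case True
      then have "last (z # zs) \<in> set (z # D)"
        using kf last_in_set[of "z # take k D"] set_take_subset[of k D] by auto
      moreover have "set (take i xs) \<inter> set (z # D) = {}"
        unfolding zD using xs by (simp add: set_take_disj_set_drop_if_distinct)
      ultimately show False using zs by auto
    next
      case False
      then have "last (z # zs) \<in> set f" using kf by auto
      then show False using kf zs xs set_take_subset[of i xs] by auto
    qed
  qed
  then show ?thesis
    unfolding clean_def last z_def[symmetric] using ttree_if_inj[OF inj] by simp
qed

section \<open>Chains of ears attached to a path\<close>

fun cverts :: "'a list \<Rightarrow> ('a \<times> 'a list \<times> 'a) list \<Rightarrow> 'a set" where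
  "cverts xs [] = set xs"
| "cverts xs ((u, f, t) # es) = set f \<union> cverts xs es"

fun cedges :: "'a list \<Rightarrow> ('a \<times> 'a list \<times> 'a) list \<Rightarrow> 'a set set" where
  "cedges xs [] = pedges xs"
| "cedges xs ((u, f, t) # es) = pedges (u # f @ [t]) \<union> cedges xs es"

text \<open>The ears are listed in reverse order: the head of the list is attached last.\<close>

fun ear_chain :: "nat \<Rightarrow> 'a list \<Rightarrow> ('a \<times> 'a list \<times> 'a) list \<Rightarrow> bool" where
  "ear_chain R xs [] \<longleftrightarrow> True"
| "ear_chain R xs ((u, f, t) # es) \<longleftrightarrow>
     ear_chain R xs es \<and> is_ear (cverts xs es) (cedges xs es) u f t \<and> length f \<le> 2 * R"

text \<open>Unlike \<open>cverts\<close>, this contains the attachment points but not the rest of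
  the path. An edge of the chain with an end outside this set is an edge of the path
  (\<open>cedges_cases\<close>), which is what \<open>local_path\<close> exploits.\<close>

fun everts :: "('a \<times> 'a list \<times> 'a) list \<Rightarrow> 'a set" where
  "everts [] = {}"
| "everts ((u, f, t) # es) = set (u # f @ [t]) \<union> everts es"

lemma cedges_cases: "e \<in> cedges xs es \<Longrightarrow> e \<in> pedges xs \<or> e \<subseteq> everts es"
proof (induction xs es rule: cedges.induct)
  case (2 xs u f t es)
  then show ?case using pedges_subset[of e "u # f @ [t]"] by auto
qed auto

lemma cverts_path: "set xs \<subseteq> cverts xs es"
  by (induction xs es rule: cverts.induct) auto

lemma cedges_path: "pedges xs \<subseteq> cedges xs es"
  by (induction xs es rule: cedges.induct) auto

lemma finite_everts: "finite (everts es)"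
  by (induction es rule: everts.induct) auto

lemma card_everts: "ear_chain R xs es \<Longrightarrow> card (everts es) \<le> length es * (2 * R + 2)"
proof (induction R xs es rule: ear_chain.induct)
  case (2 R xs u f t es)
  have "card (everts ((u, f, t) # es)) \<le> card (set (u # f @ [t])) + card (everts es)"
    unfolding everts.simps by (rule card_Un_le)
  also have "card (set (u # f @ [t])) \<le> length (u # f @ [t])" by (rule card_length)
  finally show ?case using 2 by auto
qed auto

lemma card_cverts: "ear_chain R xs es \<Longrightarrow> card (cverts xs es) \<le> length xs + length es * (2 * R)"
proof (induction R xs es rule: ear_chain.induct)
  case (2 R xs u f t es)
  have "card (cverts xs ((u, f, t) # es)) \<le> card (set f) + card (cverts xs es)"
    unfolding cverts.simps by (rule card_Un_le)
  also have "card (set f) \<le> length f" by (rule card_length)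
  finally show ?case using 2 by auto
qed (auto simp: card_length)

fun gball :: "'a set set \<Rightarrow> nat \<Rightarrow> 'a \<Rightarrow> 'a set" where
  "gball E 0 v = {v}"
| "gball E (Suc r) v = insert v (\<Union>y\<in>nb E v. gball E r y)"

lemma gball_step: "y \<in> gball E r v \<Longrightarrow> z \<in> nb E y \<Longrightarrow> z \<in> gball E (Suc r) v"
proof (induction E r v rule: gball.induct)
  case (2 E r v)
  show ?case
  proof (cases "y = v")
    case True
    then show ?thesis using 2 by (cases r) auto
  next
    case False
    then obtain y' where "y' \<in> nb E v" "y \<in> gball E r y'" using 2 by auto
    then show ?thesis using 2(1)[of y'] 2(3) by auto
  qed
qed auto

text \<open>Reverses the point of view: positions whose tree meets an ear vertex \<open>v\<close>
  lie in the ball around \<open>v\<close>, and \<open>card_gball\<close> limits their number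
  independently of the path.\<close>

lemma tverts_gball: "v \<in> tverts E r a z \<Longrightarrow> z \<in> gball E r v"
proof (induction E r a z rule: tverts.induct)
  case (2 E r a z)
  show ?case
  proof (cases "v = z")
    case False
    then obtain y where "y \<in> nb E z" "z \<in> nb E y" "y \<in> gball E r v" using 2 nb_sym[of _ E z] by auto
    then show ?thesis using gball_step by metis
  qed auto
qed auto

lemma finite_gball: "(\<And>v. finite (nb E v)) \<Longrightarrow> finite (gball E r v)"
  by (induction E r v rule: gball.induct) auto

lemma card_gball:
  assumes "\<And>v. finite (nb E v)" "\<And>v. card (nb E v) \<le> D"
  shows "card (gball E r v) \<le> (D + 1) ^ r"
proof (induction r arbitrary: v)
  case (Suc r)
  have "card (gball E (Suc r) v) \<le> Suc (card (\<Union>y\<in>nb E v. gball E r y))"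
    unfolding gball.simps by (rule card_insert_le_m1) auto
  also have "card (\<Union>y\<in>nb E v. gball E r y) \<le> (\<Sum>y\<in>nb E v. card (gball E r y))"
    by (rule card_UN_le) (rule assms)
  also have "\<dots> \<le> (\<Sum>y\<in>nb E v. (D + 1) ^ r)" by (intro sum_mono Suc)
  also have "\<dots> \<le> D * (D + 1) ^ r" using assms(2)[of v] by simp
  also have "Suc (D * (D + 1) ^ r) \<le> (D + 1) ^ Suc r" using one_le_power[of "D + 1" r] by simp
  finally show ?case by simp
qed auto

text \<open>No edge of an ear touches the vertices from which the walk steps, so every step is along
  the path. It never reverses, and as \<open>xs ! (i - 1)\<close> counts as the predecessor of its
  start, it can only go forward.\<close>

lemma local_path:
  assumes xs: "distinct xs" and i: "0 < i" "i < length xs"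
    and far: "tverts E R (xs ! (i - 1)) (xs ! i) \<inter> everts es = {}"
    and zs: "nbw E (xs ! (i - 1)) (xs ! i) zs" "length zs \<le> R" "pedges (xs ! i # zs) \<subseteq> cedges xs es"
  shows "\<exists>k. zs = take k (drop (Suc i) xs)"
  using zs
proof (induction zs rule: rev_induct)
  case Nil
  then show ?case by (intro exI[of _ 0]) simp
next
  case (snoc v zs)
  let ?z = "xs ! i" and ?a = "xs ! (i - 1)"
  have pe: "pedges (?z # zs @ [v]) = insert {last (?z # zs), v} (pedges (?z # zs))"
    using pedges_snoc[of "?z # zs" v] by simp
  obtain k0 where k0: "zs = take k0 (drop (Suc i) xs)"
    using snoc pe by (auto simp: nbw_snoc)
  define k where "k = length zs"
  have k: "zs = take k (drop (Suc i) xs)"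
    unfolding k_def k0 by (cases "k0 \<le> length (drop (Suc i) xs)") auto
  have "k \<le> length (drop (Suc i) xs)" unfolding k_def k0 by simp
  then have len: "i + k < length xs" using i by simp
  define u where "u = last (?z # zs)"
  have "u \<in> tverts E R ?a ?z"
    unfolding tverts_nbw u_def using snoc.prems by (intro exI[of _ zs]) (auto simp: nbw_snoc)
  then have "u \<notin> everts es" using far by auto
  moreover have "{u, v} \<in> cedges xs es" using snoc.prems pe u_def by auto
  ultimately have "{u, v} \<in> pedges xs" using cedges_cases by fastforce
  then obtain j where j: "Suc j < length xs" "u = xs ! j \<and> v = xs ! Suc j \<or> v = xs ! j \<and> u = xs ! Suc j"
    using pedges_nth by metis
  have nth: "last (xs ! i # take m (drop (Suc i) xs)) = xs ! (i + m)" if "i + m < length xs" for m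
    using that by (cases m) (auto simp: last_conv_nth)
  have u: "u = xs ! (i + k)" unfolding u_def using nth[OF len] k by simp
  have prev: "last (?a # butlast (?z # zs)) = xs ! (i + k - 1)"
  proof (cases k)
    case 0
    then show ?thesis using k by simp
  next
    case (Suc k')
    have "butlast zs = take k' (drop (Suc i) xs)" using k Suc len by (simp add: butlast_take)
    then show ?thesis using nth[of k'] len Suc k by auto
  qed
  have "v \<noteq> xs ! (i + k - 1)" using snoc.prems prev by (simp add: nbw_snoc)
  then have "j = i + k \<and> v = xs ! Suc j"
    using j u xs len by (auto simp: nth_eq_iff_index_eq)
  then have "zs @ [v] = take (Suc k) (drop (Suc i) xs)"
    using j k by (simp add: take_Suc_conv_app_nth)
  then show ?case by blast
qed

text \<open>The ears are found greedily. A chain of at most \<open>m\<close> ears has at most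
  \<open>m * (2 * R + 2)\<close> vertices in \<open>everts\<close>, and each of them spoils at most
  \<open>(D + 1) ^ R\<close> positions. So some bad position is far from all present ears. There a
  walk inside the chain is confined to the path by \<open>local_path\<close>, and
  \<open>clean_if_no_ear\<close> yields a further ear.\<close>

lemma ear_chain_exists:
  assumes E: "E \<subseteq> sedges X" "finite X" and D: "\<And>v. card (nb E v) \<le> D"
    and xs: "distinct xs" "pedges xs \<subseteq> E"
    and many: "m * (2 * R + 2) * (D + 1) ^ R < card (badset E R xs)"
  shows "\<exists>es. length es = m \<and> ear_chain R xs es \<and> cedges xs es \<subseteq> E"
proof -
  have finnb: "finite (nb E v)" for v
    by (rule finite_subset[OF _ E(2)]) (use E(1) sedges_iff[of v _ X] in \<open>auto simp: nb_def\<close>)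
  have "j \<le> m \<Longrightarrow> \<exists>es. length es = j \<and> ear_chain R xs es \<and> cedges xs es \<subseteq> E" for j
  proof (induction j)
    case 0
    then show ?case using xs by (intro exI[of _ "[]"]) auto
  next
    case (Suc j)
    then obtain es where es: "length es = j" "ear_chain R xs es" "cedges xs es \<subseteq> E" by auto
    define B where "B = {i. i < length xs \<and> xs ! i \<in> (\<Union>v\<in>everts es. gball E R v)}"
    have "card B \<le> card (\<Union>v\<in>everts es. gball E R v)"
    proof (rule card_inj_on_le)
      show "inj_on (\<lambda>i. xs ! i) B" unfolding B_def using xs by (auto intro!: inj_onI simp: nth_eq_iff_index_eq)
      show "finite (\<Union>v\<in>everts es. gball E R v)" by (intro finite_UN_I finite_everts finite_gball finnb)
    qed (auto simp: B_def)
    also have "\<dots> \<le> (\<Sum>v\<in>everts es. card (gball E R v))" by (rule card_UN_le) (rule finite_everts)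
    also have "\<dots> \<le> (\<Sum>v\<in>everts es. (D + 1) ^ R)" by (intro sum_mono card_gball finnb D)
    also have "\<dots> = card (everts es) * (D + 1) ^ R" by simp
    also have "\<dots> \<le> (m * (2 * R + 2)) * (D + 1) ^ R"
    proof (rule mult_right_mono)
      have "length es * (2 * R + 2) \<le> m * (2 * R + 2)"
        using es(1) Suc.prems by (intro mult_right_mono) auto
      then show "card (everts es) \<le> m * (2 * R + 2)"
        using card_everts[OF es(2)] by linarith
    qed simp
    finally have "card B < card (badset E R xs)" using many by linarith
    moreover have "finite B" unfolding B_def by simp
    ultimately obtain i where i: "i \<in> badset E R xs" "i \<notin> B"
      by (metis card_mono linorder_not_less subsetI)
    have i': "0 < i" "i < length xs" "\<not> clean E R (take i xs) (xs ! i)" using i by (auto simp: badset_def)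
    have far: "tverts E R (xs ! (i - 1)) (xs ! i) \<inter> everts es = {}"
      using i(2) i'(2) tverts_gball by (fastforce simp: B_def)
    have "\<exists>u f t. is_ear (cverts xs es) (cedges xs es) u f t \<and> pedges (u # f @ [t]) \<subseteq> E \<and> length f \<le> 2 * R"
    proof (rule ccontr)
      assume no: "\<not> ?thesis"
      have "clean E R (take i xs) (xs ! i)"
        by (rule clean_if_no_ear[OF E(1) xs(1) cedges_path cverts_path i'(1,2)
              local_path[OF xs(1) i'(1,2) far]]) (use no in blast)+
      then show False using i' by simp
    qed
    then obtain u f t where "is_ear (cverts xs es) (cedges xs es) u f t" "pedges (u # f @ [t]) \<subseteq> E"
      "length f \<le> 2 * R" by blast
    then show ?case using es by (intro exI[of _ "(u, f, t) # es"]) auto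
  qed
  then show ?thesis by blast
qed

section \<open>Counting regular graphs by switching\<close>

lemma simple_graph_sedges: "simple_graph n E \<longleftrightarrow> E \<subseteq> sedges {..<n}"
  by (simp add: simple_graph_def sedges_def)

lemma card_incident:
  assumes "E \<subseteq> sedges X"
  shows "card {e \<in> E. v \<in> e} = card (nb E v)"
proof (rule sym, rule bij_betw_same_card[of "\<lambda>y. {v, y}"], rule bij_betwI')
  fix x y assume "x \<in> nb E v" "y \<in> nb E v"
  then show "{v, x} = {v, y} \<longleftrightarrow> x = y" by (auto simp: doubleton_eq_iff)
next
  fix x assume "x \<in> nb E v"
  then show "{v, x} \<in> {e \<in> E. v \<in> e}" by (auto simp: nb_def)
next
  fix e assume e: "e \<in> {e \<in> E. v \<in> e}"
  then have "e \<in> sedges X" using assms by auto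
  then obtain a b where ab: "e = {a, b}" unfolding sedges_def by auto
  then consider "v = a" | "v = b" using e by auto
  then show "\<exists>x\<in>nb E v. e = {v, x}"
  proof cases
    case 1
    then show ?thesis using ab e by (auto simp: nb_def)
  next
    case 2
    then show ?thesis using ab e by (intro bexI[of _ a]) (auto simp: nb_def insert_commute)
  qed
qed

lemma regular_graphs_iff:
  "E \<in> regular_graphs \<Delta> n \<longleftrightarrow> E \<subseteq> sedges {..<n} \<and> (\<forall>v<n. card (nb E v) = \<Delta>)"
  using card_incident[of E "{..<n}"] by (auto simp: regular_graphs_def simple_graph_sedges)

lemma finite_regular_graphs: "finite (regular_graphs \<Delta> n)"
  by (rule finite_subset[of _ "Pow (sedges {..<n})"]) (auto simp: regular_graphs_iff finite_sedges)

lemma finite_nb: "finite X \<Longrightarrow> E \<subseteq> sedges X \<Longrightarrow> finite (nb E v)"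
  by (rule finite_subset[of _ X]) (auto simp: nb_def sedges_iff dest!: subsetD)

text \<open>A circulant graph: \<open>i\<close> is joined to \<open>i + s\<close> modulo
  \<open>n\<close> for all \<open>s\<close> in a set \<open>D\<close> of size \<Delta> that contains
  \<open>n - s\<close> along with \<open>s\<close>. For odd \<Delta> the number \<open>n\<close> is
  even, and the self-inverse element \<open>n div 2\<close> completes \<open>D\<close>.\<close>

lemma regular_graphs_nonempty:
  assumes "n > \<Delta>" "even (\<Delta> * n)"
  shows "regular_graphs \<Delta> n \<noteq> {}"
proof -
  define h where "h = \<Delta> div 2"
  define D where "D = {1..h} \<union> {n - h..<n} \<union> (if odd \<Delta> then {n div 2} else {})"
  have \<Delta>: "\<Delta> = 2 * h + of_bool (odd \<Delta>)" unfolding h_def by (cases "odd \<Delta>") auto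
  have mid: "h < n div 2" "n div 2 < n - h" "n - n div 2 = n div 2" if "odd \<Delta>"
    using that assms \<Delta> by (auto elim!: evenE)
  have h: "h < n - h" using \<Delta> assms by (cases "odd \<Delta>") auto
  have cD: "card D = \<Delta>"
  proof (cases "odd \<Delta>")
    case True
    then have "card D = card ({1..h} \<union> {n - h..<n}) + 1"
      unfolding D_def using mid by (subst card_Un_disjoint) auto
    also have "card ({1..h} \<union> {n - h..<n}) = 2 * h"
      using h by (subst card_Un_disjoint) auto
    finally show ?thesis using \<Delta> True by simp
  next
    case False
    have "card ({1..h} \<union> {n - h..<n}) = 2 * h"
      using h by (subst card_Un_disjoint) auto
    then show ?thesis using \<Delta> False unfolding D_def by simp
  qed
  have D: "0 < s \<and> s < n \<and> n - s \<in> D" if "s \<in> D" for s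
  proof -
    consider "s \<in> {1..h}" | "s \<in> {n - h..<n}" | "odd \<Delta>" "s = n div 2"
      using \<open>s \<in> D\<close> unfolding D_def by (auto split: if_splits)
    then show ?thesis
    proof cases
      case 1
      then show ?thesis using h unfolding D_def by auto
    next
      case 2
      then have "n - s \<in> {1..h}" using h by auto
      then show ?thesis using 2 h unfolding D_def by auto
    next
      case 3
      then show ?thesis using mid unfolding D_def by auto
    qed
  qed
  define E where "E = {{i, (i + s) mod n} | i s. i < n \<and> s \<in> D}"
  have md: "(i + s) mod n = (if i + s < n then i + s else i + s - n)" if "i < n" "s < n" for i s
    using that by (auto simp: le_mod_geq)
  have ne: "(i + s) mod n \<noteq> i" if "i < n" "s \<in> D" for i s
    using md[of i s] D[OF that(2)] that by (auto split: if_splits)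
  have sub: "E \<subseteq> sedges {..<n}"
    unfolding E_def using ne assms(1) by (auto simp: sedges_iff) metis
  have nbE: "nb E v = (\<lambda>s. (v + s) mod n) ` D" if v: "v < n" for v
  proof (intro equalityI subsetI)
    fix y assume "y \<in> nb E v"
    then obtain i s where yis: "{v, y} = {i, (i + s) mod n}" "i < n" "s \<in> D"
      unfolding nb_def E_def by auto
    then consider "v = i" "y = (i + s) mod n" | "y = i" "v = (i + s) mod n"
      by (auto simp: doubleton_eq_iff)
    then show "y \<in> (\<lambda>s. (v + s) mod n) ` D"
    proof cases
      case 1
      then show ?thesis using yis by auto
    next
      case 2
      have "(v + (n - s)) mod n = (i + s + (n - s)) mod n" unfolding 2 by (simp add: mod_add_left_eq)
      also have "i + s + (n - s) = i + n" using D[OF yis(3)] by simp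
      finally have "(v + (n - s)) mod n = y" using 2 yis by simp
      then show ?thesis using D[OF yis(3)] by (intro image_eqI[of _ _ "n - s"]) auto
    qed
  next
    fix y assume "y \<in> (\<lambda>s. (v + s) mod n) ` D"
    then show "y \<in> nb E v" using v unfolding nb_def E_def by auto
  qed
  have inj: "inj_on (\<lambda>s. (v + s) mod n) D" if "v < n" for v
  proof (rule inj_onI)
    fix s t assume st: "s \<in> D" "t \<in> D" "(v + s) mod n = (v + t) mod n"
    then have "s < n" "t < n" using D by auto
    then show "s = t" using st(3) md[OF that, of s] md[OF that, of t] that by (auto split: if_splits)
  qed
  have "E \<in> regular_graphs \<Delta> n"
    unfolding regular_graphs_iff using sub nbE card_image[OF inj] cD by auto
  then show ?thesis by blast
qed

section \<open>Regular graphs that contain prescribed edges\<close>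

definition gcount :: "nat \<Rightarrow> nat \<Rightarrow> nat set set \<Rightarrow> real" where
  "gcount \<Delta> n F = real (card {E \<in> regular_graphs \<Delta> n. F \<subseteq> E})"

lemma gcount_nonneg: "gcount \<Delta> n F \<ge> 0"
  by (simp add: gcount_def)

lemma card_ordered_edges:
  assumes "finite F" "F \<subseteq> sedges X"
  shows "finite {(x, y). {x, y} \<in> F} \<and> card {(x, y). {x, y} \<in> F} \<le> 2 * card F"
  using assms
proof (induction F rule: finite_induct)
  case (insert e F)
  then obtain a b where e: "e = {a, b}" unfolding sedges_def by auto
  have "{(x, y). {x, y} \<in> insert e F} = {(a, b), (b, a)} \<union> {(x, y). {x, y} \<in> F}"
    unfolding e by (auto simp: doubleton_eq_iff)
  moreover have "card ({(a, b), (b, a)} \<union> {(x, y). {x, y} \<in> F}) \<le> card {(a, b), (b, a)} + card {(x, y). {x, y} \<in> F}"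
    by (rule card_Un_le)
  moreover have "card {(a, b), (b, a)} \<le> 2"
    using card_length[of "[(a, b), (b, a)]"] by simp
  moreover have "finite {(x, y). {x, y} \<in> F}" "card {(x, y). {x, y} \<in> F} \<le> 2 * card F"
    using insert by auto
  moreover have "card (insert e F) = Suc (card F)" using insert by simp
  ultimately show ?case by simp
qed simp

lemma switch_degrees:
  fixes n u v x y a :: nat
  assumes E: "finite E" "E \<subseteq> sedges {..<n}" and d: "u \<noteq> v" "x \<noteq> y" "x \<notin> {u, v}" "y \<notin> {u, v}"
    and xy: "{u, v} \<in> E" "{x, y} \<in> E" "{u, x} \<notin> E" "{v, y} \<notin> E"
  shows "card {e \<in> insert {u, x} (insert {v, y} (E - {{u, v}, {x, y}})). a \<in> e} = card {e \<in> E. a \<in> e}"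
proof -
  have c: "int (card {e \<in> A. a \<in> e}) = (\<Sum>e\<in>A. of_bool (a \<in> e))" if "finite A" for A :: "nat set set"
  proof -
    have "(\<Sum>e\<in>A. of_bool (a \<in> e)) = (\<Sum>e\<in>{e \<in> A. a \<in> e}. (1::int))"
      unfolding of_bool_def using that by (simp add: sum.If_cases Int_def)
    then show ?thesis by simp
  qed
  let ?E0 = "E - {{u, v}, {x, y}}"
  have ne: "{u, v} \<noteq> {x, y}" "{u, x} \<noteq> {v, y}" using d by (auto simp: doubleton_eq_iff)
  have "E = insert {u, v} (insert {x, y} ?E0)" using xy by auto
  then have 1: "(\<Sum>e\<in>E. of_bool (a \<in> e)) = (\<Sum>e\<in>insert {u, v} (insert {x, y} ?E0). of_bool (a \<in> e) :: int)"
    by simp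
  also have "\<dots> = of_bool (a \<in> {u, v}) + (of_bool (a \<in> {x, y}) + (\<Sum>e\<in>?E0. of_bool (a \<in> e)))"
    using E ne by (subst sum.insert; simp)+
  also have "of_bool (a \<in> {u, v}) + (of_bool (a \<in> {x, y}) + (\<Sum>e\<in>?E0. of_bool (a \<in> e)))
      = of_bool (a \<in> {u, x}) + (of_bool (a \<in> {v, y}) + (\<Sum>e\<in>?E0. of_bool (a \<in> e)) :: int)"
    using d by auto
  also have "\<dots> = (\<Sum>e\<in>insert {u, x} (insert {v, y} ?E0). of_bool (a \<in> e))"
    using E ne xy by (subst sum.insert; simp)+
  finally show ?thesis using c[of E] c[of "insert {u, x} (insert {v, y} ?E0)"] E by simp
qed

text \<open>Switching: an edge \<open>{u, v}\<close> is removed from a regular graph together with another edge \<open>{x, y}\<close>, and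
  replaced by \<open>{u, x}\<close> and \<open>{v, y}\<close>.\<close>

lemma gcount_insert:
  assumes F: "F \<subseteq> sedges {..<n}" and uv: "u < n" "v < n" "u \<noteq> v" "{u, v} \<notin> F"
  shows "gcount \<Delta> n (insert {u, v} F) * (real (\<Delta> * n) - 2 * real (card F) - real (2 + 4 * \<Delta> + 2 * \<Delta> * \<Delta>))
     \<le> gcount \<Delta> n F * (real (\<Delta> - card (nb F u)) * real (\<Delta> - card (nb F v)))"
proof -
  let ?\<Omega> = "regular_graphs \<Delta> n"
  let ?G = "insert {u, v} F"
  have finF: "finite F" using finite_edges[OF _ F] by simp
  \<comment> \<open>The admissible second edges, with an orientation. The conditions keep the
    switched graph simple, and as \<open>{x, y}\<close> is not in \<open>?G\<close> it still
    contains \<open>F\<close>.\<close>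
  define P where "P = (\<lambda>E. {(x, y). {x, y} \<in> E \<and> {x, y} \<notin> ?G \<and> x \<notin> {u, v} \<and> y \<notin> {u, v} \<and>
      {u, x} \<notin> E \<and> {v, y} \<notin> E})"
  \<comment> \<open>What a switched graph allows for \<open>(x, y)\<close>: neighbours of
    \<open>u\<close> and of \<open>v\<close> by edges outside \<open>F\<close>. The pair is recorded
    along with the graph, so the switching can be undone and \<open>sw\<close> is injective.\<close>
  define Q where "Q = (\<lambda>E. (nb E u - nb F u) \<times> (nb E v - nb F v))"
  define A where "A = (SIGMA E:{E \<in> ?\<Omega>. ?G \<subseteq> E}. P E)"
  define B where "B = (SIGMA E:{E \<in> ?\<Omega>. F \<subseteq> E}. Q E)"
  define sw where "sw = (\<lambda>(E, x, y). (insert {u, x} (insert {v, y} (E - {{u, v}, {x, y}})), x, y))"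
  have sedg: "E \<subseteq> sedges {..<n}" if "E \<in> ?\<Omega>" for E using that by (simp add: regular_graphs_iff)
  have finE: "finite E" if "E \<in> ?\<Omega>" for E using finite_edges[OF _ sedg[OF that]] by simp
  have finnb: "finite (nb E w)" if "E \<in> ?\<Omega>" for E w using finite_nb[OF _ sedg[OF that]] by simp
  have finP: "finite (P E)" if "E \<in> ?\<Omega>" for E
    by (rule finite_subset[of _ "{(x, y). {x, y} \<in> E}"])
      (use card_ordered_edges[OF finE[OF that] sedg[OF that]] in \<open>auto simp: P_def\<close>)
  have cQ: "card (Q E) = (\<Delta> - card (nb F u)) * (\<Delta> - card (nb F v))"
    if "E \<in> ?\<Omega>" "F \<subseteq> E" for E
  proof -
    have "nb F w \<subseteq> nb E w" for w using that by (auto simp: nb_def)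
    moreover from this have "finite (nb F w)" for w using finnb[OF that(1)] finite_subset by metis
    ultimately show ?thesis
      unfolding Q_def card_cartesian_product using that uv
      by (simp add: card_Diff_subset regular_graphs_iff)
  qed
  \<comment> \<open>Of the \<open>\<Delta> * n\<close> oriented edges, at most
    \<open>2 * (card F + 1)\<close> lie in \<open>?G\<close>, at most \<open>2 * \<Delta>\<close>
    start in \<open>{u, v}\<close> and as many end there, and at most
    \<open>\<Delta> * \<Delta>\<close> start at a neighbour of \<open>u\<close>, or end at a
    neighbour of \<open>v\<close>, respectively. This is the origin of the constant.\<close>
  have cP: "real (\<Delta> * n) - 2 * real (card F) - real (2 + 4 * \<Delta> + 2 * \<Delta> * \<Delta>) \<le> real (card (P E))"
    if E: "E \<in> ?\<Omega>" "?G \<subseteq> E" for E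
  proof -
    define T where "T = {(x, y). {x, y} \<in> E}"
    have deg: "card (nb E w) \<le> \<Delta>" for w
    proof (cases "w < n")
      case False
      then have "nb E w = {}" using sedg[OF E(1)] sedges_iff[of w _ "{..<n}"] by (auto simp: nb_def)
      then show ?thesis by simp
    qed (use E in \<open>auto simp: regular_graphs_iff\<close>)
    have Teq: "T = (SIGMA x:{..<n}. nb E x)"
      unfolding T_def nb_def using sedg[OF E(1)] sedges_iff[of _ _ "{..<n}"] by auto
    have cT: "card T = \<Delta> * n"
      unfolding Teq using finnb[OF E(1)] E(1) by (simp add: regular_graphs_iff)
    have finT: "finite T" unfolding Teq using finnb[OF E(1)] by auto
    define B1 where "B1 = {(x, y). {x, y} \<in> ?G}"
    define B2 where "B2 = (SIGMA x:{u, v}. nb E x)"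
    define B3 where "B3 = prod.swap ` B2"
    define B4 where "B4 = (SIGMA x:nb E u. nb E x)"
    define B5 where "B5 = prod.swap ` (SIGMA y:nb E v. nb E y)"
    have sub: "T \<subseteq> P E \<union> (B1 \<union> (B2 \<union> (B3 \<union> (B4 \<union> B5))))"
    proof
      fix xy assume "xy \<in> T"
      then obtain x y where xy: "xy = (x, y)" "{x, y} \<in> E" by (auto simp: T_def)
      have b3: "(x, y) \<in> B3" if "y \<in> {u, v}"
      proof -
        have "(y, x) \<in> B2" using xy that by (auto simp: B2_def nb_def insert_commute)
        then show ?thesis unfolding B3_def by (metis image_eqI prod.swap_def fst_conv snd_conv)
      qed
      have b5: "(x, y) \<in> B5" if "{v, y} \<in> E"
      proof -
        have "(y, x) \<in> (SIGMA y:nb E v. nb E y)" using xy that by (auto simp: nb_def insert_commute)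
        then show ?thesis unfolding B5_def by (metis image_eqI prod.swap_def fst_conv snd_conv)
      qed
      have b2: "(x, y) \<in> B2" if "x \<in> {u, v}" using xy that by (auto simp: B2_def nb_def)
      have b4: "(x, y) \<in> B4" if "{u, x} \<in> E" using xy that by (auto simp: B4_def nb_def)
      show "xy \<in> P E \<union> (B1 \<union> (B2 \<union> (B3 \<union> (B4 \<union> B5))))"
        using b2 b3 b4 b5 xy unfolding P_def B1_def by blast
    qed
    have s2: "card (SIGMA x:S. nb E x) \<le> card S * \<Delta>" if "finite S" for S
    proof -
      have "card (SIGMA x:S. nb E x) = (\<Sum>x\<in>S. card (nb E x))" using that finnb[OF E(1)] by simp
      also have "\<dots> \<le> (\<Sum>x\<in>S. \<Delta>)" by (intro sum_mono deg)
      finally show ?thesis by simp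
    qed
    have "card B1 \<le> 2 * (card F + 1)"
      unfolding B1_def using card_ordered_edges[of ?G "{..<n}"] finF F uv
      by (auto simp: sedges_iff)
    moreover have b2: "card B2 \<le> 2 * \<Delta>" unfolding B2_def using s2[of "{u, v}"] uv by simp
    moreover have "card B3 \<le> 2 * \<Delta>"
      unfolding B3_def using b2 card_image[of prod.swap B2] inj_on_subset[OF inj_swap] by auto
    moreover have b4: "card B4 \<le> \<Delta> * \<Delta>"
      unfolding B4_def using s2[OF finnb[OF E(1), of u]] deg[of u]
      by (meson le_trans mult_le_mono1)
    moreover have "card (SIGMA y:nb E v. nb E y) \<le> \<Delta> * \<Delta>"
      using s2[OF finnb[OF E(1), of v]] deg[of v] by (meson le_trans mult_le_mono1)
    then have "card B5 \<le> \<Delta> * \<Delta>"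
      unfolding B5_def using card_image[of prod.swap "SIGMA y:nb E v. nb E y"] inj_on_subset[OF inj_swap] by auto
    moreover have "card T \<le> card (P E) + (card B1 + (card B2 + (card B3 + (card B4 + card B5))))"
    proof -
      have fin: "finite B1" "finite B2" "finite B3" "finite B4" "finite B5"
        unfolding B1_def B2_def B3_def B4_def B5_def
        using card_ordered_edges[of ?G "{..<n}"] finF F uv finnb[OF E(1)] by (auto simp: sedges_iff)
      have "card T \<le> card (P E \<union> (B1 \<union> (B2 \<union> (B3 \<union> (B4 \<union> B5)))))"
        using sub fin finP[OF E(1)] by (intro card_mono) auto
      also have "\<dots> \<le> card (P E) + (card B1 + (card B2 + (card B3 + (card B4 + card B5))))"
        by (intro order_trans[OF card_Un_le] add_left_mono order_refl)
      finally show ?thesis .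
    qed
    ultimately have "\<Delta> * n \<le> card (P E) + (2 * (card F + 1) + (2 * \<Delta> + (2 * \<Delta> + (\<Delta> * \<Delta> + \<Delta> * \<Delta>))))"
      unfolding cT by linarith
    then have "real (\<Delta> * n) \<le> real (card (P E) + (2 * (card F + 1) + (2 * \<Delta> + (2 * \<Delta> + (\<Delta> * \<Delta> + \<Delta> * \<Delta>)))))"
      by (rule of_nat_mono)
    then show ?thesis by simp
  qed
  have finA: "finite A" unfolding A_def using finite_regular_graphs finP by auto
  have finB: "finite B" unfolding B_def Q_def using finite_regular_graphs finnb by auto
  have "card A \<le> card B"
  proof (rule card_inj_on_le)
    show "inj_on sw A"
    proof (rule inj_onI)
      fix s t assume s: "s \<in> A" and t: "t \<in> A" and eq: "sw s = sw t"
      obtain E x y E' x' y' where st: "s = (E, x, y)" "t = (E', x', y')" by (metis prod.exhaust)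
      from eq have xy: "x' = x" "y' = y" by (auto simp: sw_def st)
      have rec: "D = insert {u, v} (insert {x, y} (insert {u, x} (insert {v, y} (D - {{u, v}, {x, y}})) - {{u, x}, {v, y}}))"
        if "(D, x, y) \<in> A" for D
      proof -
        have "{u, v} \<in> D" "{x, y} \<in> D" "{u, x} \<notin> D" "{v, y} \<notin> D"
          using that unfolding A_def P_def by auto
        then show ?thesis by blast
      qed
      have "insert {u, x} (insert {v, y} (E - {{u, v}, {x, y}})) = insert {u, x} (insert {v, y} (E' - {{u, v}, {x, y}}))"
        using eq unfolding st xy sw_def by simp
      then have "E = E'" using rec[of E] rec[of E'] s t unfolding st xy by metis
      then show "s = t" unfolding st xy by simp
    qed
    show "sw ` A \<subseteq> B"
    proof
      fix b assume "b \<in> sw ` A"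
      then obtain E x y where b: "b = sw (E, x, y)" "(E, x, y) \<in> A" by auto
      let ?E' = "insert {u, x} (insert {v, y} (E - {{u, v}, {x, y}}))"
      have E: "E \<in> ?\<Omega>" "?G \<subseteq> E" and xy: "{x, y} \<in> E" "{x, y} \<notin> ?G" "x \<notin> {u, v}" "y \<notin> {u, v}"
        "{u, x} \<notin> E" "{v, y} \<notin> E"
        using b(2) unfolding A_def P_def by auto
      have xyn: "x < n" "y < n" "x \<noteq> y" using xy(1) sedg[OF E(1)] sedges_iff[of x y "{..<n}"] by auto
      have sub': "?E' \<subseteq> sedges {..<n}" using sedg[OF E(1)] xyn uv xy by (auto simp: sedges_iff)
      have "?E' \<in> ?\<Omega>"
        unfolding regular_graphs_def simple_graph_sedges
        using sub' switch_degrees[OF finE[OF E(1)] sedg[OF E(1)] uv(3) xyn(3) xy(3,4) _ xy(1,5,6)] E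
        by (auto simp: regular_graphs_def)
      moreover have "F \<subseteq> ?E'" using E xy uv by auto
      moreover have "x \<in> nb ?E' u - nb F u" "y \<in> nb ?E' v - nb F v" using E xy by (auto simp: nb_def)
      ultimately show "b \<in> B" unfolding b sw_def B_def Q_def by auto
    qed
  qed (rule finB)
  then have AB: "real (card A) \<le> real (card B)" by simp
  have "gcount \<Delta> n ?G * (real (\<Delta> * n) - 2 * real (card F) - real (2 + 4 * \<Delta> + 2 * \<Delta> * \<Delta>))
     = (\<Sum>E\<in>{E \<in> ?\<Omega>. ?G \<subseteq> E}. real (\<Delta> * n) - 2 * real (card F) - real (2 + 4 * \<Delta> + 2 * \<Delta> * \<Delta>))"
    unfolding gcount_def by simp
  also have "\<dots> \<le> (\<Sum>E\<in>{E \<in> ?\<Omega>. ?G \<subseteq> E}. real (card (P E)))"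
    by (intro sum_mono cP) auto
  also have "\<dots> = real (card A)"
    unfolding A_def using finite_regular_graphs finP by (subst card_SigmaI) auto
  also have "\<dots> \<le> real (card B)" by (rule AB)
  also have "\<dots> = (\<Sum>E\<in>{E \<in> ?\<Omega>. F \<subseteq> E}. real (card (Q E)))"
    unfolding B_def Q_def using finite_regular_graphs finnb by (subst card_SigmaI) auto
  also have "\<dots> = (\<Sum>E\<in>{E \<in> ?\<Omega>. F \<subseteq> E}. real (\<Delta> - card (nb F u)) * real (\<Delta> - card (nb F v)))"
    by (intro sum.cong refl) (use cQ in auto)
  also have "\<dots> = gcount \<Delta> n F * (real (\<Delta> - card (nb F u)) * real (\<Delta> - card (nb F v)))"
    unfolding gcount_def by simp
  finally show ?thesis .
qed

text \<open>Bounds the number of switchings in \<open>gcount_insert\<close> from below for all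
  \<open>F\<close> with at most \<open>s\<close> edges, so that one denominator serves every step of
  a path or chain. It is asymptotic to \<open>\<Delta> * n\<close> if \<open>s\<close> is
  logarithmic in \<open>n\<close>.\<close>

definition cden :: "nat \<Rightarrow> nat \<Rightarrow> nat \<Rightarrow> real" where
  "cden \<Delta> n s = real (\<Delta> * n) - 2 * real s - real (2 + 4 * \<Delta> + 2 * \<Delta> * \<Delta>)"

lemma gcount_insert_le:
  assumes F: "F \<subseteq> sedges {..<n}" and uv: "u < n" "v < n" "u \<noteq> v" "{u, v} \<notin> F"
    and s: "card F \<le> s" "cden \<Delta> n s > 0"
    and ab: "real (\<Delta> - card (nb F u)) \<le> a" "real (\<Delta> - card (nb F v)) \<le> b"
  shows "gcount \<Delta> n (insert {u, v} F) \<le> gcount \<Delta> n F * (a * b / cden \<Delta> n s)"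
proof -
  have "gcount \<Delta> n (insert {u, v} F) * cden \<Delta> n s
    \<le> gcount \<Delta> n (insert {u, v} F) * (real (\<Delta> * n) - 2 * real (card F) - real (2 + 4 * \<Delta> + 2 * \<Delta> * \<Delta>))"
    unfolding cden_def using s(1) gcount_nonneg by (intro mult_left_mono) auto
  also have "\<dots> \<le> gcount \<Delta> n F * (real (\<Delta> - card (nb F u)) * real (\<Delta> - card (nb F v)))"
    by (rule gcount_insert[OF F uv])
  also have "\<dots> \<le> gcount \<Delta> n F * (a * b)"
    using ab gcount_nonneg by (intro mult_left_mono mult_mono) (auto intro: order_trans[OF of_nat_0_le_iff])
  finally show ?thesis using s(2) by (simp add: field_simps)
qed

lemma pedges_sedges: "distinct xs \<Longrightarrow> set xs \<subseteq> X \<Longrightarrow> pedges xs \<subseteq> sedges X"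
  by (induction xs rule: pedges.induct) (auto simp: sedges_iff)

lemma finite_pedges: "finite (pedges xs)"
  by (induction xs rule: pedges.induct) auto

lemma card_pedges: "card (pedges xs) \<le> length xs - 1"
proof (induction xs rule: pedges.induct)
  case (1 u v zs)
  have "card (pedges (u # v # zs)) \<le> Suc (card (pedges (v # zs)))"
    unfolding pedges.simps by (rule card_insert_le_m1) auto
  then show ?case using 1 by simp
qed auto

lemma finite_nb_pedges: "finite (nb (pedges xs) v)"
  by (rule finite_subset[of _ "set xs"]) (use pedges_subset in \<open>fastforce simp: nb_def\<close>)+

lemma nb_pedges_pos:
  assumes "length xs \<ge> 2"
  shows "card (nb (pedges xs) (last xs)) \<ge> 1" "card (nb (pedges xs) (hd xs)) \<ge> 1"
proof -
  obtain ys z where xs: "xs = ys @ [z]" "ys \<noteq> []" using assms by (cases xs rule: rev_cases) (auto simp: Suc_le_eq)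
  then have "last ys \<in> nb (pedges xs) (last xs)" using pedges_snoc[of ys z] by (auto simp: nb_def insert_commute)
  then show "card (nb (pedges xs) (last xs)) \<ge> 1"
    using finite_nb_pedges[of xs "last xs"] by (metis One_nat_def Suc_leI card_gt_0_iff empty_iff)
  obtain u v zs where xs: "xs = u # v # zs" using assms by (cases xs; cases "tl xs") auto
  then have "v \<in> nb (pedges xs) (hd xs)" by (auto simp: nb_def)
  then show "card (nb (pedges xs) (hd xs)) \<ge> 1"
    using finite_nb_pedges[of xs "hd xs"] by (metis One_nat_def Suc_leI card_gt_0_iff empty_iff)
qed

text \<open>The end of the path already carries an edge, which leaves \<open>\<Delta> - 1\<close>
  places for the next one; the new vertex has \<Delta>. Only the first edge has \<Delta> places at
  both ends, and \<open>\<Delta> \<le> 2 * (\<Delta> - 1)\<close> explains the factor 2. The saving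
  is essential for cycles, whose expected number must grow at most like
  \<open>(\<Delta> - 1) ^ l\<close>.\<close>

lemma gcount_path:
  assumes "distinct xs" "xs \<noteq> []" "set xs \<subseteq> {..<n}" "length xs \<le> s" "cden \<Delta> n s > 0" "\<Delta> \<ge> 2"
  shows "gcount \<Delta> n (pedges xs) \<le>
     gcount \<Delta> n {} * (if length xs = 1 then 1 else 2) * (real \<Delta> * (real \<Delta> - 1) / cden \<Delta> n s) ^ (length xs - 1)"
  using assms(1-4)
proof (induction xs rule: rev_induct)
  case (snoc z xs)
  let ?K = "real \<Delta> * (real \<Delta> - 1) / cden \<Delta> n s"
  have K0: "?K \<ge> 0" using assms by auto
  have g0: "gcount \<Delta> n {} \<ge> 0" by (rule gcount_nonneg)
  show ?case
  proof (cases "xs = []")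
    case False
    have sub: "pedges xs \<subseteq> sedges {..<n}" using snoc.prems by (intro pedges_sedges) auto
    have IH: "gcount \<Delta> n (pedges xs) \<le>
       gcount \<Delta> n {} * (if length xs = 1 then 1 else 2) * ?K ^ (length xs - 1)"
      using snoc False by auto
    have step: "gcount \<Delta> n (insert {last xs, z} (pedges xs)) \<le> gcount \<Delta> n (pedges xs) * (a * real \<Delta> / cden \<Delta> n s)"
      if "real (\<Delta> - card (nb (pedges xs) (last xs))) \<le> a" for a
    proof (rule gcount_insert_le[OF sub])
      show "{last xs, z} \<notin> pedges xs" using pedges_subset[of "{last xs, z}" xs] snoc.prems by auto
      have "last xs \<in> {..<n}" using snoc.prems last_in_set[OF False] by auto
      then show "last xs < n" by simp
      show "z < n" "last xs \<noteq> z" using snoc.prems last_in_set[OF False] by auto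
      show "card (pedges xs) \<le> s" using card_pedges[of xs] snoc.prems by simp
    qed (use that assms in auto)
    show ?thesis
    proof (cases "length xs = 1")
      case True
      have "gcount \<Delta> n (pedges (xs @ [z])) \<le> gcount \<Delta> n (pedges xs) * (real \<Delta> * real \<Delta> / cden \<Delta> n s)"
        unfolding pedges_snoc[OF False] by (rule step) simp
      also have "\<dots> \<le> gcount \<Delta> n {} * (real \<Delta> * real \<Delta> / cden \<Delta> n s)"
        using IH True assms by (intro mult_right_mono) auto
      also have "\<dots> \<le> gcount \<Delta> n {} * (2 * ?K)"
      proof (rule mult_left_mono[OF _ g0])
        have "real \<Delta> * real \<Delta> \<le> 2 * (real \<Delta> * (real \<Delta> - 1))"
          using assms(6) mult_left_mono[of "real \<Delta>" "2 * (real \<Delta> - 1)" "real \<Delta>"] by (simp add: mult_ac)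
        then show "real \<Delta> * real \<Delta> / cden \<Delta> n s \<le> 2 * ?K" using assms(5) by (simp add: field_simps)
      qed
      finally show ?thesis using True by simp
    next
      case two: False
      then have two': "length xs \<ge> 2" using False by (cases xs; cases "tl xs") auto
      have "gcount \<Delta> n (pedges (xs @ [z])) \<le> gcount \<Delta> n (pedges xs) * ((real \<Delta> - 1) * real \<Delta> / cden \<Delta> n s)"
        unfolding pedges_snoc[OF False] using nb_pedges_pos(1)[OF two'] assms(6) by (intro step) auto
      also have "\<dots> = gcount \<Delta> n (pedges xs) * ?K" by (simp add: mult_ac)
      also have "\<dots> \<le> gcount \<Delta> n {} * 2 * ?K ^ (length xs - 1) * ?K"
        using IH two K0 by (intro mult_right_mono) auto
      also have "\<dots> = gcount \<Delta> n {} * 2 * ?K ^ length xs"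
        using two' by (cases "length xs") auto
      finally show ?thesis using False by simp
    qed
  qed simp
qed simp

definition cyc :: "'a list \<Rightarrow> 'a set set" where
  "cyc xs = insert {last xs, hd xs} (pedges xs)"

lemma closing_edge:
  assumes "distinct xs" "length xs \<ge> 3"
  shows "{last xs, hd xs} \<notin> pedges xs" "last xs \<noteq> hd xs"
proof -
  have ne: "xs \<noteq> []" using assms by auto
  then have e: "last xs = xs ! (length xs - 1)" "hd xs = xs ! 0" by (simp_all add: last_conv_nth hd_conv_nth)
  show "{last xs, hd xs} \<notin> pedges xs"
  proof
    assume "{last xs, hd xs} \<in> pedges xs"
    then obtain j where "Suc j < length xs"
      "last xs = xs ! j \<and> hd xs = xs ! Suc j \<or> hd xs = xs ! j \<and> last xs = xs ! Suc j"
      using pedges_nth by metis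
    then show False using assms nth_eq_iff_index_eq[OF assms(1), of 0 j] ne
      unfolding e by (auto simp: nth_eq_iff_index_eq)
  qed
  show "last xs \<noteq> hd xs"
  proof
    assume "last xs = hd xs"
    moreover have "length xs - 1 < length xs" "0 < length xs" using ne by auto
    ultimately have "length xs - 1 = 0"
      using nth_eq_iff_index_eq[OF assms(1), of "length xs - 1" 0] unfolding e by blast
    then show False using assms(2) by simp
  qed
qed

lemma gcount_cyc:
  assumes "distinct xs" "length xs \<ge> 3" "set xs \<subseteq> {..<n}" "length xs \<le> s" "cden \<Delta> n s > 0" "\<Delta> \<ge> 2"
  shows "gcount \<Delta> n (cyc xs) \<le> gcount \<Delta> n {} * 2 * (real \<Delta> * (real \<Delta> - 1) / cden \<Delta> n s) ^ length xs"
proof -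
  let ?K = "real \<Delta> * (real \<Delta> - 1) / cden \<Delta> n s"
  have K0: "?K \<ge> 0" using assms by auto
  have ne: "xs \<noteq> []" using assms by auto
  have "gcount \<Delta> n (cyc xs) \<le> gcount \<Delta> n (pedges xs) * ((real \<Delta> - 1) * real \<Delta> / cden \<Delta> n s)"
    unfolding cyc_def
  proof (rule gcount_insert_le)
    show "pedges xs \<subseteq> sedges {..<n}" using assms by (intro pedges_sedges) auto
    have "last xs \<in> {..<n}" "hd xs \<in> {..<n}"
      using assms(3) last_in_set[OF ne] hd_in_set[OF ne] by blast+
    then show "last xs < n" "hd xs < n" by simp_all
    show "card (pedges xs) \<le> s" using card_pedges[of xs] assms by linarith
    show "real (\<Delta> - card (nb (pedges xs) (last xs))) \<le> real \<Delta> - 1"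
      using nb_pedges_pos(1)[of xs] assms by auto
  qed (use closing_edge[OF assms(1,2)] assms in auto)
  also have "\<dots> = gcount \<Delta> n (pedges xs) * ?K" by (simp add: mult_ac)
  also have "\<dots> \<le> gcount \<Delta> n {} * 2 * ?K ^ (length xs - 1) * ?K"
    using gcount_path[OF assms(1) ne assms(3-6)] assms(2) K0 by (intro mult_right_mono) auto
  also have "\<dots> = gcount \<Delta> n {} * 2 * ?K ^ length xs"
    using assms(2) by (cases "length xs") auto
  finally show ?thesis .
qed

text \<open>For ears the crude factor with \<open>\<Delta> * \<Delta>\<close> per edge is enough, as
  they are bounded in length and number. What counts is that it is of order \<open>1 / n\<close>
  when \<open>s\<close> is small compared to \<open>n\<close>.\<close>

lemma gcount_walk:
  assumes F: "F \<subseteq> sedges {..<n}" "\<And>e. e \<in> F \<Longrightarrow> e \<subseteq> U" and u: "u \<in> U" "u < n"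
    and s: "cden \<Delta> n s > 0"
    and f: "distinct f" "set f \<inter> U = {}" "set f \<subseteq> {..<n}" "card F + length f \<le> s"
  shows "pedges (u # f) \<union> F \<subseteq> sedges {..<n} \<and> card (pedges (u # f) \<union> F) \<le> card F + length f \<and>
    gcount \<Delta> n (pedges (u # f) \<union> F) \<le> gcount \<Delta> n F * (real \<Delta> * real \<Delta> / cden \<Delta> n s) ^ length f"
  using f
proof (induction f rule: rev_induct)
  case Nil
  then show ?case using F by simp
next
  case (snoc z f)
  let ?K = "real \<Delta> * real \<Delta> / cden \<Delta> n s"
  let ?F = "pedges (u # f) \<union> F"
  have IH: "?F \<subseteq> sedges {..<n}" "card ?F \<le> card F + length f" "gcount \<Delta> n ?F \<le> gcount \<Delta> n F * ?K ^ length f"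
    using snoc by auto
  have l: "last (u # f) \<noteq> z" "last (u # f) < n" "z < n"
  proof -
    have "set (u # f) \<subseteq> {..<n}" "z \<notin> set (u # f)" "last (u # f) \<in> set (u # f)"
      using snoc.prems u by auto
    then show "last (u # f) \<noteq> z" "last (u # f) < n" "z < n"
      using snoc.prems by (metis, metis lessThan_iff subsetD, simp)
  qed
  have "z \<notin> \<Union>?F" using pedges_subset[of _ "u # f"] F(2) snoc.prems u by fastforce
  then have zn: "{last (u # f), z} \<notin> ?F" by blast
  have pe: "pedges (u # f @ [z]) \<union> F = insert {last (u # f), z} ?F" using pedges_snoc[of "u # f" z] by simp
  have "gcount \<Delta> n (insert {last (u # f), z} ?F) \<le> gcount \<Delta> n ?F * ?K"
    using IH l zn snoc.prems s by (intro gcount_insert_le) auto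
  also have "\<dots> \<le> gcount \<Delta> n F * ?K ^ length f * ?K"
    using IH(3) s by (intro mult_right_mono) auto
  finally have 1: "gcount \<Delta> n (insert {last (u # f), z} ?F) \<le> gcount \<Delta> n F * ?K ^ length (f @ [z])"
    by (simp only: length_append_singleton power_Suc2 mult.assoc)
  have "card (insert {last (u # f), z} ?F) \<le> Suc (card ?F)" by (rule card_insert_le_m1) auto
  then have 2: "card (insert {last (u # f), z} ?F) \<le> card F + length (f @ [z])" using IH(2) by simp
  have "insert {last (u # f), z} ?F \<subseteq> sedges {..<n}" using IH(1) l by (simp add: sedges_iff)
  with 1 2 show ?case unfolding pe by blast
qed

text \<open>An ear with \<open>i\<close> new vertices has \<open>i + 1\<close> edges. Its vertices
  can be chosen in about \<open>n ^ i\<close> ways, while its edges bring \<open>i + 1\<close>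
  factors of order \<open>1 / n\<close>. This imbalance is why ears are rare.\<close>

lemma gcount_ear:
  assumes F: "F \<subseteq> sedges {..<n}" "\<And>e. e \<in> F \<Longrightarrow> e \<subseteq> U"
    and ear: "is_ear U F u f t" "set (u # f @ [t]) \<subseteq> {..<n}"
    and s: "cden \<Delta> n s > 0" "card F + length f \<le> s"
  shows "pedges (u # f @ [t]) \<union> F \<subseteq> sedges {..<n}" "card (pedges (u # f @ [t]) \<union> F) \<le> card F + length f + 1"
    "gcount \<Delta> n (pedges (u # f @ [t]) \<union> F) \<le> gcount \<Delta> n F * (real \<Delta> * real \<Delta> / cden \<Delta> n s) ^ (length f + 1)"
proof -
  let ?K = "real \<Delta> * real \<Delta> / cden \<Delta> n s"
  let ?F = "pedges (u # f) \<union> F"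
  have e: "u \<in> U" "t \<in> U \<union> set f" "distinct f" "set f \<inter> U = {}" using ear(1) by (auto simp: is_ear_def)
  have W: "?F \<subseteq> sedges {..<n}" "card ?F \<le> card F + length f" "gcount \<Delta> n ?F \<le> gcount \<Delta> n F * ?K ^ length f"
    using gcount_walk[OF F e(1) _ s(1) e(3,4) _ s(2)] ear(2) by auto
  have pe: "pedges (u # f @ [t]) \<union> F = insert {last (u # f), t} ?F" using pedges_snoc[of "u # f" t] by simp
  have lt: "last (u # f) \<noteq> t" using ear(1) by (auto simp: is_ear_def split: if_splits)
  \<comment> \<open>The closing edge is new. Without inner vertices \<open>is_ear\<close> says so;
    otherwise its first end lies outside \<open>U\<close>, and the only edge of the walk it could
    repeat is the last one, which \<open>is_ear\<close> excludes as a reversal.\<close>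
  have notin: "{last (u # f), t} \<notin> ?F"
  proof (cases "f = []")
    case True
    then show ?thesis using ear(1) by (auto simp: is_ear_def)
  next
    case False
    have "last f \<notin> U" using e False by (meson disjoint_iff last_in_set)
    then have nF: "{last (u # f), t} \<notin> F" using F(2) False by fastforce
    have du: "distinct (u # f)" using e by auto
    have "{last (u # f), t} \<notin> pedges (u # f)"
    proof
      assume "{last (u # f), t} \<in> pedges (u # f)"
      then obtain j where j: "Suc j < length (u # f)"
        "last (u # f) = (u # f) ! j \<and> t = (u # f) ! Suc j \<or> t = (u # f) ! j \<and> last (u # f) = (u # f) ! Suc j"
        using pedges_nth by metis
      have l: "last (u # f) = (u # f) ! length f" by (subst last_conv_nth) auto
      have "j \<noteq> length f" using j(1) by simp
      then have "last (u # f) \<noteq> (u # f) ! j"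
        using du j(1) unfolding l by (subst nth_eq_iff_index_eq) auto
      then have j2: "t = (u # f) ! j" "(u # f) ! length f = (u # f) ! Suc j" using j(2) l by auto
      then have "length f = Suc j" using du j(1) nth_eq_iff_index_eq[OF du, of "length f" "Suc j"] by simp
      moreover have "last (u # butlast f) = (u # f) ! (length f - 1)"
      proof -
        have "u # butlast f = butlast (u # f)" using False by simp
        then have "last (u # butlast f) = (u # butlast f) ! length (butlast f)"
          by (subst last_conv_nth) auto
        also have "\<dots> = (u # f) ! (length f - 1)"
          using nth_butlast[of "length f - 1" "u # f"] False by simp
        finally show ?thesis .
      qed
      ultimately show False using j2 ear(1) False by (auto simp: is_ear_def)
    qed
    with nF show ?thesis by blast
  qed
  have lst: "last (u # f) < n" "t < n" using ear(2) last_in_set[of "u # f"] by auto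
  have "gcount \<Delta> n (insert {last (u # f), t} ?F) \<le> gcount \<Delta> n ?F * ?K"
    using W lst lt notin s by (intro gcount_insert_le) auto
  also have "\<dots> \<le> gcount \<Delta> n F * ?K ^ length f * ?K"
    using W(3) s by (intro mult_right_mono) auto
  finally show "gcount \<Delta> n (pedges (u # f @ [t]) \<union> F) \<le> gcount \<Delta> n F * ?K ^ (length f + 1)"
    unfolding pe by (simp only: Suc_eq_plus1[symmetric] power_Suc2 mult.assoc)
  have "card (insert {last (u # f), t} ?F) \<le> Suc (card ?F)" by (rule card_insert_le_m1) auto
  then show "card (pedges (u # f @ [t]) \<union> F) \<le> card F + length f + 1" unfolding pe using W(2) by simp
  show "pedges (u # f @ [t]) \<union> F \<subseteq> sedges {..<n}" unfolding pe using W(1) lst lt by (simp add: sedges_iff)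
qed

lemma sum_lists_le:
  fixes g :: "nat \<Rightarrow> real"
  assumes "finite A"
  shows "(\<Sum>f\<in>{f. set f \<subseteq> A \<and> length f \<le> r}. g (length f)) = (\<Sum>i\<le>r. real (card A) ^ i * g i)"
proof -
  have eq: "{f. set f \<subseteq> A \<and> length f \<le> r} = (\<Union>i\<in>{..r}. {f. set f \<subseteq> A \<and> length f = i})" by auto
  have "(\<Sum>f\<in>{f. set f \<subseteq> A \<and> length f \<le> r}. g (length f)) =
      (\<Sum>i\<le>r. \<Sum>f\<in>{f. set f \<subseteq> A \<and> length f = i}. g (length f))"
    unfolding eq using finite_lists_length_eq[OF assms] by (intro sum.UNION_disjoint) auto
  also have "\<dots> = (\<Sum>i\<le>r. \<Sum>f\<in>{f. set f \<subseteq> A \<and> length f = i}. g i)"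
    by (intro sum.cong) auto
  also have "\<dots> = (\<Sum>i\<le>r. real (card A) ^ i * g i)"
    using card_lists_length_eq[OF assms] by simp
  finally show ?thesis .
qed

section \<open>First moments of chains, paths and cycles\<close>

definition chains :: "nat \<Rightarrow> nat \<Rightarrow> nat list \<Rightarrow> nat \<Rightarrow> (nat \<times> nat list \<times> nat) list set" where
  "chains n R xs m = {es. length es = m \<and> ear_chain R xs es \<and> everts es \<subseteq> {..<n}}"

lemma cedges_props:
  assumes "distinct xs" "set xs \<subseteq> {..<n}" "ear_chain R xs es" "everts es \<subseteq> {..<n}"
  shows "cedges xs es \<subseteq> sedges {..<n}" "card (cedges xs es) \<le> length xs + length es * (2 * R + 1)"
    "\<And>e. e \<in> cedges xs es \<Longrightarrow> e \<subseteq> cverts xs es" "finite (cedges xs es)"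
  using assms
proof (induction xs es rule: cedges.induct)
  case (1 xs)
  {
    case 1
    then show ?case by (simp add: pedges_sedges)
  next
    case 2
    then show ?case using card_pedges[of xs] by simp
  next
    case (3 e)
    then show ?case using pedges_subset by simp
  next
    case 4
    then show ?case by (simp add: finite_pedges)
  }
next
  case (2 xs u f t es)
  have sub: "e \<subseteq> cverts xs ((u, f, t) # es)"
    if "is_ear (cverts xs es) (cedges xs es) u f t" "e \<in> pedges (u # f @ [t])" for e
    using that pedges_subset[of e "u # f @ [t]"] by (auto simp: is_ear_def)
  have pes: "pedges (u # f @ [t]) \<subseteq> sedges {..<n}"
    if "is_ear (cverts xs es) (cedges xs es) u f t" "set (u # f @ [t]) \<subseteq> {..<n}"
  proof -
    have "distinct (u # f)" using that by (auto simp: is_ear_def)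
    then have "pedges (u # f) \<subseteq> sedges {..<n}" using that by (intro pedges_sedges) auto
    moreover have "last (u # f) \<noteq> t" using that(1) by (auto simp: is_ear_def split: if_splits)
    moreover have "last (u # f) \<in> set (u # f)" by (rule last_in_set) simp
    then have "last (u # f) < n" "t < n" using that(2) by auto
    ultimately show ?thesis using pedges_snoc[of "u # f" t] by (simp add: sedges_iff)
  qed
  have cp: "card (pedges (u # f @ [t])) \<le> length f + 1" using card_pedges[of "u # f @ [t]"] by simp
  {
    case 1
    then show ?case using 2 pes by simp
  next
    case 2
    have "card (cedges xs ((u, f, t) # es)) \<le> card (pedges (u # f @ [t])) + card (cedges xs es)"
      unfolding cedges.simps by (rule card_Un_le)
    then show ?case using cp 2 "2.IH"(2) by simp
  next
    case (3 e)
    then show ?case using sub[of e] "2.IH"(3)[of e] by auto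
  next
    case 4
    then show ?case using "2.IH"(4) by (simp add: finite_pedges)
  }
qed

text \<open>A further ear has at most \<open>s\<close> choices for \<open>u\<close>, at most
  \<open>s\<close> for \<open>t\<close> and \<open>n ^ i\<close> for its \<open>i\<close> inner
  vertices, and \<open>gcount_ear\<close> supplies the power \<open>i + 1\<close>. In the
  hypothesis, \<open>m + 1\<close> instead of \<open>m\<close> leaves room for the edges of the ear
  that is being added.\<close>

lemma sum_chains:
  assumes xs: "distinct xs" "set xs \<subseteq> {..<n}" and s: "cden \<Delta> n s > 0" "length xs + (m + 1) * (2 * R + 1) \<le> s"
  shows "finite (chains n R xs m) \<and> (\<Sum>es\<in>chains n R xs m. gcount \<Delta> n (cedges xs es)) \<le>
    gcount \<Delta> n (pedges xs) * (\<Sum>i\<le>2 * R. real s * real s * (real n ^ i * (real \<Delta> * real \<Delta> / cden \<Delta> n s) ^ (i + 1))) ^ m"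
  using s(2)
proof (induction m)
  case 0
  have "chains n R xs 0 = {[]}" unfolding chains_def by auto
  then show ?case by simp
next
  case (Suc m)
  define K where "K = real \<Delta> * real \<Delta> / cden \<Delta> n s"
  let ?A = "\<Sum>i\<le>2 * R. real s * real s * (real n ^ i * K ^ (i + 1))"
  have K0: "K \<ge> 0" using s by (simp add: K_def)
  define ears where "ears = (\<lambda>es. {(u, f, t). is_ear (cverts xs es) (cedges xs es) u f t \<and> length f \<le> 2 * R \<and>
      set (u # f @ [t]) \<subseteq> {..<n}})"
  define U where "U = (\<lambda>es. cverts xs es)"
  define Z where "Z = (\<lambda>es. SIGMA u:U es. SIGMA f:{f. set f \<subseteq> {..<n} \<and> length f \<le> 2 * R}. U es \<union> set f)"
  have finl: "finite {f :: nat list. set f \<subseteq> {..<n} \<and> length f \<le> 2 * R}"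
    by (rule finite_lists_length_le) simp
  have finU: "finite (U es)" for es unfolding U_def by (induction xs es rule: cverts.induct) auto
  have finZ: "finite (Z es)" for es unfolding Z_def using finU finl by (intro finite_SigmaI) auto
  have earsZ: "ears es \<subseteq> Z es" for es unfolding ears_def Z_def U_def is_ear_def by auto
  have fine: "finite (ears es)" for es using finite_subset[OF earsZ finZ] .
  have eq: "chains n R xs (Suc m) = (\<lambda>(es, e). e # es) ` (SIGMA es:chains n R xs m. ears es)"
  proof (intro equalityI subsetI)
    fix es' assume "es' \<in> chains n R xs (Suc m)"
    then obtain u f t es where "es' = (u, f, t) # es" "(es, (u, f, t)) \<in> (SIGMA es:chains n R xs m. ears es)"
      unfolding chains_def ears_def by (cases es') auto
    then show "es' \<in> (\<lambda>(es, e). e # es) ` (SIGMA es:chains n R xs m. ears es)" by force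
  qed (auto simp: chains_def ears_def)
  have inj: "inj_on (\<lambda>(es, e). e # es) (SIGMA es:chains n R xs m. ears es)" by (auto intro!: inj_onI)
  have IH: "finite (chains n R xs m)"
    "(\<Sum>es\<in>chains n R xs m. gcount \<Delta> n (cedges xs es)) \<le> gcount \<Delta> n (pedges xs) * ?A ^ m"
    using Suc unfolding K_def by auto
  have A0: "?A \<ge> 0"
    by (intro sum_nonneg mult_nonneg_nonneg zero_le_power K0 of_nat_0_le_iff)
  have inner: "(\<Sum>e\<in>ears es. gcount \<Delta> n (cedges xs (e # es))) \<le> gcount \<Delta> n (cedges xs es) * ?A"
    if es: "es \<in> chains n R xs m" for es
  proof -
    have es': "length es = m" "ear_chain R xs es" "everts es \<subseteq> {..<n}" using es by (auto simp: chains_def)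
    note P = cedges_props[OF xs es'(2,3)]
    have cU: "card (U es) \<le> length xs + m * (2 * R)" unfolding U_def using card_cverts[OF es'(2)] es'(1) by simp
    have "(\<Sum>e\<in>ears es. gcount \<Delta> n (cedges xs (e # es)))
        \<le> (\<Sum>(u, f, t)\<in>ears es. gcount \<Delta> n (cedges xs es) * K ^ (length f + 1))"
    proof (intro sum_mono)
      fix e assume e: "e \<in> ears es"
      obtain u f t where uft: "e = (u, f, t)" by (metis prod.exhaust)
      have "gcount \<Delta> n (pedges (u # f @ [t]) \<union> cedges xs es) \<le> gcount \<Delta> n (cedges xs es) * K ^ (length f + 1)"
        unfolding K_def
      proof (rule gcount_ear(3)[OF P(1) P(3)])
        show "card (cedges xs es) + length f \<le> s" using P(2) es'(1) e uft Suc.prems by (auto simp: ears_def)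
      qed (use e uft s in \<open>auto simp: ears_def\<close>)
      then show "gcount \<Delta> n (cedges xs (e # es)) \<le> (case e of (u, f, t) \<Rightarrow> gcount \<Delta> n (cedges xs es) * K ^ (length f + 1))"
        unfolding uft by simp
    qed
    also have "\<dots> \<le> (\<Sum>(u, f, t)\<in>Z es. gcount \<Delta> n (cedges xs es) * K ^ (length f + 1))"
      using finZ earsZ K0 gcount_nonneg by (intro sum_mono2) (auto intro!: mult_nonneg_nonneg)
    also have "\<dots> = (\<Sum>u\<in>U es. \<Sum>f\<in>{f. set f \<subseteq> {..<n} \<and> length f \<le> 2 * R}.
        real (card (U es \<union> set f)) * (gcount \<Delta> n (cedges xs es) * K ^ (length f + 1)))"
      unfolding Z_def using finU finl by (subst sum.Sigma[symmetric]; simp)+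
    also have "\<dots> \<le> (\<Sum>u\<in>U es. \<Sum>f\<in>{f. set f \<subseteq> {..<n} \<and> length f \<le> 2 * R}.
        real s * (gcount \<Delta> n (cedges xs es) * K ^ (length f + 1)))"
    proof (intro sum_mono mult_right_mono)
      fix u f assume f: "f \<in> {f. set f \<subseteq> {..<n} \<and> length f \<le> 2 * R}"
      have "card (U es \<union> set f) \<le> card (U es) + length f"
        using card_Un_le[of "U es" "set f"] card_length[of f] by linarith
      also have "\<dots> \<le> s" using cU f Suc.prems by auto
      finally show "real (card (U es \<union> set f)) \<le> real s" by simp
    qed (use K0 gcount_nonneg in \<open>auto intro!: mult_nonneg_nonneg\<close>)
    also have "\<dots> = real (card (U es)) * (\<Sum>f\<in>{f. set f \<subseteq> {..<n} \<and> length f \<le> 2 * R}.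
        real s * (gcount \<Delta> n (cedges xs es) * K ^ (length f + 1)))" by simp
    also have "\<dots> \<le> real s * (\<Sum>f\<in>{f. set f \<subseteq> {..<n} \<and> length f \<le> 2 * R}.
        real s * (gcount \<Delta> n (cedges xs es) * K ^ (length f + 1)))"
      using cU Suc.prems K0 gcount_nonneg by (intro mult_right_mono sum_nonneg) (auto intro!: mult_nonneg_nonneg)
    also have "(\<Sum>f\<in>{f. set f \<subseteq> {..<n} \<and> length f \<le> 2 * R}. real s * (gcount \<Delta> n (cedges xs es) * K ^ (length f + 1)))
        = (\<Sum>i\<le>2 * R. real n ^ i * (real s * (gcount \<Delta> n (cedges xs es) * K ^ (i + 1))))"
      using sum_lists_le[of "{..<n}" "\<lambda>i. real s * (gcount \<Delta> n (cedges xs es) * K ^ (i + 1))" "2 * R"] by simp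
    also have "real s * \<dots> = gcount \<Delta> n (cedges xs es) * ?A"
      by (simp add: sum_distrib_left mult_ac)
    finally show ?thesis .
  qed
  have "(\<Sum>es\<in>chains n R xs (Suc m). gcount \<Delta> n (cedges xs es))
      = (\<Sum>es\<in>chains n R xs m. \<Sum>e\<in>ears es. gcount \<Delta> n (cedges xs (e # es)))"
    unfolding eq sum.reindex[OF inj] using IH(1) fine by (subst sum.Sigma) (auto intro!: sum.cong)
  also have "\<dots> \<le> (\<Sum>es\<in>chains n R xs m. gcount \<Delta> n (cedges xs es) * ?A)"
    by (intro sum_mono inner)
  also have "\<dots> = (\<Sum>es\<in>chains n R xs m. gcount \<Delta> n (cedges xs es)) * ?A"
    by (simp add: sum_distrib_right)
  also have "\<dots> \<le> gcount \<Delta> n (pedges xs) * ?A ^ m * ?A"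
    using IH(2) A0 by (intro mult_right_mono) auto
  finally have "(\<Sum>es\<in>chains n R xs (Suc m). gcount \<Delta> n (cedges xs es)) \<le> gcount \<Delta> n (pedges xs) * ?A ^ Suc m"
    by (simp add: mult_ac)
  moreover have "finite (chains n R xs (Suc m))" unfolding eq using IH(1) fine by auto
  ultimately show ?case unfolding K_def by blast
qed

text \<open>For the paths that carry chains the crude factor costs only a power of \<open>n\<close>,
  their length being logarithmic. The number of ears is chosen to outweigh it.\<close>

lemma gcount_path_crude:
  assumes "distinct xs" "xs \<noteq> []" "set xs \<subseteq> {..<n}" "length xs \<le> s" "cden \<Delta> n s > 0"
  shows "gcount \<Delta> n (pedges xs) \<le> gcount \<Delta> n {} * (real \<Delta> * real \<Delta> / cden \<Delta> n s) ^ (length xs - 1)"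
proof -
  obtain u f where "xs = u # f" using assms by (cases xs) auto
  then show ?thesis using gcount_walk[of "{}" n "{u}" u \<Delta> s f] assms by auto
qed

definition paths :: "nat \<Rightarrow> nat \<Rightarrow> nat list set" where
  "paths n l = {xs. distinct xs \<and> set xs \<subseteq> {..<n} \<and> length xs = l}"

lemma finite_paths: "finite (paths n l)"
  by (rule finite_subset[OF _ finite_lists_length_eq[of "{..<n}" l]]) (auto simp: paths_def)

lemma card_paths: "card (paths n l) \<le> n ^ l"
proof -
  have "card (paths n l) \<le> card {xs. set xs \<subseteq> {..<n} \<and> length xs = l}"
    by (rule card_mono[OF finite_lists_length_eq]) (auto simp: paths_def)
  then show ?thesis by (simp add: card_lists_length_eq)
qed

text \<open>This counts vertices: a path of this length has at least \<open>C * ln n\<close>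
  edges.\<close>

definition maxlen :: "real \<Rightarrow> nat \<Rightarrow> nat" where
  "maxlen C n = nat \<lceil>C * ln (real n)\<rceil> + 1"

text \<open>The weight \<open>t ^ (l - 1)\<close> is what \<open>mu_path\<close> provides for the
  \<open>l - 1\<close> path edges of a cycle; the closing edge is bounded trivially. The sum thus
  controls the expected number of open cycles in the random-cluster model on a fixed graph.\<close>

definition cycsum :: "real \<Rightarrow> nat \<Rightarrow> nat \<Rightarrow> nat set set \<Rightarrow> real" where
  "cycsum t n k E = (\<Sum>l\<in>{3..k}. \<Sum>xs\<in>paths n l. of_bool (cyc xs \<subseteq> E) * t ^ (l - 1))"

definition no_chain :: "real \<Rightarrow> nat \<Rightarrow> nat \<Rightarrow> nat \<Rightarrow> nat set set \<Rightarrow> bool" where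
  "no_chain C R m n E \<longleftrightarrow> (\<forall>l\<in>{1..maxlen C n}. \<forall>xs\<in>paths n l. \<forall>es\<in>chains n R xs m. \<not> cedges xs es \<subseteq> E)"

lemma sum_indicator_gcount:
  "(\<Sum>E\<in>regular_graphs \<Delta> n. of_bool (F \<subseteq> E)) = gcount \<Delta> n F"
proof -
  have "(\<Sum>E\<in>regular_graphs \<Delta> n. of_bool (F \<subseteq> E)) = (\<Sum>E\<in>{E \<in> regular_graphs \<Delta> n. F \<subseteq> E}. 1 :: real)"
    unfolding of_bool_def using finite_regular_graphs by (simp add: sum.If_cases Int_def)
  then show ?thesis by (simp add: gcount_def)
qed

lemma card_chain_graphs:
  assumes s: "cden \<Delta> n s > 0" "maxlen C n + (m + 1) * (2 * R + 1) \<le> s"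
  defines "\<kappa> \<equiv> real \<Delta> * real \<Delta> / cden \<Delta> n s"
  shows "real (card {E \<in> regular_graphs \<Delta> n. \<not> no_chain C R m n E}) \<le> gcount \<Delta> n {} *
     (\<Sum>l\<in>{1..maxlen C n}. real n ^ l * \<kappa> ^ (l - 1) * (\<Sum>i\<le>2 * R. real s * real s * (real n ^ i * \<kappa> ^ (i + 1))) ^ m)"
proof -
  let ?\<Omega> = "regular_graphs \<Delta> n"
  let ?A = "\<Sum>i\<le>2 * R. real s * real s * (real n ^ i * \<kappa> ^ (i + 1))"
  have k0: "\<kappa> \<ge> 0" unfolding \<kappa>_def using s by simp
  have A0: "?A \<ge> 0"
    by (intro sum_nonneg mult_nonneg_nonneg zero_le_power k0 of_nat_0_le_iff)
  have sc: "finite (chains n R xs m)"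
    "(\<Sum>es\<in>chains n R xs m. gcount \<Delta> n (cedges xs es)) \<le> gcount \<Delta> n {} * \<kappa> ^ (l - 1) * ?A ^ m"
    if "xs \<in> paths n l" "l \<in> {1..maxlen C n}" for xs l
  proof -
    have xs: "distinct xs" "set xs \<subseteq> {..<n}" "length xs = l" "xs \<noteq> []" using that by (auto simp: paths_def)
    have le: "length xs + (m + 1) * (2 * R + 1) \<le> s" "length xs \<le> s" using s that xs by auto
    note c = sum_chains[OF xs(1,2) s(1) le(1)]
    show "finite (chains n R xs m)" using c by blast
    have "gcount \<Delta> n (pedges xs) \<le> gcount \<Delta> n {} * \<kappa> ^ (l - 1)"
      unfolding \<kappa>_def using gcount_path_crude[OF xs(1,4,2) le(2) s(1)] xs by simp
    then have "gcount \<Delta> n (pedges xs) * ?A ^ m \<le> gcount \<Delta> n {} * \<kappa> ^ (l - 1) * ?A ^ m"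
      using A0 by (intro mult_right_mono) auto
    then show "(\<Sum>es\<in>chains n R xs m. gcount \<Delta> n (cedges xs es)) \<le> gcount \<Delta> n {} * \<kappa> ^ (l - 1) * ?A ^ m"
      using c unfolding \<kappa>_def by linarith
  qed
  have "real (card {E \<in> ?\<Omega>. \<not> no_chain C R m n E}) = (\<Sum>E\<in>?\<Omega>. of_bool (\<not> no_chain C R m n E))"
    unfolding of_bool_def using finite_regular_graphs by (simp add: sum.If_cases Int_def)
  also have "\<dots> \<le> (\<Sum>E\<in>?\<Omega>. \<Sum>l\<in>{1..maxlen C n}. \<Sum>xs\<in>paths n l. \<Sum>es\<in>chains n R xs m. of_bool (cedges xs es \<subseteq> E))"
  proof (intro sum_mono)
    fix E
    show "of_bool (\<not> no_chain C R m n E) \<le>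
      (\<Sum>l\<in>{1..maxlen C n}. \<Sum>xs\<in>paths n l. \<Sum>es\<in>chains n R xs m. of_bool (cedges xs es \<subseteq> E) :: real)"
    proof (cases "no_chain C R m n E")
      case False
      then obtain l xs es where x: "l \<in> {1..maxlen C n}" "xs \<in> paths n l" "es \<in> chains n R xs m" "cedges xs es \<subseteq> E"
        unfolding no_chain_def by blast
      have "1 = (of_bool (cedges xs es \<subseteq> E) :: real)" using x by simp
      also have "\<dots> \<le> (\<Sum>es\<in>chains n R xs m. of_bool (cedges xs es \<subseteq> E))"
        using x sc(1)[OF x(2,1)] by (intro member_le_sum) auto
      also have "\<dots> \<le> (\<Sum>xs\<in>paths n l. \<Sum>es\<in>chains n R xs m. of_bool (cedges xs es \<subseteq> E))"
        using x finite_paths by (intro member_le_sum[of xs]) (auto intro: sum_nonneg)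
      also have "\<dots> \<le> (\<Sum>l\<in>{1..maxlen C n}. \<Sum>xs\<in>paths n l. \<Sum>es\<in>chains n R xs m. of_bool (cedges xs es \<subseteq> E))"
        using x by (intro member_le_sum[of l]) (auto intro!: sum_nonneg)
      finally show ?thesis using False by simp
    qed (auto intro!: sum_nonneg)
  qed
  also have "\<dots> = (\<Sum>l\<in>{1..maxlen C n}. \<Sum>xs\<in>paths n l. \<Sum>es\<in>chains n R xs m. gcount \<Delta> n (cedges xs es))"
    unfolding sum_indicator_gcount[symmetric]
    by (subst sum.swap, intro sum.cong refl, subst sum.swap, intro sum.cong refl, subst sum.swap, rule refl)
  also have "\<dots> \<le> (\<Sum>l\<in>{1..maxlen C n}. \<Sum>xs\<in>paths n l. gcount \<Delta> n {} * \<kappa> ^ (l - 1) * ?A ^ m)"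
    using sc by (intro sum_mono) auto
  also have "\<dots> = (\<Sum>l\<in>{1..maxlen C n}. real (card (paths n l)) * (gcount \<Delta> n {} * \<kappa> ^ (l - 1) * ?A ^ m))"
    by simp
  also have "\<dots> \<le> (\<Sum>l\<in>{1..maxlen C n}. real n ^ l * (gcount \<Delta> n {} * \<kappa> ^ (l - 1) * ?A ^ m))"
  proof (intro sum_mono mult_right_mono)
    show "real (card (paths n l)) \<le> real n ^ l" for l
      using of_nat_mono[OF card_paths[of n l], where 'a = real] by simp
  qed (intro mult_nonneg_nonneg gcount_nonneg zero_le_power k0 A0)
  also have "\<dots> = gcount \<Delta> n {} * (\<Sum>l\<in>{1..maxlen C n}. real n ^ l * \<kappa> ^ (l - 1) * ?A ^ m)"
    by (simp add: sum_distrib_left mult_ac)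
  finally show ?thesis .
qed

lemma cycsum_nonneg: "t \<ge> 0 \<Longrightarrow> cycsum t n k E \<ge> 0"
  unfolding cycsum_def by (intro sum_nonneg mult_nonneg_nonneg) auto

text \<open>Markov's inequality over the choice of the graph, combined with the first moment from
  \<open>gcount_cyc\<close>.\<close>

lemma card_cycsum_graphs:
  assumes s: "cden \<Delta> n s > 0" "k \<le> s" and t: "t \<ge> 0" and D: "\<Delta> \<ge> 2"
  defines "K \<equiv> real \<Delta> * (real \<Delta> - 1) / cden \<Delta> n s"
  shows "real (card {E \<in> regular_graphs \<Delta> n. \<not> cycsum t n k E \<le> h}) * h
     \<le> gcount \<Delta> n {} * (\<Sum>l\<in>{3..k}. 2 * real n ^ l * K ^ l * t ^ (l - 1))"
proof -
  let ?\<Omega> = "regular_graphs \<Delta> n"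
  have K0: "K \<ge> 0" unfolding K_def using s D by simp
  have "real (card {E \<in> ?\<Omega>. \<not> cycsum t n k E \<le> h}) * h = (\<Sum>E\<in>{E \<in> ?\<Omega>. \<not> cycsum t n k E \<le> h}. h)"
    by simp
  also have "\<dots> \<le> (\<Sum>E\<in>{E \<in> ?\<Omega>. \<not> cycsum t n k E \<le> h}. cycsum t n k E)"
    by (intro sum_mono) auto
  also have "\<dots> \<le> (\<Sum>E\<in>?\<Omega>. cycsum t n k E)"
    using finite_regular_graphs cycsum_nonneg[OF t] by (intro sum_mono2) auto
  also have "\<dots> = (\<Sum>l\<in>{3..k}. \<Sum>xs\<in>paths n l. gcount \<Delta> n (cyc xs) * t ^ (l - 1))"
    unfolding sum_indicator_gcount[symmetric] cycsum_def sum_distrib_right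
    by (subst sum.swap, intro sum.cong refl, subst sum.swap, rule refl)
  also have "\<dots> \<le> (\<Sum>l\<in>{3..k}. \<Sum>xs\<in>paths n l. gcount \<Delta> n {} * 2 * K ^ l * t ^ (l - 1))"
  proof (intro sum_mono mult_right_mono)
    fix l xs assume "l \<in> {3..k}" "xs \<in> paths n l"
    then show "gcount \<Delta> n (cyc xs) \<le> gcount \<Delta> n {} * 2 * K ^ l"
      unfolding K_def using gcount_cyc[of xs n s \<Delta>] s D by (auto simp: paths_def)
  qed (use t in auto)
  also have "\<dots> = (\<Sum>l\<in>{3..k}. real (card (paths n l)) * (gcount \<Delta> n {} * 2 * K ^ l * t ^ (l - 1)))"
    by simp
  also have "\<dots> \<le> (\<Sum>l\<in>{3..k}. real n ^ l * (gcount \<Delta> n {} * 2 * K ^ l * t ^ (l - 1)))"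
  proof (intro sum_mono mult_right_mono)
    show "real (card (paths n l)) \<le> real n ^ l" for l
      using of_nat_mono[OF card_paths[of n l], where 'a = real] by simp
  qed (intro mult_nonneg_nonneg gcount_nonneg zero_le_power K0 t zero_le_numeral)
  also have "\<dots> = gcount \<Delta> n {} * (\<Sum>l\<in>{3..k}. 2 * real n ^ l * K ^ l * t ^ (l - 1))"
    by (simp add: sum_distrib_left mult_ac)
  finally show ?thesis .
qed

definition good_graph :: "real \<Rightarrow> nat \<Rightarrow> nat \<Rightarrow> real \<Rightarrow> nat \<Rightarrow> nat set set \<Rightarrow> bool" where
  "good_graph C R m t n E \<longleftrightarrow> no_chain C R m n E \<and> cycsum t n (maxlen C n) E \<le> ln (real n)"

lemma prob_good_graph:
  assumes s: "cden \<Delta> n s > 0" "maxlen C n + (m + 1) * (2 * R + 1) \<le> s" and t: "t \<ge> 0"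
    and n: "\<Delta> \<ge> 2" "n > \<Delta>" "even (\<Delta> * n)"
  defines "\<kappa> \<equiv> real \<Delta> * real \<Delta> / cden \<Delta> n s" and "K \<equiv> real \<Delta> * (real \<Delta> - 1) / cden \<Delta> n s"
  shows "measure_pmf.prob (random_regular_graph \<Delta> n) {E. E \<in> regular_graphs \<Delta> n \<and> good_graph C R m t n E} \<ge>
    1 - ((\<Sum>l\<in>{1..maxlen C n}. real n ^ l * \<kappa> ^ (l - 1) * (\<Sum>i\<le>2 * R. real s * real s * (real n ^ i * \<kappa> ^ (i + 1))) ^ m)
       + (\<Sum>l\<in>{3..maxlen C n}. 2 * real n ^ l * K ^ l * t ^ (l - 1)) / ln (real n))"
    (is "_ \<ge> 1 - (?f + ?g / _)")
proof -
  let ?\<Omega> = "regular_graphs \<Delta> n"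
  define N0 where "N0 = real (card ?\<Omega>)"
  have ne: "?\<Omega> \<noteq> {}" using regular_graphs_nonempty n by simp
  then have N0: "N0 > 0" unfolding N0_def using finite_regular_graphs by (simp add: card_gt_0_iff)
  have g0: "gcount \<Delta> n {} = N0" unfolding gcount_def N0_def by simp
  have ln: "ln (real n) > 0" using n by simp
  define B1 where "B1 = {E \<in> ?\<Omega>. \<not> no_chain C R m n E}"
  define B2 where "B2 = {E \<in> ?\<Omega>. \<not> cycsum t n (maxlen C n) E \<le> ln (real n)}"
  define G where "G = {E. E \<in> ?\<Omega> \<and> good_graph C R m t n E}"
  have b1: "real (card B1) \<le> N0 * ?f"
    unfolding B1_def \<kappa>_def g0[symmetric] by (rule card_chain_graphs[OF s])
  have "maxlen C n \<le> s" using s(2) by linarith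
  from card_cycsum_graphs[OF s(1) this t n(1)] have "real (card B2) * ln (real n) \<le> N0 * ?g"
    unfolding B2_def K_def g0[symmetric] by blast
  then have b2: "real (card B2) \<le> N0 * (?g / ln (real n))" using ln by (simp add: field_simps)
  have "?\<Omega> = G \<union> (B1 \<union> B2)" unfolding G_def B1_def B2_def good_graph_def by auto
  then have "card ?\<Omega> \<le> card G + (card B1 + card B2)"
    by (metis card_Un_le add_left_mono le_trans)
  then have "N0 \<le> real (card G) + (real (card B1) + real (card B2))"
    unfolding N0_def by (simp flip: of_nat_add)
  then have "N0 * (1 - (?f + ?g / ln (real n))) \<le> real (card G)"
    using b1 b2 by (simp add: algebra_simps)
  then have "1 - (?f + ?g / ln (real n)) \<le> real (card G) / N0" using N0 by (simp add: field_simps)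
  moreover have "measure_pmf.prob (random_regular_graph \<Delta> n) G = real (card G) / N0"
  proof -
    have "?\<Omega> \<inter> G = G" unfolding G_def by auto
    then show ?thesis unfolding random_regular_graph_def N0_def
      using measure_pmf_of_set[OF ne finite_regular_graphs, of G] by simp
  qed
  ultimately show ?thesis unfolding G_def by simp
qed

text \<open>Both error terms of \<open>prob_good_graph\<close> vanish. The cycle sum is dominated by
  a geometric series whose ratio is close to \<open>t * (\<Delta> - 1) < 1\<close>, so it stays
  bounded while the threshold \<open>ln n\<close> grows. The chain sum is a power of
  \<open>n\<close> from the path times \<open>m\<close> factors that are at most
  \<open>n powr (- 1 / 2)\<close>.\<close>

theorem good_graphs_whp:
  assumes D: "\<Delta> \<ge> 2" and t: "t > 0" "t * (real \<Delta> - 1) < 1" and C: "C > 0"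
  shows "\<exists>m. ((\<lambda>n. measure_pmf.prob (random_regular_graph \<Delta> n)
      {E. E \<in> regular_graphs \<Delta> n \<and> good_graph C R m t n E}) \<longlongrightarrow> 1) (inf at_top (principal {n. even (\<Delta> * n)}))"
proof -
  \<comment> \<open>Up to a constant, a path with \<open>C * ln n\<close> steps contributes
    \<open>(2 * \<Delta>) powr (C * ln n) = n powr a\<close>.\<close>
  define a where "a = C * ln (2 * real \<Delta>)"
  have a0: "a \<ge> 0" unfolding a_def using C D by simp
  \<comment> \<open>The ears contribute at most \<open>n powr (- m / 2)\<close>. This has to beat
    \<open>n powr (1 + a)\<close> for the path and a further \<open>n\<close> for its length, and
    still leave \<open>1 / n\<close>.\<close>
  define m where "m = nat \<lceil>2 * (3 + a)\<rceil>"
  have m: "real m \<ge> 2 * (3 + a)" unfolding m_def by linarith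
  define M where "M = (m + 1) * (2 * R + 1)"
  define s where "s = (\<lambda>n. maxlen C n + M)"
  define d where "d = real \<Delta>"
  define c0 where "c0 = real (2 + 4 * \<Delta> + 2 * \<Delta> * \<Delta>)"
  define B where "B = real (2 * R + 1) * (2 * d) ^ (2 * R + 1)"
  define c where "c = real M + 2"
  \<comment> \<open>Halfway between \<open>t * (d - 1)\<close> and 1. The slack, expressed by the
    factor \<open>e\<close> below, absorbs the ratio of \<open>d * n\<close> to \<open>cden\<close>,
    which tends to 1.\<close>
  define \<rho> where "\<rho> = (1 + t * (d - 1)) / 2"
  have d2: "d \<ge> 2" unfolding d_def using D by simp
  have td: "t * (d - 1) > 0" "t * (d - 1) < 1" using t d2 unfolding d_def by auto
  have \<rho>: "0 < \<rho>" "\<rho> < 1" "t * (d - 1) < \<rho>" unfolding \<rho>_def using td by auto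
  define e where "e = \<rho> / (t * (d - 1))"
  have e: "e > 1" unfolding e_def using td \<rho> by (simp add: field_simps)
  have c: "c > 0" unfolding c_def by simp
  have c0: "c0 > 0" unfolding c0_def by (simp only: of_nat_0_less_iff)
  have B0: "B > 0" unfolding B_def using d2 by simp
  have s_le: "real (s n) \<le> C * ln (real n) + c" if "n \<ge> 1" for n
  proof -
    have "real (maxlen C n) \<le> C * ln (real n) + 2"
      unfolding maxlen_def using that C by (simp add: of_nat_nat) linarith
    then show ?thesis unfolding s_def c_def by simp
  qed
  have ev1: "eventually (\<lambda>n. d * real n - 2 * (C * ln (real n) + c) - c0 \<ge> d * real n / 2) at_top"
    using d2 C c c0 by real_asymp
  have ev2: "eventually (\<lambda>n. (d * real n - 2 * (C * ln (real n) + c) - c0) * e \<ge> d * real n) at_top"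
  proof -
    have "0 < d * (e - 1)" using d2 e by simp
    then have "eventually (\<lambda>n. 0 \<le> (d * (e - 1)) * real n - e * (2 * (C * ln (real n) + c) + c0)) at_top"
      using e C c c0 by real_asymp
    then show ?thesis by eventually_elim (simp add: algebra_simps)
  qed
  have ev3: "eventually (\<lambda>n. (C * ln (real n) + c) ^ 2 * B / real n \<le> real n powr (- 1 / 2)) at_top"
    using C c B0 by real_asymp
  have ev4: "eventually (\<lambda>n. C * ln (real n) + c \<le> real n) at_top"
    using C c by real_asymp
  define lower where "lower = (\<lambda>n. 1 - (2 * d * real n powr (- 1) + 2 / t / (1 - \<rho>) / ln (real n)))"
  have ev: "eventually (\<lambda>n. lower n \<le> measure_pmf.prob (random_regular_graph \<Delta> n)
      {E. E \<in> regular_graphs \<Delta> n \<and> good_graph C R m t n E}) (inf at_top (principal {n. even (\<Delta> * n)}))"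
    unfolding eventually_inf_principal
    using ev1 ev2 ev3 ev4 eventually_gt_at_top[of \<Delta>] eventually_gt_at_top[of 1]
  proof eventually_elim
    case (elim n)
    show ?case
    proof
      assume even: "n \<in> {n. even (\<Delta> * n)}"
      have n0: "real n > 0" using elim by simp
      have sl: "real (s n) \<le> C * ln (real n) + c" using s_le elim by simp
      have s1: "real (s n) \<ge> 1" unfolding s_def maxlen_def by simp
      have cd: "cden \<Delta> n (s n) \<ge> d * real n - 2 * (C * ln (real n) + c) - c0"
        unfolding cden_def d_def c0_def using sl by simp
      then have cd1: "cden \<Delta> n (s n) \<ge> d * real n / 2" using elim(1) by linarith
      have cd2: "cden \<Delta> n (s n) * e \<ge> d * real n"
        using elim(2) mult_right_mono[OF cd, of e] e by linarith
      have cpos: "cden \<Delta> n (s n) > 0" using cd1 mult_pos_pos[of d "real n"] n0 d2 by linarith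
      define \<kappa> where "\<kappa> = real \<Delta> * real \<Delta> / cden \<Delta> n (s n)"
      define K where "K = real \<Delta> * (real \<Delta> - 1) / cden \<Delta> n (s n)"
      have k0: "\<kappa> \<ge> 0" unfolding \<kappa>_def using cpos by simp
      have K0: "K \<ge> 0" unfolding K_def using cpos D by simp
      have nk: "real n * \<kappa> \<le> 2 * d"
      proof -
        have "real n * (d * d) \<le> 2 * d * cden \<Delta> n (s n)"
          using mult_left_mono[OF cd1, of "2 * d"] d2 by (simp add: mult_ac)
        then show ?thesis unfolding \<kappa>_def d_def[symmetric] using cpos by (simp add: field_simps)
      qed
      have nK: "real n * K * t \<le> \<rho>"
      proof -
        have "real n * K = (d - 1) * (d * real n) / cden \<Delta> n (s n)"
          unfolding K_def d_def by simp
        also have "\<dots> \<le> (d - 1) * (cden \<Delta> n (s n) * e) / cden \<Delta> n (s n)"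
          using cd2 cpos d2 by (intro divide_right_mono mult_left_mono) auto
        also have "\<dots> = (d - 1) * e" using cpos by simp
        finally have "real n * K * t \<le> (d - 1) * e * t" using t by (intro mult_right_mono) auto
        also have "\<dots> = e * (t * (d - 1))" by (simp only: mult_ac)
        also have "\<dots> = \<rho>"
          using nonzero_eq_divide_eq[of "t * (d - 1)" e \<rho>] td e_def by auto
        finally show ?thesis .
      qed
      define A where "A = (\<Sum>i\<le>2 * R. real (s n) * real (s n) * (real n ^ i * \<kappa> ^ (i + 1)))"
      have A0: "A \<ge> 0" unfolding A_def
        by (intro sum_nonneg mult_nonneg_nonneg zero_le_power k0 of_nat_0_le_iff)
      have A: "A \<le> real n powr (- 1 / 2)"
      proof -
        have "A \<le> (\<Sum>i\<le>2 * R. (C * ln (real n) + c) ^ 2 * ((2 * d) ^ (2 * R + 1) / real n))"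
          unfolding A_def
        proof (intro sum_mono)
          fix i assume i: "i \<in> {..2 * R}"
          have "real n ^ i * \<kappa> ^ (i + 1) = (real n * \<kappa>) ^ (i + 1) / real n"
            using n0 by (simp add: power_mult_distrib)
          also have "\<dots> \<le> (2 * d) ^ (i + 1) / real n"
            using nk k0 n0 by (intro divide_right_mono power_mono) auto
          also have "\<dots> \<le> (2 * d) ^ (2 * R + 1) / real n"
            using i d2 n0 by (intro divide_right_mono power_increasing) auto
          finally have 1: "real n ^ i * \<kappa> ^ (i + 1) \<le> (2 * d) ^ (2 * R + 1) / real n" .
          have 2: "real (s n) * real (s n) \<le> (C * ln (real n) + c) ^ 2"
            unfolding power2_eq_square using sl s1 by (intro mult_mono) auto
          show "real (s n) * real (s n) * (real n ^ i * \<kappa> ^ (i + 1))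
              \<le> (C * ln (real n) + c) ^ 2 * ((2 * d) ^ (2 * R + 1) / real n)"
            by (intro mult_mono 1 2 mult_nonneg_nonneg zero_le_power k0 zero_le_power2) auto
        qed
        also have "\<dots> = (C * ln (real n) + c) ^ 2 * B / real n" unfolding B_def by simp
        also have "\<dots> \<le> real n powr (- 1 / 2)" by (rule elim(3))
        finally show ?thesis .
      qed
      have f: "(\<Sum>l\<in>{1..maxlen C n}. real n ^ l * \<kappa> ^ (l - 1) * A ^ m) \<le> 2 * d * real n powr (- 1)"
      proof -
        have "(\<Sum>l\<in>{1..maxlen C n}. real n ^ l * \<kappa> ^ (l - 1) * A ^ m)
          \<le> (\<Sum>l\<in>{1..maxlen C n}. real n * (2 * d * real n powr a) * real n powr (- 3 - a))"
        proof (intro sum_mono, rule mult_mono)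
          fix l assume l: "l \<in> {1..maxlen C n}"
          then obtain j where j: "l = Suc j" "j \<le> nat \<lceil>C * ln (real n)\<rceil>"
            by (cases l) (auto simp: maxlen_def)
          have "real j + 1 \<le> real (maxlen C n)" using j unfolding maxlen_def by simp
          moreover have "real (maxlen C n) \<le> C * ln (real n) + 2"
            unfolding maxlen_def using elim(6) C by (simp add: of_nat_nat) linarith
          ultimately have "real j \<le> C * ln (real n) + 1" by linarith
          have "real n ^ l * \<kappa> ^ (l - 1) = real n * (real n * \<kappa>) ^ j"
            unfolding j by (simp add: power_mult_distrib)
          also have "\<dots> \<le> real n * (2 * d) ^ j"
            using nk k0 n0 by (intro mult_left_mono power_mono) auto
          also have "(2 * d) ^ j = (2 * d) powr (real j)" using d2 by (simp add: powr_realpow)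
          also have "\<dots> \<le> (2 * d) powr (C * ln (real n) + 1)"
            using \<open>real j \<le> _\<close> d2 by (intro powr_mono) auto
          also have "\<dots> = 2 * d * real n powr a"
            using d2 n0 by (simp add: a_def d_def powr_def distrib_right exp_add mult_ac)
          finally show "real n ^ l * \<kappa> ^ (l - 1) \<le> real n * (2 * d * real n powr a)"
            using n0 by simp
          have "A ^ m \<le> (real n powr (- 1 / 2)) ^ m" by (intro power_mono A A0)
          also have "\<dots> = real n powr (- real m / 2)"
            using n0 by (simp add: powr_powr flip: powr_realpow)
          also have "\<dots> \<le> real n powr (- 3 - a)" using m elim(6) by (intro powr_mono) auto
          finally show "A ^ m \<le> real n powr (- 3 - a)" .
        qed (use n0 d2 A0 in auto)
        also have "\<dots> = real (maxlen C n) * (real n * (2 * d * real n powr a) * real n powr (- 3 - a))"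
          by simp
        also have "\<dots> \<le> real n * (real n * (2 * d * real n powr a) * real n powr (- 3 - a))"
        proof (rule mult_right_mono)
          show "real (maxlen C n) \<le> real n" using sl elim(4) unfolding s_def by simp
        qed (use n0 d2 in auto)
        also have "\<dots> = 2 * d * (real n powr 1 * real n powr 1 * real n powr a * real n powr (- 3 - a))"
          using n0 by simp
        also have "\<dots> = 2 * d * real n powr (1 + 1 + a + (- 3 - a))" by (simp only: powr_add)
        also have "1 + 1 + a + (- 3 - a) = - 1" by simp
        finally show ?thesis .
      qed
      have g: "(\<Sum>l\<in>{3..maxlen C n}. 2 * real n ^ l * K ^ l * t ^ (l - 1)) \<le> 2 / t / (1 - \<rho>)"
      proof -
        have "(\<Sum>l\<in>{3..maxlen C n}. 2 * real n ^ l * K ^ l * t ^ (l - 1)) \<le> (\<Sum>l\<in>{3..maxlen C n}. 2 / t * \<rho> ^ l)"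
        proof (intro sum_mono)
          fix l assume "l \<in> {3..maxlen C n}"
          then obtain j where j: "l = Suc j" by (cases l) auto
          have "2 * real n ^ l * K ^ l * t ^ (l - 1) = 2 / t * (real n * K * t) ^ l"
            unfolding j using t by (simp add: power_mult_distrib)
          also have "\<dots> \<le> 2 / t * \<rho> ^ l"
            using nK K0 t n0 by (intro mult_left_mono power_mono) auto
          finally show "2 * real n ^ l * K ^ l * t ^ (l - 1) \<le> 2 / t * \<rho> ^ l" .
        qed
        also have "\<dots> = 2 / t * (\<Sum>l\<in>{3..maxlen C n}. \<rho> ^ l)" by (simp add: sum_distrib_left)
        also have "\<dots> \<le> 2 / t * (1 / (1 - \<rho>))"
        proof (rule mult_left_mono)
          have "(\<Sum>l\<in>{3..maxlen C n}. \<rho> ^ l) \<le> (\<Sum>l. \<rho> ^ l)"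
            using \<rho> by (intro sum_le_suminf) (auto intro: summable_geometric)
          also have "\<dots> = 1 / (1 - \<rho>)" using \<rho> by (intro suminf_geometric) auto
          finally show "(\<Sum>l\<in>{3..maxlen C n}. \<rho> ^ l) \<le> 1 / (1 - \<rho>)" .
        qed (use t in auto)
        finally show ?thesis by simp
      qed
      have "maxlen C n + (m + 1) * (2 * R + 1) \<le> s n" unfolding s_def M_def by simp
      from prob_good_graph[OF cpos this, of t] have
        "1 - ((\<Sum>l\<in>{1..maxlen C n}. real n ^ l * \<kappa> ^ (l - 1) * A ^ m)
          + (\<Sum>l\<in>{3..maxlen C n}. 2 * real n ^ l * K ^ l * t ^ (l - 1)) / ln (real n))
         \<le> measure_pmf.prob (random_regular_graph \<Delta> n) {E. E \<in> regular_graphs \<Delta> n \<and> good_graph C R m t n E}"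
        unfolding A_def \<kappa>_def K_def using t D elim even by auto
      moreover have "(\<Sum>l\<in>{3..maxlen C n}. 2 * real n ^ l * K ^ l * t ^ (l - 1)) / ln (real n)
          \<le> 2 / t / (1 - \<rho>) / ln (real n)"
        using g elim by (intro divide_right_mono) auto
      ultimately show "lower n \<le> measure_pmf.prob (random_regular_graph \<Delta> n)
          {E. E \<in> regular_graphs \<Delta> n \<and> good_graph C R m t n E}"
        unfolding lower_def using f by linarith
    qed
  qed
  have "(lower \<longlongrightarrow> 1) at_top" unfolding lower_def by real_asymp
  then have lim: "(lower \<longlongrightarrow> 1) (inf at_top (principal {n. even (\<Delta> * n)}))"
    by (rule tendsto_mono[rotated]) simp
  show ?thesis
    by (intro exI[of _ m] tendsto_sandwich[OF ev _ lim tendsto_const]) (auto intro!: always_eventually)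
qed

section \<open>The tail of the excess\<close>

lemma conn_path:
  assumes "conn S u v"
  shows "\<exists>xs. xs \<noteq> [] \<and> distinct xs \<and> hd xs = u \<and> last xs = v \<and> pedges xs \<subseteq> S"
  using assms unfolding conn_def
proof (induction rule: rtrancl_induct)
  case base
  then show ?case by (intro exI[of _ "[u]"]) auto
next
  case (step y z)
  then obtain xs where xs: "xs \<noteq> []" "distinct xs" "hd xs = u" "last xs = y" "pedges xs \<subseteq> S" by auto
  have yz: "{y, z} \<in> S" using step by (simp add: adj_def)
  show ?case
  proof (cases "z \<in> set xs")
    case True
    then obtain as bs where s: "xs = as @ z # bs" by (meson split_list)
    have "hd (as @ [z]) = u" using xs s by (cases as) auto
    moreover have "pedges (as @ [z]) \<subseteq> S" using xs s pedges_append[of as z bs] by auto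
    ultimately show ?thesis using xs s by (intro exI[of _ "as @ [z]"]) auto
  next
    case False
    have "pedges (xs @ [z]) \<subseteq> S" using pedges_snoc[OF xs(1), of z] xs yz by auto
    then show ?thesis using xs False by (intro exI[of _ "xs @ [z]"]) auto
  qed
qed

text \<open>When \<open>S\<close> is built edge by edge, each unit of excess is due to an edge whose
  ends were already connected. With a connecting path it closes a cycle, and different units belong
  to different edges.\<close>

lemma excess_le_cycles:
  assumes "finite X" "S \<subseteq> sedges X"
  shows "excess X S \<le> card {e \<in> S. \<exists>xs. distinct xs \<and> 3 \<le> length xs \<and> pedges xs \<subseteq> S \<and> e = {last xs, hd xs}}"
proof -
  have "finite S" using finite_edges[OF assms] .
  then show ?thesis using assms(2)
  proof (induction S rule: finite_induct)
    case (insert e S)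
    let ?C = "\<lambda>S. {e \<in> S. \<exists>xs. distinct xs \<and> 3 \<le> length xs \<and> pedges xs \<subseteq> S \<and> e = {last xs, hd xs}}"
    obtain u v where e: "e = {u, v}" "u \<noteq> v" using insert.prems by (auto simp: sedges_def)
    have ex: "excess X (insert e S) = excess X S + of_bool (conn S u v)"
      using excess_insert[OF assms(1), of u v S] insert.prems insert.hyps(2) unfolding e by blast
    have fin: "finite (?C (insert e S))" using insert.hyps by simp
    show ?case
    proof (cases "conn S u v")
      case True
      then obtain xs where xs: "xs \<noteq> []" "distinct xs" "hd xs = u" "last xs = v" "pedges xs \<subseteq> S"
        using conn_path by metis
      \<comment> \<open>A connecting path on one vertex would make \<open>e\<close> a loop, and one
        on two vertices would mean that \<open>e\<close> is already in \<open>S\<close>.\<close>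
      have "3 \<le> length xs"
      proof (rule ccontr)
        assume "\<not> 3 \<le> length xs"
        then consider y where "xs = [y]" | y z where "xs = [y, z]"
          using xs(1) by (cases xs; cases "tl xs"; cases "tl (tl xs)") auto
        then show False using xs e insert.hyps by cases auto
      qed
      then have "e \<in> ?C (insert e S)" using xs e by (auto intro!: exI[of _ xs] simp: insert_commute)
      then have "insert e (?C S) \<subseteq> ?C (insert e S)" by auto
      then have "card (insert e (?C S)) \<le> card (?C (insert e S))" using fin by (rule card_mono[rotated])
      moreover have "card (insert e (?C S)) = Suc (card (?C S))" using insert.hyps by simp
      moreover have "excess X S \<le> card (?C S)" using insert by simp
      ultimately show ?thesis unfolding ex using True by simp
    next
      case False
      have "?C S \<subseteq> ?C (insert e S)" by auto
      then have "card (?C S) \<le> card (?C (insert e S))" using fin by (rule card_mono[rotated])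
      moreover have "excess X S \<le> card (?C S)" using insert by simp
      ultimately show ?thesis unfolding ex using False by simp
    qed
  qed simp
qed

lemma pedges_take: "pedges (take k xs) \<subseteq> pedges xs"
proof (cases "drop k xs")
  case Nil
  then show ?thesis by simp
next
  case (Cons y ys)
  show ?thesis
  proof (cases "take k xs = []")
    case False
    have "xs = take k xs @ y # ys" using Cons by (metis append_take_drop_id)
    then show ?thesis
      using pedges_append[of "take k xs" y ys] pedges_snoc[OF False, of y] by auto
  qed auto
qed

lemma set_pedges: "length xs \<ge> 2 \<Longrightarrow> set xs \<subseteq> \<Union> (pedges xs)"
proof (induction xs rule: pedges.induct)
  case (1 u v zs)
  have "set (v # zs) \<subseteq> insert v (\<Union> (pedges (v # zs)))"
  proof (cases zs)
    case (Cons w ws)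
    then have "2 \<le> length (v # zs)" by simp
    then show ?thesis using 1 by blast
  qed simp
  then show ?case unfolding pedges.simps by auto
qed auto

text \<open>Each cycle is counted once for every starting point and direction.\<close>

definition ncyc :: "nat \<Rightarrow> nat \<Rightarrow> nat set set \<Rightarrow> real" where
  "ncyc n k S = (\<Sum>l\<in>{3..k}. \<Sum>xs\<in>paths n l. of_bool (cyc xs \<subseteq> S))"

lemma ncyc_eq: "ncyc n k S = real (card {xs \<in> (\<Union>l\<in>{3..k}. paths n l). cyc xs \<subseteq> S})"
proof -
  let ?P = "\<Union>l\<in>{3..k}. paths n l"
  have fin: "finite ?P" using finite_paths by auto
  have "ncyc n k S = (\<Sum>xs\<in>?P. of_bool (cyc xs \<subseteq> S))"
    unfolding ncyc_def using finite_paths by (intro sum.UNION_disjoint[symmetric]) (auto simp: paths_def)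
  also have "\<dots> = (\<Sum>xs\<in>{xs \<in> ?P. cyc xs \<subseteq> S}. 1)"
    unfolding of_bool_def using fin by (simp add: sum.If_cases Int_def)
  finally show ?thesis by simp
qed

text \<open>Without an open path on \<open>k\<close> vertices every open cycle has fewer than
  \<open>k\<close>. The closing edges in \<open>excess_le_cycles\<close> are then found among the
  cycles that \<open>ncyc\<close> counts.\<close>

lemma excess_le_ncyc:
  assumes S: "S \<subseteq> sedges {..<n}" and no: "\<And>xs. xs \<in> paths n k \<Longrightarrow> \<not> pedges xs \<subseteq> S" and k: "k \<ge> 1"
  shows "real (excess {..<n} S) \<le> ncyc n k S"
proof -
  let ?C = "{e \<in> S. \<exists>xs. distinct xs \<and> 3 \<le> length xs \<and> pedges xs \<subseteq> S \<and> e = {last xs, hd xs}}"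
  let ?P = "{xs \<in> (\<Union>l\<in>{3..k}. paths n l). cyc xs \<subseteq> S}"
  have sub: "?C \<subseteq> (\<lambda>xs. {last xs, hd xs}) ` ?P"
  proof
    fix e assume "e \<in> ?C"
    then obtain xs where xs: "distinct xs" "3 \<le> length xs" "pedges xs \<subseteq> S" "e = {last xs, hd xs}" "e \<in> S" by auto
    have "\<Union> (pedges xs) \<subseteq> {..<n}" using xs(3) S by (fastforce simp: sedges_def)
    then have n: "set xs \<subseteq> {..<n}" using set_pedges[of xs] xs by auto
    have "length xs < k"
    proof (rule ccontr)
      assume "\<not> length xs < k"
      then have "take k xs \<in> paths n k" using xs n set_take_subset[of k xs] by (auto simp: paths_def)
      moreover have "pedges (take k xs) \<subseteq> S" using pedges_take[of k xs] xs by auto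
      ultimately show False using no by blast
    qed
    then have "xs \<in> ?P" using xs n by (auto simp: paths_def cyc_def)
    then show "e \<in> (\<lambda>xs. {last xs, hd xs}) ` ?P" using xs(4) by auto
  qed
  have fin: "finite ?P" using finite_paths by auto
  have "excess {..<n} S \<le> card ?C" by (rule excess_le_cycles) (use S in auto)
  also have "\<dots> \<le> card ((\<lambda>xs. {last xs, hd xs}) ` ?P)" using sub fin by (intro card_mono) auto
  also have "\<dots> \<le> card ?P" using fin by (rule card_image_le)
  finally show ?thesis unfolding ncyc_eq by simp
qed

text \<open>Every step but the first avoids the vertex it came from, and
  \<open>\<Delta> \<le> 2 * (\<Delta> - 1)\<close> pays for the first one.\<close>

lemma card_open_paths:
  assumes E: "E \<in> regular_graphs \<Delta> n" and D: "\<Delta> \<ge> 2" and l: "l \<ge> 1"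
  shows "card {xs \<in> paths n l. pedges xs \<subseteq> E} \<le> 2 * n * (\<Delta> - 1) ^ (l - 1)"
  using l
proof (induction l rule: dec_induct)
  case base
  have "card {xs \<in> paths n 1. pedges xs \<subseteq> E} \<le> card (paths n 1)"
    by (rule card_mono[OF finite_paths]) auto
  then show ?case using card_paths[of n 1] by simp
next
  case (step l)
  let ?P = "\<lambda>l. {xs \<in> paths n l. pedges xs \<subseteq> E}"
  have sub: "E \<subseteq> sedges {..<n}" and deg: "\<And>v. v < n \<Longrightarrow> card (nb E v) = \<Delta>"
    using E by (auto simp: regular_graphs_iff)
  have finnb: "finite (nb E v)" for v using finite_nb[OF _ sub] by simp
  have finP: "finite (?P l)" for l using finite_paths by simp
  define nx where "nx = (\<lambda>xs. if l = 1 then nb E (last xs) else nb E (last xs) - {last (butlast xs)})"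
  have P: "?P (Suc l) \<subseteq> (\<lambda>(xs, z). xs @ [z]) ` (SIGMA xs:?P l. nx xs)"
  proof
    fix ys assume "ys \<in> ?P (Suc l)"
    then have ys: "distinct ys" "set ys \<subseteq> {..<n}" "length ys = Suc l" "pedges ys \<subseteq> E" by (auto simp: paths_def)
    then obtain xs z where xz: "ys = xs @ [z]" by (cases ys rule: rev_cases) auto
    have ne: "xs \<noteq> []" using ys xz step.hyps by auto
    have pe: "pedges ys = insert {last xs, z} (pedges xs)" unfolding xz by (rule pedges_snoc[OF ne])
    have "z \<noteq> last (butlast xs)" if "l \<noteq> 1"
    proof -
      have "length xs \<ge> 2" using that ys xz step.hyps by auto
      then have "butlast xs \<noteq> []" by (cases xs; cases "tl xs") auto
      then have "last (butlast xs) \<in> set xs" by (meson in_set_butlastD last_in_set)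
      then show ?thesis using ys xz by auto
    qed
    then have "z \<in> nx xs" using pe ys unfolding nx_def by (auto simp: nb_def)
    moreover have "xs \<in> ?P l" using ys xz pe by (auto simp: paths_def)
    ultimately show "ys \<in> (\<lambda>(xs, z). xs @ [z]) ` (SIGMA xs:?P l. nx xs)" using xz by force
  qed
  have finnx: "finite (nx xs)" for xs unfolding nx_def using finnb by simp
  have cnx: "card (nx xs) \<le> (if l = 1 then \<Delta> else \<Delta> - 1)" if "xs \<in> ?P l" for xs
  proof -
    have xs: "xs \<noteq> []" "set xs \<subseteq> {..<n}" "length xs = l" "pedges xs \<subseteq> E" using that step.hyps by (auto simp: paths_def)
    then have "last xs < n" by (meson last_in_set lessThan_iff subsetD)
    then have d: "card (nb E (last xs)) = \<Delta>" by (rule deg)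
    show ?thesis
    proof (cases "l = 1")
      case False
      then have "length xs \<ge> 2" using xs step.hyps by auto
      then obtain zs y z where z: "xs = zs @ [y, z]"
        by (metis One_nat_def append_Cons append_Nil append_assoc last_in_set le_numeral_extra(4) length_0_conv length_append_singleton list.size(3) nat_le_linear not_less_eq_eq numeral_2_eq_2 rev_exhaust)
      have "{y, z} \<in> pedges xs" unfolding z using pedges_append[of zs y "[z]"] by simp
      then have "y \<in> nb E (last xs)" using xs z by (auto simp: nb_def insert_commute)
      moreover have "last (butlast xs) = y" unfolding z by (simp add: butlast_append)
      ultimately show ?thesis using False d finnb unfolding nx_def by simp
    qed (use d in \<open>simp add: nx_def\<close>)
  qed
  have "card (?P (Suc l)) \<le> card ((\<lambda>(xs, z). xs @ [z]) ` (SIGMA xs:?P l. nx xs))"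
    using P finP finnx by (intro card_mono) auto
  also have "\<dots> \<le> card (SIGMA xs:?P l. nx xs)" using finP finnx by (intro card_image_le) auto
  also have "\<dots> = (\<Sum>xs\<in>?P l. card (nx xs))" using finP finnx by (intro card_SigmaI) auto
  also have "\<dots> \<le> (\<Sum>xs\<in>?P l. (if l = 1 then \<Delta> else \<Delta> - 1))" by (intro sum_mono cnx) auto
  also have "\<dots> = card (?P l) * (if l = 1 then \<Delta> else \<Delta> - 1)" by simp
  also have "\<dots> \<le> 2 * n * (\<Delta> - 1) ^ (Suc l - 1)"
  proof (cases "l = 1")
    case True
    have "card (?P l) \<le> n" using card_mono[OF finite_paths, of "?P l" n l] card_paths[of n l] True by simp
    then have "card (?P l) * \<Delta> \<le> n * (2 * (\<Delta> - 1))" using D by (intro mult_mono) auto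
    then show ?thesis using True by (simp add: mult_ac)
  next
    case False
    have "card (?P l) * (\<Delta> - 1) \<le> 2 * n * (\<Delta> - 1) ^ (l - 1) * (\<Delta> - 1)"
      using step.IH by (intro mult_right_mono) auto
    also have "\<dots> = 2 * n * (\<Delta> - 1) ^ (Suc l - 1)" using step.hyps by (cases l) auto
    finally show ?thesis using False by simp
  qed
  finally show ?case .
qed

context rc_graph begin

lemma sum_W_event_le:
  assumes "finite I" "\<And>S. S \<subseteq> E \<Longrightarrow> P S \<Longrightarrow> \<exists>i\<in>I. F i \<subseteq> S"
  shows "(\<Sum>S\<in>Pow E. of_bool (P S) * W S) \<le> (\<Sum>i\<in>I. mu (F i))"
proof -
  have "(\<Sum>S\<in>Pow E. of_bool (P S) * W S) \<le> (\<Sum>S\<in>Pow E. (\<Sum>i\<in>I. of_bool (F i \<subseteq> S)) * W S)"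
  proof (intro sum_mono mult_right_mono W_nonneg)
    fix S assume S: "S \<in> Pow E"
    show "of_bool (P S) \<le> (\<Sum>i\<in>I. of_bool (F i \<subseteq> S) :: real)"
    proof (cases "P S")
      case True
      then obtain i where i: "i \<in> I" "F i \<subseteq> S" using assms(2) S by blast
      then have "1 = (of_bool (F i \<subseteq> S) :: real)" by simp
      also have "\<dots> \<le> (\<Sum>i\<in>I. of_bool (F i \<subseteq> S))" using i assms(1) by (intro member_le_sum) auto
      finally show ?thesis using True by simp
    qed (auto intro: sum_nonneg)
  qed
  also have "\<dots> = (\<Sum>i\<in>I. mu (F i))"
    unfolding mu_def sum_distrib_right by (rule sum.swap)
  finally show ?thesis .
qed

end

text \<open>A large excess has one of two causes, each with at most a quarter of the total weight.
  One is a long open path, treated by a union bound that the hypothesis \<open>long\<close> makes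
  small. The other is a large number of open cycles, treated by Markov's inequality, as its mean is
  at most \<open>ln n / t ^ K0\<close>. A bound of one half is all that
  \<open>excess_tail_transfer\<close> asks for.\<close>

lemma excess_half:
  assumes E: "E \<in> regular_graphs \<Delta> n" and D: "\<Delta> \<ge> 2" and x: "x \<ge> 0" and q: "q \<ge> 1" and n: "n \<ge> 1"
    and t_def: "t = rc_graph.ptil x q (\<Delta> - 1) R" and K0_def: "K0 = m * (2 * R + 2) * (\<Delta> + 1) ^ R"
    and good: "good_graph C R m t n E" and t: "t > 0"
    and M: "M > 0" "4 * ln (real n) \<le> t ^ K0 * M"
    and long: "8 * real n * (real (\<Delta> - 1) * t) ^ (maxlen C n - 1) \<le> t ^ K0"
  shows "(\<Sum>S\<in>Pow E. of_bool (real (excess {..<n} S) > M) * cw {..<n} x q S) \<le> (\<Sum>S\<in>Pow E. cw {..<n} x q S) / 2"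
proof -
  have sub: "E \<subseteq> sedges {..<n}" and deg: "\<And>v. v < n \<Longrightarrow> card (nb E v) = \<Delta>"
    using E by (auto simp: regular_graphs_iff)
  have finnb: "finite (nb E v)" for v using finite_nb[OF _ sub] by simp
  have degle: "card (nb E v) \<le> \<Delta>" for v
  proof (cases "v < n")
    case False
    then have "nb E v = {}" using sub sedges_iff[of v _ "{..<n}"] by (auto simp: nb_def)
    then show ?thesis by simp
  qed (use deg in simp)
  interpret rc_graph "{..<n}" E x q "\<Delta> - 1"
  proof
    show "card (nb E v - {u}) \<le> \<Delta> - 1" if "{u, v} \<in> E" for u v
    proof -
      have "u \<in> nb E v" using that by (simp add: nb_def insert_commute)
      then have "card (nb E v - {u}) = card (nb E v) - 1" by simp
      then show ?thesis using degle[of v] by simp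
    qed
  qed (use sub x q in auto)
  have tp: "t = ptil R" unfolding t_def ..
  let ?k = "maxlen C n"
  have k1: "?k \<ge> 1" by (simp add: maxlen_def)
  define Z where "Z = mu {}"
  have Zeq: "Z = (\<Sum>S\<in>Pow E. W S)" unfolding Z_def mu_def by simp
  have Z0: "Z \<ge> 0" unfolding Z_def by (rule mu_nonneg)
  have path: "mu (pedges xs) * t ^ K0 \<le> t ^ (l - 1) * Z"
    if xs: "xs \<in> paths n l" "l \<in> {1..?k}" "pedges xs \<subseteq> E" for xs l
  proof -
    have x': "distinct xs" "set xs \<subseteq> {..<n}" "length xs = l" "xs \<noteq> []" using xs by (auto simp: paths_def)
    \<comment> \<open>More bad positions would produce a chain of \<open>m\<close> ears, which
      \<open>no_chain\<close> forbids.\<close>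
    have "card (badset E R xs) \<le> K0"
    proof (rule ccontr)
      assume "\<not> card (badset E R xs) \<le> K0"
      then obtain es where es: "length es = m" "ear_chain R xs es" "cedges xs es \<subseteq> E"
        using ear_chain_exists[OF sub _ degle x'(1) xs(3), of m R] unfolding K0_def by auto
      have "everts es \<subseteq> \<Union> (cedges xs es)"
      proof (induction xs es rule: cedges.induct)
        case (2 xs u f t es)
        have "set (u # f @ [t]) \<subseteq> \<Union> (pedges (u # f @ [t]))" by (rule set_pedges) simp
        then show ?case using 2 by (auto simp del: pedges.simps)
      qed simp
      then have "everts es \<subseteq> {..<n}" using es(3) sub by (fastforce simp: sedges_def)
      then have "es \<in> chains n R xs m" using es by (simp add: chains_def)
      then show False using good xs es(3) unfolding good_graph_def no_chain_def by blast
    qed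
    then have "mu (pedges xs) * t ^ K0 \<le> mu (pedges xs) * t ^ card (badset E R xs)"
      using ptil_range[of R] mu_nonneg unfolding tp by (intro mult_left_mono power_decreasing) auto
    also have "\<dots> \<le> t ^ (l - 1) * Z"
      unfolding tp Z_def x'(3)[symmetric] by (rule mu_path[OF x'(1) xs(3) x'(4)])
    finally show ?thesis .
  qed
  have tK: "t ^ K0 > 0" using t by simp
  have long_le: "(\<Sum>xs\<in>{xs \<in> paths n ?k. pedges xs \<subseteq> E}. mu (pedges xs)) \<le> Z / 4"
  proof -
    have "(\<Sum>xs\<in>{xs \<in> paths n ?k. pedges xs \<subseteq> E}. mu (pedges xs)) * t ^ K0
        \<le> (\<Sum>xs\<in>{xs \<in> paths n ?k. pedges xs \<subseteq> E}. t ^ (?k - 1) * Z)"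
      unfolding sum_distrib_right using path k1 by (intro sum_mono) auto
    also have "\<dots> = real (card {xs \<in> paths n ?k. pedges xs \<subseteq> E}) * (t ^ (?k - 1) * Z)" by simp
    also have "\<dots> \<le> real (2 * n * (\<Delta> - 1) ^ (?k - 1)) * (t ^ (?k - 1) * Z)"
      using card_open_paths[OF E D k1] t Z0 by (intro mult_right_mono) (auto simp del: of_nat_mult)
    also have "\<dots> = (8 * real n * (real (\<Delta> - 1) * t) ^ (?k - 1)) * (Z / 4)"
      by (simp add: power_mult_distrib)
    also have "\<dots> \<le> t ^ K0 * (Z / 4)" using long Z0 by (intro mult_right_mono) auto
    finally show ?thesis using tK by (simp add: mult.commute)
  qed
  have cyc_le: "(\<Sum>S\<in>Pow E. ncyc n ?k S * W S) * t ^ K0 \<le> ln (real n) * Z"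
  proof -
    have "(\<Sum>S\<in>Pow E. ncyc n ?k S * W S) = (\<Sum>l\<in>{3..?k}. \<Sum>xs\<in>paths n l. mu (cyc xs))"
      unfolding ncyc_def mu_def sum_distrib_right
      by (subst sum.swap, intro sum.cong refl, rule sum.swap)
    then have "(\<Sum>S\<in>Pow E. ncyc n ?k S * W S) * t ^ K0 = (\<Sum>l\<in>{3..?k}. \<Sum>xs\<in>paths n l. mu (cyc xs) * t ^ K0)"
      by (simp add: sum_distrib_right)
    also have "\<dots> \<le> (\<Sum>l\<in>{3..?k}. \<Sum>xs\<in>paths n l. of_bool (cyc xs \<subseteq> E) * t ^ (l - 1) * Z)"
    proof (intro sum_mono)
      fix l xs assume l: "l \<in> {3..?k}" and xs: "xs \<in> paths n l"
      show "mu (cyc xs) * t ^ K0 \<le> of_bool (cyc xs \<subseteq> E) * t ^ (l - 1) * Z"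
      proof (cases "cyc xs \<subseteq> E")
        case True
        then have "pedges xs \<subseteq> E" "mu (cyc xs) \<le> mu (pedges xs)"
          unfolding cyc_def by (auto intro!: mu_antimono)
        then have "mu (cyc xs) * t ^ K0 \<le> mu (pedges xs) * t ^ K0" using tK by (intro mult_right_mono) auto
        also have "\<dots> \<le> t ^ (l - 1) * Z" using path[OF xs _ \<open>pedges xs \<subseteq> E\<close>] l by auto
        finally show ?thesis using True by simp
      next
        case False
        then have "mu (cyc xs) = 0" unfolding mu_def by (intro sum.neutral) auto
        then show ?thesis using False by simp
      qed
    qed
    also have "\<dots> = cycsum t n ?k E * Z" unfolding cycsum_def by (simp add: sum_distrib_right)
    also have "\<dots> \<le> ln (real n) * Z" using good Z0 unfolding good_graph_def by (intro mult_right_mono) auto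
    finally show ?thesis .
  qed
  let ?L = "\<lambda>S. \<exists>xs\<in>{xs \<in> paths n ?k. pedges xs \<subseteq> E}. pedges xs \<subseteq> S"
  have "(\<Sum>S\<in>Pow E. of_bool (real (excess {..<n} S) > M) * W S)
     \<le> (\<Sum>S\<in>Pow E. of_bool (?L S) * W S + ncyc n ?k S / M * W S)"
  proof (intro sum_mono)
    fix S assume S: "S \<in> Pow E"
    have n0: "ncyc n ?k S \<ge> 0" unfolding ncyc_def by (intro sum_nonneg) auto
    show "of_bool (real (excess {..<n} S) > M) * W S \<le> of_bool (?L S) * W S + ncyc n ?k S / M * W S"
    proof (cases "?L S \<or> \<not> real (excess {..<n} S) > M")
      case True
      then show ?thesis using n0 M W_nonneg[of S] by auto
    next
      case False
      then have "\<not> pedges xs \<subseteq> S" if "xs \<in> paths n ?k" for xs using that S by auto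
      then have "real (excess {..<n} S) \<le> ncyc n ?k S"
        using S sub k1 by (intro excess_le_ncyc) auto
      then have "1 \<le> ncyc n ?k S / M" using False M by simp
      then have "1 * W S \<le> ncyc n ?k S / M * W S" by (intro mult_right_mono W_nonneg)
      then show ?thesis using False by simp
    qed
  qed
  also have "\<dots> = (\<Sum>S\<in>Pow E. of_bool (?L S) * W S) + (\<Sum>S\<in>Pow E. ncyc n ?k S * W S) / M"
    by (simp add: sum.distrib sum_divide_distrib)
  also have "\<dots> \<le> Z / 4 + Z / 4"
  proof (rule add_mono)
    have "(\<Sum>S\<in>Pow E. of_bool (?L S) * W S) \<le> (\<Sum>xs\<in>{xs \<in> paths n ?k. pedges xs \<subseteq> E}. mu (pedges xs))"
      using finite_paths by (intro sum_W_event_le) auto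
    then show "(\<Sum>S\<in>Pow E. of_bool (?L S) * W S) \<le> Z / 4" using long_le by linarith
    have "(\<Sum>S\<in>Pow E. ncyc n ?k S * W S) * t ^ K0 \<le> (t ^ K0 * M / 4) * Z"
      using cyc_le M(2) mult_right_mono[of "ln (real n)" "t ^ K0 * M / 4" Z] Z0 by linarith
    also have "\<dots> = (M * Z / 4) * t ^ K0" by simp
    finally have "(\<Sum>S\<in>Pow E. ncyc n ?k S * W S) \<le> M * Z / 4" using tK by (simp only: mult_le_cancel_right_pos)
    then show "(\<Sum>S\<in>Pow E. ncyc n ?k S * W S) / M \<le> Z / 4" using M(1) by (simp add: field_simps)
  qed
  finally show ?thesis unfolding Zeq[symmetric] by simp
qed

text \<open>The weight for \<open>lam * q\<close> is that for \<open>q\<close> times \<open>lam\<close> to the power of the excess, so that a bounded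
  median for the larger parameter yields an exponential tail for the smaller one.\<close>

lemma excess_tail_transfer:
  assumes fin: "finite E" and x: "x \<ge> 0" and q: "q \<ge> 1" and lam: "lam > 1" and M: "M \<ge> 0" and L: "L \<ge> 0"
    and half: "(\<Sum>S\<in>Pow E. of_bool (real (excess X S) > M) * cw X x (lam * q) S) \<le> (\<Sum>S\<in>Pow E. cw X x (lam * q) S) / 2"
  shows "(\<Sum>S\<in>Pow E. of_bool (real (excess X S) > L) * cw X x q S) \<le> 2 * lam powr (M - L) * (\<Sum>S\<in>Pow E. cw X x q S)"
proof -
  let ?W = "cw X x q" and ?W' = "cw X x (lam * q)" and ?e = "\<lambda>S. real (excess X S)"
  have W': "?W' S = lam powr ?e S * ?W S" for S
    using lam by (simp add: cw_def power_mult_distrib powr_realpow)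
  have W0: "?W S \<ge> 0" "?W' S \<ge> 0" for S using x q lam by (auto intro!: cw_nonneg)
  have split: "(\<Sum>S\<in>Pow E. ?W' S) = (\<Sum>S\<in>Pow E. of_bool (?e S > M) * ?W' S) + (\<Sum>S\<in>Pow E. of_bool (\<not> ?e S > M) * ?W' S)"
    unfolding sum.distrib[symmetric] by (intro sum.cong) auto
  have "(\<Sum>S\<in>Pow E. of_bool (\<not> ?e S > M) * ?W' S) \<le> (\<Sum>S\<in>Pow E. lam powr M * ?W S)"
  proof (intro sum_mono)
    fix S
    show "of_bool (\<not> ?e S > M) * ?W' S \<le> lam powr M * ?W S"
    proof (cases "?e S > M")
      case False
      then have "lam powr ?e S \<le> lam powr M" using lam by (intro powr_mono) auto
      then show ?thesis unfolding W' using False W0(1)[of S] by (auto intro: mult_right_mono)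
    qed (use W0(1)[of S] in auto)
  qed
  also have "\<dots> = lam powr M * (\<Sum>S\<in>Pow E. ?W S)" by (simp add: sum_distrib_left)
  \<comment> \<open>At least half of the weight for \<open>lam * q\<close> belongs to an excess of
    at most \<open>M\<close>, where it is at most \<open>lam powr M\<close> times the weight for
    \<open>q\<close>.\<close>
  finally have Z': "(\<Sum>S\<in>Pow E. ?W' S) \<le> 2 * lam powr M * (\<Sum>S\<in>Pow E. ?W S)"
    using half split by simp
  have "(\<Sum>S\<in>Pow E. of_bool (?e S > L) * ?W S) \<le> (\<Sum>S\<in>Pow E. lam powr (- L) * ?W' S)"
  proof (intro sum_mono)
    fix S
    show "of_bool (?e S > L) * ?W S \<le> lam powr (- L) * ?W' S"
    proof (cases "?e S > L")
      case True
      then have "1 \<le> lam powr (- L + ?e S)" using lam by (intro ge_one_powr_ge_zero) auto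
      then have "1 * ?W S \<le> lam powr (- L + ?e S) * ?W S" using W0(1) by (intro mult_right_mono) auto
      then have "?W S \<le> lam powr (- L) * (lam powr ?e S * ?W S)" by (simp only: powr_add mult.assoc mult_1)
      then show ?thesis unfolding W' using True by simp
    qed (use W0(2)[of S] in auto)
  qed
  also have "\<dots> = lam powr (- L) * (\<Sum>S\<in>Pow E. ?W' S)" by (simp add: sum_distrib_left)
  also have "\<dots> \<le> lam powr (- L) * (2 * lam powr M * (\<Sum>S\<in>Pow E. ?W S))"
    using Z' by (intro mult_left_mono) auto
  also have "\<dots> = 2 * lam powr (M - L) * (\<Sum>S\<in>Pow E. ?W S)"
    by (simp add: powr_diff powr_minus field_simps)
  finally show ?thesis .
qed

section \<open>The tree recursion below the critical value\<close>

lemma Yf_1: "Yf d w q 1 = 1"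
  by (simp add: Yf_def)

text \<open>Since \<open>Yf\<close> lies below the diagonal beyond 1, the iterates never increase,
  and they stay above 1. Their limit is a fixed point by continuity, and 1 is the only one in this
  range.\<close>

lemma Yit_tends_to_1:
  assumes w: "w \<ge> 0" and q: "q \<ge> 1" and sub: "\<And>y. y > 1 \<Longrightarrow> Yf d w q y < y" and e: "\<epsilon> > 0"
  shows "\<exists>r. Yit d w q r < 1 + \<epsilon>"
proof -
  let ?Y = "Yit d w q"
  have ge1: "?Y r \<ge> 1" for r by (rule Yit_ge_1[OF w q])
  have Suc: "?Y (Suc r) = Yf d w q (?Y r)" for r by (simp add: Yit_def)
  have "decseq ?Y"
  proof (rule decseq_SucI)
    fix r
    show "?Y (Suc r) \<le> ?Y r"
      unfolding Suc using sub[of "?Y r"] ge1[of r] Yf_1[of d w q] by (cases "?Y r = 1") auto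
  qed
  then obtain l where l: "?Y \<longlonglongrightarrow> l" using ge1 by (metis decseq_convergent)
  have l1: "l \<ge> 1" using LIMSEQ_le_const[OF l] ge1 by blast
  have "l ^ d + q - 1 + w > 0" using one_le_power[OF l1, of d] q w by linarith
  then have "(\<lambda>r. Yf d w q (?Y r)) \<longlonglongrightarrow> Yf d w q l"
    unfolding Yf_def by (intro tendsto_intros l) auto
  moreover have "(\<lambda>r. Yf d w q (?Y r)) \<longlonglongrightarrow> l"
    using LIMSEQ_Suc[OF l] unfolding Suc .
  ultimately have "Yf d w q l = l" by (rule LIMSEQ_unique)
  then have "l = 1" using sub[of l] l1 by force
  then have "eventually (\<lambda>r. ?Y r < 1 + \<epsilon>) sequentially"
    using l e by (intro order_tendstoD(2)[OF l]) auto
  then show ?thesis by (auto simp: eventually_sequentially)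
qed

lemma crit_h_pos:
  assumes "\<Delta> \<ge> 3" "q \<ge> 1" "y > 1"
  shows "y ^ (\<Delta> - 1) > y" "crit_h q \<Delta> y > 0"
proof -
  have "y ^ 1 < y ^ (\<Delta> - 1)" using assms by (intro power_strict_increasing) auto
  then show 1: "y ^ (\<Delta> - 1) > y" by simp
  show "crit_h q \<Delta> y > 0"
    unfolding crit_h_def using 1 assms by (intro divide_pos_pos mult_pos_pos) auto
qed

text \<open>The third claim comes from the limit at \<open>y = 1\<close>: after cancelling
  \<open>y - 1\<close> the function becomes \<open>g\<close>, which tends to
  \<open>q / (\<Delta> - 2)\<close>. If \<open>x * q\<close> is below the infimum, then
  \<open>x * (\<Delta> - 2) < 1\<close>, so that percolation with odds \<open>x\<close> is
  subcritical on the \<Delta>-regular tree.\<close>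

lemma crit_inf:
  assumes "\<Delta> \<ge> 3" "q \<ge> 1"
  defines "I \<equiv> INF y\<in>{1<..}. crit_h q \<Delta> y"
  shows "I \<ge> 0" "\<And>y. y > 1 \<Longrightarrow> I \<le> crit_h q \<Delta> y" "I * (real \<Delta> - 2) \<le> q"
proof -
  have pos: "crit_h q \<Delta> y \<ge> 0" if "y \<in> {1<..}" for y using crit_h_pos(2)[OF assms(1,2)] that by force
  have bdd: "bdd_below (crit_h q \<Delta> ` {1<..})" using pos by (intro bdd_belowI2[of _ 0]) auto
  show "I \<ge> 0" unfolding I_def by (rule cINF_greatest) (use pos in auto)
  show le: "I \<le> crit_h q \<Delta> y" if "y > 1" for y
    unfolding I_def using that bdd by (intro cINF_lower) auto
  define k where "k = \<Delta> - 2"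
  have k: "\<Delta> = k + 2" "k > 0" unfolding k_def using assms(1) by auto
  define g where "g = (\<lambda>y. (y ^ (\<Delta> - 1) + q - 1) / (y * (\<Sum>i<k. y ^ i)))"
  have h: "crit_h q \<Delta> y = g y" if "y > 1" for y
  proof -
    have "y ^ (\<Delta> - 1) - y = y * (y ^ k - 1)" using k by (simp add: algebra_simps)
    also have "\<dots> = (y - 1) * (y * (\<Sum>i<k. y ^ i))" by (simp only: power_diff_1_eq mult_ac)
    finally show ?thesis unfolding crit_h_def g_def using that by simp
  qed
  have "(g \<longlongrightarrow> (1 ^ (\<Delta> - 1) + q - 1) / (1 * (\<Sum>i<k. 1 ^ i))) (at_right 1)"
    unfolding g_def using k by (intro tendsto_intros) auto
  then have lim: "(g \<longlongrightarrow> q / real k) (at_right 1)" by simp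
  have "eventually (\<lambda>y. I \<le> g y) (at_right 1)"
    using le h by (auto simp: eventually_at_right_field intro!: exI[of _ 2])
  then have "I \<le> q / real k" by (intro tendsto_lowerbound[OF lim]) auto
  then show "I * (real \<Delta> - 2) \<le> q" using k by (simp add: field_simps)
qed

text \<open>The critical value is \<open>I / (1 + I)\<close>, so the hypothesis compares the odds
  \<open>p / (1 - p)\<close> with \<open>I\<close>. These odds are the parameter \<open>w\<close> of
  the tree recursion.\<close>

lemma below_p_crit:
  assumes "\<Delta> \<ge> 3" "q \<ge> 1" "0 \<le> p" "p < p_crit q \<Delta>"
  defines "I \<equiv> INF y\<in>{1<..}. crit_h q \<Delta> y"
  shows "p < 1" "p / (1 - p) < I"
proof -
  have I: "I \<ge> 0" unfolding I_def by (rule crit_inf[OF assms(1,2)])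
  have p: "p < 1 - 1 / (1 + I)" using assms(4) unfolding p_crit_def I_def .
  then show "p < 1" using I divide_nonneg_nonneg[of 1 "1 + I"] by linarith
  have "1 / (1 + I) < 1 - p" using p by simp
  then have "1 < (1 - p) * (1 + I)" using I by (simp add: field_simps)
  then have "p < (1 - p) * I" by (simp add: algebra_simps)
  then show "p / (1 - p) < I" using \<open>p < 1\<close> by (simp add: field_simps)
qed

theorem rc_excess_tail:
  assumes D: "\<Delta> \<ge> 3" and q: "q \<ge> 1" and p: "0 < p" "p < p_crit q \<Delta>"
  defines "x \<equiv> p / ((1 - p) * q)"
  shows "\<exists>A>0. ((\<lambda>n. measure_pmf.prob (random_regular_graph \<Delta> n) {E. E \<in> regular_graphs \<Delta> n \<and>
      (\<Sum>S\<in>Pow E. of_bool (real (excess {..<n} S) > A * ln (real n)) * cw {..<n} x q S)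
        \<le> 1 / real n * (\<Sum>S\<in>Pow E. cw {..<n} x q S)}) \<longlongrightarrow> 1) (inf at_top (principal {n. even (\<Delta> * n)}))"
proof -
  define I where "I = (INF y\<in>{1<..}. crit_h q \<Delta> y)"
  define d where "d = \<Delta> - 1"
  define w where "w = p / (1 - p)"
  have p1: "p < 1" and wI: "w < I"
    using below_p_crit[OF D q _ p(2)] p unfolding w_def I_def by auto
  have w0: "w > 0" unfolding w_def using p p1 by simp
  have xw: "x * q = w" unfolding x_def w_def using q by simp
  have x0: "x > 0" unfolding x_def using p p1 q by simp
  \<comment> \<open>The midpoint of 1 and \<open>I / w\<close>. So \<open>lam * w\<close> is still
    below \<open>I\<close>, and enlarging \<open>q\<close> only enlarges
    \<open>crit_h\<close>.\<close>
  define lam where "lam = (1 + I / w) / 2"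
  have lam: "lam > 1" "lam * w < I" unfolding lam_def using w0 wI by (simp_all add: field_simps)
  define q' where "q' = lam * q"
  have "1 * q \<le> lam * q" using lam q by (intro mult_right_mono) auto
  then have q': "q' \<ge> q" "q' \<ge> 1" unfolding q'_def using q by linarith+
  have w': "x * q' = lam * w" unfolding q'_def xw[symmetric] by simp
  have d: "d \<ge> 2" "real d = real \<Delta> - 1" "real d - 1 = real \<Delta> - 2" unfolding d_def using D by auto
  have Yfl: "Yf d (x * q') q' y < y" if y: "y > 1" for y
  proof -
    have yd: "y ^ d > y" unfolding d_def by (rule crit_h_pos(1)[OF D q y])
    have "lam * w < (y - 1) * (y ^ d + q - 1) / (y ^ d - y)"
      using lam(2) crit_inf(2)[OF D q y] unfolding I_def crit_h_def d_def by linarith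
    then have "lam * w * (y ^ d - y) < (y - 1) * (y ^ d + q - 1)" using yd by (simp add: field_simps)
    also have "\<dots> \<le> (y - 1) * (y ^ d + q' - 1)" using q' y by (intro mult_left_mono) auto
    finally have 1: "lam * w * (y ^ d - 1) < (y - 1) * (y ^ d + q' - 1 + lam * w)"
      by (simp add: algebra_simps)
    have "y ^ d + q' - 1 + lam * w > 0" using yd y q' lam w0 mult_pos_pos[of lam w] by linarith
    then have "lam * w * (y ^ d - 1) / (y ^ d + q' - 1 + lam * w) < y - 1"
      using 1 by (simp add: pos_divide_less_eq)
    then show ?thesis unfolding Yf_def w' by linarith
  qed
  have xd: "x * (real d - 1) < 1"
  proof -
    have "w * (real d - 1) < I * (real d - 1)" using wI d by (intro mult_strict_right_mono) auto
    also have "\<dots> \<le> q" unfolding d(3) using crit_inf(3)[OF D q] unfolding I_def .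
    finally have "(x * (real d - 1)) * q < 1 * q" unfolding xw[symmetric] by (simp add: mult_ac)
    then show ?thesis using q by (simp only: mult_less_cancel_right_pos)
  qed
  \<comment> \<open>Solves \<open>(x + \<epsilon> * (1 + x)) * (d - 1) = 1\<close>. Once
    \<open>Yit\<close> is below \<open>1 + \<epsilon>\<close>, the odds \<open>o'\<close> satisfy
    \<open>o' * (d - 1) < 1\<close>, which is equivalent to \<open>t * d < 1\<close>.\<close>
  define \<epsilon> where "\<epsilon> = (1 - x * (real d - 1)) / ((1 + x) * (real d - 1))"
  have e0: "\<epsilon> > 0" unfolding \<epsilon>_def using xd x0 d(1) by (intro divide_pos_pos mult_pos_pos) auto
  have "x * q' \<ge> 0" using x0 q' by simp
  then obtain R where R: "Yit d (x * q') q' R < 1 + \<epsilon>"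
    using Yit_tends_to_1[OF _ q'(2) Yfl e0] by blast
  define o' where "o' = x + (Yit d (x * q') q' R - 1) * (1 + x)"
  have Y1: "Yit d (x * q') q' R \<ge> 1" using \<open>x * q' \<ge> 0\<close> q' by (intro Yit_ge_1)
  have o0: "o' > 0" unfolding o'_def using x0 Y1 by (intro add_pos_nonneg mult_nonneg_nonneg) auto
  have od: "o' * (real d - 1) < 1"
  proof -
    have "(Yit d (x * q') q' R - 1) * ((1 + x) * (real d - 1)) < \<epsilon> * ((1 + x) * (real d - 1))"
      using R x0 d(1) by (intro mult_strict_right_mono mult_pos_pos) auto
    also have "\<dots> = 1 - x * (real d - 1)" unfolding \<epsilon>_def using x0 d(1) by simp
    finally show ?thesis unfolding o'_def by (simp add: algebra_simps)
  qed
  define t where "t = rc_graph.ptil x q' d R"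
  have t: "t = o' / (1 + o')"
  proof -
    \<comment> \<open>\<open>ptil\<close> depends on the parameters alone, so the empty graph serves
      to unfold it.\<close>
    interpret rc_graph "{} :: nat set" "{}" x q' d
      by unfold_locales (use x0 q' in auto)
    show ?thesis unfolding t_def ptil_def o'_def ..
  qed
  have t0: "t > 0" unfolding t using o0 by simp
  have td: "t * (real \<Delta> - 1) < 1"
    unfolding t using o0 od d(2) by (simp add: field_simps)
  define s where "s = real d * t"
  have "0 < s" unfolding s_def using t0 d(1) by simp
  moreover have "s < 1" unfolding s_def d(2) using td by (simp only: mult.commute)
  ultimately have s: "0 < s" "s < 1" by auto
  \<comment> \<open>Makes \<open>s powr (C * ln n)\<close> equal to \<open>n powr (- 2)\<close>: one
    factor \<open>n\<close> is spent on the starting points of the long paths, the other on the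
    constants.\<close>
  define C where "C = 2 / ln (1 / s)"
  have ls: "ln (1 / s) > 0" using s by (intro ln_gt_zero) (simp add: field_simps)
  have C0: "C > 0" unfolding C_def using ls by simp
  have D2: "\<Delta> \<ge> 2" using D by simp
  obtain m where m: "((\<lambda>n. measure_pmf.prob (random_regular_graph \<Delta> n)
      {E. E \<in> regular_graphs \<Delta> n \<and> good_graph C R m t n E}) \<longlongrightarrow> 1) (inf at_top (principal {n. even (\<Delta> * n)}))"
    using good_graphs_whp[OF D2 t0 td C0] by blast
  define K0 where "K0 = m * (2 * R + 2) * (\<Delta> + 1) ^ R"
  \<comment> \<open>\<open>M0 * ln n\<close> is four times the bound on the mean number of open
    cycles, as the quarter in \<open>excess_half\<close> demands.\<close>
  define M0 where "M0 = 4 / t ^ K0"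
  \<comment> \<open>The surplus \<open>2 / ln lam\<close> over \<open>M0\<close> makes
    \<open>lam powr ((M0 - A) * ln n)\<close> equal to \<open>n powr (- 2)\<close>; one factor
    \<open>1 / n\<close> then absorbs the constant 2.\<close>
  define A where "A = M0 + 2 / ln lam"
  have M0: "M0 > 0" unfolding M0_def using t0 by simp
  have ll: "ln lam > 0" using lam by simp
  have A0: "A > 0" unfolding A_def using M0 ll by (intro add_pos_pos) auto
  let ?P = "\<lambda>n E. (\<Sum>S\<in>Pow E. of_bool (real (excess {..<n} S) > A * ln (real n)) * cw {..<n} x q S)
        \<le> 1 / real n * (\<Sum>S\<in>Pow E. cw {..<n} x q S)"
  have main: "?P n E"
    if n: "n > 1" "8 / real n \<le> t ^ K0" and E: "E \<in> regular_graphs \<Delta> n" "good_graph C R m t n E" for n E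
  proof -
    have ln: "ln (real n) > 0" using n by simp
    have Esub: "E \<subseteq> sedges {..<n}" using E by (simp add: regular_graphs_iff)
    have finE: "finite E" using finite_edges[OF _ Esub] by simp
    have long: "8 * real n * (real (\<Delta> - 1) * t) ^ (maxlen C n - 1) \<le> t ^ K0"
    proof -
      have "C * ln (real n) \<le> real (maxlen C n - 1)"
        unfolding maxlen_def by (simp add: of_nat_ceiling)
      then have "s powr real (maxlen C n - 1) \<le> s powr (C * ln (real n))"
        using s by (intro powr_mono') auto
      also have "\<dots> = exp (- 2 * ln (real n))"
        unfolding powr_def C_def using s ls by (simp add: ln_div field_simps)
      also have "\<dots> = real n powr (- 2)" using n by (simp add: powr_def)
      also have "\<dots> = 1 / real n ^ 2" using n by (simp add: powr_minus divide_inverse)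
      finally have "s ^ (maxlen C n - 1) \<le> 1 / real n ^ 2" using s by (simp add: powr_realpow)
      then have "8 * real n * s ^ (maxlen C n - 1) \<le> 8 * real n * (1 / real n ^ 2)"
        by (intro mult_left_mono) auto
      also have "\<dots> = 8 / real n" using n by (simp add: power2_eq_square)
      finally show ?thesis using n(2) unfolding s_def d_def by linarith
    qed
    have tdef: "t = rc_graph.ptil x q' (\<Delta> - 1) R" unfolding t_def d_def ..
    have "(\<Sum>S\<in>Pow E. of_bool (real (excess {..<n} S) > M0 * ln (real n)) * cw {..<n} x q' S)
        \<le> (\<Sum>S\<in>Pow E. cw {..<n} x q' S) / 2"
    proof (rule excess_half[OF E(1) D2 _ q'(2) _ tdef K0_def E(2) t0 _ _ long])
      show "4 * ln (real n) \<le> t ^ K0 * (M0 * ln (real n))" unfolding M0_def using t0 by simp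
      show "M0 * ln (real n) > 0" using M0 ln by simp
    qed (use x0 n in auto)
    from excess_tail_transfer[OF finE _ q lam(1) _ _ this[unfolded q'_def], of "A * ln (real n)"]
    have 1: "(\<Sum>S\<in>Pow E. of_bool (real (excess {..<n} S) > A * ln (real n)) * cw {..<n} x q S)
      \<le> 2 * lam powr (M0 * ln (real n) - A * ln (real n)) * (\<Sum>S\<in>Pow E. cw {..<n} x q S)"
      using x0 M0 A0 ln by simp
    have "M0 * ln (real n) - A * ln (real n) = - (2 / ln lam) * ln (real n)"
      unfolding A_def by (simp add: algebra_simps)
    then have "lam powr (M0 * ln (real n) - A * ln (real n)) = exp (- 2 * ln (real n))"
      unfolding powr_def using lam ll by simp
    also have "\<dots> = real n powr (- 2)" using n by (simp add: powr_def)
    also have "\<dots> = 1 / real n ^ 2" using n by (simp add: powr_minus divide_inverse)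
    finally have "2 * lam powr (M0 * ln (real n) - A * ln (real n)) = 2 / real n * (1 / real n)"
      by (simp add: power2_eq_square)
    also have "\<dots> \<le> 1 * (1 / real n)" using n by (intro mult_right_mono) auto
    finally have "2 * lam powr (M0 * ln (real n) - A * ln (real n)) * (\<Sum>S\<in>Pow E. cw {..<n} x q S)
        \<le> 1 / real n * (\<Sum>S\<in>Pow E. cw {..<n} x q S)"
      using x0 q by (intro mult_right_mono sum_nonneg cw_nonneg) auto
    with 1 show ?thesis by linarith
  qed
  have "eventually (\<lambda>n. 8 / real n \<le> t ^ K0) at_top"
  proof -
    have "((\<lambda>n. 8 / real n) \<longlongrightarrow> 0) at_top" by real_asymp
    moreover have "0 < t ^ K0" using t0 by simp
    ultimately have "eventually (\<lambda>n. 8 / real n < t ^ K0) at_top" by (rule order_tendstoD(2))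
    then show ?thesis by eventually_elim simp
  qed
  then have ev: "eventually (\<lambda>n. measure_pmf.prob (random_regular_graph \<Delta> n)
      {E. E \<in> regular_graphs \<Delta> n \<and> good_graph C R m t n E} \<le>
      measure_pmf.prob (random_regular_graph \<Delta> n) {E. E \<in> regular_graphs \<Delta> n \<and> ?P n E})
      (inf at_top (principal {n. even (\<Delta> * n)}))"
    unfolding eventually_inf_principal using eventually_gt_at_top[of 1]
  proof eventually_elim
    case (elim n)
    have "{E. E \<in> regular_graphs \<Delta> n \<and> good_graph C R m t n E} \<subseteq> {E. E \<in> regular_graphs \<Delta> n \<and> ?P n E}"
      using main[OF elim(2,1)] by blast
    then show ?case by (intro impI measure_pmf.finite_measure_mono) (assumption, simp)
  qed
  show ?thesis
  proof (intro exI[of _ A] conjI A0)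
    show "((\<lambda>n. measure_pmf.prob (random_regular_graph \<Delta> n) {E. E \<in> regular_graphs \<Delta> n \<and> ?P n E}) \<longlongrightarrow> 1)
      (inf at_top (principal {n. even (\<Delta> * n)}))"
      by (rule tendsto_sandwich[OF ev _ m tendsto_const]) (auto intro!: always_eventually)
  qed
qed

section \<open>A program logic with running times\<close>

text \<open>\<open>run\<close> from an arbitrary configuration, so that a command can be analysed
  with any stack of commands below it.\<close>

definition steps :: "real list \<Rightarrow> nat \<Rightarrow> config \<Rightarrow> config pmf" where
  "steps \<theta> t cf = ((\<lambda>\<mu>. bind_pmf \<mu> (step \<theta>)) ^^ t) (return_pmf cf)"

lemma steps_0 [simp]: "steps \<theta> 0 cf = return_pmf cf"
  by (simp add: steps_def)

lemma steps_Suc_right: "steps \<theta> (Suc t) cf = bind_pmf (steps \<theta> t cf) (step \<theta>)"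
  by (simp add: steps_def)

lemma steps_Suc: "steps \<theta> (Suc t) cf = bind_pmf (step \<theta> cf) (steps \<theta> t)"
proof (induction t)
  case 0
  have "steps \<theta> 0 = return_pmf" by (auto simp: fun_eq_iff)
  then show ?case by (simp add: steps_Suc_right bind_return_pmf bind_return_pmf')
next
  case (Suc t)
  have "steps \<theta> (Suc (Suc t)) cf = bind_pmf (bind_pmf (step \<theta> cf) (steps \<theta> t)) (step \<theta>)"
    by (subst steps_Suc_right) (simp only: Suc)
  also have "\<dots> = bind_pmf (step \<theta> cf) (\<lambda>c. bind_pmf (steps \<theta> t c) (step \<theta>))"
    by (rule bind_assoc_pmf)
  finally show ?case by (simp add: steps_Suc_right)
qed

lemma steps_halted: "steps \<theta> t ([], s) = return_pmf ([], s)"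
  by (induction t) (simp_all add: steps_Suc bind_return_pmf)

text \<open>\<open>spec \<theta> c s t D R\<close>: started in \<open>s\<close>, the command \<open>c\<close> terminates within \<open>t\<close> steps, and its final state
  can be coupled with a random variable of law \<open>D\<close> such that the two are always related by \<open>R\<close>.\<close>

definition spec :: "real list \<Rightarrow> com \<Rightarrow> state \<Rightarrow> nat \<Rightarrow> 'a pmf \<Rightarrow> ('a \<Rightarrow> state \<Rightarrow> bool) \<Rightarrow> bool" where
  "spec \<theta> c s t D R \<longleftrightarrow> (\<exists>M :: (nat \<times> 'a \<times> state) pmf. map_pmf (\<lambda>(k, a, s'). a) M = D \<and>
     (\<forall>(k, a, s') \<in> set_pmf M. k \<le> t \<and> R a s') \<and>
     (\<forall>cs T. t \<le> T \<longrightarrow> steps \<theta> T (c # cs, s) = bind_pmf M (\<lambda>(k, a, s'). steps \<theta> (T - k) (cs, s'))))"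

abbreviation dspec :: "real list \<Rightarrow> com \<Rightarrow> state \<Rightarrow> nat \<Rightarrow> (state \<Rightarrow> bool) \<Rightarrow> bool" where
  "dspec \<theta> c s t P \<equiv> spec \<theta> c s t (return_pmf ()) (\<lambda>_. P)"

lemma spec_mono:
  assumes "spec \<theta> c s t D R" "t \<le> t'" "\<And>a s'. a \<in> set_pmf D \<Longrightarrow> R a s' \<Longrightarrow> R' a s'"
  shows "spec \<theta> c s t' D R'"
proof -
  obtain M where M: "map_pmf (\<lambda>(k, a, s'). a) M = D" "\<forall>(k, a, s') \<in> set_pmf M. k \<le> t \<and> R a s'"
    "\<forall>cs T. t \<le> T \<longrightarrow> steps \<theta> T (c # cs, s) = bind_pmf M (\<lambda>(k, a, s'). steps \<theta> (T - k) (cs, s'))"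
    using assms(1) unfolding spec_def by blast
  have "a \<in> set_pmf D" if "(k, a, s') \<in> set_pmf M" for k a s'
    unfolding M(1)[symmetric] using that by force
  then show ?thesis unfolding spec_def using M assms(2,3) by (intro exI[of _ M]) fastforce
qed

lemma spec_step:
  assumes step: "\<And>cs. step \<theta> (c # cs, s) = map_pmf (\<lambda>a. (cs, f a)) D"
    and R: "\<And>a. a \<in> set_pmf D \<Longrightarrow> R a (f a)"
  shows "spec \<theta> c s 1 D R"
  unfolding spec_def
proof (intro exI[of _ "map_pmf (\<lambda>a. (1 :: nat, a, f a)) D"] conjI allI impI)
  show "map_pmf (\<lambda>(k, a, s'). a) (map_pmf (\<lambda>a. (1 :: nat, a, f a)) D) = D"
    by (simp add: map_pmf_comp)
  show "\<forall>(k, a, s')\<in>set_pmf (map_pmf (\<lambda>a. (1 :: nat, a, f a)) D). k \<le> 1 \<and> R a s'"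
    using R by auto
  fix cs and T :: nat assume "1 \<le> T"
  then obtain T' where "T = Suc T'" by (cases T) auto
  then show "steps \<theta> T (c # cs, s) =
      bind_pmf (map_pmf (\<lambda>a. (1 :: nat, a, f a)) D) (\<lambda>(k, a, s'). steps \<theta> (T - k) (cs, s'))"
    by (simp add: steps_Suc step bind_map_pmf)
qed

lemma spec_prefix:
  assumes step: "\<And>cs. step \<theta> (c # cs, s) = return_pmf (d # cs, s)" and d: "spec \<theta> d s t D R"
  shows "spec \<theta> c s (Suc t) D R"
proof -
  obtain M where M: "map_pmf (\<lambda>(k, a, s'). a) M = D" "\<forall>(k, a, s') \<in> set_pmf M. k \<le> t \<and> R a s'"
    "\<forall>cs T. t \<le> T \<longrightarrow> steps \<theta> T (d # cs, s) = bind_pmf M (\<lambda>(k, a, s'). steps \<theta> (T - k) (cs, s'))"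
    using d unfolding spec_def by blast
  show ?thesis
    unfolding spec_def
  proof (intro exI[of _ "map_pmf (\<lambda>(k, a, s'). (Suc k, a, s')) M"] conjI allI impI)
    show "map_pmf (\<lambda>(k, a, s'). a) (map_pmf (\<lambda>(k, a, s'). (Suc k, a, s')) M) = D"
      unfolding M(1)[symmetric] by (simp add: map_pmf_comp case_prod_unfold)
    show "\<forall>(k, a, s')\<in>set_pmf (map_pmf (\<lambda>(k, a, s'). (Suc k, a, s')) M). k \<le> Suc t \<and> R a s'"
      using M(2) by fastforce
    fix cs and T :: nat assume "Suc t \<le> T"
    then obtain T' where T: "T = Suc T'" "t \<le> T'" by (cases T) auto
    then show "steps \<theta> T (c # cs, s) =
        bind_pmf (map_pmf (\<lambda>(k, a, s'). (Suc k, a, s')) M) (\<lambda>(k, a, s'). steps \<theta> (T - k) (cs, s'))"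
      using M(3) by (simp add: steps_Suc step bind_return_pmf bind_map_pmf case_prod_unfold)
  qed
qed

text \<open>The common core of \<open>Seq\<close> and of a round of \<open>While\<close>: one step
  pushes \<open>c\<close> and \<open>d\<close> on the stack. A coupling for \<open>d\<close> is
  chosen for every outcome of \<open>c\<close> separately. The number \<open>k\<close> of steps is
  part of the coupling because different outcomes may take different times.\<close>

lemma spec_compose:
  assumes step: "\<And>cs. step \<theta> (e # cs, s) = return_pmf (c # d # cs, s)"
    and c: "spec \<theta> c s t D R"
    and d: "\<And>a s'. a \<in> set_pmf D \<Longrightarrow> R a s' \<Longrightarrow> spec \<theta> d s' t' (F a) R'"
  shows "spec \<theta> e s (Suc (t + t')) (bind_pmf D F) R'"
proof -
  obtain M where M: "map_pmf (\<lambda>(k, a, s'). a) M = D" "\<forall>(k, a, s') \<in> set_pmf M. k \<le> t \<and> R a s'"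
    "\<forall>cs T. t \<le> T \<longrightarrow> steps \<theta> T (c # cs, s) = bind_pmf M (\<lambda>(k, a, s'). steps \<theta> (T - k) (cs, s'))"
    using c unfolding spec_def by blast
  have aD: "a \<in> set_pmf D" if "(k, a, s') \<in> set_pmf M" for k a s'
    unfolding M(1)[symmetric] using that by force
  define G where "G = (\<lambda>a s' M'. map_pmf (\<lambda>(k, b, s''). b) M' = F a \<and>
     (\<forall>(k, b, s'') \<in> set_pmf M'. k \<le> t' \<and> R' b s'') \<and>
     (\<forall>cs T. t' \<le> T \<longrightarrow> steps \<theta> T (d # cs, s') = bind_pmf M' (\<lambda>(k, b, s''). steps \<theta> (T - k) (cs, s''))))"
  have ex: "\<exists>M'. G a s' M'" if "(k, a, s') \<in> set_pmf M" for k a s'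
    using d[OF aD[OF that], of s'] M(2) that unfolding spec_def G_def by auto
  define H where "H = (\<lambda>a s'. SOME M'. G a s' M')"
  have H: "G a s' (H a s')" if "(k, a, s') \<in> set_pmf M" for k a s'
    unfolding H_def by (rule someI_ex[OF ex[OF that]])
  define N0 where "N0 = bind_pmf M (\<lambda>(k, a, s'). map_pmf (\<lambda>(k', b, s''). (Suc (k + k'), b, s'')) (H a s'))"
  show ?thesis
    unfolding spec_def
  proof (intro exI[of _ N0] conjI allI impI)
    have "map_pmf (\<lambda>(k, a, s'). a) N0 = bind_pmf M (\<lambda>(k, a, s'). map_pmf (\<lambda>(k, b, s''). b) (H a s'))"
      unfolding N0_def map_bind_pmf by (intro bind_pmf_cong refl) (auto simp: map_pmf_comp case_prod_unfold)
    also have "\<dots> = bind_pmf M (\<lambda>(k, a, s'). F a)"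
      using H unfolding G_def by (intro bind_pmf_cong refl) auto
    also have "\<dots> = bind_pmf D F" unfolding M(1)[symmetric] bind_map_pmf by (simp add: case_prod_unfold)
    finally show "map_pmf (\<lambda>(k, a, s'). a) N0 = bind_pmf D F" .
    show "\<forall>(k, b, s'')\<in>set_pmf N0. k \<le> Suc (t + t') \<and> R' b s''"
    proof safe
      fix k b s'' assume "(k, b, s'') \<in> set_pmf N0"
      then obtain k1 a s' k2 where 1: "(k1, a, s') \<in> set_pmf M" "(k2, b, s'') \<in> set_pmf (H a s')" "k = Suc (k1 + k2)"
        unfolding N0_def by auto
      show "k \<le> Suc (t + t')" "R' b s''"
        using 1 M(2) H[OF 1(1)] unfolding G_def by fastforce+
    qed
    fix cs and T :: nat assume "Suc (t + t') \<le> T"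
    then obtain T' where T: "T = Suc T'" "t + t' \<le> T'" by (cases T) auto
    have "steps \<theta> T (e # cs, s) = steps \<theta> T' (c # d # cs, s)"
      unfolding T by (simp add: steps_Suc step bind_return_pmf)
    also have "\<dots> = bind_pmf M (\<lambda>(k, a, s'). steps \<theta> (T' - k) (d # cs, s'))"
      using M(3) T by auto
    also have "\<dots> = bind_pmf M (\<lambda>(k, a, s'). bind_pmf (H a s') (\<lambda>(k', b, s''). steps \<theta> (T' - k - k') (cs, s'')))"
    proof (intro bind_pmf_cong refl)
      fix z assume z: "z \<in> set_pmf M"
      obtain k a s' where kas: "z = (k, a, s')" by (metis prod.exhaust)
      have "t' \<le> T' - k" using M(2) z kas T by auto
      then show "(case z of (k, a, s') \<Rightarrow> steps \<theta> (T' - k) (d # cs, s')) =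
        (case z of (k, a, s') \<Rightarrow> bind_pmf (H a s') (\<lambda>(k', b, s''). steps \<theta> (T' - k - k') (cs, s'')))"
        using H[of k a s'] z kas unfolding G_def by simp
    qed
    also have "\<dots> = bind_pmf N0 (\<lambda>(k, b, s''). steps \<theta> (T - k) (cs, s''))"
      unfolding N0_def T bind_assoc_pmf
      by (intro bind_pmf_cong refl) (auto simp: bind_map_pmf case_prod_unfold diff_diff_eq)
    finally show "steps \<theta> T (e # cs, s) = bind_pmf N0 (\<lambda>(k, b, s''). steps \<theta> (T - k) (cs, s''))" .
  qed
qed

lemma det_Skip: "P s \<Longrightarrow> dspec \<theta> Skip s 1 P"
  by (rule spec_step[where f = "\<lambda>_. s"]) auto

lemma det_Assign: "P (set_var x (aval e s) s) \<Longrightarrow> dspec \<theta> (Assign x e) s 1 P"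
  by (rule spec_step[where f = "\<lambda>_. set_var x (aval e s) s"]) auto

lemma det_Put:
  "P (s\<lparr>arr := (arr s)(a := (arr s a)(aval e s := aval f s))\<rparr>) \<Longrightarrow> dspec \<theta> (Put a e f) s 1 P"
  by (rule spec_step[where f = "\<lambda>_. s\<lparr>arr := (arr s)(a := (arr s a)(aval e s := aval f s))\<rparr>"]) auto

lemma spec_Flip:
  "(\<And>b. b \<in> {0, 1} \<Longrightarrow> R b (set_var x b s)) \<Longrightarrow> spec \<theta> (Flip x) s 1 (pmf_of_set {0, 1}) R"
  by (rule spec_step[where f = "\<lambda>b. set_var x b s"]) auto

lemma det_Digit:
  "j < length \<theta> \<Longrightarrow>
   P ((set_var x (digit (\<theta> ! j) (tape_pos s j)) s)\<lparr>tape_pos := (tape_pos s)(j := tape_pos s j + 1)\<rparr>) \<Longrightarrow>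
   dspec \<theta> (Digit x j) s 1 P"
  by (rule spec_step[where f = "\<lambda>_. (set_var x (digit (\<theta> ! j) (tape_pos s j)) s)\<lparr>tape_pos := (tape_pos s)(j := tape_pos s j + 1)\<rparr>"])
     auto

lemma det_Print: "P (s\<lparr>printed := printed s @ [aval e s]\<rparr>) \<Longrightarrow> dspec \<theta> (Print e) s 1 P"
  by (rule spec_step[where f = "\<lambda>_. s\<lparr>printed := printed s @ [aval e s]\<rparr>"]) auto

lemma spec_Seq:
  assumes "spec \<theta> c s t D R" "\<And>a s'. a \<in> set_pmf D \<Longrightarrow> R a s' \<Longrightarrow> spec \<theta> d s' t' (F a) R'"
  shows "spec \<theta> (Seq c d) s (Suc (t + t')) (bind_pmf D F) R'"
  by (rule spec_compose[OF _ assms]) simp_all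

lemma spec_Seq_det:
  assumes "dspec \<theta> c s t P" "\<And>s'. P s' \<Longrightarrow> spec \<theta> d s' t' D R"
  shows "spec \<theta> (Seq c d) s (Suc (t + t')) D R"
  using spec_Seq[OF assms(1), of d t' "\<lambda>_. D" R] assms(2) by (simp add: bind_return_pmf)

text \<open>For a second command without randomness of interest: the random variable of the first is
  kept, and the final relation may depend on its value.\<close>

lemma spec_Seq_return:
  assumes "spec \<theta> c s t D R" "\<And>a s'. a \<in> set_pmf D \<Longrightarrow> R a s' \<Longrightarrow> dspec \<theta> d s' t' (R' a)"
  shows "spec \<theta> (Seq c d) s (Suc (t + t')) D R'"
proof -
  have "spec \<theta> d s' t' (return_pmf a) R'" if a: "a \<in> set_pmf D" "R a s'" for a s'
  proof -
    obtain M :: "(nat \<times> unit \<times> state) pmf" where M: "\<forall>(k, u, s'') \<in> set_pmf M. k \<le> t' \<and> R' a s''"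
      "\<forall>cs T. t' \<le> T \<longrightarrow> steps \<theta> T (d # cs, s') = bind_pmf M (\<lambda>(k, u, s''). steps \<theta> (T - k) (cs, s''))"
      using assms(2)[OF a] unfolding spec_def by blast
    show ?thesis unfolding spec_def
    proof (intro exI[of _ "map_pmf (\<lambda>(k, u, s''). (k, a, s'')) M"] conjI allI impI)
      show "map_pmf (\<lambda>(k, a, s'). a) (map_pmf (\<lambda>(k, u, s''). (k, a, s'')) M) = return_pmf a"
        by (simp add: map_pmf_comp case_prod_unfold map_pmf_const)
    qed (use M in \<open>auto simp: bind_map_pmf case_prod_unfold\<close>)
  qed
  then have "spec \<theta> (Seq c d) s (Suc (t + t')) (bind_pmf D return_pmf) R'"
    by (rule spec_Seq[OF assms(1)])
  then show ?thesis by (simp add: bind_return_pmf')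
qed

lemma spec_If:
  assumes "spec \<theta> (if aval e s \<noteq> 0 then c else d) s t D R"
  shows "spec \<theta> (If e c d) s (Suc t) D R"
  by (rule spec_prefix[OF _ assms]) simp

lemma det_While_0: "aval e s = 0 \<Longrightarrow> P s \<Longrightarrow> dspec \<theta> (While e c) s 1 P"
  by (rule spec_step[where f = "\<lambda>_. s"]) auto

lemma spec_While_0: "aval e s = 0 \<Longrightarrow> R a s \<Longrightarrow> spec \<theta> (While e c) s 1 (return_pmf a) R"
  by (rule spec_step[where f = "\<lambda>_. s"]) auto

lemma spec_While_Suc:
  assumes "aval e s \<noteq> 0" "spec \<theta> c s t D R"
    "\<And>a s'. a \<in> set_pmf D \<Longrightarrow> R a s' \<Longrightarrow> spec \<theta> (While e c) s' t' (F a) R'"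
  shows "spec \<theta> (While e c) s (Suc (t + t')) (bind_pmf D F) R'"
  by (rule spec_compose[OF _ assms(2,3)]) (use assms(1) in simp_all)

text \<open>The counter is decremented before the body, which therefore sees the values from
  \<open>e - 1\<close> down to 0. In the rules, \<open>I k\<close> holds when \<open>k\<close>
  rounds remain; \<open>iter\<close> follows the same descending order.\<close>

definition For :: "nat \<Rightarrow> aexp \<Rightarrow> com \<Rightarrow> com" where
  "For x e c = Seq (Assign x e) (While (V x) (Seq (Assign x (Minus (V x) (N 1))) c))"

fun iter :: "(nat \<Rightarrow> 'a \<Rightarrow> 'a pmf) \<Rightarrow> nat \<Rightarrow> 'a \<Rightarrow> 'a pmf" where
  "iter F 0 a = return_pmf a"
| "iter F (Suc k) a = bind_pmf (F k a) (iter F k)"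

lemma spec_For_loop:
  assumes body: "\<And>k a s. k < m \<Longrightarrow> I (Suc k) a s \<Longrightarrow> var s x = k \<Longrightarrow>
      spec \<theta> c s tb (F k a) (\<lambda>a' s'. I k a' s' \<and> var s' x = k)"
    and stab: "\<And>k a s v. I k a s \<Longrightarrow> I k a (set_var x v s)"
  shows "k \<le> m \<Longrightarrow> I k a s \<Longrightarrow> var s x = k \<Longrightarrow>
    spec \<theta> (While (V x) (Seq (Assign x (Minus (V x) (N 1))) c)) s (1 + k * (tb + 3)) (iter F k a)
      (\<lambda>a' s'. I 0 a' s')"
proof (induction k arbitrary: a s)
  case 0
  then show ?case by (auto intro!: spec_While_0[unfolded One_nat_def])
next
  case (Suc k)
  have "spec \<theta> (Seq (Assign x (Minus (V x) (N 1))) c) s (Suc (1 + tb)) (F k a) (\<lambda>a' s'. I k a' s' \<and> var s' x = k)"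
  proof (rule spec_Seq_det[OF det_Assign[where P = "\<lambda>s'. s' = set_var x k s"]])
    show "set_var x (aval (Minus (V x) (N 1)) s) s = set_var x k s" using Suc.prems by simp
    show "spec \<theta> c s' tb (F k a) (\<lambda>a' s'. I k a' s' \<and> var s' x = k)" if "s' = set_var x k s" for s'
      unfolding that using Suc.prems by (intro body stab) (auto simp: set_var_def)
  qed
  then have "spec \<theta> (While (V x) (Seq (Assign x (Minus (V x) (N 1))) c)) s
      (Suc (Suc (1 + tb) + (1 + k * (tb + 3)))) (bind_pmf (F k a) (iter F k)) (\<lambda>a' s'. I 0 a' s')"
    by (rule spec_While_Suc[rotated]) (use Suc in auto)
  then show ?case unfolding iter.simps by (rule spec_mono) auto
qed

lemma spec_For:
  assumes body: "\<And>k a s. k < aval e s0 \<Longrightarrow> I (Suc k) a s \<Longrightarrow> var s x = k \<Longrightarrow>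
      spec \<theta> c s tb (F k a) (\<lambda>a' s'. I k a' s' \<and> var s' x = k)"
    and stab: "\<And>k a s v. I k a s \<Longrightarrow> I k a (set_var x v s)"
    and init: "I (aval e s0) a s0"
  shows "spec \<theta> (For x e c) s0 (3 + aval e s0 * (tb + 3)) (iter F (aval e s0) a) (\<lambda>a' s'. I 0 a' s')"
proof -
  have "spec \<theta> (For x e c) s0 (Suc (1 + (1 + aval e s0 * (tb + 3)))) (iter F (aval e s0) a) (\<lambda>a' s'. I 0 a' s')"
    unfolding For_def
  proof (rule spec_Seq_det[OF det_Assign[where P = "\<lambda>s'. s' = set_var x (aval e s0) s0"]])
    show "spec \<theta> (While (V x) (Seq (Assign x (Minus (V x) (N 1))) c)) s' (1 + aval e s0 * (tb + 3))
        (iter F (aval e s0) a) (\<lambda>a' s'. I 0 a' s')" if "s' = set_var x (aval e s0) s0" for s'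
      unfolding that using init
      by (intro spec_For_loop[OF body stab, where m = "aval e s0"] stab) (auto simp: set_var_def)
  qed simp
  then show ?thesis by (rule spec_mono) auto
qed

lemma iter_return: "iter (\<lambda>k. return_pmf) k a = return_pmf a"
  by (induction k) (auto simp: bind_return_pmf)

lemma det_For:
  assumes body: "\<And>k s. k < aval e s0 \<Longrightarrow> I (Suc k) s \<Longrightarrow> var s x = k \<Longrightarrow>
      dspec \<theta> c s tb (\<lambda>s'. I k s' \<and> var s' x = k)"
    and stab: "\<And>k s v. I k s \<Longrightarrow> I k (set_var x v s)"
    and init: "I (aval e s0) s0"
  shows "dspec \<theta> (For x e c) s0 (3 + aval e s0 * (tb + 3)) (I 0)"
  using spec_For[of e s0 "\<lambda>k _. I k" x \<theta> c tb "\<lambda>k. return_pmf" "()"] assms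
  by (simp add: iter_return)

text \<open>The output is defined at the least time within which the program halts; by
  \<open>run_halted\<close> the run up to the bound \<open>t\<close> is the same.\<close>

lemma spec_program:
  assumes "spec \<theta> c (init_state w) t D R"
  shows "halts_within \<theta> c w t"
    and "(\<And>a s'. R a s' \<Longrightarrow> g (printed s') = f a) \<Longrightarrow> map_pmf g (output_pmf \<theta> c w) = map_pmf f D"
proof -
  obtain M where M: "map_pmf (\<lambda>(k, a, s'). a) M = D" "\<forall>(k, a, s') \<in> set_pmf M. k \<le> t \<and> R a s'"
    "\<forall>cs T. t \<le> T \<longrightarrow> steps \<theta> T (c # cs, init_state w) = bind_pmf M (\<lambda>(k, a, s'). steps \<theta> (T - k) (cs, s'))"
    using assms unfolding spec_def by blast
  have run: "run \<theta> c w t = map_pmf (\<lambda>(k, a, s'). ([], s')) M"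
  proof -
    have "run \<theta> c w t = steps \<theta> t ([c], init_state w)" by (simp add: run_def steps_def)
    also have "\<dots> = bind_pmf M (\<lambda>(k, a, s'). steps \<theta> (t - k) ([], s'))" using M(3) by simp
    finally show ?thesis by (simp add: steps_halted map_pmf_def case_prod_unfold)
  qed
  show h: "halts_within \<theta> c w t" unfolding halts_within_def run by auto
  assume Rg: "\<And>a s'. R a s' \<Longrightarrow> g (printed s') = f a"
  let ?l = "LEAST t. halts_within \<theta> c w t"
  have "halts_within \<theta> c w ?l" using h by (rule LeastI)
  moreover have "?l \<le> t" using h by (rule Least_le)
  ultimately have "run \<theta> c w ?l = run \<theta> c w t" using run_halted by metis
  then have "map_pmf g (output_pmf \<theta> c w) = map_pmf (\<lambda>(k, a, s'). g (printed s')) M"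
    unfolding output_pmf_def by (simp add: run map_pmf_comp case_prod_unfold)
  also have "\<dots> = map_pmf (\<lambda>(k, a, s'). f a) M"
    using M(2) Rg by (intro map_pmf_cong refl) auto
  also have "\<dots> = map_pmf f D" unfolding M(1)[symmetric] by (simp add: map_pmf_comp case_prod_unfold)
  finally show "map_pmf g (output_pmf \<theta> c w) = map_pmf f D" .
qed

section \<open>The sampling program\<close>

lemma spec_map:
  assumes "spec \<theta> c s t D R" "\<And>a s'. a \<in> set_pmf D \<Longrightarrow> R a s' \<Longrightarrow> R' (f a) s'"
  shows "spec \<theta> c s t (map_pmf f D) R'"
proof -
  obtain M where M: "map_pmf (\<lambda>(k, a, s'). a) M = D" "\<forall>(k, a, s') \<in> set_pmf M. k \<le> t \<and> R a s'"
    "\<forall>cs T. t \<le> T \<longrightarrow> steps \<theta> T (c # cs, s) = bind_pmf M (\<lambda>(k, a, s'). steps \<theta> (T - k) (cs, s'))"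
    using assms(1) unfolding spec_def by blast
  have aD: "a \<in> set_pmf D" if "(k, a, s') \<in> set_pmf M" for k a s'
    unfolding M(1)[symmetric] using that by force
  show ?thesis
    unfolding spec_def
  proof (intro exI[of _ "map_pmf (\<lambda>(k, a, s'). (k, f a, s')) M"] conjI)
    show "map_pmf (\<lambda>(k, a, s'). a) (map_pmf (\<lambda>(k, a, s'). (k, f a, s')) M) = map_pmf f D"
      unfolding M(1)[symmetric] by (simp add: map_pmf_comp case_prod_unfold)
    show "\<forall>(k, a, s')\<in>set_pmf (map_pmf (\<lambda>(k, a, s'). (k, f a, s')) M). k \<le> t \<and> R' a s'"
      using M(2) assms(2) aD by fastforce
  qed (use M(3) in \<open>simp add: bind_map_pmf case_prod_unfold\<close>)
qed

lemma spec_return: "dspec \<theta> c s t P \<Longrightarrow> (\<And>s'. P s' \<Longrightarrow> R a s') \<Longrightarrow> spec \<theta> c s t (return_pmf a) R"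
  using spec_map[of \<theta> c s t "return_pmf ()" "\<lambda>_. P" R "\<lambda>_. a"] by simp

lemma spec_Assign_Seq:
  "spec \<theta> d (set_var x (aval e s) s) t D R \<Longrightarrow> spec \<theta> (Seq (Assign x e) d) s (Suc (Suc t)) D R"
  using spec_Seq_det[OF det_Assign[of "\<lambda>s'. s' = set_var x (aval e s) s"]] by fastforce

lemma spec_Put_Seq:
  "spec \<theta> d (s\<lparr>arr := (arr s)(a := (arr s a)(aval e s := aval f s))\<rparr>) t D R \<Longrightarrow>
   spec \<theta> (Seq (Put a e f) d) s (Suc (Suc t)) D R"
  using spec_Seq_det[OF det_Put[of "\<lambda>s'. s' = s\<lparr>arr := (arr s)(a := (arr s a)(aval e s := aval f s))\<rparr>"]]
  by fastforce

lemma set_var_simps [simp]: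
  "var (set_var x k s) y = (if y = x then k else var s y)" "arr (set_var x k s) = arr s"
  "tape_pos (set_var x k s) = tape_pos s" "printed (set_var x k s) = printed s"
  by (simp_all add: set_var_def)

text \<open>A frame condition: nothing changes but the variables \<open>Xs\<close> and the arrays
  \<open>As\<close>. It also fixes the tapes, so \<open>dspec_read\<close>, which moves one of them,
  lists its frame explicitly.\<close>

definition agr :: "nat set \<Rightarrow> nat set \<Rightarrow> state \<Rightarrow> state \<Rightarrow> bool" where
  "agr Xs As s s' \<longleftrightarrow> (\<forall>x. x \<notin> Xs \<longrightarrow> var s' x = var s x) \<and> (\<forall>a. a \<notin> As \<longrightarrow> arr s' a = arr s a) \<and>
     tape_pos s' = tape_pos s \<and> printed s' = printed s"

lemma agr_refl [simp]: "agr Xs As s s"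
  by (simp add: agr_def)

lemma agr_set_var [simp]: "x \<in> Xs \<Longrightarrow> agr Xs As s (set_var x k s') \<longleftrightarrow> agr Xs As s s'"
  "x \<in> Xs \<Longrightarrow> agr Xs As (set_var x k s) s' \<longleftrightarrow> agr Xs As s s'"
  by (auto simp: agr_def)

lemma agr_arr [simp]: "a \<in> As \<Longrightarrow> agr Xs As s (s'\<lparr>arr := (arr s')(a := f)\<rparr>) \<longleftrightarrow> agr Xs As s s'"
  by (auto simp: agr_def)

lemma agr_trans: "agr Xs As s s' \<Longrightarrow> agr Ys Bs s' s'' \<Longrightarrow> Xs \<union> Ys \<subseteq> Zs \<Longrightarrow> As \<union> Bs \<subseteq> Cs \<Longrightarrow> agr Zs Cs s s''"
  unfolding agr_def by (metis UnI1 UnI2 subsetD)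

lemma agr_var: "agr Xs As s s' \<Longrightarrow> x \<notin> Xs \<Longrightarrow> var s' x = var s x"
  and agr_arrD: "agr Xs As s s' \<Longrightarrow> a \<notin> As \<Longrightarrow> arr s' a = arr s a"
  by (simp_all add: agr_def)

text \<open>Array \<open>0\<close> is the input. Arrays \<open>1\<close> and \<open>2\<close> hold the endpoints of the edges of the graph, arrays \<open>3\<close>
  and \<open>4\<close> those of the sampled edges, and array \<open>5\<close> labels the vertices by their components.\<close>

abbreviation (input) "vn \<equiv> 0 :: nat"
abbreviation (input) "vtmp \<equiv> 1 :: nat"
abbreviation (input) "vl \<equiv> 2 :: nat"
abbreviation (input) "vK \<equiv> 3 :: nat"
abbreviation (input) "vL \<equiv> 4 :: nat"
abbreviation (input) "vpw \<equiv> 5 :: nat"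
abbreviation (input) "vP \<equiv> 6 :: nat"
abbreviation (input) "vQ \<equiv> 7 :: nat"
abbreviation (input) "vd \<equiv> 8 :: nat"
abbreviation (input) "vden \<equiv> 9 :: nat"
abbreviation (input) "vnum \<equiv> 10 :: nat"
abbreviation (input) "vt \<equiv> 11 :: nat"
abbreviation (input) "vr \<equiv> 12 :: nat"
abbreviation (input) "vi \<equiv> 13 :: nat"
abbreviation (input) "vj \<equiv> 14 :: nat"
abbreviation (input) "vm \<equiv> 15 :: nat"
abbreviation (input) "vix \<equiv> 16 :: nat"
abbreviation (input) "vT \<equiv> 17 :: nat"
abbreviation (input) "vc \<equiv> 18 :: nat"
abbreviation (input) "vs \<equiv> 19 :: nat"
abbreviation (input) "vk \<equiv> 20 :: nat"
abbreviation (input) "vu \<equiv> 21 :: nat"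
abbreviation (input) "vb \<equiv> 22 :: nat"
abbreviation (input) "vx \<equiv> 23 :: nat"
abbreviation (input) "vy \<equiv> 24 :: nat"
abbreviation (input) "vok \<equiv> 25 :: nat"
abbreviation (input) "vv \<equiv> 26 :: nat"

section \<open>Random integers, arithmetic without products, binary expansions\<close>

definition flips :: com where
  "flips = Seq (Assign vu (N 0)) (For vb (V vK)
     (Seq (Flip vd) (Assign vu (Plus (Plus (V vu) (V vu)) (V vd)))))"

text \<open>The most significant bit comes first, and sending \<open>(b, r)\<close> to
  \<open>b * 2 ^ k + r\<close> is a bijection from bits and numbers below \<open>2 ^ k\<close> onto
  the numbers below \<open>2 ^ (k + 1)\<close>.\<close>

lemma iter_bits:
  "iter (\<lambda>k v. map_pmf (\<lambda>b. 2 * v + b) (pmf_of_set {0, 1})) k v =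
     map_pmf (\<lambda>r. v * 2 ^ k + r) (pmf_of_set {..<2 ^ k :: nat})"
proof (induction k arbitrary: v)
  case 0
  then show ?case by (simp add: pmf_of_set_singleton lessThan_Suc)
next
  case (Suc k)
  define f where "f = (\<lambda>(b, r). b * 2 ^ k + r :: nat)"
  have inj: "inj_on f ({0, 1} \<times> {..<2 ^ k})"
    unfolding f_def by (auto intro!: inj_onI)
  have img: "f ` ({0, 1} \<times> {..<2 ^ k}) = {..<2 ^ Suc k}"
  proof (rule card_subset_eq)
    show "f ` ({0, 1} \<times> {..<2 ^ k}) \<subseteq> {..<2 ^ Suc k}" unfolding f_def by auto
    show "card (f ` ({0, 1} \<times> {..<2 ^ k})) = card {..<2 ^ Suc k :: nat}"
      using card_image[OF inj] by (simp add: card_cartesian_product)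
  qed simp
  have pp: "pair_pmf (pmf_of_set {0, 1 :: nat}) (pmf_of_set {..<2 ^ k :: nat}) = pmf_of_set ({0, 1} \<times> {..<2 ^ k})"
    by (rule pmf_eqI) (auto simp: pmf_pair pmf_of_set lessThan_empty_iff indicator_def card_cartesian_product)
  have "iter (\<lambda>k v. map_pmf (\<lambda>b. 2 * v + b) (pmf_of_set {0, 1})) (Suc k) v =
     bind_pmf (pmf_of_set {0, 1}) (\<lambda>b. map_pmf (\<lambda>r. (2 * v + b) * 2 ^ k + r) (pmf_of_set {..<2 ^ k}))"
    by (simp only: iter.simps bind_map_pmf Suc)
  also have "\<dots> = map_pmf (\<lambda>r. v * 2 ^ Suc k + r) (map_pmf f (pair_pmf (pmf_of_set {0, 1}) (pmf_of_set {..<2 ^ k})))"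
    unfolding pair_pmf_def f_def
    by (simp add: map_bind_pmf map_pmf_def bind_assoc_pmf bind_return_pmf algebra_simps)
  also have "map_pmf f (pair_pmf (pmf_of_set {0, 1}) (pmf_of_set {..<2 ^ k})) = pmf_of_set {..<2 ^ Suc k}"
    unfolding pp img[symmetric]
    by (rule map_pmf_of_set_inj[OF inj]) (auto simp: lessThan_empty_iff)
  finally show ?case .
qed

lemma iter_bits_0:
  "iter (\<lambda>k v. map_pmf (\<lambda>b. 2 * v + b) (pmf_of_set {0, 1})) k 0 = pmf_of_set {..<2 ^ k :: nat}"
proof -
  have "(\<lambda>r :: nat. 0 * 2 ^ k + r) = (\<lambda>r. r)" by auto
  then show ?thesis unfolding iter_bits by (simp only: map_pmf_ident)
qed

lemma spec_flips:
  "spec \<theta> flips s (5 + var s vK * 6) (pmf_of_set {..<2 ^ var s vK})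
     (\<lambda>v s'. var s' vu = v \<and> agr {vu, vb, vd} {} s s')"
proof -
  let ?s = "set_var vu 0 s"
  have "spec \<theta> (For vb (V vK) (Seq (Flip vd) (Assign vu (Plus (Plus (V vu) (V vu)) (V vd))))) ?s
      (3 + aval (V vK) ?s * (3 + 3)) (iter (\<lambda>k v. map_pmf (\<lambda>b. 2 * v + b) (pmf_of_set {0, 1})) (aval (V vK) ?s) 0)
      (\<lambda>v s'. var s' vu = v \<and> agr {vu, vb, vd} {} s s')"
  proof (rule spec_For[where I = "\<lambda>k v s'. var s' vu = v \<and> agr {vu, vb, vd} {} s s'"])
    fix k v s'
    assume a: "var s' vu = v \<and> agr {vu, vb, vd} {} s s'" and k: "var s' vb = k"
    have "spec \<theta> (Seq (Flip vd) (Assign vu (Plus (Plus (V vu) (V vu)) (V vd)))) s' (Suc (1 + 1)) (pmf_of_set {0, 1})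
       (\<lambda>b s''. (var s'' vu = 2 * v + b \<and> agr {vu, vb, vd} {} s s'') \<and> var s'' vb = k)"
      by (rule spec_Seq_return[OF spec_Flip[where R = "\<lambda>b s''. s'' = set_var vd b s'"]])
         (use a k in \<open>auto intro!: det_Assign[unfolded One_nat_def]\<close>)
    then have "spec \<theta> (Seq (Flip vd) (Assign vu (Plus (Plus (V vu) (V vu)) (V vd)))) s' (Suc (1 + 1))
      (map_pmf (\<lambda>b. 2 * v + b) (pmf_of_set {0, 1}))
       (\<lambda>w s''. (var s'' vu = w \<and> agr {vu, vb, vd} {} s s'') \<and> var s'' vb = k)"
      by (rule spec_map) auto
    then show "spec \<theta> (Seq (Flip vd) (Assign vu (Plus (Plus (V vu) (V vu)) (V vd)))) s' 3
      (map_pmf (\<lambda>b. 2 * v + b) (pmf_of_set {0, 1}))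
       (\<lambda>w s''. (var s'' vu = w \<and> agr {vu, vb, vd} {} s s'') \<and> var s'' vb = k)"
      by (simp add: numeral_3_eq_3)
  qed auto
  then have "spec \<theta> (For vb (V vK) (Seq (Flip vd) (Assign vu (Plus (Plus (V vu) (V vu)) (V vd))))) ?s
      (3 + var s vK * (3 + 3)) (pmf_of_set {..<2 ^ var s vK}) (\<lambda>v s'. var s' vu = v \<and> agr {vu, vb, vd} {} s s')"
    unfolding iter_bits_0 by simp
  then have "spec \<theta> flips s (Suc (Suc (3 + var s vK * (3 + 3)))) (pmf_of_set {..<2 ^ var s vK})
      (\<lambda>v s'. var s' vu = v \<and> agr {vu, vb, vd} {} s s')"
    unfolding flips_def by (intro spec_Assign_Seq) simp
  then show ?thesis by (rule spec_mono) auto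
qed

definition double :: "nat \<Rightarrow> com" where
  "double x = For vi (V vK) (Assign x (Plus (V x) (V x)))"

lemma dspec_double:
  assumes "x \<noteq> vi" "x \<noteq> vK"
  shows "dspec \<theta> (double x) s (3 + var s vK * 4)
    (\<lambda>s'. var s' x = var s x * 2 ^ var s vK \<and> agr {x, vi} {} s s')"
proof -
  have "dspec \<theta> (double x) s (3 + aval (V vK) s * (1 + 3))
    (\<lambda>s'. var s' x * 2 ^ 0 = var s x * 2 ^ var s vK \<and> agr {x, vi} {} s s')"
    unfolding double_def
  proof (rule det_For[where I = "\<lambda>k s'. var s' x * 2 ^ k = var s x * 2 ^ var s vK \<and> agr {x, vi} {} s s'"])
    fix k s' assume "var s' x * 2 ^ Suc k = var s x * 2 ^ var s vK \<and> agr {x, vi} {} s s'" "var s' vi = k"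
    then show "dspec \<theta> (Assign x (Plus (V x) (V x))) s' 1
      (\<lambda>s'. (var s' x * 2 ^ k = var s x * 2 ^ var s vK \<and> agr {x, vi} {} s s') \<and> var s' vi = k)"
      using assms by (intro det_Assign) (auto simp: algebra_simps)
  qed (use assms in auto)
  then show ?thesis by (rule spec_mono) auto
qed

text \<open>Repeated subtraction, in time proportional to the quotient. This is affordable because
  the dividends are at most \<open>2 ^ (3 * K)\<close> with \<open>K\<close> logarithmic in
  \<open>n\<close>. As subtraction is truncated, the test is nonzero exactly if \<open>vnum\<close>
  is at least the divisor.\<close>

definition divide :: "nat \<Rightarrow> nat \<Rightarrow> com" where
  "divide z y = Seq (Assign z (N 0)) (While (Minus (Plus (V vnum) (N 1)) (V y))
     (Seq (Assign vnum (Minus (V vnum) (V y))) (Assign z (Plus (V z) (N 1)))))"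

lemma dspec_divide:
  assumes z: "z \<noteq> vnum" "y \<noteq> vnum" "z \<noteq> y" and y: "var s y > 0"
  shows "dspec \<theta> (divide z y) s (3 + 5 * (var s vnum div var s y))
    (\<lambda>s'. var s' z = var s vnum div var s y \<and> agr {z, vnum} {} s s')"
proof -
  let ?W = "While (Minus (Plus (V vnum) (N 1)) (V y))
     (Seq (Assign vnum (Minus (V vnum) (V y))) (Assign z (Plus (V z) (N 1))))"
  have loop: "dspec \<theta> ?W s' (1 + 5 * k) (\<lambda>s''. var s'' z = var s' z + k \<and> agr {z, vnum} {} s' s'')"
    if "k = var s' vnum div var s y" "var s' y = var s y" for k s'
    using that
  proof (induction k arbitrary: s')
    case 0
    then have "var s' vnum < var s y" using y by (simp add: div_eq_0_iff)
    then show ?case using 0 by (intro spec_mono[OF det_While_0[where P = "\<lambda>s''. s'' = s'"]]) auto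
  next
    case (Suc k)
    have ge: "var s' vnum \<ge> var s y" using Suc.prems y by (metis div_less linorder_not_less nat.distinct(1))
    have "dspec \<theta> ?W s' (Suc (Suc (Suc 1) + (1 + 5 * k))) (\<lambda>s''. var s'' z = var s' z + Suc k \<and> agr {z, vnum} {} s' s'')"
    proof -
      let ?s = "set_var z (var s' z + 1) (set_var vnum (var s' vnum - var s y) s')"
      have "dspec \<theta> ?W s' (Suc (Suc (Suc 1) + (1 + 5 * k))) (\<lambda>s''. var s'' z = var ?s z + k \<and> agr {z, vnum} {} ?s s'')
        \<longleftrightarrow> spec \<theta> ?W s' (Suc (Suc (Suc 1) + (1 + 5 * k))) (bind_pmf (return_pmf ()) (\<lambda>_. return_pmf ())) (\<lambda>_ s''. var s'' z = var ?s z + k \<and> agr {z, vnum} {} ?s s'')"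
        by (simp add: bind_return_pmf)
      also have "\<dots>"
      proof (rule spec_While_Suc[where R = "\<lambda>_ s''. s'' = ?s"])
        show "aval (Minus (Plus (V vnum) (N 1)) (V y)) s' \<noteq> 0" using ge Suc.prems by simp
        show "dspec \<theta> (Seq (Assign vnum (Minus (V vnum) (V y))) (Assign z (Plus (V z) (N 1)))) s' (Suc (Suc 1)) (\<lambda>s''. s'' = ?s)"
          using z Suc.prems by (intro spec_Assign_Seq det_Assign) auto
        show "dspec \<theta> ?W s'' (1 + 5 * k) (\<lambda>s''. var s'' z = var ?s z + k \<and> agr {z, vnum} {} ?s s'')"
          if "s'' = ?s" for s''
          unfolding that using Suc.prems ge z y
          by (intro Suc.IH) (auto simp: le_div_geq)
      qed
      finally show ?thesis by (rule spec_mono) (use z in auto)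
    qed
    then show ?case by (rule spec_mono) auto
  qed
  have "dspec \<theta> (divide z y) s (Suc (Suc (1 + 5 * (var s vnum div var s y))))
    (\<lambda>s'. var s' z = var s vnum div var s y \<and> agr {z, vnum} {} s s')"
    unfolding divide_def
    by (rule spec_Assign_Seq, rule spec_mono[OF loop[OF refl]]) (use z in auto)
  then show ?thesis by (rule spec_mono) auto
qed

text \<open>The program's substitute for the binary logarithm, from which it differs by at most 1
  (\<open>bitlen_bounds\<close>); it can be computed by halving.\<close>

fun bitlen :: "nat \<Rightarrow> nat" where
  "bitlen n = (if n = 0 then 0 else Suc (bitlen (n div 2)))"

declare bitlen.simps [simp del]

lemma bitlen_0 [simp]: "bitlen 0 = 0"
  by (simp add: bitlen.simps)

lemma bitlen_bounds: "n < 2 ^ bitlen n" "n > 0 \<Longrightarrow> 2 ^ bitlen n \<le> 2 * n"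
proof (induction n rule: bitlen.induct)
  case (1 n)
  {
    case 1
    then show ?case using "1.IH"(1) by (cases "n = 0") (auto simp: bitlen.simps[of n])
  next
    case 2
    then show ?case
      using "1.IH"(2) by (cases "n div 2 = 0") (auto simp: bitlen.simps[of n] bitlen.simps[of 0])
  }
qed

definition bits_com :: com where
  "bits_com = Seq (Assign vn (Get 0 (N 0))) (Seq (Assign vtmp (V vn)) (Seq (Assign vl (N 0))
     (While (V vtmp) (Seq (Assign vtmp (Half (V vtmp))) (Assign vl (Plus (V vl) (N 1)))))))"

lemma dspec_bits:
  "dspec \<theta> bits_com s (7 + 5 * bitlen (arr s 0 0))
    (\<lambda>s'. var s' vn = arr s 0 0 \<and> var s' vl = bitlen (arr s 0 0) \<and> agr {vn, vtmp, vl} {} s s')"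
proof -
  let ?W = "While (V vtmp) (Seq (Assign vtmp (Half (V vtmp))) (Assign vl (Plus (V vl) (N 1))))"
  have loop: "dspec \<theta> ?W s' (1 + 5 * bitlen k) (\<lambda>s''. var s'' vl = var s' vl + bitlen k \<and> agr {vtmp, vl} {} s' s'')"
    if "k = var s' vtmp" for k s'
    using that
  proof (induction k arbitrary: s' rule: bitlen.induct)
    case (1 k)
    show ?case
    proof (cases "k = 0")
      case True
      then show ?thesis using 1 by (intro spec_mono[OF det_While_0[where P = "\<lambda>s''. s'' = s'"]]) auto
    next
      case False
      let ?s = "set_var vl (var s' vl + 1) (set_var vtmp (k div 2) s')"
      have "spec \<theta> ?W s' (Suc (Suc (Suc 1) + (1 + 5 * bitlen (k div 2)))) (bind_pmf (return_pmf ()) (\<lambda>_. return_pmf ()))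
          (\<lambda>_ s''. var s'' vl = var ?s vl + bitlen (k div 2) \<and> agr {vtmp, vl} {} ?s s'')"
      proof (rule spec_While_Suc[where R = "\<lambda>_ s''. s'' = ?s"])
        show "aval (V vtmp) s' \<noteq> 0" using False 1 by simp
        show "dspec \<theta> (Seq (Assign vtmp (Half (V vtmp))) (Assign vl (Plus (V vl) (N 1)))) s' (Suc (Suc 1)) (\<lambda>s''. s'' = ?s)"
          using 1 by (intro spec_Assign_Seq det_Assign) auto
        show "dspec \<theta> ?W s'' (1 + 5 * bitlen (k div 2))
            (\<lambda>s''. var s'' vl = var ?s vl + bitlen (k div 2) \<and> agr {vtmp, vl} {} ?s s'')"
          if "s'' = ?s" for s''
          unfolding that using False by (intro 1) auto
      qed
      then have "dspec \<theta> ?W s' (Suc (Suc (Suc 1) + (1 + 5 * bitlen (k div 2))))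
          (\<lambda>s''. var s'' vl = var ?s vl + bitlen (k div 2) \<and> agr {vtmp, vl} {} ?s s'')"
        by (simp add: bind_return_pmf)
      then show ?thesis
        by (rule spec_mono) (use False in \<open>auto simp: bitlen.simps[of k]\<close>)
    qed
  qed
  let ?s = "set_var vl 0 (set_var vtmp (arr s 0 0) (set_var vn (arr s 0 0) s))"
  have "dspec \<theta> ?W ?s (1 + 5 * bitlen (arr s 0 0)) (\<lambda>s'. var s' vl = var ?s vl + bitlen (arr s 0 0) \<and> agr {vtmp, vl} {} ?s s')"
    by (rule loop) simp
  then have "dspec \<theta> ?W ?s (1 + 5 * bitlen (arr s 0 0))
      (\<lambda>s'. var s' vn = arr s 0 0 \<and> var s' vl = bitlen (arr s 0 0) \<and> agr {vn, vtmp, vl} {} s s')"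
    by (rule spec_mono) (auto simp: agr_def)
  then have "dspec \<theta> bits_com s (Suc (Suc (Suc (Suc (Suc (Suc (1 + 5 * bitlen (arr s 0 0)))))))) 
      (\<lambda>s'. var s' vn = arr s 0 0 \<and> var s' vl = bitlen (arr s 0 0) \<and> agr {vn, vtmp, vl} {} s s')"
    unfolding bits_com_def by (intro spec_Assign_Seq) simp
  then show ?thesis by (rule spec_mono) auto
qed

definition read :: "nat \<Rightarrow> nat \<Rightarrow> com" where
  "read x j = Seq (Digit x j) (For vi (V vK) (Seq (Digit vd j) (Assign x (Plus (Plus (V x) (V x)) (V vd)))))"

lemma dspec_read:
  assumes j: "j < length \<theta>" "tape_pos s j = 0" "\<theta> ! j \<ge> 0" and x: "x \<notin> {vi, vd, vK}"
  shows "dspec \<theta> (read x j) s (5 + var s vK * 6)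
    (\<lambda>s'. var s' x = nat \<lfloor>2 ^ var s vK * \<theta> ! j\<rfloor> \<and> (\<forall>y. y \<notin> {x, vi, vd} \<longrightarrow> var s' y = var s y) \<and>
       arr s' = arr s \<and> printed s' = printed s \<and> (\<forall>i. i \<noteq> j \<longrightarrow> tape_pos s' i = tape_pos s i))"
proof -
  let ?y = "\<theta> ! j" and ?K = "var s vK"
  have dig: "nat \<lfloor>2 ^ Suc i * ?y\<rfloor> = nat \<lfloor>2 ^ i * ?y\<rfloor> + nat \<lfloor>2 ^ i * ?y\<rfloor> + digit ?y (Suc i)" for i
  proof -
    have "2 * \<lfloor>2 ^ i * ?y\<rfloor> \<le> \<lfloor>2 ^ Suc i * ?y\<rfloor> \<and> \<lfloor>2 ^ Suc i * ?y\<rfloor> \<le> 2 * \<lfloor>2 ^ i * ?y\<rfloor> + 1"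
      by (simp add: le_floor_iff floor_le_iff) linarith
    moreover have "\<lfloor>2 ^ i * ?y\<rfloor> \<ge> 0" using j by simp
    ultimately have "nat \<lfloor>2 ^ Suc i * ?y\<rfloor> = 2 * nat \<lfloor>2 ^ i * ?y\<rfloor> \<or> nat \<lfloor>2 ^ Suc i * ?y\<rfloor> = 2 * nat \<lfloor>2 ^ i * ?y\<rfloor> + 1"
      by linarith
    then have "nat \<lfloor>2 ^ Suc i * ?y\<rfloor> = 2 * nat \<lfloor>2 ^ i * ?y\<rfloor> + nat \<lfloor>2 ^ Suc i * ?y\<rfloor> mod 2" by auto
    then show ?thesis by (simp only: digit.simps mult_2)
  qed
  define Q where "Q = (\<lambda>i (s' :: state). var s' x = nat \<lfloor>2 ^ i * ?y\<rfloor> \<and> tape_pos s' j = Suc i \<and>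
      (\<forall>y. y \<notin> {x, vi, vd} \<longrightarrow> var s' y = var s y) \<and>
      arr s' = arr s \<and> printed s' = printed s \<and> (\<forall>i. i \<noteq> j \<longrightarrow> tape_pos s' i = tape_pos s i))"
  have "dspec \<theta> (read x j) s (Suc (1 + (3 + ?K * (3 + 3)))) (Q ?K)"
    unfolding read_def
  proof (rule spec_Seq_det[OF det_Digit[where P = "Q 0"]])
    show "Q 0 ((set_var x (digit ?y (tape_pos s j)) s)\<lparr>tape_pos := (tape_pos s)(j := tape_pos s j + 1)\<rparr>)"
      unfolding Q_def using j x by auto
    fix s' assume s': "Q 0 s'"
    then have K: "aval (V vK) s' = ?K" using x by (auto simp: Q_def)
    have "dspec \<theta> (For vi (V vK) (Seq (Digit vd j) (Assign x (Plus (Plus (V x) (V x)) (V vd))))) s'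
       (3 + aval (V vK) s' * (3 + 3)) (\<lambda>s''. Q (?K - 0) s'')"
    proof (rule det_For[where I = "\<lambda>k. Q (?K - k)"])
      fix k s'' assume k: "k < aval (V vK) s'" "Q (?K - Suc k) s''" "var s'' vi = k"
      define i where "i = ?K - Suc k"
      have i: "?K - k = Suc i" unfolding i_def using k K by simp
      let ?s = "(set_var vd (digit ?y (Suc i)) s'')\<lparr>tape_pos := (tape_pos s'')(j := Suc (Suc i))\<rparr>"
      have "dspec \<theta> (Seq (Digit vd j) (Assign x (Plus (Plus (V x) (V x)) (V vd)))) s'' (Suc (1 + 1))
        (\<lambda>s'. Q (?K - k) s' \<and> var s' vi = k)"
      proof (rule spec_Seq_det[OF det_Digit[where P = "\<lambda>s'. s' = ?s"]])
        show "dspec \<theta> (Assign x (Plus (Plus (V x) (V x)) (V vd))) t 1 (\<lambda>s'. Q (?K - k) s' \<and> var s' vi = k)"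
          if "t = ?s" for t
          unfolding that i
        proof (intro det_Assign conjI)
          have "aval (Plus (Plus (V x) (V x)) (V vd)) ?s = nat \<lfloor>2 ^ Suc i * ?y\<rfloor>"
            unfolding dig using k(2) x by (simp add: Q_def i_def)
          then show "Q (Suc i) (set_var x (aval (Plus (Plus (V x) (V x)) (V vd)) ?s) ?s)"
            using k(2) x unfolding Q_def i_def by auto
          show "var (set_var x (aval (Plus (Plus (V x) (V x)) (V vd)) ?s) ?s) vi = k" using k(3) x by auto
        qed
      qed (use j k in \<open>auto simp: Q_def i_def\<close>)
      then show "dspec \<theta> (Seq (Digit vd j) (Assign x (Plus (Plus (V x) (V x)) (V vd)))) s'' 3
        (\<lambda>s'. Q (?K - k) s' \<and> var s' vi = k)" by (simp add: numeral_3_eq_3)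
    next
      show "Q (?K - k) (set_var vi v s'')" if "Q (?K - k) s''" for k s'' v
        using that x unfolding Q_def by auto
    qed (use s' K in simp)
    then show "dspec \<theta> (For vi (V vK) (Seq (Digit vd j) (Assign x (Plus (Plus (V x) (V x)) (V vd))))) s'
       (3 + ?K * (3 + 3)) (Q ?K)" unfolding K by simp
  qed (rule j)
  then show ?thesis by (rule spec_mono) (auto simp: Q_def)
qed

text \<open>This and the following rules work with a time budget \<open>T\<close> fixed in advance,
  so that exact running times need not be known when a rule is applied.\<close>

lemma spec_Seq_det_le:
  assumes "dspec \<theta> c s t P" "t + 1 \<le> T" "\<And>s'. P s' \<Longrightarrow> spec \<theta> d s' (T - (t + 1)) D R"
  shows "spec \<theta> (Seq c d) s T D R"
  by (rule spec_mono[OF spec_Seq_det[OF assms(1,3)]]) (use assms(2) in auto)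

lemma spec_Assign_Seq_le:
  assumes "2 \<le> T" "spec \<theta> d (set_var x (aval e s) s) (T - 2) D R"
  shows "spec \<theta> (Seq (Assign x e) d) s T D R"
  by (rule spec_mono[OF spec_Assign_Seq[OF assms(2)]]) (use assms(1) in auto)

lemma spec_Put_Seq_le:
  assumes "2 \<le> T" "spec \<theta> d (s\<lparr>arr := (arr s)(a := (arr s a)(aval e s := aval f s))\<rparr>) (T - 2) D R"
  shows "spec \<theta> (Seq (Put a e f) d) s T D R"
  by (rule spec_mono[OF spec_Put_Seq[OF assms(2)]]) (use assms(1) in auto)

lemma spec_If_le:
  assumes "1 \<le> T" "spec \<theta> (if aval e s \<noteq> 0 then c else d) s (T - 1) D R"
  shows "spec \<theta> (If e c d) s T D R"
  by (rule spec_mono[OF spec_If[OF assms(2)]]) (use assms(1) in auto)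

lemma det_Assign_le: "1 \<le> T \<Longrightarrow> P (set_var x (aval e s) s) \<Longrightarrow> dspec \<theta> (Assign x e) s T P"
  by (rule spec_mono[OF det_Assign]) auto

lemma det_Put_le:
  "1 \<le> T \<Longrightarrow> P (s\<lparr>arr := (arr s)(a := (arr s a)(aval e s := aval f s))\<rparr>) \<Longrightarrow> dspec \<theta> (Put a e f) s T P"
  by (rule spec_mono[OF det_Put]) auto

lemma det_Skip_le: "1 \<le> T \<Longrightarrow> P s \<Longrightarrow> dspec \<theta> Skip s T P"
  by (rule spec_mono[OF det_Skip]) auto

lemma agr_arr_upd [simp]:
  "a \<in> As \<Longrightarrow> agr Xs As s (s'\<lparr>arr := h(a := f)\<rparr>) \<longleftrightarrow> agr Xs As s (s'\<lparr>arr := h\<rparr>)"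
  "agr Xs As s (s'\<lparr>arr := arr s'\<rparr>) \<longleftrightarrow> agr Xs As s s'"
  by (auto simp: agr_def)

text \<open>After \<open>thresh_com\<close>, \<open>vt\<close> and \<open>vr\<close> are \<open>2 ^ K\<close> times approximations to \<open>x / (1 + x)\<close>, where
  \<open>x = p / ((1 - p) q)\<close>, and to \<open>1 / q\<close>; see \<open>thresholds_close\<close>.\<close>

definition thresh_com :: com where
  "thresh_com = Seq (Assign vden (N 0))
     (Seq (For vi (V vpw) (If (Minus (V vP) (V vi)) (Assign vden (Plus (V vden) (V vpw))) (Assign vden (Plus (V vden) (V vQ)))))
     (Seq (Assign vnum (V vP)) (Seq (double vnum) (Seq (double vnum) (Seq (divide vt vden)
     (Seq (Assign vnum (N 1)) (Seq (double vnum) (Seq (double vnum) (divide vr vQ)))))))))"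

text \<open>Since \<open>x / (1 + x) = p / (p + (1 - p) * q)\<close>, the first quotient
  approximates \<open>2 ^ K\<close> times this number when \<open>vP\<close> and \<open>vQ\<close>
  are \<open>2 ^ K\<close> times \<open>p\<close> and \<open>q\<close>, rounded down: its
  denominator carries the scale \<open>2 ^ (2 * K)\<close> and its numerator
  \<open>2 ^ (3 * K)\<close>.\<close>

lemma dspec_thresh:
  assumes P: "var s vP \<le> var s vpw" and Q: "var s vQ > 0" and pw: "var s vpw = 2 ^ var s vK"
  shows "dspec \<theta> thresh_com s (100 + 20 * var s vK + 15 * 2 ^ (3 * var s vK))
    (\<lambda>s'. var s' vt = var s vP * 2 ^ (2 * var s vK) div (var s vP * var s vpw + (var s vpw - var s vP) * var s vQ) \<and>
       var s' vr = 2 ^ (2 * var s vK) div var s vQ \<and> agr {vden, vnum, vt, vr, vi} {} s s')"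
proof -
  define P Q w K where "P = var s vP" and "Q = var s vQ" and "w = var s vpw" and "K = var s vK"
  define dn where "dn = P * w + (w - P) * Q"
  have wK: "w = 2 ^ K" using pw by (simp add: w_def K_def)
  have Q0: "Q > 0" and Pw: "P \<le> w" using P Q by (simp_all add: P_def Q_def w_def)
  have w0: "w > 0" using wK by simp
  have dn0: "dn > 0"
    unfolding dn_def using Q0 Pw w0 by (cases "P = 0") auto
  have big: "w \<le> 2 ^ (3 * K)" "P * 2 ^ (2 * K) \<le> 2 ^ (3 * K)" "2 ^ (2 * K) \<le> (2 :: nat) ^ (3 * K)"
  proof -
    show "w \<le> 2 ^ (3 * K)" "2 ^ (2 * K) \<le> (2 :: nat) ^ (3 * K)" unfolding wK by (intro power_increasing; simp)+
    have "P * 2 ^ (2 * K) \<le> 2 ^ K * 2 ^ (2 * K)" using Pw wK by simp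
    then show "P * 2 ^ (2 * K) \<le> 2 ^ (3 * K)" by (simp add: power_add[symmetric])
  qed
  let ?X = "{vden, vnum, vt, vr, vi}"
  let ?loop = "For vi (V vpw) (If (Minus (V vP) (V vi)) (Assign vden (Plus (V vden) (V vpw))) (Assign vden (Plus (V vden) (V vQ))))"
  have den: "dspec \<theta> ?loop s1 (3 + aval (V vpw) s1 * (2 + 3)) (\<lambda>s'. var s' vden = dn \<and> agr ?X {} s s')"
    if s1: "var s1 vden = 0" "agr ?X {} s s1" for s1
  proof -
    \<comment> \<open>The denominator \<open>P * w + (w - P) * Q\<close> is formed by
      \<open>w\<close> additions, of \<open>w\<close> below \<open>P\<close> and of \<open>Q\<close>
      from there on, as the machine has no product.\<close>
    define S where "S = (\<lambda>k. \<Sum>i\<in>{k..<w}. if i < P then w else Q)"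
    have S0: "S 0 = dn"
    proof -
      have "{..<w} = {..<P} \<union> {P..<w}" using Pw by auto
      then have "S 0 = (\<Sum>i\<in>{..<P} \<union> {P..<w}. if i < P then w else Q)" unfolding S_def by (simp add: lessThan_atLeast0)
      also have "\<dots> = dn" unfolding dn_def by (subst sum.union_disjoint) auto
      finally show ?thesis .
    qed
    have Sk: "S k = (if k < P then w else Q) + S (Suc k)" if "k < w" for k
      unfolding S_def using that by (simp add: sum.atLeast_Suc_lessThan)
    have av: "aval (V vpw) s1 = w" using agr_var[OF s1(2), of vpw] by (simp add: w_def)
    have "dspec \<theta> ?loop s1 (3 + aval (V vpw) s1 * (2 + 3)) (\<lambda>s'. var s' vden = S 0 \<and> agr ?X {} s s')"
    proof (rule det_For[where I = "\<lambda>k s'. var s' vden = S k \<and> agr ?X {} s s'"])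
      fix k s2 assume k: "k < aval (V vpw) s1" "var s2 vden = S (Suc k) \<and> agr ?X {} s s2" "var s2 vi = k"
      have v: "var s2 vP = P" "var s2 vQ = Q" "var s2 vpw = w"
        using k(2) by (auto simp: agr_def P_def Q_def w_def)
      show "dspec \<theta> (If (Minus (V vP) (V vi)) (Assign vden (Plus (V vden) (V vpw))) (Assign vden (Plus (V vden) (V vQ)))) s2 2
          (\<lambda>s'. (var s' vden = S k \<and> agr ?X {} s s') \<and> var s' vi = k)"
        using k Sk[of k] av v by (intro spec_If_le) (auto intro!: det_Assign_le)
    qed (use s1 av in \<open>auto simp: S_def\<close>)
    then show ?thesis unfolding S0 .
  qed
  show ?thesis
    unfolding thresh_com_def
  proof (rule spec_Assign_Seq_le, simp, rule spec_Seq_det_le[OF den])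
    show "var (set_var vden (aval (N 0) s) s) vden = 0" "agr ?X {} s (set_var vden (aval (N 0) s) s)" by simp_all
    show "3 + aval (V vpw) (set_var vden (aval (N 0) s) s) * (2 + 3) + 1 \<le> 100 + 20 * var s vK + 15 * 2 ^ (3 * var s vK) - 2"
      using big(1) by (simp add: w_def[symmetric] K_def[symmetric])
    fix s1 assume s1: "var s1 vden = dn \<and> agr ?X {} s s1"
    then have v1: "var s1 vK = K" "var s1 vP = P" "var s1 vQ = Q" by (auto simp: agr_def K_def P_def Q_def)
    let ?s2 = "set_var vnum (aval (V vP) s1) s1"
    let ?T = "100 + 20 * var s vK + 15 * 2 ^ (3 * var s vK) - 2 - (3 + aval (V vpw) (set_var vden (aval (N 0) s) s) * (2 + 3) + 1)"
    have T: "?T \<ge> 90 + 20 * K + 10 * 2 ^ (3 * K)"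
      using big(1) by (simp add: w_def[symmetric] K_def[symmetric])
    show "spec \<theta> (Seq (Assign vnum (V vP)) (Seq (double vnum) (Seq (double vnum) (Seq (divide vt vden)
     (Seq (Assign vnum (N 1)) (Seq (double vnum) (Seq (double vnum) (divide vr vQ)))))))) s1 ?T (return_pmf ())
     (\<lambda>_ s'. var s' vt = var s vP * 2 ^ (2 * var s vK) div (var s vP * var s vpw + (var s vpw - var s vP) * var s vQ) \<and>
       var s' vr = 2 ^ (2 * var s vK) div var s vQ \<and> agr ?X {} s s')"
    proof (rule spec_mono[OF _ T], rule spec_Assign_Seq_le, simp, rule spec_Seq_det_le[OF dspec_double])
      fix s3 assume s3: "var s3 vnum = var ?s2 vnum * 2 ^ var ?s2 vK \<and> agr {vnum, vi} {} ?s2 s3"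
      then have v3: "var s3 vK = K" "var s3 vnum = P * 2 ^ K" "var s3 vden = dn" "agr ?X {} s s3" "var s3 vQ = Q"
        using v1 s1 by (auto simp: agr_def)
      show "spec \<theta> (Seq (double vnum) (Seq (divide vt vden)
        (Seq (Assign vnum (N 1)) (Seq (double vnum) (Seq (double vnum) (divide vr vQ)))))) s3
        (90 + 20 * K + 10 * 2 ^ (3 * K) - 2 - (3 + var ?s2 vK * 4 + 1)) (return_pmf ())
        (\<lambda>_ s'. var s' vt = var s vP * 2 ^ (2 * var s vK) div (var s vP * var s vpw + (var s vpw - var s vP) * var s vQ) \<and>
         var s' vr = 2 ^ (2 * var s vK) div var s vQ \<and> agr ?X {} s s')"
      proof (rule spec_Seq_det_le[OF dspec_double])
        fix s4 assume s4: "var s4 vnum = var s3 vnum * 2 ^ var s3 vK \<and> agr {vnum, vi} {} s3 s4"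
        then have v4: "var s4 vK = K" "var s4 vnum = P * 2 ^ (2 * K)" "var s4 vden = dn" "agr ?X {} s s4" "var s4 vQ = Q"
          using v3 by (auto simp: agr_def mult_2 power_add)
        have q4: "var s4 vnum div var s4 vden \<le> 2 ^ (3 * K)" unfolding v4 using big(2) by (meson div_le_dividend le_trans)
        show "spec \<theta> (Seq (divide vt vden)
          (Seq (Assign vnum (N 1)) (Seq (double vnum) (Seq (double vnum) (divide vr vQ))))) s4
          (90 + 20 * K + 10 * 2 ^ (3 * K) - 2 - (3 + var ?s2 vK * 4 + 1) - (3 + var s3 vK * 4 + 1)) (return_pmf ())
          (\<lambda>_ s'. var s' vt = var s vP * 2 ^ (2 * var s vK) div (var s vP * var s vpw + (var s vpw - var s vP) * var s vQ) \<and>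
           var s' vr = 2 ^ (2 * var s vK) div var s vQ \<and> agr ?X {} s s')"
        proof (rule spec_Seq_det_le[OF dspec_divide])
          fix s5 assume s5: "var s5 vt = var s4 vnum div var s4 vden \<and> agr {vt, vnum} {} s4 s5"
          then have v5: "var s5 vK = K" "var s5 vt = P * 2 ^ (2 * K) div dn" "agr ?X {} s s5" "var s5 vQ = Q"
            using v4 by (auto simp: agr_def)
          let ?T5 = "90 + 20 * K + 10 * 2 ^ (3 * K) - 2 - (3 + var ?s2 vK * 4 + 1) - (3 + var s3 vK * 4 + 1) - (3 + 5 * (var s4 vnum div var s4 vden) + 1)"
          have T5: "70 + 12 * K + 5 * 2 ^ (3 * K) \<le> ?T5" using q4 v1 v3 by simp
          show "spec \<theta> (Seq (Assign vnum (N 1)) (Seq (double vnum) (Seq (double vnum) (divide vr vQ)))) s5 ?T5 (return_pmf ())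
            (\<lambda>_ s'. var s' vt = var s vP * 2 ^ (2 * var s vK) div (var s vP * var s vpw + (var s vpw - var s vP) * var s vQ) \<and>
             var s' vr = 2 ^ (2 * var s vK) div var s vQ \<and> agr ?X {} s s')"
          proof (rule spec_mono[OF _ T5], rule spec_Assign_Seq_le, simp, rule spec_Seq_det_le[OF dspec_double])
            let ?s6 = "set_var vnum (aval (N 1) s5) s5"
            fix s7 assume s7: "var s7 vnum = var ?s6 vnum * 2 ^ var ?s6 vK \<and> agr {vnum, vi} {} ?s6 s7"
            then have v7: "var s7 vK = K" "var s7 vnum = 2 ^ K" "var s7 vt = P * 2 ^ (2 * K) div dn" "agr ?X {} s s7" "var s7 vQ = Q"
              using v5 by (auto simp: agr_def)
            show "spec \<theta> (Seq (double vnum) (divide vr vQ)) s7 (70 + 12 * K + 5 * 2 ^ (3 * K) - 2 - (3 + var ?s6 vK * 4 + 1)) (return_pmf ())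
              (\<lambda>_ s'. var s' vt = var s vP * 2 ^ (2 * var s vK) div (var s vP * var s vpw + (var s vpw - var s vP) * var s vQ) \<and>
               var s' vr = 2 ^ (2 * var s vK) div var s vQ \<and> agr ?X {} s s')"
            proof (rule spec_Seq_det_le[OF dspec_double])
              fix s8 assume s8: "var s8 vnum = var s7 vnum * 2 ^ var s7 vK \<and> agr {vnum, vi} {} s7 s8"
              then have v8: "var s8 vK = K" "var s8 vnum = 2 ^ (2 * K)" "var s8 vt = P * 2 ^ (2 * K) div dn" "agr ?X {} s s8" "var s8 vQ = Q"
                using v7 by (auto simp: agr_def mult_2 power_add)
              have q8: "var s8 vnum div var s8 vQ \<le> 2 ^ (3 * K)" unfolding v8 using big(3) by (meson div_le_dividend le_trans)
              show "dspec \<theta> (divide vr vQ) s8 (70 + 12 * K + 5 * 2 ^ (3 * K) - 2 - (3 + var ?s6 vK * 4 + 1) - (3 + var s7 vK * 4 + 1))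
               (\<lambda>s'. var s' vt = var s vP * 2 ^ (2 * var s vK) div (var s vP * var s vpw + (var s vpw - var s vP) * var s vQ) \<and>
               var s' vr = 2 ^ (2 * var s vK) div var s vQ \<and> agr ?X {} s s')"
              proof (rule spec_mono[OF dspec_divide])
                show "3 + 5 * (var s8 vnum div var s8 vQ) \<le> 70 + 12 * K + 5 * 2 ^ (3 * K) - 2 - (3 + var ?s6 vK * 4 + 1) - (3 + var s7 vK * 4 + 1)"
                  using q8 v5 v7 by simp
                show "var s' vt = var s vP * 2 ^ (2 * var s vK) div (var s vP * var s vpw + (var s vpw - var s vP) * var s vQ) \<and>
               var s' vr = 2 ^ (2 * var s vK) div var s vQ \<and> agr ?X {} s s'"
                  if "var s' vr = var s8 vnum div var s8 vQ \<and> agr {vr, vnum} {} s8 s'" for s'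
                  using that v8 by (auto simp: agr_def dn_def P_def Q_def K_def w_def)
              qed (use v8 Q0 in auto)
            qed (use v5 v7 in auto)
          qed (use v5 in auto)
        qed (use v1 v3 v4 dn0 q4 in auto)
      qed (use v1 v3 in auto)
    qed (use v1 in auto)
  qed
qed

section \<open>Listing the edges of the input graph\<close>

definition edge_com :: com where
  "edge_com = Seq (If (Get 0 (V vix)) (If (Minus (V vi) (V vj))
       (Seq (Put 1 (V vm) (V vi)) (Seq (Put 2 (V vm) (V vj)) (Assign vm (Plus (V vm) (N 1))))) Skip) Skip)
     (Assign vix (Minus (V vix) (N 1)))"

text \<open>The matrix is read from its last cell backwards, in step with the descending loops, so
  its index needs only decrements after \<open>n * n\<close> has been computed by additions. Cell 0
  holds \<open>n\<close>, hence the entry \<open>(i, j)\<close> is in cell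
  \<open>i * n + j + 1\<close>. Taking only \<open>j < i\<close> lists each edge once.\<close>

definition edges_com :: com where
  "edges_com = Seq (Assign vix (N 0)) (Seq (For vi (V vn) (Assign vix (Plus (V vix) (V vn))))
     (Seq (Assign vm (N 0)) (For vi (V vn) (For vj (V vn) edge_com))))"

definition elist :: "(nat \<times> nat) list \<Rightarrow> state \<Rightarrow> bool" where
  "elist es s \<longleftrightarrow> var s vm = length es \<and> (\<forall>k<length es. arr s 1 k = fst (es ! k) \<and> arr s 2 k = snd (es ! k))"

lemma elist_set_var [simp]: "x \<noteq> vm \<Longrightarrow> elist es (set_var x v s) \<longleftrightarrow> elist es s"
  by (simp add: elist_def)

lemma dspec_edges:
  assumes inp: "\<And>i j. i < var s vn \<Longrightarrow> j < var s vn \<Longrightarrow> arr s 0 (Suc (i * var s vn + j)) = of_bool ({i, j} \<in> E)"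
  shows "dspec \<theta> edges_com s (20 + var s vn * (20 + var s vn * 15))
    (\<lambda>s'. (\<exists>es. elist es s' \<and> distinct es \<and> set es = {(a, b). b < a \<and> a < var s vn \<and> {a, b} \<in> E}) \<and>
       agr {vi, vj, vm, vix} {1, 2} s s')"
proof -
  define n where "n = var s vn"
  let ?X = "{vi, vj, vm, vix}" and ?A = "{1, 2 :: nat}"
  define Inv where "Inv = (\<lambda>i j s'. (\<exists>es. elist es s' \<and> distinct es \<and>
      set es = {(a, b). b < a \<and> a < n \<and> {a, b} \<in> E \<and> (i < a \<or> a = i \<and> j \<le> b)}) \<and>
      var s' vix = i * n + j \<and> agr ?X ?A s s')"
  have vn: "var s' vn = n" if "agr ?X ?A s s'" for s' using that by (simp add: agr_def n_def)
  have step: "dspec \<theta> edge_com s' 10 (\<lambda>s'. (Inv i j s' \<and> var s' vi = i) \<and> var s' vj = j)"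
    if I: "Inv i (Suc j) s'" "var s' vi = i" "var s' vj = j" and ij: "i < n" "j < n" for i j s'
  proof -
    from I(1) obtain es where es: "elist es s'" "distinct es"
      "set es = {(a, b). b < a \<and> a < n \<and> {a, b} \<in> E \<and> (i < a \<or> a = i \<and> Suc j \<le> b)}"
      and ix: "var s' vix = i * n + Suc j" and ag: "agr ?X ?A s s'" unfolding Inv_def by blast
    have get: "aval (Get 0 (V vix)) s' = of_bool ({i, j} \<in> E)"
      using inp[of i j] ij ix agr_arrD[OF ag, of 0] by (simp add: n_def)
    define c where "c \<longleftrightarrow> {i, j} \<in> E \<and> j < i"
    define es' where "es' = (if c then es @ [(i, j)] else es)"
    define Q where "Q = (\<lambda>s''. elist es' s'' \<and> var s'' vix = i * n + Suc j \<and> agr ?X ?A s s'' \<and> var s'' vi = i \<and> var s'' vj = j)"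
    have nin: "(i, j) \<notin> set es" using es(3) by auto
    have set': "set es' = {(a, b). b < a \<and> a < n \<and> {a, b} \<in> E \<and> (i < a \<or> a = i \<and> j \<le> b)}"
    proof -
      have "{(a, b). b < a \<and> a < n \<and> {a, b} \<in> E \<and> (i < a \<or> a = i \<and> j \<le> b)} =
        {(a, b). b < a \<and> a < n \<and> {a, b} \<in> E \<and> (i < a \<or> a = i \<and> Suc j \<le> b)} \<union> (if c then {(i, j)} else {})"
        using ij unfolding c_def by (auto simp: Suc_le_eq le_less)
      then show ?thesis unfolding es'_def using es(3) by auto
    qed
    have dist': "distinct es'" unfolding es'_def using es(2) nin by auto
    have add: "dspec \<theta> (Seq (Put 1 (V vm) (V vi)) (Seq (Put 2 (V vm) (V vj)) (Assign vm (Plus (V vm) (N 1))))) s' 5 Q"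
      if c
      using es(1) ix ag I that
      by (intro spec_Put_Seq_le det_Assign_le) (auto simp: Q_def elist_def es'_def nth_append less_Suc_eq)
    have "dspec \<theta> (If (Get 0 (V vix)) (If (Minus (V vi) (V vj))
       (Seq (Put 1 (V vm) (V vi)) (Seq (Put 2 (V vm) (V vj)) (Assign vm (Plus (V vm) (N 1))))) Skip) Skip) s' 7 Q"
    proof (cases c)
      case True
      then have cc: "{i, j} \<in> E" "j < i" by (auto simp: c_def)
      show ?thesis
        by (rule spec_If_le, simp, subst get, simp add: cc, rule spec_If_le, simp)
           (use cc I add[OF True] in simp)
    next
      case False
      then have "Q s'" using es(1) ix ag I by (simp add: Q_def es'_def)
      then show ?thesis
        using False I get unfolding c_def
        by (intro spec_If_le) (auto intro!: spec_If_le det_Skip_le)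
    qed
    then show ?thesis
      unfolding edge_com_def
    proof (rule spec_Seq_det_le)
      fix s'' assume Q: "Q s''"
      show "dspec \<theta> (Assign vix (Minus (V vix) (N 1))) s'' (10 - (7 + 1)) (\<lambda>s'. (Inv i j s' \<and> var s' vi = i) \<and> var s' vj = j)"
        using Q dist' set' by (intro det_Assign_le) (auto simp: Inv_def Q_def)
    qed simp
  qed
  have inner: "dspec \<theta> (For vj (V vn) edge_com) s' (3 + n * 13) (\<lambda>s'. Inv i 0 s' \<and> var s' vi = i)"
    if I: "Inv i n s'" "var s' vi = i" "i < n" for i s'
  proof -
    have n': "aval (V vn) s' = n" using I vn unfolding Inv_def by simp
    have "dspec \<theta> (For vj (V vn) edge_com) s' (3 + aval (V vn) s' * (10 + 3)) (\<lambda>s'. Inv i 0 s' \<and> var s' vi = i)"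
      by (rule det_For[where I = "\<lambda>j s'. Inv i j s' \<and> var s' vi = i"])
         (use I step n' in \<open>auto simp: Inv_def\<close>)
    then show ?thesis unfolding n' by simp
  qed
  have outer: "dspec \<theta> (For vi (V vn) (For vj (V vn) edge_com)) s' (3 + n * (6 + n * 13)) (\<lambda>s'. Inv 0 0 s')"
    if I: "elist [] s'" "var s' vix = n * n" "agr ?X ?A s s'" for s'
  proof -
    have n': "aval (V vn) s' = n" using I vn by simp
    have shift: "Inv i n s'" if "Inv (Suc i) 0 s'" for i s'
    proof -
      have "{(a, b). b < a \<and> a < n \<and> {a, b} \<in> E \<and> (Suc i < a \<or> a = Suc i \<and> 0 \<le> b)} =
        {(a, b). b < a \<and> a < n \<and> {a, b} \<in> E \<and> (i < a \<or> a = i \<and> n \<le> b)}" by auto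
      then show ?thesis using that unfolding Inv_def by (simp add: add.commute)
    qed
    have "dspec \<theta> (For vi (V vn) (For vj (V vn) edge_com)) s' (3 + aval (V vn) s' * ((3 + n * 13) + 3)) (\<lambda>s'. Inv 0 0 s')"
    proof (rule det_For[where I = "\<lambda>i s'. Inv i 0 s'"])
      show "dspec \<theta> (For vj (V vn) edge_com) s'' (3 + n * 13) (\<lambda>s'. Inv i 0 s' \<and> var s' vi = i)"
        if "i < aval (V vn) s'" "Inv (Suc i) 0 s''" "var s'' vi = i" for i s''
        using inner[OF shift] that n' by simp
      show "Inv (aval (V vn) s') 0 s'"
        unfolding n' Inv_def using I by (auto intro!: exI[of _ "[]"])
    qed (auto simp: Inv_def)
    then show ?thesis unfolding n' by (simp add: add.commute add.left_commute)
  qed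
  have ixl: "dspec \<theta> (For vi (V vn) (Assign vix (Plus (V vix) (V vn)))) s' (3 + n * 4) (\<lambda>s'. var s' vix = n * n \<and> agr ?X ?A s s')"
    if I: "var s' vix = 0" "agr ?X ?A s s'" for s'
  proof -
    have n': "aval (V vn) s' = n" using I vn by simp
    have "dspec \<theta> (For vi (V vn) (Assign vix (Plus (V vix) (V vn)))) s' (3 + aval (V vn) s' * (1 + 3))
       (\<lambda>s'. var s' vix + 0 * n = n * n \<and> agr ?X ?A s s')"
    proof (rule det_For[where I = "\<lambda>k s'. var s' vix + k * n = n * n \<and> agr ?X ?A s s'"])
      fix k s'' assume "var s'' vix + Suc k * n = n * n \<and> agr ?X ?A s s''" "var s'' vi = k"
      then show "dspec \<theta> (Assign vix (Plus (V vix) (V vn))) s'' 1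
         (\<lambda>s'. (var s' vix + k * n = n * n \<and> agr ?X ?A s s') \<and> var s' vi = k)"
        using vn[of s''] by (intro det_Assign) auto
    qed (use I n' in auto)
    then show ?thesis unfolding n' by simp
  qed
  let ?s0 = "set_var vix (aval (N 0) s) s"
  show ?thesis
    unfolding edges_com_def n_def[symmetric]
  proof (rule spec_Assign_Seq_le, simp, rule spec_Seq_det_le[OF ixl])
    fix s1 assume s1: "var s1 vix = n * n \<and> agr ?X ?A s s1"
    have T: "10 + n * (6 + n * 13) \<le> 20 + n * (20 + n * 15) - 2 - (3 + n * 4 + 1)"
      by (simp add: algebra_simps)
    show "spec \<theta> (Seq (Assign vm (N 0)) (For vi (V vn) (For vj (V vn) edge_com))) s1
       (20 + n * (20 + n * 15) - 2 - (3 + n * 4 + 1)) (return_pmf ())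
       (\<lambda>_ s'. (\<exists>es. elist es s' \<and> distinct es \<and> set es = {(a, b). b < a \<and> a < n \<and> {a, b} \<in> E}) \<and> agr ?X ?A s s')"
    proof (rule spec_mono[OF _ T], rule spec_Assign_Seq_le, simp, rule spec_mono[OF outer])
      show "3 + n * (6 + n * 13) \<le> 10 + n * (6 + n * 13) - 2" by simp
      show "(\<exists>es. elist es s' \<and> distinct es \<and> set es = {(a, b). b < a \<and> a < n \<and> {a, b} \<in> E}) \<and> agr ?X ?A s s'"
        if "Inv 0 0 s'" for s'
      proof -
        have "{(a, b). b < a \<and> a < n \<and> {a, b} \<in> E \<and> (0 < a \<or> a = 0 \<and> 0 \<le> b)} = {(a, b). b < a \<and> a < n \<and> {a, b} \<in> E}"
          by auto
        then show ?thesis using that unfolding Inv_def by auto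
      qed
    qed (use s1 in \<open>auto simp: elist_def\<close>)
  qed (auto simp: algebra_simps)
qed

section \<open>Component labels and the excess of a growing edge set\<close>

definition relabel :: com where
  "relabel = For vv (V vn) (If (Plus (Minus (Get 5 (V vv)) (V vy)) (Minus (V vy) (Get 5 (V vv)))) Skip (Put 5 (V vv) (V vx)))"

lemma dspec_relabel:
  "dspec \<theta> relabel s (3 + var s vn * 5)
    (\<lambda>s'. (\<forall>i<var s vn. arr s' 5 i = (if arr s 5 i = var s vy then var s vx else arr s 5 i)) \<and> agr {vv} {5} s s')"
proof -
  let ?n = "var s vn"
  define Q where "Q = (\<lambda>k s'. (\<forall>i<?n. arr s' 5 i = (if k \<le> i \<and> arr s 5 i = var s vy then var s vx else arr s 5 i)) \<and> agr {vv} {5} s s')"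
  have "dspec \<theta> relabel s (3 + aval (V vn) s * (2 + 3)) (Q 0)"
    unfolding relabel_def
  proof (rule det_For[where I = Q])
    fix k s' assume k: "k < aval (V vn) s" "Q (Suc k) s'" "var s' vv = k"
    then have q: "\<forall>i<?n. arr s' 5 i = (if Suc k \<le> i \<and> arr s 5 i = var s vy then var s vx else arr s 5 i)"
      and ag: "agr {vv} {5} s s'" by (auto simp: Q_def)
    have v: "var s' vy = var s vy" "var s' vx = var s vx" using ag by (auto simp: agr_def)
    have a: "arr s' 5 k = arr s 5 k" using q k by simp
    \<comment> \<open>With truncated subtraction, the sum of the two differences is nonzero exactly
      if the numbers differ.\<close>
    show "dspec \<theta> (If (Plus (Minus (Get 5 (V vv)) (V vy)) (Minus (V vy) (Get 5 (V vv)))) Skip (Put 5 (V vv) (V vx))) s' 2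
      (\<lambda>s'. Q k s' \<and> var s' vv = k)"
    proof (cases "arr s 5 k = var s vy")
      case True
      have "Q k (s'\<lparr>arr := (arr s')(5 := (arr s' 5)(k := var s vx))\<rparr>)"
        using q ag True k unfolding Q_def by auto
      then show ?thesis
        using True k a v by (intro spec_If_le) (auto intro!: det_Put_le)
    next
      case False
      have "Q k s'" using q ag False k(1) unfolding Q_def
        by (metis Suc_leI le_neq_implies_less less_imp_le Suc_le_lessD)
      then show ?thesis
        using False k a v by (intro spec_If_le) (auto intro!: det_Skip_le)
    qed
  qed (auto simp: Q_def)
  then show ?thesis by (rule spec_mono) (auto simp: Q_def)
qed

text \<open>The arrays 3 and 4 list \<open>S\<close> without repetition, as \<open>vs\<close> equals
  its cardinality. Two vertices have equal labels if and only if they are connected. This turns the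
  global quantity \<open>excess\<close> into a counter that can be updated edge by edge.\<close>

definition sinv :: "nat \<Rightarrow> nat set set \<Rightarrow> state \<Rightarrow> bool" where
  "sinv n S s \<longleftrightarrow> S = (\<lambda>k. {arr s 3 k, arr s 4 k}) ` {..<var s vs} \<and> var s vs = card S \<and>
     (\<forall>i<n. \<forall>j<n. arr s 5 i = arr s 5 j \<longleftrightarrow> conn S i j) \<and> var s vc = excess {..<n} S"

lemma sinv_set_var [simp]: "x \<noteq> vs \<Longrightarrow> x \<noteq> vc \<Longrightarrow> sinv n S (set_var x v s) \<longleftrightarrow> sinv n S s"
  by (simp add: sinv_def)

lemma sinv_agr:
  assumes "sinv n S s" "agr Xs As s s'" "vs \<notin> Xs" "vc \<notin> Xs" "3 \<notin> As" "4 \<notin> As" "5 \<notin> As"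
  shows "sinv n S s'"
proof -
  have eqs: "var s' vs = var s vs" "var s' vc = var s vc" "arr s' 3 = arr s 3" "arr s' 4 = arr s 4" "arr s' 5 = arr s 5"
    using assms(2-7) by (auto simp: agr_def)
  show ?thesis using assms(1) unfolding sinv_def eqs .
qed

lemma sinvI:
  "S = (\<lambda>k. {arr s 3 k, arr s 4 k}) ` {..<var s vs} \<Longrightarrow> var s vs = card S \<Longrightarrow>
   (\<And>i j. i < n \<Longrightarrow> j < n \<Longrightarrow> arr s 5 i = arr s 5 j \<longleftrightarrow> conn S i j) \<Longrightarrow> var s vc = excess {..<n} S \<Longrightarrow> sinv n S s"
  unfolding sinv_def by blast

lemma sinvD:
  assumes "sinv n S s"
  shows "S = (\<lambda>k. {arr s 3 k, arr s 4 k}) ` {..<var s vs}" "var s vs = card S"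
    "\<And>i j. i < n \<Longrightarrow> j < n \<Longrightarrow> arr s 5 i = arr s 5 j \<longleftrightarrow> conn S i j" "var s vc = excess {..<n} S"
  using assms unfolding sinv_def by blast+

definition add_com :: com where
  "add_com = Seq (Put 3 (V vs) (Get 1 (V vk))) (Seq (Put 4 (V vs) (Get 2 (V vk))) (Seq (Assign vs (Plus (V vs) (N 1)))
     (Seq (Assign vx (Get 5 (Get 1 (V vk)))) (Seq (Assign vy (Get 5 (Get 2 (V vk))))
       (If (Plus (Minus (V vx) (V vy)) (Minus (V vy) (V vx))) relabel (Assign vc (Plus (V vc) (N 1))))))))"

text \<open>Equal labels mean that the new edge closes a cycle, and exactly then
  \<open>excess_insert\<close> adds 1. Otherwise giving one class the label of the other merges them
  as \<open>conn_insert\<close> prescribes.\<close>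

lemma dspec_add:
  assumes S: "sinv n S s" and n: "var s vn = n" and uv: "arr s 1 (var s vk) = u" "arr s 2 (var s vk) = v"
    and sub: "insert {u, v} S \<subseteq> sedges {..<n}" "{u, v} \<notin> S"
  shows "dspec \<theta> add_com s (15 + n * 5) (\<lambda>s'. sinv n (insert {u, v} S) s' \<and> agr {vs, vx, vy, vc, vv} {3, 4, 5} s s')"
proof -
  let ?X = "{vs, vx, vy, vc, vv}" and ?A = "{3, 4, 5 :: nat}"
  have uvn: "u < n" "v < n" "u \<noteq> v" using sub(1) by (auto simp: sedges_iff)
  have finS: "finite S" using finite_edges[of "{..<n}" S] sub by simp
  let ?s1 = "s\<lparr>arr := (arr s)(3 := (arr s 3)(var s vs := u))\<rparr>"
  let ?s2 = "?s1\<lparr>arr := (arr ?s1)(4 := (arr ?s1 4)(var s vs := v))\<rparr>"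
  define t where "t = set_var vy (arr s 5 v) (set_var vx (arr s 5 u) (set_var vs (var s vs + 1) ?s2))"
  have ag: "agr ?X ?A s t" unfolding t_def by simp
  have t: "var t vs = var s vs + 1" "var t vx = arr s 5 u" "var t vy = arr s 5 v" "var t vc = var s vc"
    "arr t 3 = (arr s 3)(var s vs := u)" "arr t 4 = (arr s 4)(var s vs := v)" "arr t 5 = arr s 5" "var t vn = n"
    unfolding t_def using n by auto
  have "S = (\<lambda>k. {arr t 3 k, arr t 4 k}) ` {..<var s vs}"
    by (subst sinvD(1)[OF S], rule image_cong) (auto simp: t)
  moreover have "(\<lambda>k. {arr t 3 k, arr t 4 k}) ` {..<var t vs} =
      insert {u, v} ((\<lambda>k. {arr t 3 k, arr t 4 k}) ` {..<var s vs})"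
    unfolding t by (simp add: lessThan_Suc)
  ultimately have img: "insert {u, v} S = (\<lambda>k. {arr t 3 k, arr t 4 k}) ` {..<var t vs}" by metis
  have cd: "var t vs = card (insert {u, v} S)" using sinvD(2)[OF S] finS sub(2) t(1) by simp
  have ex: "excess {..<n} (insert {u, v} S) = excess {..<n} S + of_bool (conn S u v)"
    using sub by (intro excess_insert) auto
  note lab = sinvD(3)[OF S]
  have fin: "dspec \<theta> (If (Plus (Minus (V vx) (V vy)) (Minus (V vy) (V vx))) relabel (Assign vc (Plus (V vc) (N 1)))) t (4 + n * 5)
     (\<lambda>s'. sinv n (insert {u, v} S) s' \<and> agr ?X ?A s s')"
  proof (cases "conn S u v")
    case True
    then have eq: "arr s 5 u = arr s 5 v" using lab uvn by simp
    have cn: "conn (insert {u, v} S) i j \<longleftrightarrow> conn S i j" for i j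
      unfolding conn_insert using True by (meson conn_sym conn_trans)
    have "sinv n (insert {u, v} S) (set_var vc (var t vc + 1) t)"
    proof (rule sinvI)
      show "arr (set_var vc (var t vc + 1) t) 5 i = arr (set_var vc (var t vc + 1) t) 5 j \<longleftrightarrow> conn (insert {u, v} S) i j"
        if "i < n" "j < n" for i j using lab[OF that] t(7) cn by simp
    qed (use img cd ex True t(4) sinvD(4)[OF S] in simp_all)
    moreover have "aval (Plus (Minus (V vx) (V vy)) (Minus (V vy) (V vx))) t = 0" using eq t by simp
    ultimately show ?thesis
      by (intro spec_If_le) (use ag in \<open>auto intro!: det_Assign_le\<close>)
  next
    case False
    then have ne: "arr s 5 u \<noteq> arr s 5 v" using lab uvn by simp
    have "dspec \<theta> relabel t (3 + n * 5) (\<lambda>s'. sinv n (insert {u, v} S) s' \<and> agr ?X ?A s s')"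
    proof (rule spec_mono[OF dspec_relabel])
      fix s' assume "(\<forall>i<var t vn. arr s' 5 i = (if arr t 5 i = var t vy then var t vx else arr t 5 i)) \<and> agr {vv} {5} t s'"
      then have l: "\<And>i. i < n \<Longrightarrow> arr s' 5 i = (if arr s 5 i = arr s 5 v then arr s 5 u else arr s 5 i)"
        and a: "agr {vv} {5} t s'" using t by auto
      have l2: "arr s' 5 i = arr s' 5 j \<longleftrightarrow> conn (insert {u, v} S) i j" if "i < n" "j < n" for i j
        unfolding l[OF that(1)] l[OF that(2)] conn_insert
        unfolding lab[OF that, symmetric] lab[OF that(1) uvn(1), symmetric] lab[OF uvn(2) that(2), symmetric]
          lab[OF that(1) uvn(2), symmetric] lab[OF uvn(1) that(2), symmetric]
        using ne by auto
      have e: "var s' vs = var t vs" "var s' vc = var t vc" "arr s' 3 = arr t 3" "arr s' 4 = arr t 4"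
        using a by (auto simp: agr_def)
      have "sinv n (insert {u, v} S) s'"
        by (rule sinvI) (use img cd ex False t(4) sinvD(4)[OF S] l2 in \<open>simp_all add: e\<close>)
      moreover have "agr ?X ?A s s'" by (rule agr_trans[OF ag a]) auto
      ultimately show "sinv n (insert {u, v} S) s' \<and> agr ?X ?A s s'" by simp
    qed (use t in auto)
    moreover have "aval (Plus (Minus (V vx) (V vy)) (Minus (V vy) (V vx))) t \<noteq> 0" using ne t by auto
    ultimately show ?thesis by (intro spec_If_le) auto
  qed
  let ?p1 = "s\<lparr>arr := (arr s)(3 := (arr s 3)(aval (V vs) s := aval (Get 1 (V vk)) s))\<rparr>"
  let ?p2 = "?p1\<lparr>arr := (arr ?p1)(4 := (arr ?p1 4)(aval (V vs) ?p1 := aval (Get 2 (V vk)) ?p1))\<rparr>"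
  let ?p3 = "set_var vs (aval (Plus (V vs) (N 1)) ?p2) ?p2"
  let ?p4 = "set_var vx (aval (Get 5 (Get 1 (V vk))) ?p3) ?p3"
  have tt: "set_var vy (aval (Get 5 (Get 2 (V vk))) ?p4) ?p4 = t"
    unfolding t_def using uv by simp
  have "dspec \<theta> add_com s (Suc (Suc (Suc (Suc (Suc (Suc (Suc (Suc (Suc (Suc (4 + n * 5)))))))))))
     (\<lambda>s'. sinv n (insert {u, v} S) s' \<and> agr ?X ?A s s')"
    unfolding add_com_def
    by (rule spec_Put_Seq, rule spec_Put_Seq, rule spec_Assign_Seq, rule spec_Assign_Seq, rule spec_Assign_Seq,
        subst tt, rule fin)
  then show ?thesis by (rule spec_mono) auto
qed

section \<open>Proposal, acceptance and repetition\<close>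

definition coin :: "nat \<Rightarrow> nat \<Rightarrow> bool pmf" where
  "coin K t = map_pmf (\<lambda>u. u < t) (pmf_of_set {..<2 ^ K})"

definition sample_com :: com where
  "sample_com = For vk (V vm) (Seq flips (If (Minus (V vt) (V vu)) add_com Skip))"

definition sample :: "nat \<Rightarrow> nat \<Rightarrow> (nat \<Rightarrow> nat set) \<Rightarrow> nat \<Rightarrow> nat set set \<Rightarrow> nat set set pmf" where
  "sample K t ed = iter (\<lambda>k S. map_pmf (\<lambda>b. if b then insert (ed k) S else S) (coin K t))"

abbreviation (input) "mvars \<equiv> {vs, vx, vy, vc, vv, vk, vu, vb, vd :: nat}"

lemma spec_sample:
  assumes el: "elist es s" and n: "var s vn = n" and S: "sinv n {} s" and dist: "distinct es"
    and ord: "\<And>a b. (a, b) \<in> set es \<Longrightarrow> b < a \<and> a < n"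
  defines "ed \<equiv> \<lambda>k. {fst (es ! k), snd (es ! k)}"
  shows "spec \<theta> sample_com s (3 + length es * (25 + 6 * var s vK + n * 5)) (sample (var s vK) (var s vt) ed (length es) {})
    (\<lambda>S s'. sinv n S s' \<and> S \<subseteq> ed ` {..<length es} \<and> agr mvars {3, 4, 5} s s')"
proof -
  define m where "m = length es"
  define K where "K = var s vK"
  let ?A = "{3, 4, 5 :: nat}"
  have av: "aval (V vm) s = m" using el by (simp add: elist_def m_def)
  have edn: "ed k = ed l \<Longrightarrow> k = l" if "k < m" "l < m" for k l
  proof -
    assume eq: "ed k = ed l"
    have "es ! k \<in> set es" "es ! l \<in> set es" using that by (auto simp: m_def)
    then have "snd (es ! k) < fst (es ! k)" "snd (es ! l) < fst (es ! l)" using ord by (metis prod.collapse)+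
    then have "es ! k = es ! l" using eq unfolding ed_def doubleton_eq_iff by (auto simp: prod_eq_iff)
    then show "k = l" using dist that by (simp add: nth_eq_iff_index_eq m_def)
  qed
  have edS: "ed k \<in> sedges {..<n}" if "k < m" for k
  proof -
    have "es ! k \<in> set es" using that by (auto simp: m_def)
    then have "snd (es ! k) < fst (es ! k)" "fst (es ! k) < n" using ord by (metis prod.collapse)+
    then show ?thesis unfolding ed_def by (simp add: sedges_iff)
  qed
  \<comment> \<open>The loop index descends, so all edges chosen so far have larger indices. As
    \<open>ed\<close> is injective, the edge under consideration is new.\<close>
  define I where "I = (\<lambda>k S s'. sinv n S s' \<and> S \<subseteq> ed ` {k..<m} \<and> agr mvars ?A s s')"
  have "spec \<theta> sample_com s (3 + aval (V vm) s * ((22 + 6 * K + n * 5) + 3)) (iter (\<lambda>k S. map_pmf (\<lambda>b. if b then insert (ed k) S else S) (coin K (var s vt))) (aval (V vm) s) {})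
    (\<lambda>S s'. I 0 S s')"
    unfolding sample_com_def
  proof (rule spec_For)
    show "I k S (set_var vk v s')" if "I k S s'" for k S s' v
      using that unfolding I_def by simp
    show "I (aval (V vm) s) {} s" unfolding I_def av using S by simp
    fix k S' s' assume k: "k < aval (V vm) s" "I (Suc k) S' s'" "var s' vk = k"
    have km: "k < m" using k av by simp
    have s': "sinv n S' s'" "S' \<subseteq> ed ` {Suc k..<m}" "agr mvars ?A s s'" using k(2) by (auto simp: I_def)
    have v': "var s' vK = K" "var s' vt = var s vt" "var s' vn = n"
      using s'(3) n by (auto simp: agr_def K_def)
    have new: "ed k \<notin> S'"
    proof
      assume "ed k \<in> S'"
      then obtain l where "ed k = ed l" "Suc k \<le> l" "l < m" using s'(2) by auto
      then show False using edn[of k l] km by simp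
    qed
    have "spec \<theta> (Seq flips (If (Minus (V vt) (V vu)) add_com Skip)) s' (Suc ((5 + var s' vK * 6) + (16 + n * 5))) (pmf_of_set {..<2 ^ var s' vK})
       (\<lambda>u s''. I k (if u < var s vt then insert (ed k) S' else S') s'' \<and> var s'' vk = k)"
    proof (rule spec_Seq_return[OF spec_flips])
      fix u s'' assume u: "var s'' vu = u \<and> agr {vu, vb, vd} {} s' s''"
      have s2: "sinv n S' s''" by (rule sinv_agr[OF s'(1) conjunct2[OF u]]) auto
      have a2: "agr mvars ?A s s''" by (rule agr_trans[OF s'(3) conjunct2[OF u]]) auto
      have v2: "var s'' vk = k" "var s'' vt = var s vt" "var s'' vn = n" "arr s'' 1 k = fst (es ! k)" "arr s'' 2 k = snd (es ! k)"
        using u a2 k(3) n el km by (auto simp: agr_def elist_def m_def)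
      show "dspec \<theta> (If (Minus (V vt) (V vu)) add_com Skip) s'' (16 + n * 5)
          (\<lambda>s''. I k (if u < var s vt then insert (ed k) S' else S') s'' \<and> var s'' vk = k)"
      proof (cases "u < var s vt")
        case True
        have "dspec \<theta> add_com s'' (15 + n * 5) (\<lambda>s3. sinv n (insert {fst (es ! k), snd (es ! k)} S') s3 \<and> agr {vs, vx, vy, vc, vv} {3, 4, 5} s'' s3)"
        proof (rule dspec_add[OF s2 v2(3)])
          have "S' \<subseteq> sedges {..<n}" using s'(2) edS by fastforce
          then show "insert {fst (es ! k), snd (es ! k)} S' \<subseteq> sedges {..<n}"
            using edS[OF km] unfolding ed_def by blast
          show "{fst (es ! k), snd (es ! k)} \<notin> S'" using new by (simp add: ed_def)
        qed (use v2 in auto)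
        then have "dspec \<theta> add_com s'' (15 + n * 5) (\<lambda>s''. I k (insert (ed k) S') s'' \<and> var s'' vk = k)"
        proof (rule spec_mono)
          fix s3 assume 3: "sinv n (insert {fst (es ! k), snd (es ! k)} S') s3 \<and> agr {vs, vx, vy, vc, vv} {3, 4, 5} s'' s3"
          have "agr mvars ?A s s3" by (rule agr_trans[OF a2 conjunct2[OF 3]]) auto
          moreover have "insert (ed k) S' \<subseteq> ed ` {k..<m}" using s'(2) km by (auto simp: Suc_le_eq)
          moreover have "var s3 vk = k" using 3 v2 by (auto simp: agr_def)
          ultimately show "I k (insert (ed k) S') s3 \<and> var s3 vk = k" using 3 unfolding I_def by (simp add: ed_def)
        qed simp
        then show ?thesis using True u v2 by (intro spec_If_le) auto
      next
        case False
        have "I k S' s''" unfolding I_def using s2 a2 s'(2) by (auto simp: Suc_le_eq)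
        then show ?thesis using False u v2 by (intro spec_If_le) (auto intro!: det_Skip_le)
      qed
    qed
    then have "spec \<theta> (Seq flips (If (Minus (V vt) (V vu)) add_com Skip)) s' (Suc ((5 + var s' vK * 6) + (16 + n * 5)))
       (map_pmf (\<lambda>u. if u < var s vt then insert (ed k) S' else S') (pmf_of_set {..<2 ^ var s' vK}))
       (\<lambda>S s''. I k S s'' \<and> var s'' vk = k)"
      by (rule spec_map)
    then show "spec \<theta> (Seq flips (If (Minus (V vt) (V vu)) add_com Skip)) s' (22 + 6 * K + n * 5)
       (map_pmf (\<lambda>b. if b then insert (ed k) S' else S') (coin K (var s vt)))
       (\<lambda>S s''. I k S s'' \<and> var s'' vk = k)"
      unfolding coin_def map_pmf_comp v'(1) by (rule spec_mono) auto
  qed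
  then have "spec \<theta> sample_com s (3 + m * ((22 + 6 * K + n * 5) + 3)) (sample K (var s vt) ed m {}) (\<lambda>S s'. I 0 S s')"
    unfolding sample_def av .
  then show ?thesis unfolding K_def m_def
    by (rule spec_mono) (auto simp: I_def m_def lessThan_atLeast0 algebra_simps)
qed

definition accept_com :: com where
  "accept_com = Seq (Assign vok (N 1)) (If (Minus (V vc) (V vL)) (Assign vok (N 0))
     (For vi (Minus (V vL) (V vc)) (Seq flips (If (Minus (V vr) (V vu)) Skip (Assign vok (N 0))))))"

text \<open>Acceptance requires \<open>L - c\<close> independent successes with probability close to
  \<open>1 / q\<close>, hence it has probability about \<open>q\<close> to the power
  \<open>c - L\<close>; the power itself is never computed. An excess above \<open>L\<close> is
  rejected outright, which truncates the distribution.\<close>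

definition accept :: "nat \<Rightarrow> nat \<Rightarrow> nat \<Rightarrow> nat \<Rightarrow> bool pmf" where
  "accept K r L c = (if L < c then return_pmf False
     else iter (\<lambda>_ ok. map_pmf (\<lambda>b. ok \<and> b) (coin K r)) (L - c) True)"

lemma spec_accept:
  "spec \<theta> accept_com s (10 + var s vL * (15 + 6 * var s vK)) (accept (var s vK) (var s vr) (var s vL) (var s vc))
    (\<lambda>ok s'. (var s' vok \<noteq> 0 \<longleftrightarrow> ok) \<and> agr {vok, vi, vu, vb, vd} {} s s')"
proof -
  let ?X = "{vok, vi, vu, vb, vd}"
  let ?s = "set_var vok 1 s"
  define L c K where "L = var s vL" and "c = var s vc" and "K = var s vK"
  have "spec \<theta> (If (Minus (V vc) (V vL)) (Assign vok (N 0))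
     (For vi (Minus (V vL) (V vc)) (Seq flips (If (Minus (V vr) (V vu)) Skip (Assign vok (N 0))))))
     ?s (8 + L * (15 + 6 * K)) (accept K (var s vr) L c) (\<lambda>ok s'. (var s' vok \<noteq> 0 \<longleftrightarrow> ok) \<and> agr ?X {} s s')"
  proof (rule spec_If_le, simp, cases "L < c")
    case True
    have "dspec \<theta> (Assign vok (N 0)) ?s (8 + L * (15 + 6 * K) - 1) (\<lambda>s'. s' = set_var vok 0 ?s)"
      by (rule det_Assign_le) auto
    then have "spec \<theta> (Assign vok (N 0)) ?s (8 + L * (15 + 6 * K) - 1) (return_pmf False)
        (\<lambda>ok s'. (var s' vok \<noteq> 0 \<longleftrightarrow> ok) \<and> agr ?X {} s s')"
      by (rule spec_return) auto
    then show "spec \<theta> (if aval (Minus (V vc) (V vL)) ?s \<noteq> 0 then Assign vok (N 0) else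
     For vi (Minus (V vL) (V vc)) (Seq flips (If (Minus (V vr) (V vu)) Skip (Assign vok (N 0)))))
     ?s (8 + L * (15 + 6 * K) - 1) (accept K (var s vr) L c) (\<lambda>ok s'. (var s' vok \<noteq> 0 \<longleftrightarrow> ok) \<and> agr ?X {} s s')"
      using True unfolding accept_def L_def c_def by simp
  next
    case False
    let ?e = "Minus (V vL) (V vc)"
    have av: "aval ?e ?s = L - c" by (simp add: L_def c_def)
    have "spec \<theta> (For vi ?e (Seq flips (If (Minus (V vr) (V vu)) Skip (Assign vok (N 0))))) ?s (3 + aval ?e ?s * ((8 + 6 * K) + 3))
      (iter (\<lambda>_ ok. map_pmf (\<lambda>b. ok \<and> b) (coin K (var s vr))) (aval ?e ?s) True)
      (\<lambda>ok s'. (var s' vok \<noteq> 0 \<longleftrightarrow> ok) \<and> agr ?X {} s s')"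
    proof (rule spec_For[where I = "\<lambda>k ok s'. (var s' vok \<noteq> 0 \<longleftrightarrow> ok) \<and> agr ?X {} s s'"])
      fix k ok s' assume a: "(var s' vok \<noteq> 0 \<longleftrightarrow> ok) \<and> agr ?X {} s s'" and k: "var s' vi = k"
      have v': "var s' vK = K" "var s' vr = var s vr" using a by (auto simp: agr_def K_def)
      have "spec \<theta> (Seq flips (If (Minus (V vr) (V vu)) Skip (Assign vok (N 0)))) s' (Suc ((5 + var s' vK * 6) + 2)) (pmf_of_set {..<2 ^ var s' vK})
        (\<lambda>u s''. ((var s'' vok \<noteq> 0 \<longleftrightarrow> ok \<and> u < var s vr) \<and> agr ?X {} s s'') \<and> var s'' vi = k)"
      proof (rule spec_Seq_return[OF spec_flips])
        fix u s'' assume u: "var s'' vu = u \<and> agr {vu, vb, vd} {} s' s''"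
        have "agr ?X {} s s''" by (rule agr_trans[OF conjunct2[OF a] conjunct2[OF u]]) auto
        moreover have "var s'' vok = var s' vok" "var s'' vi = k" "var s'' vr = var s vr" using u k v' by (auto simp: agr_def)
        ultimately show "dspec \<theta> (If (Minus (V vr) (V vu)) Skip (Assign vok (N 0))) s'' 2
          (\<lambda>s''. ((var s'' vok \<noteq> 0 \<longleftrightarrow> ok \<and> u < var s vr) \<and> agr ?X {} s s'') \<and> var s'' vi = k)"
          using a u by (intro spec_If_le) (auto intro!: det_Skip_le det_Assign_le)
      qed
      then have "spec \<theta> (Seq flips (If (Minus (V vr) (V vu)) Skip (Assign vok (N 0)))) s' (Suc ((5 + var s' vK * 6) + 2))
        (map_pmf (\<lambda>u. ok \<and> u < var s vr) (pmf_of_set {..<2 ^ var s' vK}))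
        (\<lambda>ok s''. ((var s'' vok \<noteq> 0 \<longleftrightarrow> ok) \<and> agr ?X {} s s'') \<and> var s'' vi = k)"
        by (rule spec_map)
      then show "spec \<theta> (Seq flips (If (Minus (V vr) (V vu)) Skip (Assign vok (N 0)))) s' (8 + 6 * K)
        (map_pmf (\<lambda>b. ok \<and> b) (coin K (var s vr)))
        (\<lambda>ok s''. ((var s'' vok \<noteq> 0 \<longleftrightarrow> ok) \<and> agr ?X {} s s'') \<and> var s'' vi = k)"
        unfolding coin_def map_pmf_comp v'(1) by (rule spec_mono) auto
    qed auto
    then have "spec \<theta> (For vi ?e (Seq flips (If (Minus (V vr) (V vu)) Skip (Assign vok (N 0))))) ?s (3 + (L - c) * ((8 + 6 * K) + 3))
      (accept K (var s vr) L c) (\<lambda>ok s'. (var s' vok \<noteq> 0 \<longleftrightarrow> ok) \<and> agr ?X {} s s')"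
      unfolding av accept_def using False by simp
    moreover have "3 + (L - c) * ((8 + 6 * K) + 3) \<le> 8 + L * (15 + 6 * K) - 1"
    proof -
      have "(L - c) * ((8 + 6 * K) + 3) \<le> L * (15 + 6 * K)" by (intro mult_mono) auto
      then show ?thesis by simp
    qed
    ultimately have "spec \<theta> (For vi ?e (Seq flips (If (Minus (V vr) (V vu)) Skip (Assign vok (N 0))))) ?s (8 + L * (15 + 6 * K) - 1)
      (accept K (var s vr) L c) (\<lambda>ok s'. (var s' vok \<noteq> 0 \<longleftrightarrow> ok) \<and> agr ?X {} s s')"
      by (rule spec_mono) auto
    then show "spec \<theta> (if aval (Minus (V vc) (V vL)) ?s \<noteq> 0 then Assign vok (N 0) else
     For vi ?e (Seq flips (If (Minus (V vr) (V vu)) Skip (Assign vok (N 0)))))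
     ?s (8 + L * (15 + 6 * K) - 1) (accept K (var s vr) L c) (\<lambda>ok s'. (var s' vok \<noteq> 0 \<longleftrightarrow> ok) \<and> agr ?X {} s s')"
      using False unfolding L_def c_def by simp
  qed
  then show ?thesis
    unfolding accept_com_def L_def K_def c_def by (intro spec_Assign_Seq_le) auto
qed

definition trial_com :: com where
  "trial_com = Seq (For vi (V vn) (Put 5 (V vi) (V vi))) (Seq (Assign vc (N 0)) (Seq (Assign vs (N 0))
     (Seq sample_com accept_com)))"

definition trial :: "nat \<Rightarrow> nat \<Rightarrow> nat \<Rightarrow> nat \<Rightarrow> nat \<Rightarrow> (nat \<Rightarrow> nat set) \<Rightarrow> nat \<Rightarrow> (nat set set \<times> bool) pmf" where
  "trial K t r L n ed m = bind_pmf (sample K t ed m {}) (\<lambda>S. map_pmf (\<lambda>ok. (S, ok)) (accept K r L (excess {..<n} S)))"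

abbreviation (input) "tvars \<equiv> {vs, vx, vy, vc, vv, vk, vu, vb, vd, vok, vi :: nat}"

lemma spec_trial:
  assumes el: "elist es s" and n: "var s vn = n" and dist: "distinct es"
    and ord: "\<And>a b. (a, b) \<in> set es \<Longrightarrow> b < a \<and> a < n"
  defines "ed \<equiv> \<lambda>k. {fst (es ! k), snd (es ! k)}"
  shows "spec \<theta> trial_com s (30 + n * 4 + length es * (25 + 6 * var s vK + n * 5) + var s vL * (15 + 6 * var s vK))
    (trial (var s vK) (var s vt) (var s vr) (var s vL) n ed (length es))
    (\<lambda>(S, ok) s'. sinv n S s' \<and> S \<subseteq> ed ` {..<length es} \<and> (var s' vok \<noteq> 0 \<longleftrightarrow> ok) \<and> agr tvars {3, 4, 5} s s')"
proof -
  let ?A = "{3, 4, 5 :: nat}"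
  define K L m where "K = var s vK" and "L = var s vL" and "m = length es"
  define ts where "ts = 3 + m * (25 + 6 * K + n * 5)"
  define ta where "ta = 10 + L * (15 + 6 * K)"
  have init: "dspec \<theta> (For vi (V vn) (Put 5 (V vi) (V vi))) s (3 + n * (1 + 3)) (\<lambda>s'. (\<forall>i<n. arr s' 5 i = i) \<and> agr tvars ?A s s')"
  proof -
    have "dspec \<theta> (For vi (V vn) (Put 5 (V vi) (V vi))) s (3 + aval (V vn) s * (1 + 3)) (\<lambda>s'. (\<forall>i<n. 0 \<le> i \<longrightarrow> arr s' 5 i = i) \<and> agr tvars ?A s s')"
    proof (rule det_For[where I = "\<lambda>k s'. (\<forall>i<n. k \<le> i \<longrightarrow> arr s' 5 i = i) \<and> agr tvars ?A s s'"])
      fix k s' assume "(\<forall>i<n. Suc k \<le> i \<longrightarrow> arr s' 5 i = i) \<and> agr tvars ?A s s'" "var s' vi = k"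
      then show "dspec \<theta> (Put 5 (V vi) (V vi)) s' 1 (\<lambda>s'. ((\<forall>i<n. k \<le> i \<longrightarrow> arr s' 5 i = i) \<and> agr tvars ?A s s') \<and> var s' vi = k)"
        by (intro det_Put) (auto simp: Suc_le_eq)
    qed (use n in auto)
    then show ?thesis using n by simp
  qed
  have "spec \<theta> trial_com s (Suc (3 + n * (1 + 3) + Suc (Suc (Suc (Suc (Suc (ts + ta)))))))
    (trial K (var s vt) (var s vr) L n ed m)
    (\<lambda>(S, ok) s'. sinv n S s' \<and> S \<subseteq> ed ` {..<m} \<and> (var s' vok \<noteq> 0 \<longleftrightarrow> ok) \<and> agr tvars ?A s s')"
    unfolding trial_com_def
  proof (rule spec_Seq_det[OF init], rule spec_Assign_Seq, rule spec_Assign_Seq)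
    fix s1 assume s1: "(\<forall>i<n. arr s1 5 i = i) \<and> agr tvars ?A s s1"
    let ?s2 = "set_var vs (aval (N 0) (set_var vc (aval (N 0) s1) s1)) (set_var vc (aval (N 0) s1) s1)"
    have conn0: "conn {} i j \<longleftrightarrow> i = j" for i j :: nat by (simp add: conn_def adj_def)
    have i2: "sinv n {} ?s2" by (rule sinvI) (use s1 in \<open>simp_all add: conn0\<close>)
    have a2: "agr tvars ?A s ?s2" using s1 by simp
    have v2: "var ?s2 vn = n" "var ?s2 vK = K" "var ?s2 vt = var s vt" "elist es ?s2"
      using a2 n el by (auto simp: agr_def K_def elist_def)
    have smp: "spec \<theta> sample_com ?s2 ts (sample K (var s vt) ed m {})
      (\<lambda>S s'. sinv n S s' \<and> S \<subseteq> ed ` {..<m} \<and> agr mvars ?A ?s2 s')"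
      using spec_sample[OF v2(4,1) i2 dist ord, of \<theta>] unfolding v2(2,3) ts_def m_def ed_def .
    show "spec \<theta> (Seq sample_com accept_com) ?s2 (Suc (ts + ta)) (trial K (var s vt) (var s vr) L n ed m)
      (\<lambda>(S, ok) s'. sinv n S s' \<and> S \<subseteq> ed ` {..<m} \<and> (var s' vok \<noteq> 0 \<longleftrightarrow> ok) \<and> agr tvars ?A s s')"
      unfolding trial_def
    proof (rule spec_Seq[OF smp])
      fix S s3 assume s3: "sinv n S s3 \<and> S \<subseteq> ed ` {..<m} \<and> agr mvars ?A ?s2 s3"
      have a3: "agr tvars ?A s s3" by (rule agr_trans[OF a2 conjunct2[OF conjunct2[OF s3]]]) auto
      have v3: "var s3 vK = K" "var s3 vL = L" "var s3 vr = var s vr"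
        using a3 by (auto simp: agr_def K_def L_def)
      have v3c: "var s3 vc = excess {..<n} S" using s3 unfolding sinv_def by blast
      have "spec \<theta> accept_com s3 ta (accept K (var s vr) L (excess {..<n} S))
        (\<lambda>ok s'. (var s' vok \<noteq> 0 \<longleftrightarrow> ok) \<and> agr {vok, vi, vu, vb, vd} {} s3 s')"
        using spec_accept[of \<theta> s3] unfolding v3 v3c ta_def .
      then show "spec \<theta> accept_com s3 ta (map_pmf (Pair S) (accept K (var s vr) L (excess {..<n} S)))
       (\<lambda>(S, ok) s'. sinv n S s' \<and> S \<subseteq> ed ` {..<m} \<and> (var s' vok \<noteq> 0 \<longleftrightarrow> ok) \<and> agr tvars ?A s s')"
      proof (rule spec_map)
        fix ok s4 assume s4: "(var s4 vok \<noteq> 0 \<longleftrightarrow> ok) \<and> agr {vok, vi, vu, vb, vd} {} s3 s4"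
        have "sinv n S s4" by (rule sinv_agr[OF conjunct1[OF s3] conjunct2[OF s4]]) auto
        moreover have "agr tvars ?A s s4" by (rule agr_trans[OF a3 conjunct2[OF s4]]) auto
        ultimately show "(case (S, ok) of (S, ok) \<Rightarrow> \<lambda>s'. sinv n S s' \<and> S \<subseteq> ed ` {..<m} \<and> (var s' vok \<noteq> 0 \<longleftrightarrow> ok) \<and> agr tvars ?A s s') s4"
          using s3 s4 by simp
      qed
    qed
  qed
  then show ?thesis unfolding K_def L_def m_def ts_def ta_def
    by (rule spec_mono) auto
qed

text \<open>If all trials fail, the last proposal is returned. Its law does not matter, because this
  happens with small probability, but it is still a set of edges of the graph.\<close>

fun rej :: "('a \<times> bool) pmf \<Rightarrow> nat \<Rightarrow> 'a \<Rightarrow> 'a pmf" where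
  "rej Tr 0 S = return_pmf S"
| "rej Tr (Suc k) S = bind_pmf Tr (\<lambda>(S', ok). if ok then return_pmf S' else rej Tr k S')"

definition main_com :: com where
  "main_com = Seq (Assign vT (V vpw)) (While (V vT) (Seq (Assign vT (Minus (V vT) (N 1)))
     (Seq trial_com (If (V vok) (Assign vT (N 0)) Skip))))"

abbreviation (input) "avars \<equiv> {vs, vx, vy, vc, vv, vk, vu, vb, vd, vok, vi, vT :: nat}"

lemma spec_main:
  assumes el: "elist es s" and n: "var s vn = n" and dist: "distinct es"
    and ord: "\<And>a b. (a, b) \<in> set es \<Longrightarrow> b < a \<and> a < n" and pw: "var s vpw > 0"
  defines "ed \<equiv> \<lambda>k. {fst (es ! k), snd (es ! k)}"
  defines "Tr \<equiv> trial (var s vK) (var s vt) (var s vr) (var s vL) n ed (length es)"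
  shows "spec \<theta> main_com s (3 + var s vpw * (40 + n * 4 + length es * (25 + 6 * var s vK + n * 5) + var s vL * (15 + 6 * var s vK)))
    (rej Tr (var s vpw) {})
    (\<lambda>S s'. sinv n S s' \<and> S \<subseteq> ed ` {..<length es} \<and> agr avars {3, 4, 5} s s')"
proof -
  let ?A = "{3, 4, 5 :: nat}"
  define m where "m = length es"
  define tt where "tt = 30 + n * 4 + m * (25 + 6 * var s vK + n * 5) + var s vL * (15 + 6 * var s vK)"
  let ?B = "Seq (Assign vT (Minus (V vT) (N 1))) (Seq trial_com (If (V vok) (Assign vT (N 0)) Skip))"
  define G where "G = (\<lambda>S s'. sinv n S s' \<and> S \<subseteq> ed ` {..<m} \<and> agr avars ?A s s')"
  have body: "spec \<theta> ?B s' (tt + 7) Tr (\<lambda>(S, ok) s''. G S s'' \<and> var s'' vT = (if ok then 0 else k))"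
    if k: "var s' vT = Suc k" and a: "agr avars ?A s s'" for k s'
  proof -
    let ?s = "set_var vT (aval (Minus (V vT) (N 1)) s') s'"
    have a': "agr avars ?A s ?s" using a by simp
    have v: "elist es ?s" "var ?s vn = n" "var ?s vK = var s vK" "var ?s vt = var s vt" "var ?s vr = var s vr" "var ?s vL = var s vL"
      using a' el n by (auto simp: agr_def elist_def)
    have tr: "spec \<theta> trial_com ?s tt Tr
      (\<lambda>(S, ok) s'. sinv n S s' \<and> S \<subseteq> ed ` {..<m} \<and> (var s' vok \<noteq> 0 \<longleftrightarrow> ok) \<and> agr tvars ?A ?s s')"
      using spec_trial[OF v(1,2) dist ord, of \<theta>] unfolding v(3-6) tt_def Tr_def ed_def m_def .
    have "spec \<theta> (Seq trial_com (If (V vok) (Assign vT (N 0)) Skip)) ?s (Suc (tt + 2)) Tr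
        (\<lambda>z s''. G (fst z) s'' \<and> var s'' vT = (if snd z then 0 else k))"
    proof (rule spec_Seq_return[OF tr])
      fix z s3
      assume "(case z of (S, ok) \<Rightarrow> \<lambda>s'. sinv n S s' \<and> S \<subseteq> ed ` {..<m} \<and> (var s' vok \<noteq> 0 \<longleftrightarrow> ok) \<and> agr tvars ?A ?s s') s3"
      then have z: "sinv n (fst z) s3" "fst z \<subseteq> ed ` {..<m}" "var s3 vok \<noteq> 0 \<longleftrightarrow> snd z" "agr tvars ?A ?s s3"
        by (auto simp: case_prod_unfold)
      have "agr avars ?A s s3" by (rule agr_trans[OF a' z(4)]) auto
      then have G3: "G (fst z) s3" unfolding G_def using z by blast
      have G4: "G (fst z) (set_var vT v s3)" for v using G3 unfolding G_def by simp
      have T3: "var s3 vT = k" using z(4) k by (auto simp: agr_def)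
      show "dspec \<theta> (If (V vok) (Assign vT (N 0)) Skip) s3 2 (\<lambda>s''. G (fst z) s'' \<and> var s'' vT = (if snd z then 0 else k))"
        using z(3) G3 G4 T3 by (intro spec_If_le) (auto intro!: det_Skip_le det_Assign_le)
    qed
    then have "spec \<theta> ?B s' (Suc (Suc (Suc (tt + 2)))) Tr (\<lambda>z s''. G (fst z) s'' \<and> var s'' vT = (if snd z then 0 else k))"
      by (rule spec_Assign_Seq)
    then show ?thesis by (rule spec_mono) auto
  qed
  \<comment> \<open>The stored set has to match \<open>S\<close> only when the loop is about to end:
    before the first trial nothing is stored, and each trial starts afresh.\<close>
  have loop: "spec \<theta> (While (V vT) ?B) s' (1 + k * (tt + 10)) (rej Tr k S) G"
    if "var s' vT = k" "agr avars ?A s s'" "k = 0 \<Longrightarrow> G S s'" for k S s'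
    using that
  proof (induction k arbitrary: s' S)
    case 0
    then show ?case by (auto intro!: spec_While_0[unfolded One_nat_def])
  next
    case (Suc k)
    have "spec \<theta> (While (V vT) ?B) s' (Suc ((tt + 7) + (1 + k * (tt + 10)))) (rej Tr (Suc k) S) G"
      unfolding rej.simps
    proof (rule spec_While_Suc[OF _ body[OF Suc.prems(1,2)]])
      show "aval (V vT) s' \<noteq> 0" using Suc.prems by simp
      fix z s3 assume "(case z of (S, ok) \<Rightarrow> \<lambda>s''. G S s'' \<and> var s'' vT = (if ok then 0 else k)) s3"
      then have z: "G (fst z) s3" "var s3 vT = (if snd z then 0 else k)" by (auto simp: case_prod_unfold)
      have a3: "agr avars ?A s s3" using z(1) by (simp add: G_def)
      show "spec \<theta> (While (V vT) ?B) s3 (1 + k * (tt + 10)) (case z of (S', ok) \<Rightarrow> if ok then return_pmf S' else rej Tr k S') G"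
      proof (cases "snd z")
        case True
        have "spec \<theta> (While (V vT) ?B) s3 1 (return_pmf (fst z)) G"
          using z True by (intro spec_While_0) auto
        then have "spec \<theta> (While (V vT) ?B) s3 (1 + k * (tt + 10)) (return_pmf (fst z)) G"
          by (rule spec_mono) auto
        then show ?thesis using True by (simp add: case_prod_unfold)
      next
        case False
        have "spec \<theta> (While (V vT) ?B) s3 (1 + k * (tt + 10)) (rej Tr k (fst z)) G"
          using z False a3 by (intro Suc.IH) auto
        then show ?thesis using False by (simp add: case_prod_unfold)
      qed
    qed
    then show ?case by (rule spec_mono) auto
  qed
  have "spec \<theta> (While (V vT) ?B) (set_var vT (aval (V vpw) s) s) (1 + var s vpw * (tt + 10)) (rej Tr (var s vpw) {}) G"
    using pw by (intro loop) auto
  then have "spec \<theta> main_com s (Suc (Suc (1 + var s vpw * (tt + 10)))) (rej Tr (var s vpw) {}) G"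
    unfolding main_com_def by (rule spec_Assign_Seq)
  then show ?thesis
    by (rule spec_mono) (auto simp: G_def tt_def m_def algebra_simps)
qed

definition print_com :: com where
  "print_com = For vk (V vs) (Seq (Print (Get 3 (V vk))) (Print (Get 4 (V vk))))"

lemma decode_edges_concat:
  "decode_edges (concat (map (\<lambda>i. [f i, g i]) xs)) = (\<lambda>i. {f i, g i}) ` set xs"
  by (induction xs) auto

lemma dspec_print:
  assumes S: "sinv n S s" and pr: "printed s = []"
  shows "dspec \<theta> print_com s (3 + card S * 6) (\<lambda>s'. decode_edges (printed s') = S)"
proof -
  define m where "m = var s vs"
  define Q where "Q = (\<lambda>k (s' :: state). printed s' = concat (map (\<lambda>i. [arr s 3 i, arr s 4 i]) (rev [k..<m])) \<and> arr s' = arr s)"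
  have "dspec \<theta> print_com s (3 + aval (V vs) s * (3 + 3)) (Q 0)"
    unfolding print_com_def
  proof (rule det_For[where I = Q])
    fix k s' assume k: "k < aval (V vs) s" "Q (Suc k) s'" "var s' vk = k"
    have rv: "rev [k..<m] = rev [Suc k..<m] @ [k]" using k(1) by (simp add: m_def upt_conv_Cons)
    have "dspec \<theta> (Seq (Print (Get 3 (V vk))) (Print (Get 4 (V vk)))) s' (Suc (1 + 1)) (\<lambda>s'. Q k s' \<and> var s' vk = k)"
    proof (rule spec_Seq_det[OF det_Print[where P = "\<lambda>t. t = s'\<lparr>printed := printed s' @ [aval (Get 3 (V vk)) s']\<rparr>"]])
      show "dspec \<theta> (Print (Get 4 (V vk))) t 1 (\<lambda>s'. Q k s' \<and> var s' vk = k)"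
        if "t = s'\<lparr>printed := printed s' @ [aval (Get 3 (V vk)) s']\<rparr>" for t
        unfolding that using k rv by (intro det_Print) (simp add: Q_def)
    qed simp
    then show "dspec \<theta> (Seq (Print (Get 3 (V vk))) (Print (Get 4 (V vk)))) s' 3 (\<lambda>s'. Q k s' \<and> var s' vk = k)"
      by (simp add: numeral_3_eq_3)
  qed (use pr in \<open>auto simp: Q_def m_def\<close>)
  then show ?thesis
  proof (rule spec_mono)
    show "3 + aval (V vs) s * (3 + 3) \<le> 3 + card S * 6" using sinvD(2)[OF S] by simp
    fix s' assume "Q 0 s'"
    then have "decode_edges (printed s') = (\<lambda>i. {arr s 3 i, arr s 4 i}) ` {..<m}"
      by (simp add: Q_def decode_edges_concat lessThan_atLeast0)
    then show "decode_edges (printed s') = S" using sinvD(1)[OF S] unfolding m_def by simp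
  qed
qed

text \<open>Multiplication by a constant of the program, unrolled into a sum.\<close>

primrec times :: "nat \<Rightarrow> aexp \<Rightarrow> aexp" where
  "times 0 e = N 0"
| "times (Suc k) e = Plus e (times k e)"

lemma aval_times [simp]: "aval (times k e) s = k * aval e s"
  by (induction k) auto

text \<open>\<open>vK\<close> is the precision in bits, \<open>2 ^ vK\<close> is also the number of trials, and \<open>vL\<close> is the largest
  excess that can be accepted.\<close>

definition prog :: "nat \<Rightarrow> nat \<Rightarrow> com" where
  "prog a b = Seq bits_com (Seq (Assign vK (times b (V vl))) (Seq (Assign vL (times a (V vl)))
     (Seq (Assign vpw (N 1)) (Seq (double vpw) (Seq (read vP 0) (Seq (read vQ 1)
     (Seq thresh_com (Seq edges_com (Seq main_com print_com)))))))))"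

lemma nth_concat_rows:
  "i < m \<Longrightarrow> j < n \<Longrightarrow> concat (map (\<lambda>i. map (f i) [0..<n]) [0..<m]) ! (i * n + j) = f i j"
proof (induction m)
  case (Suc m)
  have len: "length (concat (map (\<lambda>i. map (f i) [0..<n]) [0..<m])) = m * n"
    by (simp add: length_concat comp_def sum_list_triv)
  show ?case
  proof (cases "i < m")
    case True
    then have "(i + 1) * n \<le> m * n" by (intro mult_right_mono) auto
    then have "i * n + j < m * n" using Suc.prems(2) by simp
    then show ?thesis using Suc.IH True Suc.prems(2) len by (simp add: nth_append)
  next
    case False
    then have "i = m" using Suc.prems by simp
    then show ?thesis using len Suc.prems(2) by (simp add: nth_append)
  qed
qed simp

lemma encode_graph_nth:
  "i < n \<Longrightarrow> j < n \<Longrightarrow> encode_graph n E ! Suc (i * n + j) = of_bool ({i, j} \<in> E)"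
  unfolding encode_graph_def using nth_concat_rows[of i n j n "\<lambda>i j. of_bool ({i, j} \<in> E)"] by simp

lemma length_encode_graph: "length (encode_graph n E) = Suc (n * n)"
  unfolding encode_graph_def by (simp add: length_concat comp_def sum_list_triv)

definition prog_time :: "nat \<Rightarrow> nat \<Rightarrow> nat \<Rightarrow> nat" where
  "prog_time a b n = (let K = b * bitlen n; L = a * bitlen n in
     1000 + 5 * bitlen n + 100 * K + 15 * 2 ^ (3 * K) + n * (20 + n * 15) + 6 * (n * n)
     + 2 ^ K * (40 + n * 4 + (n * n) * (25 + 6 * K + n * 5) + L * (15 + 6 * K)))"

section \<open>The law of the proposal, and the whole program\<close>

lemma pmf_bind_bool:
  "pmf (bind_pmf c g) S = pmf c True * pmf (g True) S + (1 - pmf c True) * pmf (g False) S"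
proof -
  have "(\<Sum>b\<in>UNIV. pmf c b) = 1" by (rule sum_pmf_eq_1) auto
  then have "pmf c False = 1 - pmf c True" by (simp add: UNIV_bool)
  moreover have "pmf (bind_pmf c g) S = (\<Sum>b\<in>UNIV. pmf c b * pmf (g b) S)"
    unfolding pmf_bind by (subst integral_measure_pmf[of UNIV]) auto
  ultimately show ?thesis by (simp add: UNIV_bool)
qed

text \<open>As \<open>ed\<close> is injective and its values are not in \<open>S0\<close>, each
  reachable \<open>S\<close> stems from exactly one sequence of coin results, and its probability is
  a product.\<close>

lemma pmf_sample:
  fixes ed :: "nat \<Rightarrow> nat set" and K t :: nat
  assumes "inj_on ed {..<k}" "S0 \<inter> ed ` {..<k} = {}" "finite S0"
  defines "c \<equiv> pmf (coin K t) True"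
  shows "pmf (sample K t ed k S0) S = (if S0 \<subseteq> S \<and> S \<subseteq> S0 \<union> ed ` {..<k}
     then c ^ card (S - S0) * (1 - c) ^ (k - card (S - S0)) else 0)"
  using assms(1-3)
proof (induction k arbitrary: S0)
  case 0
  then show ?case by (auto simp: sample_def indicator_def)
next
  case (Suc k)
  let ?f = "ed k"
  have f: "?f \<notin> S0" "?f \<notin> ed ` {..<k}"
    using Suc.prems(2) by (auto dest!: inj_onD[OF Suc.prems(1)])
  have IH: "pmf (sample K t ed k S1) S = (if S1 \<subseteq> S \<and> S \<subseteq> S1 \<union> ed ` {..<k}
     then c ^ card (S - S1) * (1 - c) ^ (k - card (S - S1)) else 0)"
    if "S1 \<inter> ed ` {..<k} = {}" "finite S1" for S1
    using Suc.IH[OF _ that] Suc.prems(1) by (auto simp: inj_on_def)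
  have 1: "pmf (sample K t ed (Suc k) S0) S =
      c * pmf (sample K t ed k (insert ?f S0)) S + (1 - c) * pmf (sample K t ed k S0) S"
    unfolding sample_def c_def by (simp add: bind_map_pmf pmf_bind_bool)
  have im: "ed ` {..<Suc k} = insert ?f (ed ` {..<k})" by (simp add: lessThan_Suc)
  have fin: "finite S" if "S \<subseteq> S0 \<union> ed ` {..<Suc k}"
    by (rule finite_subset[OF that]) (use Suc.prems(3) in simp)
  have IH1: "pmf (sample K t ed k (insert ?f S0)) S = (if insert ?f S0 \<subseteq> S \<and> S \<subseteq> insert ?f S0 \<union> ed ` {..<k}
     then c ^ card (S - insert ?f S0) * (1 - c) ^ (k - card (S - insert ?f S0)) else 0)"
    by (rule IH) (use Suc.prems f in auto)
  have IH2: "pmf (sample K t ed k S0) S = (if S0 \<subseteq> S \<and> S \<subseteq> S0 \<union> ed ` {..<k}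
     then c ^ card (S - S0) * (1 - c) ^ (k - card (S - S0)) else 0)"
    by (rule IH) (use Suc.prems in auto)
  show ?case
  proof (cases "?f \<in> S")
    case True
    then have "\<not> S \<subseteq> S0 \<union> ed ` {..<k}" using f by auto
    then have z: "pmf (sample K t ed k S0) S = 0" unfolding IH2 by simp
    show ?thesis
    proof (cases "S0 \<subseteq> S \<and> S \<subseteq> S0 \<union> ed ` {..<Suc k}")
      case c: True
      then have c': "insert ?f S0 \<subseteq> S \<and> S \<subseteq> insert ?f S0 \<union> ed ` {..<k}" using True unfolding im by auto
      have "S - S0 = insert ?f (S - insert ?f S0)" using True f by auto
      then have cd: "card (S - S0) = Suc (card (S - insert ?f S0))"
        using fin c by (metis Diff_iff card_insert_disjoint finite_Diff insertI1)
      show ?thesis unfolding 1 z IH1 using c c' cd by simp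
    next
      case False
      then have "\<not> (insert ?f S0 \<subseteq> S \<and> S \<subseteq> insert ?f S0 \<union> ed ` {..<k})" using True unfolding im by auto
      then show ?thesis unfolding 1 z IH1 using False by auto
    qed
  next
    case F: False
    then have z: "pmf (sample K t ed k (insert ?f S0)) S = 0" unfolding IH1 by simp
    have eq: "S \<subseteq> S0 \<union> ed ` {..<Suc k} \<longleftrightarrow> S \<subseteq> S0 \<union> ed ` {..<k}" using F unfolding im by auto
    show ?thesis
    proof (cases "S0 \<subseteq> S \<and> S \<subseteq> S0 \<union> ed ` {..<k}")
      case True
      then have "card (S - S0) \<le> card (ed ` {..<k})" by (intro card_mono) auto
      also have "\<dots> \<le> k" using card_image_le[of "{..<k}" ed] by simp
      finally have "Suc k - card (S - S0) = Suc (k - card (S - S0))" by simp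
      then show ?thesis unfolding 1 z IH2 eq using True by simp
    next
      case False
      then show ?thesis unfolding 1 z IH2 eq by auto
    qed
  qed
qed

lemma pmf_sample_edges:
  fixes ed :: "nat \<Rightarrow> nat set"
  assumes "bij_betw ed {..<m} E"
  shows "pmf (sample K t ed m {}) S = (if S \<subseteq> E then pmf (coin K t) True ^ card S *
     (1 - pmf (coin K t) True) ^ (card E - card S) else 0)"
proof -
  have "inj_on ed {..<m}" "ed ` {..<m} = E" "card E = m"
    using assms bij_betw_same_card[OF assms] by (auto simp: bij_betw_def)
  then show ?thesis using pmf_sample[of ed m "{}" K t S] by simp
qed

text \<open>By \<open>pmf_sample_edges\<close> the law depends on the edge set alone and not on its
  enumeration. The program's list is known only to exist, so this is needed to name the output law
  in advance.\<close>

lemma trial_cong: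
  assumes "bij_betw ed {..<m} E" "bij_betw ed' {..<m'} E"
  shows "trial K t r L n ed m = trial K t r L n ed' m'"
proof -
  have "sample K t ed m {} = sample K t ed' m' {}"
    by (rule pmf_eqI) (simp add: pmf_sample_edges[OF assms(1)] pmf_sample_edges[OF assms(2)])
  then show ?thesis by (simp add: trial_def)
qed

lemma spec_prog:
  fixes a b n :: nat
  assumes E: "E \<subseteq> sedges {..<n}" and p: "0 \<le> p" "p < 1" and q: "q \<ge> 1"
  defines "K \<equiv> b * bitlen n" and "L \<equiv> a * bitlen n"
  defines "P \<equiv> nat \<lfloor>2 ^ K * p\<rfloor>" and "Q \<equiv> nat \<lfloor>2 ^ K * q\<rfloor>"
  defines "t \<equiv> P * 2 ^ (2 * K) div (P * 2 ^ K + (2 ^ K - P) * Q)" and "r \<equiv> 2 ^ (2 * K) div Q"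
  shows "\<exists>ed m. bij_betw ed {..<m} E \<and>
    spec [p, q] (prog a b) (init_state (encode_graph n E)) (prog_time a b n)
      (rej (trial K t r L n ed m) (2 ^ K) {}) (\<lambda>S s'. S \<subseteq> E \<and> decode_edges (printed s') = S)"
proof -
  let ?\<theta> = "[p, q]"
  define s0 where "s0 = init_state (encode_graph n E)"
  define edl where "edl = (\<lambda>es k. {fst (es ! k), snd (es ! k)} :: nat set)"
  have P: "P \<le> 2 ^ K"
  proof -
    have "2 ^ K * p \<le> 2 ^ K * 1" using p by (intro mult_left_mono) auto
    then have "\<lfloor>2 ^ K * p\<rfloor> \<le> \<lfloor>2 ^ K :: real\<rfloor>" by (intro floor_mono) simp
    then have "\<lfloor>2 ^ K * p\<rfloor> \<le> 2 ^ K" by simp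
    then show ?thesis unfolding P_def by (simp add: nat_le_iff)
  qed
  have Q: "Q > 0"
  proof -
    have "(1 :: real) \<le> 2 ^ K" by simp
    then have "1 * 1 \<le> 2 ^ K * q" using q by (intro mult_mono) auto
    then show ?thesis unfolding Q_def by simp
  qed
  have inp0: "arr s0 0 0 = n" unfolding s0_def init_state_def by (simp add: length_encode_graph) (simp add: encode_graph_def)
  have inp: "arr s0 0 (Suc (i * n + j)) = of_bool ({i, j} \<in> E)" if "i < n" "j < n" for i j
  proof -
    have "(i + 1) * n \<le> n * n" using that by (intro mult_right_mono) auto
    then have "i * n + j < n * n" using that by simp
    then show ?thesis unfolding s0_def init_state_def using encode_graph_nth[OF that] by (simp add: length_encode_graph)
  qed
  have tp0: "tape_pos s0 i = 0" "printed s0 = []" for i unfolding s0_def init_state_def by auto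
  define Z where "Z = {(a, b). b < a \<and> a < n \<and> {a, b} \<in> E}"
  define Good where "Good = (\<lambda>es s. elist es s \<and> distinct es \<and> set es = Z)"
  have finZ: "finite Z" by (rule finite_subset[of _ "{..<n} \<times> {..<n}"]) (auto simp: Z_def)
  have cZ: "card Z \<le> n * n"
  proof -
    have "card Z \<le> card ({..<n} \<times> {..<n})" by (rule card_mono) (auto simp: Z_def)
    then show ?thesis by simp
  qed
  have bij: "bij_betw (edl es) {..<length es} E" if es: "distinct es" "set es = Z" for es
  proof -
    have "bij_betw (\<lambda>k. es ! k) {..<length es} Z" using es by (simp add: bij_betw_nth lessThan_def)
    moreover have "bij_betw (\<lambda>(a, b). {a, b}) Z E"
    proof (rule bij_betw_imageI)
      show "inj_on (\<lambda>(a, b). {a, b}) Z" unfolding Z_def by (auto intro!: inj_onI simp: doubleton_eq_iff)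
      show "(\<lambda>(a, b). {a, b}) ` Z = E"
      proof (intro equalityI subsetI)
        fix e assume e: "e \<in> E"
        then obtain u v where uv: "e = {u, v}" "u < n" "v < n" "u \<noteq> v" using E by (auto simp: sedges_def)
        show "e \<in> (\<lambda>(a, b). {a, b}) ` Z"
        proof (cases "u < v")
          case True
          then have "(v, u) \<in> Z" using e uv by (simp add: Z_def insert_commute)
          then show ?thesis using uv by (force simp: insert_commute)
        next
          case False
          then have "(u, v) \<in> Z" using e uv by (simp add: Z_def)
          then show ?thesis using uv by force
        qed
      qed (auto simp: Z_def)
    qed
    ultimately have "bij_betw ((\<lambda>(a, b). {a, b}) \<circ> (\<lambda>k. es ! k)) {..<length es} E" by (rule bij_betw_trans)
    then show ?thesis unfolding edl_def comp_def case_prod_unfold .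
  qed
  obtain es0 where es0: "distinct es0" "set es0 = Z" using finite_distinct_list[OF finZ] by auto
  define m where "m = card Z"
  define D where "D = rej (trial K t r L n (edl es0) (length es0)) (2 ^ K) {}"
  define R where "R = (\<lambda>S (s' :: state). S \<subseteq> E \<and> decode_edges (printed s') = S)"
  define T9 where "T9 = 3 + 2 ^ K * (40 + n * 4 + m * (25 + 6 * K + n * 5) + L * (15 + 6 * K))"
  define St where "St = (\<lambda>s :: state. var s vn = n \<and> var s vK = K \<and> var s vL = L \<and> var s vpw = 2 ^ K \<and> printed s = [])"
  \<comment> \<open>The commands are treated from the last to the first, so that each step can cite
    the specification of everything that follows it. The law \<open>D\<close> refers to the fixed
    list \<open>es0\<close> instead of the list found by the program.\<close>
  have s9: "spec ?\<theta> (Seq main_com print_com) s (Suc (T9 + (3 + n * n * 6))) D R"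
    if s: "St s" "var s vt = t" "var s vr = r" "elist es s" "distinct es" "set es = Z" for s es
  proof -
    have v: "var s vn = n" "var s vK = K" "var s vL = L" "var s vpw = 2 ^ K" "printed s = []"
      using s(1) by (auto simp: St_def)
    have len: "length es = m" using s(5,6) distinct_card unfolding m_def by metis
    have b: "bij_betw (edl es) {..<m} E" using bij[OF s(5,6)] len by simp
    have "spec ?\<theta> main_com s T9 (rej (trial K t r L n (edl es) (length es)) (2 ^ K) {})
      (\<lambda>S s'. sinv n S s' \<and> S \<subseteq> edl es ` {..<length es} \<and> agr avars {3, 4, 5} s s')"
    proof -
      have ord: "b < a \<and> a < n" if "(a, b) \<in> set es" for a b using that s(6) by (simp add: Z_def)
      have "var s vpw > 0" using v by simp
      from spec_main[OF s(4) v(1) s(5) ord this, of ?\<theta>] show ?thesis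
        unfolding v s(2,3) T9_def len edl_def .
    qed
    moreover have "trial K t r L n (edl es) (length es) = trial K t r L n (edl es0) (length es0)"
      by (rule trial_cong[OF bij[OF s(5,6)] bij[OF es0]])
    ultimately have 1: "spec ?\<theta> main_com s T9 D (\<lambda>S s'. sinv n S s' \<and> S \<subseteq> edl es ` {..<m} \<and> agr avars {3, 4, 5} s s')"
      unfolding D_def len by simp
    show ?thesis
    proof (rule spec_Seq_return[OF 1])
      fix S s' assume S: "sinv n S s' \<and> S \<subseteq> edl es ` {..<m} \<and> agr avars {3, 4, 5} s s'"
      have SE: "S \<subseteq> E" using S b by (auto simp: bij_betw_def)
      have "card S \<le> card (edl es ` {..<m})" using S by (intro card_mono) auto
      also have "\<dots> \<le> m" using card_image_le[of "{..<m}" "edl es"] by simp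
      finally have "card S \<le> n * n" using cZ m_def by simp
      moreover have "printed s' = []" using S v by (auto simp: agr_def)
      ultimately show "dspec ?\<theta> print_com s' (3 + n * n * 6) (R S)"
        using dspec_print[of n S s' ?\<theta>] S SE unfolding R_def by (auto intro: spec_mono)
    qed
  qed
  define Te where "Te = 20 + n * (20 + n * 15)"
  have s8: "spec ?\<theta> (Seq edges_com (Seq main_com print_com)) s (Suc (Te + Suc (T9 + (3 + n * n * 6)))) D R"
    if s: "St s" "var s vt = t" "var s vr = r" "arr s 0 = arr s0 0" for s
  proof -
    have "var s vn = n" using s(1) by (simp add: St_def)
    then have "dspec ?\<theta> edges_com s Te
      (\<lambda>s'. (\<exists>es. elist es s' \<and> distinct es \<and> set es = Z) \<and> agr {vi, vj, vm, vix} {1, 2} s s')"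
      using dspec_edges[of s E ?\<theta>] inp s(4) unfolding Z_def Te_def by simp
    then show ?thesis
    proof (rule spec_Seq_det)
      fix s' assume a: "(\<exists>es. elist es s' \<and> distinct es \<and> set es = Z) \<and> agr {vi, vj, vm, vix} {1, 2} s s'"
      then obtain es where es: "elist es s'" "distinct es" "set es = Z" by blast
      show "spec ?\<theta> (Seq main_com print_com) s' (Suc (T9 + (3 + n * n * 6))) D R"
        by (rule s9[OF _ _ _ es]) (use a s in \<open>auto simp: St_def agr_def\<close>)
    qed
  qed
  define Tt where "Tt = 100 + 20 * K + 15 * 2 ^ (3 * K)"
  have s7: "spec ?\<theta> (Seq thresh_com (Seq edges_com (Seq main_com print_com))) s
      (Suc (Tt + Suc (Te + Suc (T9 + (3 + n * n * 6))))) D R"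
    if s: "St s" "var s vP = P" "var s vQ = Q" "arr s = arr s0" for s
  proof -
    have v: "var s vK = K" "var s vpw = 2 ^ K" using s(1) by (auto simp: St_def)
    have "dspec ?\<theta> thresh_com s Tt (\<lambda>s'. var s' vt = t \<and> var s' vr = r \<and> agr {vden, vnum, vt, vr, vi} {} s s')"
      using dspec_thresh[of s ?\<theta>] s P Q unfolding v s(2,3) t_def r_def Tt_def by simp
    then show ?thesis
      by (rule spec_Seq_det) (rule s8; use s in \<open>auto simp: St_def agr_def\<close>)
  qed
  have s6: "spec ?\<theta> (Seq (read vQ 1) (Seq thresh_com (Seq edges_com (Seq main_com print_com)))) s
      (Suc ((5 + K * 6) + Suc (Tt + Suc (Te + Suc (T9 + (3 + n * n * 6)))))) D R"
    if s: "St s" "var s vP = P" "arr s = arr s0" "tape_pos s 1 = 0" for s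
  proof -
    have v: "var s vK = K" using s(1) by (auto simp: St_def)
    have r1: "dspec ?\<theta> (read vQ 1) s (5 + K * 6)
      (\<lambda>s'. var s' vQ = Q \<and> (\<forall>y. y \<notin> {vQ, vi, vd} \<longrightarrow> var s' y = var s y) \<and> arr s' = arr s \<and> printed s' = printed s \<and>
         (\<forall>i. i \<noteq> 1 \<longrightarrow> tape_pos s' i = tape_pos s i))"
      using dspec_read[of 1 ?\<theta> s vQ] s(4) q unfolding v Q_def by simp
    show ?thesis
      by (rule spec_Seq_det[OF r1]) (rule s7; use s in \<open>auto simp: St_def\<close>)
  qed
  have s5: "spec ?\<theta> (Seq (read vP 0) (Seq (read vQ 1) (Seq thresh_com (Seq edges_com (Seq main_com print_com))))) s
      (Suc ((5 + K * 6) + Suc ((5 + K * 6) + Suc (Tt + Suc (Te + Suc (T9 + (3 + n * n * 6))))))) D R"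
    if s: "St s" "arr s = arr s0" "tape_pos s = tape_pos s0" for s
  proof -
    have v: "var s vK = K" using s(1) by (auto simp: St_def)
    have r1: "dspec ?\<theta> (read vP 0) s (5 + K * 6)
      (\<lambda>s'. var s' vP = P \<and> (\<forall>y. y \<notin> {vP, vi, vd} \<longrightarrow> var s' y = var s y) \<and> arr s' = arr s \<and> printed s' = printed s \<and>
         (\<forall>i. i \<noteq> 0 \<longrightarrow> tape_pos s' i = tape_pos s i))"
      using dspec_read[of 0 ?\<theta> s vP] s(3) tp0 p unfolding v P_def by simp
    show ?thesis
      by (rule spec_Seq_det[OF r1]) (rule s6; use s tp0 in \<open>auto simp: St_def\<close>)
  qed
  define T5 where "T5 = Suc ((5 + K * 6) + Suc ((5 + K * 6) + Suc (Tt + Suc (Te + Suc (T9 + (3 + n * n * 6))))))"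
  have s4: "spec ?\<theta> (Seq (double vpw) (Seq (read vP 0) (Seq (read vQ 1) (Seq thresh_com (Seq edges_com (Seq main_com print_com)))))) s
      (Suc ((3 + K * 4) + T5)) D R"
    if s: "var s vn = n" "var s vK = K" "var s vL = L" "var s vpw = 1" "printed s = []" "arr s = arr s0" "tape_pos s = tape_pos s0" for s
  proof -
    have r1: "dspec ?\<theta> (double vpw) s (3 + K * 4) (\<lambda>s'. var s' vpw = 2 ^ K \<and> agr {vpw, vi} {} s s')"
      using dspec_double[of vpw ?\<theta> s] unfolding s(2,4) by simp
    show ?thesis
      unfolding T5_def by (rule spec_Seq_det[OF r1]) (rule s5; use s in \<open>auto simp: St_def agr_def\<close>)
  qed
  have "spec ?\<theta> (prog a b) s0 (Suc ((7 + 5 * bitlen n) + Suc (Suc (Suc (Suc (Suc (Suc (Suc ((3 + K * 4) + T5))))))))) D R"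
    unfolding prog_def
  proof (rule spec_Seq_det[OF dspec_bits[of ?\<theta> s0, unfolded inp0]], rule spec_Assign_Seq, rule spec_Assign_Seq, rule spec_Assign_Seq, rule s4)
  qed (use tp0 in \<open>auto simp: agr_def K_def L_def\<close>)
  then have "spec ?\<theta> (prog a b) s0 (prog_time a b n) D R"
  proof (rule spec_mono)
    have "2 ^ K * (40 + n * 4 + m * (25 + 6 * K + n * 5) + L * (15 + 6 * K))
        \<le> 2 ^ K * (40 + n * 4 + (n * n) * (25 + 6 * K + n * 5) + L * (15 + 6 * K))"
      using cZ unfolding m_def by (intro mult_left_mono add_mono mult_right_mono order_refl) auto
    then show "Suc ((7 + 5 * bitlen n) + Suc (Suc (Suc (Suc (Suc (Suc (Suc ((3 + K * 4) + T5)))))))) \<le> prog_time a b n"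
      unfolding prog_time_def Let_def K_def[symmetric] L_def[symmetric] T5_def T9_def Te_def Tt_def by linarith
  qed auto
  then show ?thesis
    using bij[OF es0] unfolding D_def R_def s0_def by blast
qed

section \<open>Running time\<close>

text \<open>One number \<open>k\<close> serves as factor and as exponent, as in
  \<open>polynomial_time\<close>. The base \<open>n + 1\<close> avoids an exception for
  \<open>n = 0\<close>.\<close>

definition pbound :: "(nat \<Rightarrow> nat) \<Rightarrow> bool" where
  "pbound f \<longleftrightarrow> (\<exists>k. \<forall>n. f n \<le> k * (n + 1) ^ k)"

lemma pbound_mono: "pbound g \<Longrightarrow> (\<And>n. f n \<le> g n) \<Longrightarrow> pbound f"
  unfolding pbound_def by (meson le_trans)

lemma pbound_const: "pbound (\<lambda>_. c)"
  unfolding pbound_def by (intro exI[of _ c]) simp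

lemma pbound_id: "pbound (\<lambda>n. n)"
  unfolding pbound_def by (intro exI[of _ 1]) simp

lemma pbound_add:
  assumes "pbound f" "pbound g"
  shows "pbound (\<lambda>n. f n + g n)"
proof -
  obtain k l where k: "\<And>n. f n \<le> k * (n + 1) ^ k" and l: "\<And>n. g n \<le> l * (n + 1) ^ l"
    using assms unfolding pbound_def by auto
  have "f n + g n \<le> (k + l) * (n + 1) ^ (k + l)" for n
  proof -
    have "f n \<le> k * (n + 1) ^ (k + l)" "g n \<le> l * (n + 1) ^ (k + l)"
      using k[of n] l[of n] by (auto intro: order_trans[OF _ mult_left_mono[OF power_increasing]])
    then show ?thesis by (simp add: distrib_right)
  qed
  then show ?thesis unfolding pbound_def by blast
qed

lemma pbound_mult:
  assumes "pbound f" "pbound g"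
  shows "pbound (\<lambda>n. f n * g n)"
proof -
  obtain k l where k: "\<And>n. f n \<le> k * (n + 1) ^ k" and l: "\<And>n. g n \<le> l * (n + 1) ^ l"
    using assms unfolding pbound_def by auto
  have "f n * g n \<le> (k * l + k + l) * (n + 1) ^ (k * l + k + l)" for n
  proof -
    have "f n * g n \<le> (k * (n + 1) ^ k) * (l * (n + 1) ^ l)" by (intro mult_mono k l) auto
    also have "\<dots> = k * l * (n + 1) ^ (k + l)" by (simp add: power_add)
    also have "\<dots> \<le> (k * l + k + l) * (n + 1) ^ (k * l + k + l)"
      by (intro mult_mono power_increasing) auto
    finally show ?thesis .
  qed
  then show ?thesis unfolding pbound_def by blast
qed

lemma pbound_power: "pbound f \<Longrightarrow> pbound (\<lambda>n. f n ^ c)"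
  by (induction c) (auto intro: pbound_const pbound_mult)

lemma bitlen_le: "bitlen n \<le> n"
proof (induction n rule: bitlen.induct)
  case (1 n)
  then show ?case by (cases "n = 0") (auto simp: bitlen.simps[of n])
qed

lemma pbound_bits: "pbound (\<lambda>n. 2 ^ (c * bitlen n))"
proof -
  have "pbound (\<lambda>n. 2 ^ bitlen n)"
  proof (rule pbound_mono)
    show "pbound (\<lambda>n. 2 * n + 1)" by (intro pbound_add pbound_mult pbound_const pbound_id)
    show "2 ^ bitlen n \<le> 2 * n + 1" for n using bitlen_bounds(2)[of n] by (cases "n = 0") auto
  qed
  then have "pbound (\<lambda>n. (2 ^ bitlen n) ^ c)" by (rule pbound_power)
  then show ?thesis by (simp add: power_mult[symmetric] mult.commute)
qed

lemma pbound_prog_time: "pbound (prog_time a b)"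
proof -
  have l: "pbound (\<lambda>n. c * bitlen n)" for c
    by (rule pbound_mono[of "\<lambda>n. c * n"]) (auto intro: pbound_mult pbound_const pbound_id bitlen_le)
  have "pbound (\<lambda>n. 2 ^ (3 * (b * bitlen n)))" using pbound_bits[of "3 * b"] by (simp add: mult.assoc)
  then show ?thesis
    unfolding prog_time_def Let_def
    by (intro pbound_add pbound_mult pbound_const pbound_id l pbound_bits)
qed

lemma halts_within_mono: "halts_within \<theta> c w t \<Longrightarrow> t \<le> t' \<Longrightarrow> halts_within \<theta> c w t'"
  using run_halted[of \<theta> c w t t'] unfolding halts_within_def by simp

lemma polynomial_time_prog:
  assumes "0 \<le> p" "p < 1" "q \<ge> 1"
  shows "polynomial_time [p, q] (prog a b) graph_inputs"
proof -
  obtain k where k: "\<And>n. prog_time a b n \<le> k * (n + 1) ^ k" using pbound_prog_time unfolding pbound_def by blast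
  have "halts_within [p, q] (prog a b) w (k * length w ^ k + k)" if w0: "w \<in> graph_inputs" for w
  proof -
    obtain n E where w: "w = encode_graph n E" "E \<subseteq> sedges {..<n}"
      using w0 unfolding graph_inputs_def simple_graph_sedges by blast
    have h: "halts_within [p, q] (prog a b) w (prog_time a b n)"
      using spec_prog[OF w(2) assms, of a b] spec_program(1) unfolding w(1) by blast
    have "n \<le> n * n" by (cases n) auto
    then have "(n + 1) ^ k \<le> length w ^ k" unfolding w(1) length_encode_graph by (intro power_mono) auto
    then have "k * (n + 1) ^ k \<le> k * length w ^ k" by (rule mult_left_mono) simp
    then have "prog_time a b n \<le> k * length w ^ k + k" using k[of n] by linarith
    then show ?thesis using halts_within_mono h by blast
  qed
  then show ?thesis unfolding polynomial_time_def by blast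
qed

section \<open>Accuracy of rejection sampling\<close>

lemma prob_finite:
  assumes "finite B" "set_pmf \<mu> \<subseteq> B"
  shows "measure_pmf.prob \<mu> A = (\<Sum>z\<in>B. of_bool (z \<in> A) * pmf \<mu> z)"
proof -
  have "measure_pmf.prob \<mu> A = measure_pmf.prob \<mu> (A \<inter> B)"
    using assms(2) by (intro measure_pmf.finite_measure_eq_AE) (auto simp: AE_measure_pmf_iff)
  also have "\<dots> = (\<Sum>z\<in>A \<inter> B. pmf \<mu> z)" using assms(1) by (intro measure_measure_pmf_finite) auto
  also have "\<dots> = (\<Sum>z\<in>B. of_bool (z \<in> A) * pmf \<mu> z)"
    using assms(1) by (intro sum.mono_neutral_cong_left) auto
  finally show ?thesis .
qed

lemma prob_bind_finite:
  assumes "finite B" "set_pmf \<mu> \<subseteq> B"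
  shows "measure_pmf.prob (bind_pmf \<mu> F) A = (\<Sum>z\<in>B. pmf \<mu> z * measure_pmf.prob (F z) A)"
proof -
  have "measure_pmf.prob (bind_pmf \<mu> F) A = (\<integral>z. measure_pmf.prob (F z) A \<partial>measure_pmf \<mu>)"
    unfolding measure_pmf_bind
    by (subst measure_pmf.measure_bind[where N = "count_space UNIV"])
       (auto simp: space_subprob_algebra intro!: prob_space_imp_subprob_space measure_pmf.prob_space_axioms)
  also have "\<dots> = (\<Sum>z\<in>B. pmf \<mu> z * measure_pmf.prob (F z) A)"
    using assms by (subst integral_measure_pmf[of B]) auto
  finally show ?thesis .
qed

text \<open>The law of an accepted proposal is invariant: \<open>y = \<beta> + \<gamma> * y\<close>,
  where \<gamma> is the probability of rejection. So each further trial shrinks the deviation from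
  \<open>y\<close> by the factor \<gamma>, and at the start it is at most 1.\<close>

lemma prob_rej:
  assumes B: "finite B" "set_pmf Tr \<subseteq> B \<times> UNIV"
  defines "\<alpha> \<equiv> \<Sum>S\<in>B. pmf Tr (S, True)"
  assumes \<alpha>: "\<alpha> > 0"
  shows "\<bar>measure_pmf.prob (rej Tr k S0) A - (\<Sum>S\<in>B. of_bool (S \<in> A) * pmf Tr (S, True)) / \<alpha>\<bar> \<le> (1 - \<alpha>) ^ k"
proof -
  define \<beta> where "\<beta> = (\<Sum>S\<in>B. of_bool (S \<in> A) * pmf Tr (S, True))"
  define y where "y = \<beta> / \<alpha>"
  define \<gamma> where "\<gamma> = (\<Sum>S\<in>B. pmf Tr (S, False))"
  have fB: "finite (B \<times> (UNIV :: bool set))" using B by simp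
  have split: "(\<Sum>z\<in>B \<times> UNIV. g z) = (\<Sum>S\<in>B. g (S, True)) + (\<Sum>S\<in>B. g (S, False))" for g :: "_ \<Rightarrow> real"
  proof -
    have "(\<Sum>S\<in>B. \<Sum>b\<in>UNIV. g (S, b)) = (\<Sum>z\<in>B \<times> UNIV. g z)" by (simp add: sum.cartesian_product)
    then show ?thesis by (simp add: UNIV_bool sum.distrib add.commute)
  qed
  have tot: "\<alpha> + \<gamma> = 1"
    using sum_pmf_eq_1[OF fB B(2)] unfolding split \<alpha>_def \<gamma>_def .
  have "\<beta> \<le> \<alpha>" unfolding \<beta>_def \<alpha>_def by (intro sum_mono) auto
  moreover have "\<beta> \<ge> 0" unfolding \<beta>_def by (intro sum_nonneg) auto
  ultimately have y: "0 \<le> y" "y \<le> 1" unfolding y_def using \<alpha> by auto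
  have "\<bar>measure_pmf.prob (rej Tr k S0) A - y\<bar> \<le> \<gamma> ^ k"
  proof (induction k arbitrary: S0)
    case 0
    have "0 \<le> measure_pmf.prob (rej Tr 0 S0) A" "measure_pmf.prob (rej Tr 0 S0) A \<le> 1" by auto
    then show ?case using y unfolding power_0 abs_le_iff by linarith
  next
    case (Suc k)
    have "measure_pmf.prob (rej Tr (Suc k) S0) A =
        (\<Sum>S\<in>B. pmf Tr (S, True) * measure_pmf.prob (return_pmf S) A) + (\<Sum>S\<in>B. pmf Tr (S, False) * measure_pmf.prob (rej Tr k S) A)"
      unfolding rej.simps prob_bind_finite[OF fB B(2)] split by simp
    also have "(\<Sum>S\<in>B. pmf Tr (S, True) * measure_pmf.prob (return_pmf S) A) = \<beta>"
      unfolding \<beta>_def by (intro sum.cong refl) (auto simp: indicator_def)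
    finally have 1: "measure_pmf.prob (rej Tr (Suc k) S0) A = \<beta> + (\<Sum>S\<in>B. pmf Tr (S, False) * measure_pmf.prob (rej Tr k S) A)" .
    have "y = \<beta> + \<gamma> * y"
    proof -
      have "\<alpha> * y = \<beta>" unfolding y_def using \<alpha> by simp
      moreover have "y = (\<alpha> + \<gamma>) * y" using tot by simp
      ultimately show ?thesis by (simp add: distrib_right)
    qed
    then have "measure_pmf.prob (rej Tr (Suc k) S0) A - y = (\<Sum>S\<in>B. pmf Tr (S, False) * (measure_pmf.prob (rej Tr k S) A - y))"
      unfolding 1 \<gamma>_def by (simp add: sum_distrib_right right_diff_distrib sum_subtractf)
    also have "\<bar>\<dots>\<bar> \<le> (\<Sum>S\<in>B. \<bar>pmf Tr (S, False) * (measure_pmf.prob (rej Tr k S) A - y)\<bar>)" by (rule sum_abs)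
    also have "\<dots> \<le> (\<Sum>S\<in>B. pmf Tr (S, False) * \<gamma> ^ k)"
      using Suc.IH by (intro sum_mono) (auto simp: abs_mult intro!: mult_left_mono)
    also have "\<dots> = \<gamma> ^ Suc k" unfolding \<gamma>_def by (simp add: sum_distrib_right)
    finally show ?case .
  qed
  moreover have "\<gamma> = 1 - \<alpha>" using tot by simp
  ultimately show ?thesis unfolding y_def \<beta>_def by simp
qed

lemma pmf_coin:
  assumes "t \<le> 2 ^ K"
  shows "pmf (coin K t) True = real t / 2 ^ K"
proof -
  have "pmf (coin K t) True = measure_pmf.prob (pmf_of_set {..<2 ^ K}) {u. u < t}"
    unfolding coin_def pmf_map by (simp add: vimage_def)
  also have "\<dots> = real (card ({..<2 ^ K} \<inter> {u. u < t})) / real (card {..<2 ^ K :: nat})"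
    by (rule measure_pmf_of_set) (auto simp: lessThan_empty_iff)
  also have "{..<2 ^ K} \<inter> {u. u < t} = {..<t}" using assms by auto
  finally show ?thesis by simp
qed

lemma pmf_accept:
  "pmf (accept K r L c) True = (if c \<le> L then pmf (coin K r) True ^ (L - c) else 0)"
proof -
  have "pmf (iter (\<lambda>_ ok. map_pmf (\<lambda>b. ok \<and> b) (coin K r)) k ok) True = (if ok then pmf (coin K r) True ^ k else 0)" for k ok
    by (induction k arbitrary: ok) (auto simp: bind_map_pmf pmf_bind_bool indicator_def)
  then show ?thesis by (auto simp: accept_def)
qed

lemma pmf_bind_Pair:
  "pmf (bind_pmf \<mu> (\<lambda>S. map_pmf (\<lambda>b. (S, b)) (g S))) (S, b) = pmf \<mu> S * pmf (g S) b"
proof -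
  have "pmf (map_pmf (\<lambda>b. (S', b)) (g S')) (S, b) = indicator {S} S' * pmf (g S) b" for S'
  proof (cases "S' = S")
    case True
    have "inj (\<lambda>b. (S, b))" by (auto intro: injI)
    then show ?thesis using True pmf_map_inj'[of "\<lambda>b. (S, b)" "g S" b] by simp
  next
    case False
    then show ?thesis by (subst pmf_map_outside) auto
  qed
  then have "pmf (bind_pmf \<mu> (\<lambda>S. map_pmf (\<lambda>b. (S, b)) (g S))) (S, b) = (\<integral>S'. indicator {S} S' * pmf (g S) b \<partial>measure_pmf \<mu>)"
    unfolding pmf_bind by simp
  also have "\<dots> = pmf \<mu> S * pmf (g S) b" by (simp add: pmf.rep_eq)
  finally show ?thesis .
qed

lemma pmf_trial:
  assumes "bij_betw ed {..<m} E"
  shows "pmf (trial K t r L n ed m) (S, True) = (if S \<subseteq> E \<and> excess {..<n} S \<le> L then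
     pmf (coin K t) True ^ card S * (1 - pmf (coin K t) True) ^ (card E - card S) *
     pmf (coin K r) True ^ (L - excess {..<n} S) else 0)"
  unfolding trial_def pmf_bind_Pair pmf_sample_edges[OF assms] pmf_accept by simp

lemma set_trial:
  assumes "bij_betw ed {..<m} E"
  shows "set_pmf (trial K t r L n ed m) \<subseteq> Pow E \<times> UNIV"
proof -
  have "S \<subseteq> E" if "S \<in> set_pmf (sample K t ed m {})" for S
    using that pmf_sample_edges[OF assms, of K t S] by (auto simp: set_pmf_iff split: if_splits)
  then show ?thesis unfolding trial_def by fastforce
qed

lemma sum_Pow_power:
  fixes x :: real
  assumes "finite E"
  shows "(\<Sum>S\<in>Pow E. x ^ card S) = (1 + x) ^ card E"
  using assms
proof (induction E rule: finite_induct)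
  case (insert e E)
  have "(\<Sum>S\<in>Pow (insert e E). x ^ card S) = (\<Sum>S\<in>Pow E. x ^ card S + x ^ card (insert e S))"
    by (rule sum_Pow_insert) (rule insert)
  also have "\<dots> = (\<Sum>S\<in>Pow E. (1 + x) * x ^ card S)"
  proof (intro sum.cong refl)
    fix S assume "S \<in> Pow E"
    then have "finite S" "e \<notin> S" using insert finite_subset by auto
    then show "x ^ card S + x ^ card (insert e S) = (1 + x) * x ^ card S" by (simp add: distrib_right)
  qed
  also have "\<dots> = (1 + x) ^ card (insert e E)"
    using insert by (simp add: sum_distrib_left[symmetric])
  finally show ?case .
qed simp

text \<open>Numerator and denominator are each off by at most \<open>\<epsilon> * G\<close>, and the
  denominator \<open>F\<close> is at least \<open>G / 2\<close>; this gives
  \<open>2 * \<epsilon>\<close> twice over.\<close>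

lemma ratio_close:
  fixes f g :: "'a \<Rightarrow> real"
  assumes "finite B" "\<And>z. z \<in> B \<Longrightarrow> 0 \<le> g z" "\<And>z. z \<in> B \<Longrightarrow> \<bar>f z - g z\<bar> \<le> \<epsilon> * g z"
    and \<epsilon>: "\<epsilon> \<le> 1 / 2" and pos: "(\<Sum>z\<in>B. g z) > 0"
  shows "(\<Sum>z\<in>B. g z) / 2 \<le> (\<Sum>z\<in>B. f z)"
    and "\<bar>(\<Sum>z\<in>B. of_bool (z \<in> A) * f z) / (\<Sum>z\<in>B. f z) - (\<Sum>z\<in>B. of_bool (z \<in> A) * g z) / (\<Sum>z\<in>B. g z)\<bar> \<le> 4 * \<epsilon>"
proof -
  define F G FA GA where "F = (\<Sum>z\<in>B. f z)" and "G = (\<Sum>z\<in>B. g z)"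
    and "FA = (\<Sum>z\<in>B. of_bool (z \<in> A) * f z)" and "GA = (\<Sum>z\<in>B. of_bool (z \<in> A) * g z)"
  note defs = F_def G_def FA_def GA_def
  have GA: "0 \<le> GA" "GA \<le> G" unfolding defs using assms(2) by (auto intro!: sum_nonneg sum_mono)
  have dF: "\<bar>F - G\<bar> \<le> \<epsilon> * G"
    unfolding defs sum_subtractf[symmetric] sum_distrib_left
    by (rule order_trans[OF sum_abs]) (intro sum_mono assms(3))
  have dFA: "\<bar>FA - GA\<bar> \<le> \<epsilon> * G"
    unfolding defs sum_subtractf[symmetric] sum_distrib_left
  proof (rule order_trans[OF sum_abs], intro sum_mono)
    fix z assume z: "z \<in> B"
    show "\<bar>of_bool (z \<in> A) * f z - of_bool (z \<in> A) * g z\<bar> \<le> \<epsilon> * g z"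
      using assms(3)[OF z] abs_ge_zero[of "f z - g z"] by (cases "z \<in> A") auto
  qed
  have G: "G > 0" using pos unfolding defs .
  have "\<epsilon> * G \<le> 1 / 2 * G" using \<epsilon> G by (intro mult_right_mono) auto
  then have F: "G / 2 \<le> F" using dF by linarith
  then show "(\<Sum>z\<in>B. g z) / 2 \<le> (\<Sum>z\<in>B. f z)" unfolding defs .
  have F0: "F > 0" using F G by linarith
  have eG: "0 \<le> \<epsilon> * G" using dF by linarith
  have "FA * G - GA * F = (FA - GA) * G + GA * (G - F)" by (simp add: algebra_simps)
  also have "\<bar>\<dots>\<bar> \<le> \<bar>(FA - GA) * G\<bar> + \<bar>GA * (G - F)\<bar>" by (rule abs_triangle_ineq)
  also have "\<dots> = \<bar>FA - GA\<bar> * G + GA * \<bar>F - G\<bar>" using G GA by (simp add: abs_mult abs_minus_commute)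
  also have "\<dots> \<le> (\<epsilon> * G) * G + G * (\<epsilon> * G)"
    using dF dFA G GA eG by (intro add_mono mult_mono) auto
  also have "\<dots> = 4 * (\<epsilon> * G) * (G / 2)" by simp
  also have "\<dots> \<le> 4 * (\<epsilon> * G) * F" using F eG by (intro mult_left_mono) auto
  finally have "\<bar>FA * G - GA * F\<bar> \<le> 4 * \<epsilon> * (F * G)" by (simp add: mult_ac)
  moreover have "FA / F - GA / G = (FA * G - GA * F) / (F * G)" using F0 G by (simp add: field_simps)
  ultimately have "\<bar>FA / F - GA / G\<bar> \<le> 4 * \<epsilon>" using F0 G by (simp add: divide_le_eq)
  then show "\<bar>(\<Sum>z\<in>B. of_bool (z \<in> A) * f z) / (\<Sum>z\<in>B. f z) - (\<Sum>z\<in>B. of_bool (z \<in> A) * g z) / (\<Sum>z\<in>B. g z)\<bar> \<le> 4 * \<epsilon>"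
    unfolding defs .
qed

text \<open>Conditioning on an event that misses at most the proportion \<kappa> of the weight
  changes no probability by more than \<kappa>. Over the common denominator the difference is
  \<open>FA * T - F * TA\<close>, and both terms lie between 0 and \<open>F * T\<close>.\<close>

lemma truncation_close:
  fixes W :: "'a \<Rightarrow> real"
  assumes "finite B" "\<And>z. z \<in> B \<Longrightarrow> 0 \<le> W z" "(\<Sum>z\<in>B. of_bool (\<not> P z) * W z) \<le> \<kappa> * (\<Sum>z\<in>B. W z)"
    and \<kappa>: "\<kappa> \<le> 1 / 2" and pos: "(\<Sum>z\<in>B. W z) > 0"
  shows "(\<Sum>z\<in>B. W z) / 2 \<le> (\<Sum>z\<in>B. of_bool (P z) * W z)"
    and "\<bar>(\<Sum>z\<in>B. of_bool (z \<in> A) * (of_bool (P z) * W z)) / (\<Sum>z\<in>B. of_bool (P z) * W z) -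
          (\<Sum>z\<in>B. of_bool (z \<in> A) * W z) / (\<Sum>z\<in>B. W z)\<bar> \<le> \<kappa>"
proof -
  define F G FA GA where "F = (\<Sum>z\<in>B. of_bool (P z) * W z)" and "G = (\<Sum>z\<in>B. W z)"
    and "FA = (\<Sum>z\<in>B. of_bool (z \<in> A) * (of_bool (P z) * W z))" and "GA = (\<Sum>z\<in>B. of_bool (z \<in> A) * W z)"
  define T TA where "T = (\<Sum>z\<in>B. of_bool (\<not> P z) * W z)" and "TA = (\<Sum>z\<in>B. of_bool (z \<in> A) * (of_bool (\<not> P z) * W z))"
  note defs = F_def G_def FA_def GA_def T_def TA_def
  have G: "G > 0" using pos unfolding defs .
  have FT: "G = F + T" "GA = FA + TA"
    unfolding defs sum.distrib[symmetric] by (intro sum.cong refl, simp add: of_bool_def)+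
  have FA: "0 \<le> FA" "FA \<le> F" "0 \<le> TA" "TA \<le> T" unfolding defs using assms(2) by (intro sum_nonneg sum_mono, force)+
  have T: "T \<le> \<kappa> * G" using assms(3) unfolding defs .
  have "\<kappa> * G \<le> 1 / 2 * G" using \<kappa> G by (intro mult_right_mono) auto
  then have F: "G / 2 \<le> F" using FT T by linarith
  then show "(\<Sum>z\<in>B. W z) / 2 \<le> (\<Sum>z\<in>B. of_bool (P z) * W z)" unfolding defs .
  have F0: "F > 0" using F G by linarith
  have "FA * G - GA * F = FA * T - F * TA" unfolding FT by (simp add: algebra_simps)
  moreover have "0 \<le> FA * T" "FA * T \<le> F * T" "0 \<le> F * TA" "F * TA \<le> F * T"
    using FA F0 by (simp_all add: mult_right_mono mult_left_mono)
  ultimately have "\<bar>FA * G - GA * F\<bar> \<le> F * T" by linarith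
  also have "\<dots> \<le> F * (\<kappa> * G)" using T F0 by (intro mult_left_mono) auto
  finally have "\<bar>FA * G - GA * F\<bar> \<le> \<kappa> * (F * G)" by (simp add: mult_ac)
  moreover have "FA / F - GA / G = (FA * G - GA * F) / (F * G)" using F0 G by (simp add: field_simps)
  ultimately have "\<bar>FA / F - GA / G\<bar> \<le> \<kappa>" using F0 G by (simp add: divide_le_eq)
  then show "\<bar>(\<Sum>z\<in>B. of_bool (z \<in> A) * (of_bool (P z) * W z)) / (\<Sum>z\<in>B. of_bool (P z) * W z) -
          (\<Sum>z\<in>B. of_bool (z \<in> A) * W z) / (\<Sum>z\<in>B. W z)\<bar> \<le> \<kappa>"
    unfolding defs .
qed

lemma power_one_plus_le:
  fixes \<eta> :: real
  assumes "0 \<le> \<eta>" "real l * \<eta> \<le> 1"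
  shows "(1 + \<eta>) ^ l \<le> 1 + 2 * (real l * \<eta>)"
proof -
  have "(1 + \<eta>) ^ l \<le> exp \<eta> ^ l" using assms by (intro power_mono) (auto simp: exp_ge_add_one_self)
  also have "\<dots> = exp (real l * \<eta>)" by (simp add: exp_of_nat_mult)
  also have "\<dots> \<le> 1 + real l * \<eta> + (real l * \<eta>)\<^sup>2" using assms by (intro exp_bound) auto
  also have "(real l * \<eta>)\<^sup>2 \<le> real l * \<eta>" using assms by (simp add: power2_eq_square mult_left_le)
  finally show ?thesis by linarith
qed

lemma power_product_mono:
  fixes a c r :: real
  assumes "0 \<le> a" "a \<le> a'" "0 \<le> c" "c \<le> c'" "0 \<le> r" "r \<le> r'"
  shows "a ^ i * c ^ j * r ^ k \<le> a' ^ i * c' ^ j * r' ^ k"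
proof -
  have "0 \<le> a'" "0 \<le> c'" using assms by linarith+
  then show ?thesis using assms by (intro mult_mono power_mono mult_nonneg_nonneg zero_le_power)
qed

text \<open>Each of at most \<open>l\<close> factors has relative error \<eta>. Bernoulli's
  inequality bounds the product of the errors from below, and the exponential function
  (\<open>power_one_plus_le\<close>) from above.\<close>

lemma product_close:
  fixes a c a' c' \<rho> \<rho>' \<eta> :: real
  assumes \<eta>: "0 \<le> \<eta>" "2 * (real l * \<eta>) \<le> 1 / 2" and kl: "i + j + k \<le> l"
    and d: "\<bar>a' - a\<bar> \<le> \<eta> * a" "\<bar>c' - c\<bar> \<le> \<eta> * c" "\<bar>\<rho>' - \<rho>\<bar> \<le> \<eta> * \<rho>"
    and nn: "0 \<le> a" "0 \<le> c" "0 \<le> \<rho>"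
  shows "\<bar>a' ^ i * c' ^ j * \<rho>' ^ k - a ^ i * c ^ j * \<rho> ^ k\<bar> \<le> 2 * (real l * \<eta>) * (a ^ i * c ^ j * \<rho> ^ k)"
proof (cases "l = 0")
  case True
  then show ?thesis using kl by simp
next
  case False
  then have "\<eta> \<le> real l * \<eta>" using mult_right_mono[of 1 "real l" \<eta>] \<eta> by simp
  then have \<eta>1: "\<eta> \<le> 1" using \<eta> by linarith
  define w where "w = a ^ i * c ^ j * \<rho> ^ k"
  have w: "w \<ge> 0" unfolding w_def using nn by simp
  have lo: "(1 - \<eta>) * z \<le> z'" and hi: "z' \<le> (1 + \<eta>) * z" if "\<bar>z' - z\<bar> \<le> \<eta> * z" for z z' :: real
    using that by (auto simp: abs_le_iff algebra_simps)
  have nl: "0 \<le> (1 - \<eta>) * z" if "0 \<le> z" for z using that \<eta>1 by simp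
  note b = lo[OF d(1)] lo[OF d(2)] lo[OF d(3)] hi[OF d(1)] hi[OF d(2)] hi[OF d(3)]
  have nn': "0 \<le> a'" "0 \<le> c'" "0 \<le> \<rho>'" using b nl nn by (meson order_trans)+
  have "((1 - \<eta>) * a) ^ i * ((1 - \<eta>) * c) ^ j * ((1 - \<eta>) * \<rho>) ^ k \<le> a' ^ i * c' ^ j * \<rho>' ^ k"
    by (intro power_product_mono b nl nn)
  moreover have "((1 - \<eta>) * a) ^ i * ((1 - \<eta>) * c) ^ j * ((1 - \<eta>) * \<rho>) ^ k = (1 - \<eta>) ^ (i + j + k) * w"
    unfolding w_def power_mult_distrib power_add by (simp only: mult_ac)
  moreover have "(1 - \<eta>) ^ l \<le> (1 - \<eta>) ^ (i + j + k)" using kl \<eta> \<eta>1 by (intro power_decreasing) auto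
  moreover have "1 + real l * (- \<eta>) \<le> (1 + (- \<eta>)) ^ l" using \<eta>1 by (intro Bernoulli_inequality) auto
  ultimately have lw: "(1 - real l * \<eta>) * w \<le> a' ^ i * c' ^ j * \<rho>' ^ k"
    using mult_right_mono[of "1 - real l * \<eta>" "(1 - \<eta>) ^ (i + j + k)" w] w by simp
  have "a' ^ i * c' ^ j * \<rho>' ^ k \<le> ((1 + \<eta>) * a) ^ i * ((1 + \<eta>) * c) ^ j * ((1 + \<eta>) * \<rho>) ^ k"
    by (intro power_product_mono b nn')
  moreover have "((1 + \<eta>) * a) ^ i * ((1 + \<eta>) * c) ^ j * ((1 + \<eta>) * \<rho>) ^ k = (1 + \<eta>) ^ (i + j + k) * w"
    unfolding w_def power_mult_distrib power_add by (simp only: mult_ac)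
  moreover have "(1 + \<eta>) ^ (i + j + k) \<le> (1 + \<eta>) ^ l" using kl \<eta> by (intro power_increasing) auto
  moreover have "(1 + \<eta>) ^ l \<le> 1 + 2 * (real l * \<eta>)" using \<eta> by (intro power_one_plus_le) auto
  ultimately have u: "a' ^ i * c' ^ j * \<rho>' ^ k \<le> (1 + 2 * (real l * \<eta>)) * w"
    using mult_right_mono[of "(1 + \<eta>) ^ (i + j + k)" "1 + 2 * (real l * \<eta>)" w] w by simp
  have "0 \<le> real l * \<eta> * w" using \<eta> w by simp
  then show ?thesis using lw u unfolding w_def[symmetric] by (simp add: abs_le_iff algebra_simps)
qed

text \<open>The three error terms stand for the failure of all \<open>k\<close> trials, the rounded
  biases of the coins and the missing configurations of excess above \<open>L\<close>. With exact
  coins a trial would propose and accept \<open>S\<close> with probability \<open>g S\<close>, which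
  is proportional to the truncated weight, since \<open>(1 / (1 + x)) ^ m * (1 / q) ^ L\<close> does
  not depend on \<open>S\<close>.\<close>

lemma prob_rej_trial:
  fixes x q \<eta> \<kappa> :: real
  assumes bij: "bij_betw ed {..<m} E" and E: "E \<subseteq> sedges {..<n}"
    and x: "x > 0" and q: "q \<ge> 1" and t: "t \<le> 2 ^ K" and r: "r \<le> 2 ^ K" and k: "k > 0"
    and \<eta>: "0 \<le> \<eta>" "2 * (real (m + L) * \<eta>) \<le> 1 / 2"
    and d: "\<bar>t / 2 ^ K - x / (1 + x)\<bar> \<le> \<eta> * (x / (1 + x))" "\<bar>t / 2 ^ K - x / (1 + x)\<bar> \<le> \<eta> * (1 / (1 + x))"
      "\<bar>r / 2 ^ K - 1 / q\<bar> \<le> \<eta> * (1 / q)"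
    and \<kappa>: "\<kappa> \<le> 1 / 2" "(\<Sum>S\<in>Pow E. of_bool (excess {..<n} S > L) * cw {..<n} x q S) \<le> \<kappa> * (\<Sum>S\<in>Pow E. cw {..<n} x q S)"
  shows "\<bar>measure_pmf.prob (rej (trial K t r L n ed m) k S0) A -
      (\<Sum>S\<in>Pow E. of_bool (S \<in> A) * cw {..<n} x q S) / (\<Sum>S\<in>Pow E. cw {..<n} x q S)\<bar>
    \<le> 4 * q ^ L / real k + 8 * (real (m + L) * \<eta>) + \<kappa>"
proof -
  define X W where "X = {..<n}" and "W = cw X x q"
  define Tr where "Tr = trial K t r L n ed m"
  define f g where "f S = pmf Tr (S, True)" and "g S = (1 / (1 + x)) ^ m * (1 / q) ^ L * (of_bool (excess X S \<le> L) * W S)" for S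
  have finX: "finite X" by (simp add: X_def)
  have finE: "finite E" by (rule finite_edges[OF _ E]) simp
  have m: "card E = m" using bij_betw_same_card[OF bij] by simp
  have W0: "W S \<ge> 0" for S unfolding W_def using x q by (intro cw_nonneg) auto
  \<comment> \<open>For \<open>q \<ge> 1\<close> the weights dominate those of percolation, whose
    sum is explicit. This bounds the probability of acceptance from below by a multiple of
    \<open>(1 / q) ^ L\<close>.\<close>
  have WE: "(1 + x) ^ m \<le> (\<Sum>S\<in>Pow E. W S)"
    unfolding sum_Pow_power[OF finE, symmetric] m[symmetric]
  proof (intro sum_mono)
    fix S
    show "x ^ card S \<le> W S" unfolding W_def cw_def
      using mult_left_mono[OF one_le_power[OF q, of "excess X S"], of "x ^ card S"] x by simp
  qed
  have W1: "(\<Sum>S\<in>Pow E. W S) > 0" using WE zero_less_power[of "1 + x" m] x by linarith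
  have c: "pmf (coin K t) True = real t / 2 ^ K" "pmf (coin K r) True = real r / 2 ^ K"
    using t r by (simp_all add: pmf_coin)
  have fg: "\<bar>f S - g S\<bar> \<le> 2 * (real (m + L) * \<eta>) * g S" if S: "S \<in> Pow E" for S
  proof (cases "excess X S \<le> L")
    case True
    define e where "e = excess X S"
    have cS: "card S \<le> m" using S card_mono[OF finE, of S] m by auto
    have f: "f S = (t / 2 ^ K) ^ card S * (1 - t / 2 ^ K) ^ (m - card S) * (r / 2 ^ K) ^ (L - e)"
      unfolding f_def Tr_def pmf_trial[OF bij] c m using S True by (simp add: X_def e_def)
    have m1: "(1 / (1 + x)) ^ m = (1 / (1 + x)) ^ card S * (1 / (1 + x)) ^ (m - card S)"
      unfolding power_add[symmetric] using cS by simp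
    have "(1 / q) ^ L = (1 / q) ^ (L - e) * (1 / q) ^ e" unfolding power_add[symmetric] using True by (simp add: e_def)
    moreover have "(1 / q) ^ e * q ^ e = 1" using q by (simp add: power_mult_distrib[symmetric])
    ultimately have qe: "(1 / q) ^ L * q ^ e = (1 / q) ^ (L - e)" by (simp only: mult.assoc mult_1_right)
    have xe: "(1 / (1 + x)) ^ card S * x ^ card S = (x / (1 + x)) ^ card S" unfolding power_mult_distrib[symmetric] by simp
    have "g S = (1 / (1 + x)) ^ m * (1 / q) ^ L * (x ^ card S * q ^ e)"
      unfolding g_def W_def cw_def e_def using True by simp
    also have "\<dots> = ((1 / (1 + x)) ^ card S * x ^ card S) * (1 / (1 + x)) ^ (m - card S) * ((1 / q) ^ L * q ^ e)"
      unfolding m1 by (simp only: mult_ac)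
    finally have g: "g S = (x / (1 + x)) ^ card S * (1 / (1 + x)) ^ (m - card S) * (1 / q) ^ (L - e)"
      unfolding xe qe .
    have "1 / (1 + x) = 1 - x / (1 + x)" using x by (simp add: field_simps)
    then have d2: "\<bar>(1 - t / 2 ^ K) - 1 / (1 + x)\<bar> \<le> \<eta> * (1 / (1 + x))" using d(2) by simp
    show ?thesis unfolding f g
      by (rule product_close[OF \<eta> _ d(1) d2 d(3)]) (use cS x q in auto)
  next
    case False
    then show ?thesis unfolding f_def g_def Tr_def pmf_trial[OF bij] by (simp add: X_def)
  qed
  define cc where "cc = (1 / (1 + x)) ^ m * (1 / q) ^ L"
  have cc: "cc > 0" unfolding cc_def using x q by simp
  have sg: "(\<Sum>S\<in>Pow E. g S) = cc * (\<Sum>S\<in>Pow E. of_bool (excess X S \<le> L) * W S)"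
    "(\<Sum>S\<in>Pow E. of_bool (S \<in> A) * g S) = cc * (\<Sum>S\<in>Pow E. of_bool (S \<in> A) * (of_bool (excess X S \<le> L) * W S))"
    unfolding g_def cc_def[symmetric] sum_distrib_left by (auto intro!: sum.cong)
  have fP: "finite (Pow E)" using finE by simp
  have tr: "(\<Sum>S\<in>Pow E. of_bool (\<not> excess X S \<le> L) * W S) \<le> \<kappa> * (\<Sum>S\<in>Pow E. W S)"
    using \<kappa>(2) unfolding X_def W_def not_le .
  note t1 = truncation_close(1)[OF fP W0 tr \<kappa>(1) W1] and t2 = truncation_close(2)[OF fP W0 tr \<kappa>(1) W1, of A]
  have g0: "g S \<ge> 0" for S unfolding g_def using W0[of S] x q by simp
  have "(1 / q) ^ L = cc * (1 + x) ^ m" unfolding cc_def using x by (simp add: power_divide)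
  also have "\<dots> \<le> cc * (\<Sum>S\<in>Pow E. W S)" using WE cc by (intro mult_left_mono) auto
  also have "\<dots> \<le> cc * (2 * (\<Sum>S\<in>Pow E. of_bool (excess X S \<le> L) * W S))" using t1 cc by (intro mult_left_mono) auto
  finally have g2: "(1 / q) ^ L \<le> 2 * (\<Sum>S\<in>Pow E. g S)" unfolding sg by simp
  have q0: "(1 / q) ^ L > 0" using q by simp
  then have g1: "(\<Sum>S\<in>Pow E. g S) > 0" using g2 by linarith
  note r1 = ratio_close(1)[OF fP g0 fg \<eta>(2) g1] and r2 = ratio_close(2)[OF fP g0 fg \<eta>(2) g1, of A]
  define \<alpha> where "\<alpha> = (\<Sum>S\<in>Pow E. f S)"
  have \<alpha>: "(1 / q) ^ L / 4 \<le> \<alpha>" unfolding \<alpha>_def using r1 g2 by linarith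
  then have \<alpha>0: "\<alpha> > 0" using q0 by linarith
  have sT: "set_pmf Tr \<subseteq> Pow E \<times> UNIV" unfolding Tr_def by (rule set_trial[OF bij])
  have rj: "\<bar>measure_pmf.prob (rej Tr k S0) A - (\<Sum>S\<in>Pow E. of_bool (S \<in> A) * f S) / (\<Sum>S\<in>Pow E. f S)\<bar> \<le> (1 - \<alpha>) ^ k"
    unfolding \<alpha>_def f_def by (rule prob_rej[OF fP sT]) (use \<alpha>0 in \<open>simp add: \<alpha>_def f_def\<close>)
  have \<alpha>1: "\<alpha> \<le> 1"
  proof -
    have "\<alpha> = (\<Sum>z\<in>(\<lambda>S. (S, True)) ` Pow E. pmf Tr z)" unfolding \<alpha>_def f_def by (subst sum.reindex) (auto intro: inj_onI)
    also have "\<dots> = measure_pmf.prob Tr ((\<lambda>S. (S, True)) ` Pow E)" using fP by (simp add: measure_measure_pmf_finite)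
    finally show ?thesis by simp
  qed
  have "(1 - \<alpha>) ^ k \<le> 4 * q ^ L / real k"
  proof -
    \<comment> \<open>\<open>k * \<alpha> \<le> (1 + \<alpha>) ^ k\<close> by Bernoulli's
      inequality, and \<open>(1 + \<alpha>) * (1 - \<alpha>) \<le> 1\<close>. The resulting bound
      \<open>1 / (k * \<alpha>)\<close> is weak, but enough when \<open>k\<close> exceeds
      \<open>q ^ L\<close> by a power of \<open>n\<close>.\<close>
    have "real k * \<alpha> * (1 - \<alpha>) ^ k \<le> (1 + \<alpha>) ^ k * (1 - \<alpha>) ^ k"
      using Bernoulli_inequality[of \<alpha> k] \<alpha>0 \<alpha>1 by (intro mult_right_mono) auto
    also have "\<dots> = (1 - \<alpha> * \<alpha>) ^ k" unfolding power_mult_distrib[symmetric] by (simp add: algebra_simps)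
    also have "\<dots> \<le> 1" using \<alpha>0 \<alpha>1 by (intro power_le_one) (auto simp: mult_le_one)
    finally have "(1 - \<alpha>) ^ k \<le> 1 / (real k * \<alpha>)" using k \<alpha>0 by (simp add: field_simps)
    also have "\<dots> \<le> 1 / (real k * ((1 / q) ^ L / 4))" using k \<alpha> q0 by (intro divide_left_mono mult_left_mono mult_pos_pos) auto
    also have "\<dots> = 4 * q ^ L / real k" using q by (simp add: power_divide)
    finally show ?thesis .
  qed
  moreover have "(\<Sum>S\<in>Pow E. of_bool (S \<in> A) * g S) / (\<Sum>S\<in>Pow E. g S) =
      (\<Sum>S\<in>Pow E. of_bool (S \<in> A) * (of_bool (excess X S \<le> L) * W S)) / (\<Sum>S\<in>Pow E. of_bool (excess X S \<le> L) * W S)"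
    unfolding sg using cc by simp
  ultimately have "\<bar>measure_pmf.prob (rej Tr k S0) A - (\<Sum>S\<in>Pow E. of_bool (S \<in> A) * W S) / (\<Sum>S\<in>Pow E. W S)\<bar>
    \<le> 4 * q ^ L / real k + 4 * (2 * (real (m + L) * \<eta>)) + \<kappa>"
    using rj r2 t2 by linarith
  then show ?thesis unfolding Tr_def W_def X_def by simp
qed

lemma spec_support: "spec \<theta> c s t D R \<Longrightarrow> a \<in> set_pmf D \<Longrightarrow> \<exists>s'. R a s'"
  unfolding spec_def by fastforce

lemma real_div_bounds:
  fixes a b :: nat
  assumes "b > 0"
  shows "real (a div b) \<le> real a / real b" "real a / real b < real (a div b) + 1"
proof -
  have "a = b * (a div b) + a mod b" by simp
  moreover have "a mod b < b" by (rule mod_less_divisor[OF assms])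
  ultimately have "real a = real b * real (a div b) + real (a mod b)" "real (a mod b) < real b"
    unfolding of_nat_mult[symmetric] of_nat_add[symmetric] of_nat_eq_iff of_nat_less_iff by simp_all
  then show "real (a div b) \<le> real a / real b" "real a / real b < real (a div b) + 1"
    using assms by (auto simp: field_simps)
qed

text \<open>Rounding \<open>p\<close> and \<open>q\<close> down and the two truncated divisions each
  cause an error of at most \<open>1 / 2 ^ K\<close> before propagation. It is not amplified by
  small denominators, since \<open>q \<ge> 1\<close> keeps \<open>q\<close> and
  \<open>p + (1 - p) * q\<close>, as well as their rounded versions, at least 1.\<close>

lemma thresholds_close:
  fixes p q :: real and K :: nat
  assumes p: "0 \<le> p" "p < 1" and q: "q \<ge> 1"
  defines "P \<equiv> nat \<lfloor>2 ^ K * p\<rfloor>" and "Q \<equiv> nat \<lfloor>2 ^ K * q\<rfloor>"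
  defines "t :: nat \<equiv> P * 2 ^ (2 * K) div (P * 2 ^ K + (2 ^ K - P) * Q)" and "r :: nat \<equiv> 2 ^ (2 * K) div Q"
  shows "t \<le> 2 ^ K" "\<bar>t / 2 ^ K - p / (p + (1 - p) * q)\<bar> \<le> (2 * q + 2) / 2 ^ K"
    and "r \<le> 2 ^ K" "\<bar>r / 2 ^ K - 1 / q\<bar> \<le> 1 / 2 ^ K"
proof -
  define M :: real where "M = 2 ^ K"
  have M: "M > 0" by (simp add: M_def)
  have P: "real P \<le> M * p" "M * p < real P + 1" using p unfolding P_def M_def by (auto intro: of_nat_floor)
  have Q: "real Q \<le> M * q" "M * q < real Q + 1" using q unfolding Q_def M_def by (auto intro: of_nat_floor)
  have "M * p \<le> M * 1" "M * 1 \<le> M * q" using p q M by (intro mult_left_mono; simp)+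
  then have "real P \<le> real (2 ^ K)" "real (2 ^ K) < real (Q + 1)" using P Q
    unfolding of_nat_add of_nat_power of_nat_numeral of_nat_1 M_def[symmetric] by linarith+
  then have PM: "P \<le> 2 ^ K" and QM: "2 ^ K \<le> Q" unfolding of_nat_le_iff of_nat_less_iff by linarith+
  have QM': "M \<le> real Q" using QM unfolding M_def by (metis of_nat_le_iff of_nat_numeral of_nat_power)
  have Q0: "Q > 0" using QM by (metis gr0I le_zero_eq power_not_zero zero_neq_numeral)
  have scale: "y / M \<le> z \<and> z - 1 / M \<le> y / M" if "y \<le> M * z" "M * z < y + 1" for y z :: real
  proof
    show "y / M \<le> z" using that M by (simp add: divide_le_eq mult.commute)
    have "(M * z - 1) / M \<le> y / M" using that M by (intro divide_right_mono) auto
    then show "z - 1 / M \<le> y / M" using M by (simp add: diff_divide_distrib)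
  qed
  define w where "w = M / real Q"
  have w: "w \<le> 1" unfolding w_def using QM' Q0 by simp
  have "real (2 ^ (2 * K)) / real Q = M * w" unfolding w_def M_def by (simp add: mult_2 power_add)
  then have r: "real r \<le> M * w" "M * w < real r + 1"
    using real_div_bounds[OF Q0, where a = "2 ^ (2 * K)"] unfolding r_def by simp_all
  have "real r \<le> M" using r w M mult_left_mono[of w 1 M] by linarith
  then show "r \<le> 2 ^ K" unfolding M_def by (metis of_nat_le_iff of_nat_numeral of_nat_power)
  have "real r / M \<le> w" "w - 1 / M \<le> real r / M" using scale[OF r] by auto
  moreover have "1 / q \<le> w" "w \<le> 1 / q + 1 / M"
  proof -
    show "1 / q \<le> w" unfolding w_def using Q q Q0 by (simp add: field_simps)
    have "M * q \<le> real Q + real Q * q / M"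
    proof -
      have "1 * 1 \<le> real Q / M * q" using QM' M q by (intro mult_mono) auto
      then show ?thesis using Q by simp
    qed
    then show "w \<le> 1 / q + 1 / M" unfolding w_def using Q0 q M by (simp add: field_simps)
  qed
  ultimately have "\<bar>real r / M - 1 / q\<bar> \<le> 1 / M" by linarith
  then show "\<bar>r / 2 ^ K - 1 / q\<bar> \<le> 1 / 2 ^ K" unfolding M_def .
  define u v where "u = real P / M" and "v = real Q / M"
  have u: "0 \<le> u" "u \<le> p" "p - u \<le> 1 / M" using scale[of "real P" p] P M by (auto simp: u_def)
  have v: "1 \<le> v" "v \<le> q" "q - v \<le> 1 / M" using scale[of "real Q" q] Q QM' M by (auto simp: v_def)
  define D where "D = P * 2 ^ K + (2 ^ K - P) * Q"
  have D: "real D = M\<^sup>2 * (u + (1 - u) * v)"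
  proof -
    have uv: "M * u = real P" "M * v = real Q" unfolding u_def v_def using M by simp_all
    have "real D = real P * M + (M - real P) * real Q"
      unfolding D_def M_def using PM by (simp add: of_nat_diff)
    also have "\<dots> = M\<^sup>2 * (u + (1 - u) * v)" unfolding uv[symmetric] by (simp add: power2_eq_square algebra_simps)
    finally show ?thesis .
  qed
  define e f where "e = u + (1 - u) * v" and "f = p + (1 - p) * q"
  have "(1 - u) * 1 \<le> (1 - u) * v" "(1 - p) * 1 \<le> (1 - p) * q" using u v p q by (intro mult_left_mono; simp)+
  then have ef: "1 \<le> e" "1 \<le> f" unfolding e_def f_def by simp_all
  have "real D > 0" unfolding D e_def[symmetric] using M ef by simp
  then have D0: "D > 0" by simp
  define z where "z = u / e"
  have "u \<le> e" using u v p unfolding e_def by simp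
  then have z: "z \<le> 1" unfolding z_def using ef by simp
  have "real (P * 2 ^ (2 * K)) / real D = M * z"
  proof -
    have "real (P * 2 ^ (2 * K)) = (M * u) * M\<^sup>2" unfolding u_def using M by (simp add: M_def power_mult mult.commute)
    then show ?thesis using M ef unfolding D e_def[symmetric] z_def by simp
  qed
  then have t: "real t \<le> M * z" "M * z < real t + 1"
    using real_div_bounds[OF D0, where a = "P * 2 ^ (2 * K)"] unfolding t_def D_def[symmetric] by simp_all
  have "real t \<le> M" using t z M mult_left_mono[of z 1 M] by linarith
  then show "t \<le> 2 ^ K" unfolding M_def by (metis of_nat_le_iff of_nat_numeral of_nat_power)
  have tz: "real t / M \<le> z" "z - 1 / M \<le> real t / M" using scale[OF t] by auto
  \<comment> \<open>The cross difference is written so that every term contains one of the rounding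
    errors \<open>u - p\<close> and \<open>q - v\<close>.\<close>
  have "u * f - p * e = (u - p) * ((1 - p) * q) + (p * (1 - p) * (q - v) + p * v * (u - p))"
    unfolding e_def f_def by (simp add: algebra_simps)
  also have "\<bar>\<dots>\<bar> \<le> \<bar>(u - p) * ((1 - p) * q)\<bar> + (\<bar>p * (1 - p) * (q - v)\<bar> + \<bar>p * v * (u - p)\<bar>)"
    by (meson abs_triangle_ineq add_left_mono order_trans)
  also have "\<dots> = (p - u) * ((1 - p) * q) + (p * (1 - p) * (q - v) + p * v * (p - u))"
    using u v p q by (simp add: abs_mult)
  also have "\<dots> \<le> 1 / M * (1 * q) + (1 * 1 * (1 / M) + 1 * q * (1 / M))"
    using u v p q M by (intro add_mono mult_mono mult_nonneg_nonneg) auto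
  also have "\<dots> = (2 * q + 1) / M" by (simp add: add_divide_distrib)
  finally have num: "\<bar>u * f - p * e\<bar> \<le> (2 * q + 1) / M" .
  have "z - p / f = (u * f - p * e) / (e * f)" unfolding z_def using ef by (simp add: field_simps)
  then have "\<bar>z - p / f\<bar> = \<bar>u * f - p * e\<bar> / (e * f)" using ef by simp
  also have "\<dots> \<le> \<bar>u * f - p * e\<bar> / 1"
    using ef mult_mono[of 1 e 1 f] by (intro divide_left_mono) auto
  finally have "\<bar>z - p / f\<bar> \<le> (2 * q + 1) / M" using num by simp
  then have "\<bar>real t / M - p / f\<bar> \<le> (2 * q + 1) / M + 1 / M" using tz by linarith
  also have "\<dots> = (2 * q + 2) / M" by (simp add: add_divide_distrib[symmetric])
  finally show "\<bar>t / 2 ^ K - p / (p + (1 - p) * q)\<bar> \<le> (2 * q + 2) / 2 ^ K" unfolding M_def f_def .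
qed

lemma card_sedges_le: "E \<subseteq> sedges {..<n} \<Longrightarrow> card E \<le> n * n"
proof -
  assume "E \<subseteq> sedges {..<n}"
  moreover have "sedges {..<n} \<subseteq> (\<lambda>(u, v). {u, v}) ` ({..<n} \<times> {..<n})" unfolding sedges_def by auto
  ultimately have "E \<subseteq> (\<lambda>(u, v). {u, v}) ` ({..<n} \<times> {..<n})" by (rule subset_trans)
  then have "card E \<le> card ({..<n} \<times> {..<n})" by (rule surj_card_le[rotated]) simp
  then show ?thesis by simp
qed

lemma prob_random_cluster:
  assumes "finite X" "E \<subseteq> sedges X" "0 \<le> p" "p < 1" "q > 0"
  defines "x \<equiv> p / ((1 - p) * q)"
  shows "measure_pmf.prob (random_cluster p q X E) A =
     (\<Sum>S\<in>Pow E. of_bool (S \<in> A) * cw X x q S) / (\<Sum>S\<in>Pow E. cw X x q S)"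
proof -
  have finE: "finite E" by (rule finite_edges[OF assms(1,2)])
  have p: "p \<in> {0..1}" using assms by simp
  note pm = pmf_random_cluster[OF finE p assms(5), of X]
  define C where "C = (1 - p) ^ card E * q ^ card X"
  have C: "C > 0" unfolding C_def using assms by simp
  have W: "rc_weight p q X E S = C * cw X x q S" if "S \<in> Pow E" for S
    using rc_weight_cw[OF assms(1,2) _ assms(3-5)] that unfolding C_def x_def by simp
  have Z: "rc_partition p q X E = C * (\<Sum>S\<in>Pow E. cw X x q S)"
    unfolding rc_partition_def sum_distrib_left by (intro sum.cong refl W)
  have "set_pmf (random_cluster p q X E) \<subseteq> Pow E" using pm by (auto simp: set_pmf_iff split: if_splits)
  then have "measure_pmf.prob (random_cluster p q X E) A = (\<Sum>S\<in>Pow E. of_bool (S \<in> A) * pmf (random_cluster p q X E) S)"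
    using finE by (intro prob_finite) auto
  also have "\<dots> = (\<Sum>S\<in>Pow E. of_bool (S \<in> A) * cw X x q S / (\<Sum>S\<in>Pow E. cw X x q S))"
    using C by (intro sum.cong refl) (auto simp: pm W Z)
  finally show ?thesis by (simp only: sum_divide_distrib)
qed

lemma tv_dist_le: "(\<And>A. \<bar>measure_pmf.prob \<mu> A - measure_pmf.prob \<nu> A\<bar> \<le> c) \<Longrightarrow> tv_dist \<mu> \<nu> \<le> c"
  unfolding tv_dist_def by (rule cSUP_least) auto

text \<open>The choice of \<open>a\<close> makes \<open>L\<close> at least \<open>A * ln n\<close>,
  so that \<open>tail\<close> controls the truncation. With \<open>l = bitlen n\<close>, the number
  \<open>2 ^ K\<close> is the product of \<open>2 ^ (h * a * l)\<close>, at least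
  \<open>q ^ L\<close>, which pays for the low rate of acceptance, and of
  \<open>2 ^ (3 * l)\<close>, at least \<open>n ^ 3\<close>, which pays for the \<open>m + L\<close>
  rounded factors, of order \<open>n ^ 2\<close> at most, and leaves \<open>1 / n\<close>. The
  constant \<open>c\<close> turns the absolute errors of \<open>thresholds_close\<close> into errors
  relative to \<open>x / (1 + x)\<close>, \<open>1 / (1 + x)\<close> and
  \<open>1 / q\<close>.\<close>

lemma graph_output_close:
  fixes A p q :: real
  assumes p: "0 < p" "p < 1" and q: "q \<ge> 1" "q \<le> 2 ^ h" and a: "A \<le> real a"
  defines "b \<equiv> h * a + 3" and "x \<equiv> p / ((1 - p) * q)"
  defines "c \<equiv> (2 * q + 2) * ((1 + x) / x + (1 + x)) + q"
  assumes E: "E \<subseteq> sedges {..<n}" and n: "n \<ge> 2" "4 * ((1 + real a) * c) \<le> real n"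
    and tail: "(\<Sum>S\<in>Pow E. of_bool (real (excess {..<n} S) > A * ln (real n)) * cw {..<n} x q S)
      \<le> 1 / real n * (\<Sum>S\<in>Pow E. cw {..<n} x q S)"
  shows "set_pmf (graph_output [p, q] (prog a b) n E) \<subseteq> Pow E"
    and "tv_dist (graph_output [p, q] (prog a b) n E) (random_cluster p q {..<n} E) \<le> (5 + 8 * ((1 + real a) * c)) / real n"
proof -
  define l where "l = bitlen n"
  define K L where "K = b * l" and "L = a * l"
  define P Q where "P = nat \<lfloor>2 ^ K * p\<rfloor>" and "Q = nat \<lfloor>2 ^ K * q\<rfloor>"
  define t r where "t = P * 2 ^ (2 * K) div (P * 2 ^ K + (2 ^ K - P) * Q)" and "r = 2 ^ (2 * K) div Q"
  obtain ed m where bij: "bij_betw ed {..<m} E"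
    and sp: "spec [p, q] (prog a b) (init_state (encode_graph n E)) (prog_time a b n)
      (rej (trial K t r L n ed m) (2 ^ K) {}) (\<lambda>S s'. S \<subseteq> E \<and> decode_edges (printed s') = S)"
    using spec_prog[OF E less_imp_le[OF p(1)] p(2) q(1), of a b]
    unfolding t_def r_def P_def Q_def K_def L_def l_def by blast
  have out: "graph_output [p, q] (prog a b) n E = rej (trial K t r L n ed m) (2 ^ K) {}"
    unfolding graph_output_def using spec_program(2)[OF sp, of decode_edges "\<lambda>S. S"] by simp
  show "set_pmf (graph_output [p, q] (prog a b) n E) \<subseteq> Pow E"
    unfolding out using spec_support[OF sp] by blast
  have x: "x > 0" unfolding x_def using p q by simp
  have px: "p / (p + (1 - p) * q) = x / (1 + x)" 
  proof -
    define w where "w = (1 - p) * q"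
    have "w > 0" unfolding w_def using p q by simp
    then show ?thesis unfolding x_def w_def[symmetric] using p by (simp add: field_simps)
  qed
  have c0: "c > 0" unfolding c_def using q x by (intro add_nonneg_pos mult_nonneg_nonneg) auto
  define M :: real where "M = 2 ^ K"
  have M: "M > 0" unfolding M_def by simp
  define \<eta> where "\<eta> = c / M"
  have \<eta>: "\<eta> \<ge> 0" unfolding \<eta>_def using c0 M by simp
  have d: "\<bar>t / 2 ^ K - x / (1 + x)\<bar> \<le> (2 * q + 2) / M" "\<bar>r / 2 ^ K - 1 / q\<bar> \<le> 1 / M" and tr: "t \<le> 2 ^ K" "r \<le> 2 ^ K"
    using thresholds_close[OF less_imp_le[OF p(1)] p(2) q(1), of K] unfolding t_def r_def P_def Q_def px M_def by auto
  have c1: "(2 * q + 2) * ((1 + x) / x) \<le> c" "(2 * q + 2) * (1 + x) \<le> c" "q \<le> c"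
    unfolding c_def using q x by (auto simp: distrib_left)
  have dd: "e / M \<le> \<eta> * y" if "e \<le> c * y" for e y
    using divide_right_mono[OF that, of M] M unfolding \<eta>_def by simp
  have "2 * q + 2 \<le> c * (x / (1 + x))" using mult_right_mono[OF c1(1), of "x / (1 + x)"] x by simp
  then have d1: "\<bar>t / 2 ^ K - x / (1 + x)\<bar> \<le> \<eta> * (x / (1 + x))" using d(1) dd by (meson order_trans)
  have "2 * q + 2 \<le> c * (1 / (1 + x))" using mult_right_mono[OF c1(2), of "1 / (1 + x)"] x by simp
  then have d2: "\<bar>t / 2 ^ K - x / (1 + x)\<bar> \<le> \<eta> * (1 / (1 + x))" using d(1) dd by (meson order_trans)
  have "1 \<le> c * (1 / q)" using c1(3) q by simp
  then have d3: "\<bar>r / 2 ^ K - 1 / q\<bar> \<le> \<eta> * (1 / q)" using d(2) dd by (meson order_trans)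
  have nl: "n < 2 ^ l" unfolding l_def by (rule bitlen_bounds)
  have nl': "real n < 2 ^ l" using nl by (metis of_nat_less_iff of_nat_numeral of_nat_power)
  have Meq: "M = 2 ^ (h * a * l) * 2 ^ (3 * l)" unfolding M_def K_def b_def by (simp add: distrib_right power_add)
  have n3: "real n ^ 3 \<le> 2 ^ (3 * l)"
    using power_mono[of "real n" "2 ^ l" 3] nl' by (simp add: power_mult[symmetric] mult.commute)
  also have "\<dots> \<le> M" unfolding Meq using mult_right_mono[of 1 "2 ^ (h * a * l)" "2 ^ (3 * l)"] by simp
  finally have Mn: "real n ^ 3 \<le> M" .
  have m: "m = card E" using bij_betw_same_card[OF bij] by simp
  have "m \<le> n * n" unfolding m by (rule card_sedges_le[OF E])
  moreover have "L \<le> a * (n * n)"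
    unfolding L_def using bitlen_le[of n] by (intro mult_left_mono) (auto simp: l_def intro: order_trans)
  ultimately have "m + L \<le> (1 + a) * (n * n)" by simp
  then have mL: "real (m + L) \<le> (1 + real a) * (real n * real n)"
    by (metis of_nat_1 of_nat_add of_nat_le_iff of_nat_mult)
  have "real (m + L) * \<eta> \<le> (1 + real a) * (real n * real n) * (c / real n ^ 3)"
    unfolding \<eta>_def using mL Mn c0 n M by (intro mult_mono divide_left_mono mult_pos_pos) auto
  also have "\<dots> = (1 + real a) * c / real n" using n by (simp add: power3_eq_cube field_simps)
  finally have m\<eta>: "real (m + L) * \<eta> \<le> (1 + real a) * c / real n" .
  also have "\<dots> \<le> 1 / 4" using n by (simp add: field_simps)
  finally have \<eta>2: "2 * (real (m + L) * \<eta>) \<le> 1 / 2" by simp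
  have "A * ln (real n) \<le> real a * real l"
  proof (rule mult_mono)
    have "real n \<le> exp (real l)"
    proof -
      have "(2::real) ^ l \<le> exp 1 ^ l" using exp_ge_add_one_self[of 1] by (intro power_mono) auto
      then have "2 ^ l \<le> exp (real l)" by (simp add: exp_of_nat_mult[symmetric])
      then show ?thesis using nl' by linarith
    qed
    then show "ln (real n) \<le> real l" using n ln_mono[of "real n" "exp (real l)"] by simp
  qed (use a n in auto)
  then have AL: "A * ln (real n) \<le> real L" unfolding L_def by simp
  have "(\<Sum>S\<in>Pow E. of_bool (excess {..<n} S > L) * cw {..<n} x q S)
      \<le> (\<Sum>S\<in>Pow E. of_bool (real (excess {..<n} S) > A * ln (real n)) * cw {..<n} x q S)"
    using x q AL by (intro sum_mono mult_right_mono cw_nonneg) (auto simp: of_bool_def)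
  then have \<kappa>: "(\<Sum>S\<in>Pow E. of_bool (excess {..<n} S > L) * cw {..<n} x q S) \<le> 1 / real n * (\<Sum>S\<in>Pow E. cw {..<n} x q S)"
    using tail by linarith
  have "q ^ L \<le> 2 ^ (h * a * l)"
    using power_mono[OF q(2), of L] q by (simp add: L_def power_mult[symmetric] mult.assoc)
  then have "4 * q ^ L / M \<le> 4 * 2 ^ (h * a * l) / M" using M by (intro divide_right_mono) auto
  also have "\<dots> = 4 / 2 ^ (3 * l)" unfolding Meq by simp
  also have "\<dots> \<le> 4 / real n"
  proof (intro divide_left_mono)
    have "real n \<le> real n ^ 3" using n by (intro self_le_power) auto
    then show "real n \<le> 2 ^ (3 * l)" using n3 by linarith
  qed (use n in auto)
  finally have qM: "4 * q ^ L / real (2 ^ K) \<le> 4 / real n" unfolding M_def by simp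
  show "tv_dist (graph_output [p, q] (prog a b) n E) (random_cluster p q {..<n} E) \<le> (5 + 8 * ((1 + real a) * c)) / real n"
  proof (rule tv_dist_le)
    fix B
    have q0: "q > 0" using q by simp
    have "\<bar>measure_pmf.prob (rej (trial K t r L n ed m) (2 ^ K) {}) B -
        measure_pmf.prob (random_cluster p q {..<n} E) B\<bar> \<le> 4 * q ^ L / real (2 ^ K) + 8 * (real (m + L) * \<eta>) + 1 / real n"
      unfolding prob_random_cluster[OF finite_lessThan E less_imp_le[OF p(1)] p(2) q0] x_def[symmetric]
      by (rule prob_rej_trial[OF bij E x q(1) tr _ \<eta> \<eta>2 d1 d2 d3 _ \<kappa>]) (use n in auto)
    also have "\<dots> \<le> 4 / real n + 8 * ((1 + real a) * c / real n) + 1 / real n"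
      using qM m\<eta> by linarith
    also have "\<dots> = (5 + 8 * ((1 + real a) * c)) / real n" by (simp add: add_divide_distrib)
    finally show "\<bar>measure_pmf.prob (graph_output [p, q] (prog a b) n E) B -
        measure_pmf.prob (random_cluster p q {..<n} E) B\<bar> \<le> (5 + 8 * ((1 + real a) * c)) / real n"
      unfolding out .
  qed
qed

lemma random_cluster_0:
  assumes "finite E" "q > 0"
  shows "random_cluster 0 q X E = return_pmf {}"
proof -
  have "S = {}" if "S \<in> set_pmf (random_cluster 0 q X E)" for S
  proof -
    have "S \<subseteq> E" "rc_weight 0 q X E S \<noteq> 0"
      using that pmf_random_cluster[OF assms(1) _ assms(2), of 0 X S] by (auto simp: set_pmf_iff split: if_splits)
    then show ?thesis using finite_subset[OF _ assms(1), of S] by (auto simp: rc_weight_def power_0_left split: if_splits)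
  qed
  then have "set_pmf (random_cluster 0 q X E) \<subseteq> {{}}" by blast
  then show ?thesis by (simp only: set_pmf_subset_singleton)
qed

theorem theorem2p5:
  fixes \<Delta> :: nat and p q :: real
  assumes "\<Delta> \<ge> 3" and "q \<ge> 1" and "p \<in> {0..1}" and "p < p_crit q \<Delta>"
  shows "\<exists>\<delta>>0. \<exists>(A :: com) (C :: real).
           polynomial_time [p, q] A graph_inputs \<and>
           ((\<lambda>n. measure_pmf.prob (random_regular_graph \<Delta> n)
                   {E. set_pmf (graph_output [p, q] A n E) \<subseteq> Pow E \<and>
                       tv_dist (graph_output [p, q] A n E) (random_cluster p q {..<n} E)
                         \<le> C / real n powr \<delta>})
             \<longlongrightarrow> 1) (inf at_top (principal {n. even (\<Delta> * n)}))"
proof (cases "p = 0")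
  \<comment> \<open>Here \<open>x = 0\<close>, and an error relative to \<open>x\<close> cannot be
    controlled. But the random-cluster law is concentrated on the empty set, which is what the empty
    program outputs.\<close>
  case True
  define F :: "nat filter" where "F = inf at_top (principal {n. even (\<Delta> * n)})"
  have sp: "dspec [p, q] Skip (init_state w) 1 (\<lambda>s. printed s = [])" for w
    by (rule det_Skip) (simp add: init_state_def)
  have out: "graph_output [p, q] Skip n E = return_pmf {}" for n E
    unfolding graph_output_def using spec_program(2)[OF sp, of decode_edges "\<lambda>_. {}"] by simp
  have "polynomial_time [p, q] Skip graph_inputs"
    unfolding polynomial_time_def
  proof (intro exI[of _ 1] ballI)
    fix w
    show "halts_within [p, q] Skip w (1 * length w ^ 1 + 1)"
      by (rule halts_within_mono[OF spec_program(1)[OF sp]]) simp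
  qed
  moreover have "eventually (\<lambda>n. measure_pmf.prob (random_regular_graph \<Delta> n)
      {E. set_pmf (graph_output [p, q] Skip n E) \<subseteq> Pow E \<and>
          tv_dist (graph_output [p, q] Skip n E) (random_cluster p q {..<n} E) \<le> 0 / real n powr 1} = 1) F"
    unfolding F_def eventually_inf_principal using eventually_gt_at_top[of \<Delta>]
  proof eventually_elim
    case (elim n)
    have *: "set_pmf (graph_output [p, q] Skip n E) \<subseteq> Pow E \<and>
          tv_dist (graph_output [p, q] Skip n E) (random_cluster p q {..<n} E) \<le> 0 / real n powr 1"
      if E: "E \<in> regular_graphs \<Delta> n" for E
    proof -
      have "finite E" using E finite_edges[of "{..<n}" E] by (simp add: regular_graphs_iff)
      then show ?thesis unfolding out using assms(2) True by (auto simp: random_cluster_0 intro!: tv_dist_le)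
    qed
    show ?case
    proof (intro impI)
      assume "n \<in> {n. even (\<Delta> * n)}"
      then have "set_pmf (random_regular_graph \<Delta> n) = regular_graphs \<Delta> n"
        unfolding random_regular_graph_def using regular_graphs_nonempty[OF elim] finite_regular_graphs by simp
      then show "measure_pmf.prob (random_regular_graph \<Delta> n)
      {E. set_pmf (graph_output [p, q] Skip n E) \<subseteq> Pow E \<and>
          tv_dist (graph_output [p, q] Skip n E) (random_cluster p q {..<n} E) \<le> 0 / real n powr 1} = 1"
        by (subst measure_pmf.prob_eq_1) (use * in \<open>auto simp: AE_measure_pmf_iff\<close>)
    qed
  qed
  then have "((\<lambda>n. measure_pmf.prob (random_regular_graph \<Delta> n)
      {E. set_pmf (graph_output [p, q] Skip n E) \<subseteq> Pow E \<and>
          tv_dist (graph_output [p, q] Skip n E) (random_cluster p q {..<n} E) \<le> 0 / real n powr 1}) \<longlongrightarrow> 1) F"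
    by (rule tendsto_eventually)
  ultimately show ?thesis unfolding F_def by (intro exI[of _ 1] exI[of _ Skip] exI[of _ 0] conjI) auto
next
  case False
  then have p: "0 < p" using assms(3) by simp
  have p1: "p < 1" using below_p_crit(1)[OF assms(1,2) less_imp_le[OF p] assms(4)] .
  define F :: "nat filter" where "F = inf at_top (principal {n. even (\<Delta> * n)})"
  define x where "x = p / ((1 - p) * q)"
  define G where "G A n = {E. E \<in> regular_graphs \<Delta> n \<and>
      (\<Sum>S\<in>Pow E. of_bool (real (excess {..<n} S) > A * ln (real n)) * cw {..<n} x q S)
        \<le> 1 / real n * (\<Sum>S\<in>Pow E. cw {..<n} x q S)}" for A n
  obtain A where A: "((\<lambda>n. measure_pmf.prob (random_regular_graph \<Delta> n) (G A n)) \<longlongrightarrow> 1) F"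
    using rc_excess_tail[OF assms(1,2) p assms(4)] unfolding G_def F_def x_def by blast
  define a where "a = nat \<lceil>A\<rceil>"
  have a: "A \<le> real a" unfolding a_def by linarith
  obtain h where h: "q < 2 ^ h" using real_arch_pow[of 2 q] by auto
  define b where "b = h * a + 3"
  define c where "c = (2 * q + 2) * ((1 + x) / x + (1 + x)) + q"
  define C where "C = 5 + 8 * ((1 + real a) * c)"
  define H where "H n = {E. set_pmf (graph_output [p, q] (prog a b) n E) \<subseteq> Pow E \<and>
      tv_dist (graph_output [p, q] (prog a b) n E) (random_cluster p q {..<n} E) \<le> C / real n powr 1}" for n
  have "eventually (\<lambda>n. 4 * ((1 + real a) * c) \<le> real n) at_top" by real_asymp
  then have "eventually (\<lambda>n. G A n \<subseteq> H n) F"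
    unfolding F_def eventually_inf_principal using eventually_ge_at_top[of 2]
  proof eventually_elim
    case (elim n)
    have "E \<in> H n" if "E \<in> G A n" for E
    proof -
      have E: "E \<subseteq> sedges {..<n}" and tl: "(\<Sum>S\<in>Pow E. of_bool (real (excess {..<n} S) > A * ln (real n)) * cw {..<n} x q S)
        \<le> 1 / real n * (\<Sum>S\<in>Pow E. cw {..<n} x q S)"
        using that unfolding G_def by (auto simp: regular_graphs_iff)
      show ?thesis
        using graph_output_close[OF p p1 assms(2) less_imp_le[OF h] a E elim(2), folded x_def, folded c_def, OF elim(1) tl]
        elim(2) unfolding H_def C_def b_def by simp
    qed
    then show ?case by blast
  qed
  then have "eventually (\<lambda>n. measure_pmf.prob (random_regular_graph \<Delta> n) (G A n) \<le>
      measure_pmf.prob (random_regular_graph \<Delta> n) (H n)) F"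
    by eventually_elim (intro measure_pmf.finite_measure_mono; simp)
  then have "((\<lambda>n. measure_pmf.prob (random_regular_graph \<Delta> n) (H n)) \<longlongrightarrow> 1) F"
    by (rule tendsto_sandwich[OF _ _ A tendsto_const]) auto
  moreover have "polynomial_time [p, q] (prog a b) graph_inputs"
    using polynomial_time_prog p p1 assms(2) by simp
  \<comment> \<open>All error terms are of order \<open>1 / n\<close>, so 1 can be taken for
    \<delta>. The program depends on the parameters only, not on \<open>n\<close> or the
    graph.\<close>
  ultimately show ?thesis
    unfolding H_def F_def by (intro exI[of _ 1] exI[of _ "prog a b"] exI[of _ C] conjI) auto
qed

end
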